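(* Let $2\le m<n$ be integers, $\alpha=\frac{\log m}{\log n}$, and let $\mu$ be a Bernoulli measure for $T_{m,n}$ (regarded as a measure on $[0,1]^2$). Then $\mu$ generates an ergodic CP-chain $Q$ (with respect to the approximate-square partition operator $\Delta$ described in the context). The measure component $\tilde Q$ of $Q$ is the distribution of the random measure $$S_t(\pi_1\mu\times\mu_x),\qquad S_t=\begin{pmatrix} n^{-t/2}&0\\0&n^{t/2}\end{pmatrix},$$ (push-forward under the linear map $S_t$), where $\mu_x$ is the conditional measure of $\mu$ on the vertical fibre $\pi_1^{-1}\{x\}$, $x$ is drawn according to $\pi_1\mu$, and, independently, $t\in[0,1)$ is drawn according to Lebesgue measure if $\alpha\notin\mathbb Q$, and according to $$\tau_\alpha=\frac1q\sum_{k=0}^{q-1}\delta_{k\alpha \bmod 1}$$ if $\alpha=p/q\in\mathbb Q$ with $\gcd(p,q)=1$.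
   Context: Measures are Borel probability measures; $\mathcal P(X)$ is the space of measures on a metric space $X$ with the weak topology; $f\mu=\mu\circ f^{-1}$ denotes push-forward. $\pi_1(x,y)=x$. **Bernoulli measures for $T_{m,n}$.** $T_{m,n}(x,y)=(mx \bmod 1, ny\bmod 1)$ on $\mathbb T^2$. Let $I=\{0,\dots,m-1\}$, $J=\{0,\dots,n-1\}$, $\Sigma=I^{\infty}\times J^{\infty}$ (infinite words indexed from $0$). Given weights $p_{ij}\in[0,1]$ ($i\in I,j\in J$) with $\sum_{i,j}p_{ij}=1$, the Bernoulli measure on $\Sigma$ is the measure with $\mu([i_0\cdots i_{k-1}]\times[j_0\cdots j_{k-1}])=\prod_{l<k}p_{i_lj_l}$ for all $k$ and all words of length $k$. A Bernoulli measure for $T_{m,n}$ is the image of such a measure under $\xi(\mathtt i,\mathtt j)=\sum_{k\ge0}(i_km^{-(k+1)},j_kn^{-(k+1)})\in[0,1]^2$. The conditional measures $\mu_x$ are those of the disintegration $\mu=\int \delta_x\times\mu_x\,d\pi_1\mu(x)$ (viewing $\mu_x$ as a measure on $[0,1]$). **Boxes.** A box $B\subset\mathbb R^d$ is a product of bounded non-degenerate intervals (open, closed or half-open). Let $T_B(x)=|B|^{-1/d}(x-\min\overline B)$, where $|B|$ is the volume and $\min\overline B$ is the lexicographically minimal point of $\overline B$; $B^*=T_B(B)$ (volume $1$). If $\mu(B)>0$, $\mu^B=\mu(B)^{-1}T_B(\mu|_B)\in\mathcal P(B^* )$. **Partition operators.** Let $\mathcal E$ be a collection of boxes (closed under homotheties,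 i.e. positive scalings and translations). A partition operator $\Delta$ on $\mathcal E$ assigns to each $B\in\mathcal E$ a partition $\Delta B\subset\mathcal E$ of $B$ such that $S(\Delta B)=\Delta(SB)$ for homotheties $S$. Put $\Delta^0(B)=\{B\}$, $\Delta^{k+1}(B)=\bigcup_{A\in\Delta^k(B)}\Delta(A)$. $\Delta$ is $\delta$-regular ($0<\delta<1$) if for each $B\in\mathcal E$ there is $c>1$ such that for all $k$ every $A\in\Delta^k(B)$ contains a ball of radius $\delta^k/c$ and is contained in a ball of radius $c\delta^k$. **CP-chains.** A ($\delta$-regular) CP-chain with respect to a $\delta$-regular $\Delta$ is a stationary Markov process on $\Omega=\{(B,\nu):B\in\mathcal E,\nu\in\mathcal P(B^* )\}$ with transition kernel $F(B,\nu)=\sum_{A\in\Delta(B^* )}\nu(A)\delta_{(A,\nu^A)}$. Its law $Q$ is a shift-invariant measure on $\Omega^{\mathbb N}$ (its stationary distribution is also denoted $Q$); it is ergodic if this shift-invariant measure is ergodic. The measure component $\tilde Q$ is the marginal of the stationary distribution on the $\nu$-coordinate. **Generating.** For $B\in\mathcal E$, a measure $\mu\in\mathcal P(B^* )$ generates $Q$ if, writing $\Delta^k(x)$ for the element of $\Delta^k(B^* )$ containing $x$, for $\mu$-a.e. $x$ one has $\frac1N\sum_{k=0}^{N-1}\delta_{\mu^{\Delta^k(x)}}\to\tilde Q$ weakly as $N\to\infty$, and for every $q\in\mathbb N$ there is a distribution $\tilde Q_q$ (possibly different from $\tilde Q$) such that for $\mu$-a.e. $x$, $\frac1N\sum_{k=0}^{N-1}\delta_{\mu^{\Delta^{qk}(x)}}\to\tilde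 Q_q$ weakly. **Approximate-square partition operator.** For $t\in[0,1)$ let $R_t=[0,1]\times[0,n^t]$; $\mathcal E$ is the collection of all boxes obtained from some $R_t$ by scaling and translation (up to inclusion or not of boundary edges). $\Delta$ is defined on $R_t$ and extended by similitudes: split $R_t$ into $m$ rectangles of width $1/m$ and height $n^t$; if $t\ge1-\alpha$, further split each of these into $n$ rectangles of height $n^{t-1}$. The pieces are taken of the form $[a,b)\times[c,d)$, except that edges on the right/upper boundary of the parent rectangle are included. The pieces are similar to $R_{t+\alpha \bmod 1}$, and $\Delta$ is $\frac1m$-regular. The generation statement for $\mu$ is with starting box $R_0=R_0^*=[0,1]^2$. *)

theory Defs
  imports "HOL-Probability.Probability"
begin

section \<open>Spaces of probability measures\<close>

definition borel_of :: "'a topology \<Rightarrow> 'a measure" where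
  "borel_of X = sigma (topspace X) {U. openin X U}"

definition prob_measures :: "'a topology \<Rightarrow> 'a measure set" where
  "prob_measures X = {M. prob_space M \<and> sets M = sets (borel_of X)}"

text \<open>The space of Borel probability measures on \<open>X\<close>, as a topological space. It can be iterated:
  distributions (measures on a space of measures) are points of
  \<open>weak_topology (weak_topology X)\<close>.\<close>

definition weak_topology :: "'a topology \<Rightarrow> 'a measure topology" where
  "weak_topology X = topology_generated_by
     {{M \<in> prob_measures X. (\<integral>x. f x \<partial>M) \<in> U} | f U.
        continuous_map X euclideanreal f \<and> bounded (f ` topspace X) \<and> open (U :: real set)}"

abbreviation planar_measures :: "(real \<times> real) measure topology" where
  "planar_measures \<equiv> weak_topology euclidean"

text \<open>The finite combination \<open>\<Sum>i\<in>I. w i \<cdot> \<delta>(x i)\<close> of point masses, as a measure on the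
  \<open>\<sigma>\<close>-algebra of \<open>M\<close>.\<close>

definition atomic_measure ::
  "'b measure \<Rightarrow> 'i set \<Rightarrow> ('i \<Rightarrow> ennreal) \<Rightarrow> ('i \<Rightarrow> 'b) \<Rightarrow> 'b measure" where
  "atomic_measure M I w x = measure_of (space M) (sets M) (\<lambda>C. \<Sum>i\<in>I. w i * indicator C (x i))"

section \<open>Bernoulli measures\<close>

definition cylinder :: "nat \<Rightarrow> nat \<Rightarrow> (nat \<Rightarrow> nat) \<Rightarrow> (nat \<Rightarrow> nat) set" where
  "cylinder a k w = {u. (\<forall>l. u l < a) \<and> (\<forall>l<k. u l = w l)}"

text \<open>The case \<open>k = 0\<close> of the last clause makes \<open>M\<close> a probability measure.\<close>

definition symbolic_bernoulli ::
  "nat \<Rightarrow> nat \<Rightarrow> (nat \<Rightarrow> nat \<Rightarrow> real) \<Rightarrow> ((nat \<Rightarrow> nat) \<times> (nat \<Rightarrow> nat)) measure \<Rightarrow> bool" where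
  "symbolic_bernoulli m n p M \<longleftrightarrow>
     sets M = sets ((\<Pi>\<^sub>M l\<in>UNIV. count_space {..<m}) \<Otimes>\<^sub>M (\<Pi>\<^sub>M l\<in>UNIV. count_space {..<n})) \<and>
     (\<forall>k i j. (\<forall>l<k. i l < m \<and> j l < n) \<longrightarrow>
        emeasure M (cylinder m k i \<times> cylinder n k j) = ennreal (\<Prod>l<k. p (i l) (j l)))"

definition digit_map :: "nat \<Rightarrow> nat \<Rightarrow> (nat \<Rightarrow> nat) \<times> (nat \<Rightarrow> nat) \<Rightarrow> real \<times> real" where
  "digit_map m n = (\<lambda>(i, j). \<Sum>k. (real (i k) / real m ^ (k + 1), real (j k) / real n ^ (k + 1)))"

text \<open>Bernoulli measures for the map \<open>(x, y) \<mapsto> (m x mod 1, n y mod 1)\<close>, on \<open>[0,1]\<^sup>2\<close>.\<close>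

definition bernoulli_for :: "nat \<Rightarrow> nat \<Rightarrow> (real \<times> real) measure \<Rightarrow> bool" where
  "bernoulli_for m n \<mu> \<longleftrightarrow>
     (\<exists>p M. (\<forall>i<m. \<forall>j<n. 0 \<le> p i j \<and> p i j \<le> 1) \<and> (\<Sum>i<m. \<Sum>j<n. p i j) = 1 \<and>
        symbolic_bernoulli m n p M \<and> \<mu> = distr M borel (digit_map m n))"

text \<open>\<open>\<kappa>\<close> is a version of the conditional measures of \<open>\<mu>\<close> on vertical fibres:
  \<open>\<mu> = \<integral> \<delta>\<^sub>x \<times> \<kappa>\<^sub>x d\<pi>\<^sub>1\<mu>(x)\<close>.\<close>

definition vertical_disintegration :: "(real \<times> real) measure \<Rightarrow> (real \<Rightarrow> real measure) \<Rightarrow> bool" where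
  "vertical_disintegration \<mu> \<kappa> \<longleftrightarrow>
     \<kappa> \<in> borel \<rightarrow>\<^sub>M borel_of (weak_topology euclidean) \<and>
     (\<forall>x\<in>{0..1}. emeasure (\<kappa> x) {0..1} = 1) \<and>
     (\<forall>A\<in>sets borel. emeasure \<mu> A =
        (\<integral>\<^sup>+ x. emeasure (return borel x \<Otimes>\<^sub>M \<kappa> x) A \<partial>distr \<mu> borel fst))"

section \<open>Boxes\<close>

definition is_box :: "(real \<times> real) set \<Rightarrow> bool" where
  "is_box B \<longleftrightarrow> (\<exists>X Y. is_interval X \<and> bounded X \<and> interior X \<noteq> {} \<and>
     is_interval Y \<and> bounded Y \<and> interior Y \<noteq> {} \<and> B = X \<times> Y)"

definition lex_min :: "(real \<times> real) set \<Rightarrow> real \<times> real" where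
  "lex_min K = (THE p. p \<in> K \<and> (\<forall>q\<in>K. fst p < fst q \<or> fst p = fst q \<and> snd p \<le> snd q))"

text \<open>The normalisation \<open>|B|\<close> to the power \<open>-1/d\<close>, with \<open>d = 2\<close>.\<close>

definition box_map :: "(real \<times> real) set \<Rightarrow> real \<times> real \<Rightarrow> real \<times> real" where
  "box_map B x = (measure lborel B powr (- 1 / 2)) *\<^sub>R (x - lex_min (closure B))"

definition normal_box :: "(real \<times> real) set \<Rightarrow> (real \<times> real) set" where
  "normal_box B = box_map B ` B"

text \<open>\<open>P(B)\<close>, with measures on \<open>B\<close> viewed as measures on the plane giving \<open>B\<close> full mass.\<close>

definition measures_on :: "(real \<times> real) set \<Rightarrow> (real \<times> real) measure set" where
  "measures_on B = {\<nu> \<in> prob_measures euclidean. emeasure \<nu> B = 1}"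

text \<open>\<open>\<mu>\<^sup>B\<close>; meaningful only when \<open>\<mu>(B) > 0\<close>.\<close>

definition rescale :: "(real \<times> real) measure \<Rightarrow> (real \<times> real) set \<Rightarrow> (real \<times> real) measure" where
  "rescale \<mu> B = distr (uniform_measure \<mu> B) borel (box_map B)"

section \<open>Partition operators\<close>

definition homothety :: "real \<Rightarrow> real \<times> real \<Rightarrow> real \<times> real \<Rightarrow> real \<times> real" where
  "homothety r v x = r *\<^sub>R x + v"

definition partition_operator ::
  "(real \<times> real) set set \<Rightarrow> ((real \<times> real) set \<Rightarrow> (real \<times> real) set set) \<Rightarrow> bool" where
  "partition_operator E \<Delta> \<longleftrightarrow>
     (\<forall>B\<in>E. is_box B) \<and>
     (\<forall>B\<in>E. \<forall>r>0. \<forall>v. homothety r v ` B \<in> E) \<and>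
     (\<forall>B\<in>E. \<Delta> B \<subseteq> E \<and> partition_on B (\<Delta> B)) \<and>
     (\<forall>B\<in>E. \<forall>r>0. \<forall>v. \<Delta> (homothety r v ` B) = (\<lambda>A. homothety r v ` A) ` \<Delta> B)"

primrec partition_iter ::
  "((real \<times> real) set \<Rightarrow> (real \<times> real) set set) \<Rightarrow> nat \<Rightarrow> (real \<times> real) set \<Rightarrow> (real \<times> real) set set" where
  "partition_iter \<Delta> 0 B = {B}"
| "partition_iter \<Delta> (Suc k) B = (\<Union>A\<in>partition_iter \<Delta> k B. \<Delta> A)"

definition regular_operator ::
  "(real \<times> real) set set \<Rightarrow> real \<Rightarrow> ((real \<times> real) set \<Rightarrow> (real \<times> real) set set) \<Rightarrow> bool" where
  "regular_operator E \<delta> \<Delta> \<longleftrightarrow> 0 < \<delta> \<and> \<delta> < 1 \<and>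
     (\<forall>B\<in>E. \<exists>c>1. \<forall>k. \<forall>A\<in>partition_iter \<Delta> k B.
        (\<exists>x. ball x (\<delta> ^ k / c) \<subseteq> A) \<and> (\<exists>x. A \<subseteq> ball x (c * \<delta> ^ k)))"

section \<open>CP-chains\<close>

text \<open>A box is determined by the end points of its two sides and by which of them belong to it;
  the \<open>\<sigma>\<close>-algebra on a collection of boxes is the one making these data measurable.\<close>

definition interval_code :: "real set \<Rightarrow> real \<times> real \<times> bool \<times> bool" where
  "interval_code X = (Inf X, Sup X, Inf X \<in> X, Sup X \<in> X)"

definition box_space :: "(real \<times> real) set set \<Rightarrow> (real \<times> real) set measure" where
  "box_space E =
     (let C = borel \<Otimes>\<^sub>M borel \<Otimes>\<^sub>M count_space UNIV \<Otimes>\<^sub>M count_space UNIV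
      in vimage_algebra E (\<lambda>B. (interval_code (fst ` B), interval_code (snd ` B))) (C \<Otimes>\<^sub>M C))"

type_synonym cp_state = "(real \<times> real) set \<times> (real \<times> real) measure"

definition cp_space :: "(real \<times> real) set set \<Rightarrow> cp_state measure" where
  "cp_space E = restrict_space (box_space E \<Otimes>\<^sub>M borel_of planar_measures)
     {(B, \<nu>). B \<in> E \<and> \<nu> \<in> measures_on (normal_box B)}"

text \<open>Boxes \<open>A\<close> with \<open>\<nu>(A) = 0\<close>, for which \<open>rescale \<nu> A\<close> is meaningless, get weight zero.\<close>

definition cp_kernel ::
  "(real \<times> real) set set \<Rightarrow> ((real \<times> real) set \<Rightarrow> (real \<times> real) set set) \<Rightarrow>
   cp_state \<Rightarrow> cp_state measure" where
  "cp_kernel E \<Delta> = (\<lambda>(B, \<nu>).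
     atomic_measure (cp_space E) (\<Delta> (normal_box B)) (\<lambda>A. emeasure \<nu> A) (\<lambda>A. (A, rescale \<nu> A)))"

definition markov_law :: "'s measure \<Rightarrow> ('s \<Rightarrow> 's measure) \<Rightarrow> (nat \<Rightarrow> 's) measure \<Rightarrow> bool" where
  "markov_law S F Q \<longleftrightarrow>
     F \<in> S \<rightarrow>\<^sub>M prob_algebra S \<and>
     prob_space Q \<and> sets Q = sets (\<Pi>\<^sub>M k\<in>UNIV. S) \<and>
     (\<forall>k A. (\<forall>l. A l \<in> sets S) \<longrightarrow>
        emeasure Q {\<omega> \<in> space Q. \<forall>l\<le>Suc k. \<omega> l \<in> A l} =
        (\<integral>\<^sup>+ \<omega>. indicator {\<omega>. \<forall>l\<le>k. \<omega> l \<in> A l} \<omega> * emeasure (F (\<omega> k)) (A (Suc k)) \<partial>Q))"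

definition shift :: "(nat \<Rightarrow> 's) \<Rightarrow> nat \<Rightarrow> 's" where
  "shift \<omega> = (\<lambda>k. \<omega> (Suc k))"

definition cp_chain ::
  "(real \<times> real) set set \<Rightarrow> real \<Rightarrow> ((real \<times> real) set \<Rightarrow> (real \<times> real) set set) \<Rightarrow>
   (nat \<Rightarrow> cp_state) measure \<Rightarrow> bool" where
  "cp_chain E \<delta> \<Delta> Q \<longleftrightarrow>
     partition_operator E \<Delta> \<and> regular_operator E \<delta> \<Delta> \<and>
     markov_law (cp_space E) (cp_kernel E \<Delta>) Q \<and> distr Q Q shift = Q"

definition ergodic_law :: "(nat \<Rightarrow> 's) measure \<Rightarrow> bool" where
  "ergodic_law Q \<longleftrightarrow>
     (\<forall>A\<in>sets Q. shift -` A \<inter> space Q = A \<longrightarrow> emeasure Q A = 0 \<or> emeasure Q A = 1)"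

definition measure_component :: "(nat \<Rightarrow> cp_state) measure \<Rightarrow> (real \<times> real) measure measure" where
  "measure_component Q = distr Q (borel_of planar_measures) (\<lambda>\<omega>. snd (\<omega> 0))"

section \<open>Generation\<close>

definition cell ::
  "((real \<times> real) set \<Rightarrow> (real \<times> real) set set) \<Rightarrow> (real \<times> real) set \<Rightarrow> nat \<Rightarrow>
   real \<times> real \<Rightarrow> (real \<times> real) set" where
  "cell \<Delta> B k x = (THE A. A \<in> partition_iter \<Delta> k B \<and> x \<in> A)"

definition empirical_distribution ::
  "nat \<Rightarrow> (nat \<Rightarrow> (real \<times> real) measure) \<Rightarrow> (real \<times> real) measure measure" where
  "empirical_distribution N \<nu> =
     atomic_measure (borel_of planar_measures) {..<N} (\<lambda>k. 1 / of_nat N) \<nu>"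

definition generates ::
  "((real \<times> real) set \<Rightarrow> (real \<times> real) set set) \<Rightarrow> (real \<times> real) set \<Rightarrow>
   (real \<times> real) measure \<Rightarrow> (nat \<Rightarrow> cp_state) measure \<Rightarrow> bool" where
  "generates \<Delta> B \<mu> Q \<longleftrightarrow>
     \<mu> \<in> measures_on (normal_box B) \<and>
     (AE x in \<mu>. limitin (weak_topology planar_measures)
        (\<lambda>N. empirical_distribution N (\<lambda>k. rescale \<mu> (cell \<Delta> (normal_box B) k x)))
        (measure_component Q) sequentially) \<and>
     (\<forall>q. \<exists>Qq. AE x in \<mu>. limitin (weak_topology planar_measures)
        (\<lambda>N. empirical_distribution N (\<lambda>k. rescale \<mu> (cell \<Delta> (normal_box B) (q * k) x)))
        Qq sequentially)"

section \<open>Approximate squares\<close>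

definition base_rect :: "nat \<Rightarrow> real \<Rightarrow> (real \<times> real) set" where
  "base_rect n t = {0..1} \<times> {0..real n powr t}"

definition asq_boxes :: "nat \<Rightarrow> (real \<times> real) set set" where
  "asq_boxes n = {B. is_box B \<and>
     (\<exists>t r v. 0 \<le> t \<and> t < 1 \<and> 0 < r \<and> closure B = homothety r v ` base_rect n t)}"

text \<open>\<open>[0,L]\<close> cut into \<open>N\<close> equal half-open intervals, the last one closed.\<close>

definition split_interval :: "nat \<Rightarrow> real \<Rightarrow> real set set" where
  "split_interval N L =
     (\<lambda>k. if Suc k = N then {real k * L / real N..L}
          else {real k * L / real N..<real (Suc k) * L / real N}) ` {..<N}"

definition asq_exponent :: "nat \<Rightarrow> nat \<Rightarrow> real" where
  "asq_exponent m n = ln (real m) / ln (real n)"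

definition base_partition :: "nat \<Rightarrow> nat \<Rightarrow> real \<Rightarrow> (real \<times> real) set set" where
  "base_partition m n t = {X \<times> Y | X Y. X \<in> split_interval m 1 \<and>
     Y \<in> (if t \<ge> 1 - asq_exponent m n then split_interval n (real n powr t)
          else {{0..real n powr t}})}"

text \<open>Extension by similitudes: \<open>t\<close>, \<open>r\<close>, \<open>v\<close> below are determined by \<open>B\<close>. Intersecting with
  \<open>B\<close> matters only when \<open>B\<close> is not closed; a boundary edge of \<open>B\<close> then belongs to the pieces
  exactly when it belongs to \<open>B\<close>.\<close>

definition asq_operator :: "nat \<Rightarrow> nat \<Rightarrow> (real \<times> real) set \<Rightarrow> (real \<times> real) set set" where
  "asq_operator m n B = {homothety r v ` A \<inter> B | t r v A.
     0 \<le> t \<and> t < 1 \<and> 0 < r \<and> closure B = homothety r v ` base_rect n t \<and>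
     A \<in> base_partition m n t}"

section \<open>The limiting random measure\<close>

definition stretch :: "nat \<Rightarrow> real \<Rightarrow> real \<times> real \<Rightarrow> real \<times> real" where
  "stretch n t = (\<lambda>(x, y). (real n powr (- t / 2) * x, real n powr (t / 2) * y))"

definition phase_measure :: "real \<Rightarrow> real measure" where
  "phase_measure \<alpha> =
     (if \<alpha> \<in> \<rat> then
        (let q = (THE q :: nat. 0 < q \<and> (\<exists>p :: int. coprime p (int q) \<and> \<alpha> = of_int p / real q))
         in atomic_measure borel {..<q} (\<lambda>k. 1 / of_nat q) (\<lambda>k. frac (real k * \<alpha>)))
      else uniform_measure lborel {0..<1})"

definition product_fibre_distribution ::
  "nat \<Rightarrow> real measure \<Rightarrow> (real \<times> real) measure \<Rightarrow> (real \<Rightarrow> real measure) \<Rightarrow>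
   (real \<times> real) measure measure" where
  "product_fibre_distribution n \<tau> \<mu> \<kappa> =
     distr (distr \<mu> borel fst \<Otimes>\<^sub>M \<tau>) (borel_of planar_measures)
       (\<lambda>(x, t). distr (distr \<mu> borel fst \<Otimes>\<^sub>M \<kappa> x) borel (stretch n t))"

end

theory Submission
  imports Defs "HOL-Analysis.Kronecker_Approximation_Theorem" "HOL-Library.Discrete_Functions"
begin

lemma topspace_weak_topology: "topspace (weak_topology X) = prob_measures X"
  unfolding weak_topology_def topology_generated_by_topspace
proof
  have "prob_measures X = {M \<in> prob_measures X. (\<integral>x. (\<lambda>_. 0::real) x \<partial>M) \<in> UNIV}" by simp
  moreover have "continuous_map X euclideanreal (\<lambda>_. 0) \<and> bounded ((\<lambda>_. 0::real) ` topspace X) \<and> open (UNIV :: real set)"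
    by (auto simp: image_def intro: bounded_subset[of "{0}"])
  ultimately show "prob_measures X \<subseteq> \<Union> {{M \<in> prob_measures X. (\<integral>x. f x \<partial>M) \<in> U} |f U.
      continuous_map X euclideanreal f \<and> bounded (f ` topspace X) \<and> open (U::real set)}"
    by blast
qed auto

lemma borel_of_subset: "{U. openin X U} \<subseteq> Pow (topspace X)"
  using openin_subset by blast

lemma space_borel_of [simp]: "space (borel_of X) = topspace X"
  unfolding borel_of_def using borel_of_subset by (rule space_measure_of)

lemma sets_borel_of: "sets (borel_of X) = sigma_sets (topspace X) {U. openin X U}"
  unfolding borel_of_def using borel_of_subset by (rule sets_measure_of)

lemma openin_in_borel_of: "openin X U \<Longrightarrow> U \<in> sets (borel_of X)"
  by (auto simp: sets_borel_of)

lemma sets_borel_of_euclidean [simp]: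
  "sets (borel_of (euclidean :: 'a::topological_space topology)) = sets borel"
  unfolding borel_of_def borel_def by (simp add: sets_measure_of)

lemma prob_measures_euclidean:
  "prob_measures euclidean = {M. prob_space M \<and> sets M = sets borel}"
  by (simp add: prob_measures_def)

lemma space_prob_algebra_borel: "space (prob_algebra borel) = prob_measures euclidean"
  by (auto simp: prob_measures_euclidean space_prob_algebra)

lemma borel_measurable_continuous_map:
  fixes f :: "'a \<Rightarrow> real"
  assumes "continuous_map X euclideanreal f"
  shows "f \<in> borel_measurable (borel_of X)"
proof (rule borel_measurableI)
  fix S :: "real set" assume "open S"
  then have "openin X {x \<in> topspace X. f x \<in> S}"
    using assms by (simp add: continuous_map_def)
  moreover have "f -` S \<inter> space (borel_of X) = {x \<in> topspace X. f x \<in> S}"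
    by auto
  ultimately show "f -` S \<inter> space (borel_of X) \<in> sets (borel_of X)"
    by (simp add: openin_in_borel_of)
qed

lemma continuous_map_integral_weak_topology:
  assumes "continuous_map X euclideanreal f" "bounded (f ` topspace X)"
  shows "continuous_map (weak_topology X) euclideanreal (\<lambda>M. \<integral>x. f x \<partial>M)"
  unfolding continuous_map_def topspace_weak_topology
proof (intro conjI allI impI)
  fix U :: "real set" assume "openin euclideanreal U"
  then show "openin (weak_topology X) {M \<in> prob_measures X. (\<integral>x. f x \<partial>M) \<in> U}"
    unfolding weak_topology_def using assms by (intro topology_generated_by_Basis) auto
qed auto

lemma limitin_weak_topology:
  assumes "\<forall>\<^sub>F k in F. M k \<in> prob_measures X" "M' \<in> prob_measures X"
    and lim: "\<And>f. continuous_map X euclideanreal f \<Longrightarrow> bounded (f ` topspace X) \<Longrightarrow>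
      ((\<lambda>k. \<integral>x. f x \<partial>M k) \<longlongrightarrow> (\<integral>x. f x \<partial>M')) F"
  shows "limitin (weak_topology X) M M' F"
  unfolding limitin_def topspace_weak_topology
proof (intro conjI allI impI)
  show "M' \<in> prob_measures X" by fact
  fix W assume "openin (weak_topology X) W \<and> M' \<in> W"
  then have "generate_topology_on {{M \<in> prob_measures X. (\<integral>x. f x \<partial>M) \<in> U} | f U.
        continuous_map X euclideanreal f \<and> bounded (f ` topspace X) \<and> open (U :: real set)} W"
    and "M' \<in> W"
    unfolding weak_topology_def by (auto intro: openin_topology_generated_by)
  then show "\<forall>\<^sub>F k in F. M k \<in> W"
  proof induction
    case (Int a b)
    then show ?case by (auto intro: eventually_conj)
  next
    case (UN K)
    then obtain k where "k \<in> K" "\<forall>\<^sub>F j in F. M j \<in> k" by auto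
    then show ?case by (auto elim: eventually_mono)
  next
    case (Basis s)
    then obtain f and U :: "real set" where s: "s = {M \<in> prob_measures X. (\<integral>x. f x \<partial>M) \<in> U}"
      and f: "continuous_map X euclideanreal f" "bounded (f ` topspace X)" "open U"
      by auto
    have "\<forall>\<^sub>F k in F. (\<integral>x. f x \<partial>M k) \<in> U"
      using lim[OF f(1,2)] Basis s f(3) by (auto simp: tendsto_def)
    with assms(1) show ?case unfolding s by (auto elim: eventually_elim2)
  qed auto
qed

lemma limitin_weak_topology_euclidean:
  fixes M :: "'b \<Rightarrow> 'a::topological_space measure"
  assumes "\<forall>\<^sub>F k in F. M k \<in> prob_measures euclidean" "M' \<in> prob_measures euclidean"
    and lim: "\<And>f. continuous_on UNIV f \<Longrightarrow> bounded (range f) \<Longrightarrow>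
      ((\<lambda>k. \<integral>x. f x \<partial>M k) \<longlongrightarrow> (\<integral>x. (f x :: real) \<partial>M')) F"
  shows "limitin (weak_topology euclidean) M M' F"
  using assms by (intro limitin_weak_topology) auto

text \<open>Approximating the indicator of an open set from below by continuous functions.\<close>

lemma open_indicator_LIMSEQ:
  fixes U :: "'a::metric_space set"
  assumes "open U" "U \<noteq> UNIV"
  shows "(\<lambda>k. min 1 (real k * infdist x (- U))) \<longlonglongrightarrow> indicator U x"
proof (cases "x \<in> U")
  case True
  have "infdist x (- U) > 0"
    using assms True infdist_pos_not_in_closed[of "- U" x] by auto
  then obtain K where K: "1 \<le> real K * infdist x (- U)"
    using reals_Archimedean3 by (meson less_imp_le)
  have "\<forall>\<^sub>F k in sequentially. min 1 (real k * infdist x (- U)) = 1"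
    using eventually_ge_at_top[of K]
  proof eventually_elim
    case (elim k)
    then have "real K * infdist x (- U) \<le> real k * infdist x (- U)"
      by (intro mult_right_mono) (auto simp: infdist_nonneg)
    with K show ?case by auto
  qed
  with True show ?thesis
    by (simp add: tendsto_eventually)
next
  case False
  then show ?thesis by simp
qed

lemma measurable_emeasure_weak_topology:
  fixes A :: "'a::metric_space set"
  shows "(\<lambda>M. M) \<in> borel_of (weak_topology (euclidean :: 'a topology)) \<rightarrow>\<^sub>M prob_algebra borel"
proof (rule measurable_prob_algebra_generated[of _ UNIV "{S. open S}"])
  show "sets borel = sigma_sets UNIV {S :: 'a set. open S}"
    unfolding borel_def by (simp add: sets_measure_of)
  show "Int_stable {S :: 'a set. open S}" by (auto simp: Int_stable_def)
  fix M :: "'a measure"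
  assume "M \<in> space (borel_of (weak_topology euclidean))"
  then show "prob_space M" "sets M = sets borel"
    by (auto simp: topspace_weak_topology prob_measures_euclidean)
next
  fix U :: "'a set" assume "U \<in> {S. open S}"
  then have U: "open U" by simp
  let ?W = "borel_of (weak_topology (euclidean :: 'a topology))"
  have sp: "prob_space M" "sets M = sets borel" if "M \<in> space ?W" for M
    using that by (auto simp: topspace_weak_topology prob_measures_euclidean)
  have "(\<lambda>M. measure M U) \<in> borel_measurable ?W"
  proof (cases "U = UNIV")
    case True
    have "measure M U = 1" if "M \<in> space ?W" for M
      using True prob_space.prob_space[OF sp(1)[OF that]] sp(2)[OF that] sets_eq_imp_space_eq[OF sp(2)[OF that]] by simp
    then show ?thesis by (subst measurable_cong[of _ _ "\<lambda>_. 1"]) auto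
  next
    case False
    let ?f = "\<lambda>k x. min 1 (real k * infdist x (- U))"
    show ?thesis
    proof (rule borel_measurable_LIMSEQ_real)
      fix k
      have c: "continuous_on UNIV (?f k)"
        by (intro continuous_intros)
      have "range (?f k) \<subseteq> {0..1}" by (auto simp: infdist_nonneg)
      then have "bounded (range (?f k))"
        by (meson bounded_closed_interval bounded_subset)
      then show "(\<lambda>M. \<integral>x. ?f k x \<partial>M) \<in> borel_measurable ?W"
        using c by (intro borel_measurable_continuous_map continuous_map_integral_weak_topology) auto
    next
      fix M assume "M \<in> space ?W"
      note M = sp[OF this]
      interpret prob_space M by fact
      have "(\<lambda>k. \<integral>x. ?f k x \<partial>M) \<longlonglongrightarrow> (\<integral>x. indicator U x \<partial>M)"
      proof (rule integral_dominated_convergence[where w="\<lambda>_. 1"])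
        show "AE x in M. (\<lambda>k. ?f k x) \<longlonglongrightarrow> indicator U x"
          using open_indicator_LIMSEQ[OF U False] by auto
        show "AE x in M. norm (?f k x) \<le> 1" for k
          by (auto simp: infdist_nonneg)
        show "?f k \<in> borel_measurable M" for k
          using M(2) by (auto simp: measurable_cong_sets[OF M(2) refl] intro!: borel_measurable_continuous_onI continuous_intros)
        show "indicat_real U \<in> borel_measurable M"
          using U by (intro borel_measurable_indicator) (simp add: M(2))
      qed simp
      then show "(\<lambda>k. \<integral>x. ?f k x \<partial>M) \<longlonglongrightarrow> measure M U"
        using U M(2) by simp
    qed
  qed
  then have "(\<lambda>M. ennreal (measure M U)) \<in> borel_measurable ?W" by simp
  then show "(\<lambda>M. emeasure M U) \<in> borel_measurable ?W"
    by (subst measurable_cong[of _ _ "\<lambda>M. ennreal (measure M U)"])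
       (auto simp: finite_measure.emeasure_eq_measure prob_space.finite_measure sp)
qed auto

text \<open>Lower semicontinuity on a countable subbasis.\<close>

lemma layer_cake_bounds:
  fixes y :: real
  assumes "0 \<le> y" "y \<le> 1" "0 < K"
  shows "(\<Sum>i=1..K. indicator {y. real i / real K < y} y) / real K \<le> y"
    and "y \<le> (\<Sum>i=1..K. indicator {y. real i / real K < y} y) / real K + 1 / real K"
proof -
  let ?S = "{i \<in> {1..K}. real i / real K < y}"
  have eq: "(\<Sum>i=1..K. indicator {y. real i / real K < y} y) = real (card ?S)"
    by (simp add: indicator_def of_bool_def sum.If_cases Int_def)
  define c where "c = nat (\<lceil>y * real K\<rceil> - 1)"
  have c: "?S = {1..c}"
  proof -
    have "real i / real K < y \<longleftrightarrow> i \<le> c" if "1 \<le> i" for i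
      using assms that by (simp add: c_def field_simps) linarith
    moreover have "c \<le> K" 
      unfolding c_def using assms mult_right_mono[of y 1 "real K"] by linarith
    ultimately show ?thesis by auto
  qed
  have "real (card ?S) \<le> y * real K" "y * real K \<le> real (card ?S) + 1"
    unfolding c using assms by (auto simp: c_def le_ceiling_iff)
      (use mult_nonneg_nonneg[of y "real K"] in linarith)+
  then show "(\<Sum>i=1..K. indicator {y. real i / real K < y} y) / real K \<le> y"
    and "y \<le> (\<Sum>i=1..K. indicator {y. real i / real K < y} y) / real K + 1 / real K"
    unfolding eq using assms by (auto simp: field_simps)
qed

definition finite_unions :: "'a set set \<Rightarrow> 'a set set" where
  "finite_unions B = Union ` {F. finite F \<and> F \<subseteq> B}"

definition mass_subbasis :: "'a::topological_space set set \<Rightarrow> 'a measure set set" where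
  "mass_subbasis B = (\<lambda>(V, q). {M \<in> prob_measures euclidean. of_rat q < measure M V}) ` (finite_unions B \<times> UNIV)"

definition mass_basis :: "'a::topological_space set set \<Rightarrow> 'a measure set set" where
  "mass_basis B = (\<lambda>F. prob_measures euclidean \<inter> \<Inter>F) ` {F. finite F \<and> F \<subseteq> mass_subbasis B}"

lemma countable_finite_unions: "countable B \<Longrightarrow> countable (finite_unions B)"
  unfolding finite_unions_def by (intro countable_image countable_Collect_finite_subset)

lemma countable_mass_basis: "countable B \<Longrightarrow> countable (mass_basis B)"
  unfolding mass_basis_def mass_subbasis_def
  by (intro countable_image countable_Collect_finite_subset countable_SIGMA countable_finite_unions) auto

lemma mass_basis_Int: "I \<in> mass_basis B \<Longrightarrow> J \<in> mass_basis B \<Longrightarrow> I \<inter> J \<in> mass_basis B"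
proof -
  assume "I \<in> mass_basis B" "J \<in> mass_basis B"
  then obtain F G where "I = prob_measures euclidean \<inter> \<Inter>F" "finite F" "F \<subseteq> mass_subbasis B"
    "J = prob_measures euclidean \<inter> \<Inter>G" "finite G" "G \<subseteq> mass_subbasis B"
    by (auto simp: mass_basis_def)
  then show ?thesis
    unfolding mass_basis_def by (intro image_eqI[of _ _ "F \<union> G"]) auto
qed

lemma mass_basis_INT:
  assumes "finite A" "\<And>a. a \<in> A \<Longrightarrow> I a \<in> mass_basis B"
  shows "prob_measures euclidean \<inter> (\<Inter>a\<in>A. I a) \<in> mass_basis B"
  using assms
proof (induction A rule: finite_induct)
  case empty
  show ?case unfolding mass_basis_def by (intro image_eqI[of _ _ "{}"]) auto
next
  case (insert a A)
  have "prob_measures euclidean \<inter> (\<Inter>a\<in>insert a A. I a) = I a \<inter> (prob_measures euclidean \<inter> (\<Inter>a\<in>A. I a))"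
    by auto
  with insert show ?case by (auto intro!: mass_basis_Int)
qed

lemma open_mass_approximation:
  fixes V :: "'a::second_countable_topology set"
  assumes B: "topological_basis B" "countable B"
    and V: "open V" and M: "prob_space M" "sets M = sets borel" and e: "e > 0"
  shows "\<exists>V'\<in>finite_unions B. V' \<subseteq> V \<and> open V' \<and> measure M V' > measure M V - e"
proof -
  interpret prob_space M by fact
  obtain B' where B': "B' \<subseteq> B" "\<Union>B' = V"
    using topological_basisE[OF B(1)] B(1) V unfolding topological_basis_def by blast
  have cB': "countable B'" using B' B(2) countable_subset by blast
  show ?thesis
  proof (cases "B' = {}")
    case True
    then have "V = {}" using B' by auto
    moreover have "{} \<in> finite_unions B" unfolding finite_unions_def by (intro image_eqI[of _ _ "{}"]) auto
    ultimately show ?thesis using e by auto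
  next
    case False
    define b where "b = from_nat_into B'"
    have b: "range b = B'" using False cB' by (simp add: b_def)
    let ?V = "\<lambda>k. \<Union>i\<le>k. b i"
    have ob: "open (b i)" for i
      using b B' B(1) by (metis subsetD rangeI topological_basis_open)
    have "(\<lambda>k. measure M (?V k)) \<longlonglongrightarrow> measure M (\<Union>k. ?V k)"
    proof (rule finite_Lim_measure_incseq)
      have "open (?V k)" for k using ob by blast
      then show "range ?V \<subseteq> sets M" using M(2) by auto
      show "incseq ?V" by (fastforce simp: incseq_def)
    qed
    also have "(\<Union>k. ?V k) = V" using b B' by auto
    finally obtain k where "measure M (?V k) > measure M V - e"
      using e by (metis (no_types, lifting) diff_less_eq eventually_happens' less_add_same_cancel1 order_tendstoD(1) sequentially_bot)
    moreover have "?V k \<in> finite_unions B"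
      unfolding finite_unions_def using b B' by (intro image_eqI[of _ _ "b ` {..k}"]) auto
    moreover have "?V k \<subseteq> V" using b B' by blast
    moreover have "open (?V k)" using ob by blast
    ultimately show ?thesis by blast
  qed
qed

lemma integral_lower_mass_basis:
  fixes g :: "'a::second_countable_topology \<Rightarrow> real"
  assumes B: "topological_basis B" "countable B"
    and g: "continuous_on UNIV g" "\<And>x. 0 \<le> g x" "\<And>x. g x \<le> 1"
    and M0: "M0 \<in> prob_measures euclidean" and e: "e > 0"
  shows "\<exists>I\<in>mass_basis B. M0 \<in> I \<and> (\<forall>M\<in>I. (\<integral>x. g x \<partial>M) > (\<integral>x. g x \<partial>M0) - e)"
proof -
  obtain K where K: "0 < K" "1 / real K < e / 2"
    using e by (metis half_gt_zero nat_approx_posE zero_less_Suc)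
  define V where "V i = {x. real i / real K < g x}" for i :: nat
  have oV: "open (V i)" for i
    unfolding V_def using g(1) by (auto intro!: open_Collect_less continuous_on_const)
  have int: "(\<Sum>i=1..K. measure M (V i)) / real K \<le> (\<integral>x. g x \<partial>M)"
    "(\<integral>x. g x \<partial>M) \<le> (\<Sum>i=1..K. measure M (V i)) / real K + 1 / real K"
    if M: "M \<in> prob_measures euclidean" for M
  proof -
    interpret prob_space M using M by (simp add: prob_measures_euclidean)
    have sM: "sets M = sets borel" using M by (simp add: prob_measures_euclidean)
    have [measurable]: "g \<in> borel_measurable M" "V i \<in> sets M" for i
      using g(1) oV by (auto simp: measurable_cong_sets[OF sM refl] sM borel_measurable_continuous_onI)
    have ig: "integrable M g"
      by (rule integrable_const_bound[of _ 1]) (use g in \<open>auto intro!: AE_I2\<close>)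
    let ?S = "\<lambda>x. (\<Sum>i=1..K. indicator (V i) x) / real K :: real"
    have S: "?S x \<le> g x" "g x \<le> ?S x + 1 / real K" for x
      using layer_cake_bounds[of "g x" K] g K by (auto simp: V_def indicator_def)
    have iS: "integrable M ?S"
      by (intro Bochner_Integration.integrable_divide Bochner_Integration.integrable_sum)
         (auto intro!: integrable_const_bound[of _ 1])
    have eq: "(\<integral>x. ?S x \<partial>M) = (\<Sum>i=1..K. measure M (V i)) / real K"
      by (subst Bochner_Integration.integral_divide_zero, subst Bochner_Integration.integral_sum)
         (auto intro!: integrable_const_bound[of _ 1])
    show "(\<Sum>i=1..K. measure M (V i)) / real K \<le> (\<integral>x. g x \<partial>M)"
      unfolding eq[symmetric] using iS ig S by (intro integral_mono) auto
    have "(\<integral>x. g x \<partial>M) \<le> (\<integral>x. ?S x + 1 / real K \<partial>M)"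
      using iS ig S by (intro integral_mono) auto
    also have "\<dots> = (\<integral>x. ?S x \<partial>M) + 1 / real K"
      using iS by (subst Bochner_Integration.integral_add) (auto simp: prob_space)
    finally show "(\<integral>x. g x \<partial>M) \<le> (\<Sum>i=1..K. measure M (V i)) / real K + 1 / real K"
      unfolding eq .
  qed
  have M0': "prob_space M0" "sets M0 = sets borel" using M0 by (auto simp: prob_measures_euclidean)
  have "\<exists>V' q. V' \<in> finite_unions B \<and> V' \<subseteq> V i \<and> open V' \<and> measure M0 V' > of_rat q \<and> of_rat q > measure M0 (V i) - e / 2" for i
  proof -
    obtain V' where V': "V' \<in> finite_unions B" "V' \<subseteq> V i" "open V'" "measure M0 V' > measure M0 (V i) - e / 2"
      using open_mass_approximation[OF B oV M0', of "e / 2" i] e by auto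
    then show ?thesis using of_rat_dense[OF V'(4)] by blast
  qed
  then obtain V' q where V': "\<And>i. V' i \<in> finite_unions B" "\<And>i. V' i \<subseteq> V i" "\<And>i. open (V' i)"
    "\<And>i. measure M0 (V' i) > of_rat (q i)" "\<And>i. of_rat (q i) > measure M0 (V i) - e / 2"
    by metis
  define I where "I = prob_measures euclidean \<inter> (\<Inter>i\<in>{1..K}. {M \<in> prob_measures euclidean. of_rat (q i) < measure M (V' i)})"
  have "I \<in> mass_basis B"
    unfolding I_def mass_basis_def mass_subbasis_def using V'(1)
    by (intro image_eqI[of _ _ "(\<lambda>i. {M \<in> prob_measures euclidean. of_rat (q i) < measure M (V' i)}) ` {1..K}"]) auto
  moreover have "M0 \<in> I" unfolding I_def using M0 V' by auto
  moreover have "(\<integral>x. g x \<partial>M) > (\<integral>x. g x \<partial>M0) - e" if "M \<in> I" for M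
  proof -
    have M: "M \<in> prob_measures euclidean" and q: "\<And>i. i \<in> {1..K} \<Longrightarrow> of_rat (q i) < measure M (V' i)"
      using that by (auto simp: I_def)
    interpret prob_space M using M by (simp add: prob_measures_euclidean)
    have sM: "sets M = sets borel" using M by (simp add: prob_measures_euclidean)
    have "measure M (V i) \<ge> measure M0 (V i) - e / 2" if "i \<in> {1..K}" for i
    proof -
      have "measure M (V' i) \<le> measure M (V i)"
        using V' oV sM by (intro finite_measure_mono) auto
      with q[OF that] V'(5)[of i] show ?thesis by linarith
    qed
    then have "(\<Sum>i=1..K. measure M (V i)) \<ge> (\<Sum>i=1..K. measure M0 (V i) - e / 2)"
      by (intro sum_mono)
    then have "(\<Sum>i=1..K. measure M (V i)) \<ge> (\<Sum>i=1..K. measure M0 (V i)) - real K * (e / 2)"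
      by (simp add: sum_subtractf)
    then have "(\<Sum>i=1..K. measure M (V i)) / real K \<ge> ((\<Sum>i=1..K. measure M0 (V i)) - real K * (e / 2)) / real K"
      by (rule divide_right_mono) simp
    then have "(\<Sum>i=1..K. measure M (V i)) / real K \<ge> (\<Sum>i=1..K. measure M0 (V i)) / real K - e / 2"
      using K by (simp add: diff_divide_distrib)
    with int(1)[OF M] int(2)[OF M0] K show ?thesis by linarith
  qed
  ultimately show ?thesis by blast
qed

lemma weak_topology_mass_basis:
  fixes W :: "'a::second_countable_topology measure set"
  assumes B: "topological_basis B" "countable B"
    and W: "openin (weak_topology euclidean) W" and M0: "M0 \<in> W"
  shows "\<exists>I\<in>mass_basis B. M0 \<in> I \<and> I \<subseteq> W"
proof -
  have "generate_topology_on {{M \<in> prob_measures (euclidean :: 'a topology). (\<integral>x. f x \<partial>M) \<in> U} | f U.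
        continuous_map euclidean euclideanreal f \<and> bounded (f ` topspace euclidean) \<and> open (U :: real set)} W"
    using W unfolding weak_topology_def by (rule openin_topology_generated_by)
  then show ?thesis using M0
  proof induction
    case (Int a b)
    then show ?case by (metis (no_types, lifting) Int_iff Int_mono mass_basis_Int)
  next
    case (UN K)
    then show ?case by (metis (no_types, lifting) Sup_upper UnionE order_trans)
  next
    case (Basis s)
    then obtain f and U :: "real set" where s: "s = {M \<in> prob_measures euclidean. (\<integral>x. f x \<partial>M) \<in> U}"
      and f: "continuous_on UNIV f" "bounded (range f)" and U: "open U"
      by auto
    have M0: "M0 \<in> prob_measures euclidean" "(\<integral>x. f x \<partial>M0) \<in> U" using Basis s by auto
    then obtain e where e: "e > 0" "\<And>y. \<bar>y - (\<integral>x. f x \<partial>M0)\<bar> < e \<Longrightarrow> y \<in> U"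
      using U by (auto simp: open_dist dist_real_def)
    obtain c where c: "c > 0" "\<And>x. \<bar>f x\<bar> \<le> c"
      using f(2) by (auto simp: bounded_pos)
    let ?g = "\<lambda>x. (f x + c) / (2 * c)" and ?h = "\<lambda>x. (c - f x) / (2 * c)"
    have fb: "f x \<le> c" "- f x \<le> c" for x using c(2)[of x] by auto
    have e': "e / (2 * c) > 0" using e c by auto
    have "\<exists>I\<in>mass_basis B. M0 \<in> I \<and> (\<forall>M\<in>I. (\<integral>x. ?g x \<partial>M) > (\<integral>x. ?g x \<partial>M0) - e / (2 * c))"
    proof (rule integral_lower_mass_basis[OF B _ _ _ M0(1) e'])
      show "continuous_on UNIV ?g" using c by (intro continuous_intros f) auto
      show "0 \<le> ?g x" "?g x \<le> 1" for x using c fb[of x] by (auto simp: field_simps)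
    qed
    moreover have "\<exists>I\<in>mass_basis B. M0 \<in> I \<and> (\<forall>M\<in>I. (\<integral>x. ?h x \<partial>M) > (\<integral>x. ?h x \<partial>M0) - e / (2 * c))"
    proof (rule integral_lower_mass_basis[OF B _ _ _ M0(1) e'])
      show "continuous_on UNIV ?h" using c by (intro continuous_intros f) auto
      show "0 \<le> ?h x" "?h x \<le> 1" for x using c fb[of x] by (auto simp: field_simps)
    qed
    ultimately obtain I J where I: "I \<in> mass_basis B" "M0 \<in> I" "\<And>M. M \<in> I \<Longrightarrow> (\<integral>x. ?g x \<partial>M) > (\<integral>x. ?g x \<partial>M0) - e / (2 * c)"
      and J: "J \<in> mass_basis B" "M0 \<in> J" "\<And>M. M \<in> J \<Longrightarrow> (\<integral>x. ?h x \<partial>M) > (\<integral>x. ?h x \<partial>M0) - e / (2 * c)"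
      by blast
    have sub: "M \<in> prob_measures euclidean" if "M \<in> I" for M
      using I(1) that by (auto simp: mass_basis_def)
    have int: "(\<integral>x. ?g x \<partial>M) = ((\<integral>x. f x \<partial>M) + c) / (2 * c)" "(\<integral>x. ?h x \<partial>M) = (c - (\<integral>x. f x \<partial>M)) / (2 * c)"
      if M: "M \<in> prob_measures euclidean" for M
    proof -
      interpret prob_space M using M by (simp add: prob_measures_euclidean)
      have sM: "sets M = sets borel" using M by (simp add: prob_measures_euclidean)
      have "f \<in> borel_measurable M" using f by (auto simp: measurable_cong_sets[OF sM refl] borel_measurable_continuous_onI)
      then have "integrable M f"
        by (intro integrable_const_bound[of _ c]) (use c in auto)
      then show "(\<integral>x. ?g x \<partial>M) = ((\<integral>x. f x \<partial>M) + c) / (2 * c)" "(\<integral>x. ?h x \<partial>M) = (c - (\<integral>x. f x \<partial>M)) / (2 * c)"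
        by (auto simp: prob_space)
    qed
    have "I \<inter> J \<subseteq> s"
    proof
      fix M assume M: "M \<in> I \<inter> J"
      then have Mp: "M \<in> prob_measures euclidean" using sub by auto
      have "(\<integral>x. f x \<partial>M) > (\<integral>x. f x \<partial>M0) - e" "(\<integral>x. f x \<partial>M) < (\<integral>x. f x \<partial>M0) + e"
        using I(3)[of M] J(3)[of M] M c(1) unfolding int[OF Mp] int[OF M0(1)] diff_divide_distrib[symmetric] divide_less_cancel
        by auto
      then show "M \<in> s" unfolding s using Mp e(2) by auto
    qed
    then show ?case using mass_basis_Int[OF I(1) J(1)] I(2) J(2) by blast
  qed auto
qed

lemma measurable_into_weak_topology:
  assumes K: "K \<in> N \<rightarrow>\<^sub>M prob_algebra (borel :: 'a::second_countable_topology measure)"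
  shows "K \<in> N \<rightarrow>\<^sub>M borel_of (weak_topology euclidean)"
proof -
  obtain B :: "'a set set" where B: "countable B" "topological_basis B"
    using ex_countable_basis by blast
  have meas: "I \<in> sets (prob_algebra borel)" if I': "I \<in> mass_basis B" for I
  proof -
    have open_B: "open V" if "V \<in> finite_unions B" for V
      using that B(2) by (auto simp: finite_unions_def topological_basis_open intro!: open_Union)
    have sub: "S \<in> sets (prob_algebra borel)" if S': "S \<in> mass_subbasis B" for S
    proof -
      obtain V :: "'a set" and q :: rat where S: "S = {M \<in> space (prob_algebra borel). of_rat q < measure M V}"
        and V: "V \<in> finite_unions B"
        using S' unfolding mass_subbasis_def space_prob_algebra_borel by auto
      have [measurable]: "V \<in> sets borel" using open_B[OF V] by simp
      show ?thesis unfolding S by measurable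
    qed
    obtain F where F: "I = prob_measures euclidean \<inter> \<Inter>F" "finite F" "F \<subseteq> mass_subbasis B"
      using I' by (auto simp: mass_basis_def)
    have "space (prob_algebra borel) \<inter> \<Inter>F \<in> sets (prob_algebra borel)"
    proof (cases "F = {}")
      case False
      then show ?thesis using F sub sets.finite_INT[where I=F and A="\<lambda>x. x" and M="prob_algebra borel"]
        by (intro sets.Int) (auto simp: subset_iff)
    qed auto
    then show ?thesis using F(1) by (simp add: space_prob_algebra_borel)
  qed
  have "(\<lambda>M. M) \<in> prob_algebra borel \<rightarrow>\<^sub>M borel_of (weak_topology (euclidean :: 'a topology))"
  proof (rule measurableI)
    fix W :: "'a measure set" 
    assume "W \<in> sets (borel_of (weak_topology euclidean))"
    then show "(\<lambda>M. M) -` W \<inter> space (prob_algebra borel) \<in> sets (prob_algebra borel)"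
      unfolding sets_borel_of topspace_weak_topology
    proof induction
      case (Basic W)
      then have W: "openin (weak_topology euclidean) W" by simp
      have "W = \<Union>{I \<in> mass_basis B. I \<subseteq> W}"
        using weak_topology_mass_basis[OF B(2,1) W] by blast
      also have "\<dots> \<in> sets (prob_algebra borel)"
        using countable_mass_basis[OF B(1)] meas by (intro sets.countable_Union) (auto intro: countable_subset)
      finally show ?case by auto
    next
      case (Compl a)
      have "(\<lambda>M. M) -` (prob_measures euclidean - a) \<inter> space (prob_algebra borel) = space (prob_algebra borel) - ((\<lambda>M. M) -` a \<inter> space (prob_algebra borel))"
        by (auto simp: space_prob_algebra_borel)
      then show ?case using Compl by auto
    next
      case (Union a)
      then have "(\<Union>i. (\<lambda>M. M) -` a i \<inter> space (prob_algebra borel)) \<in> sets (prob_algebra borel)" by blast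
      moreover have "(\<Union>i. (\<lambda>M. M) -` a i \<inter> space (prob_algebra borel)) = (\<lambda>M. M) -` (\<Union>i. a i) \<inter> space (prob_algebra borel)"
        by auto
      ultimately show ?case by simp
    qed auto
  qed (auto simp: topspace_weak_topology space_prob_algebra_borel)
  from measurable_compose[OF K this] show ?thesis by simp
qed

lemma measurable_prob_algebra_of_weak:
  assumes "K \<in> N \<rightarrow>\<^sub>M borel_of (weak_topology (euclidean :: 'a::metric_space topology))"
  shows "K \<in> N \<rightarrow>\<^sub>M prob_algebra borel"
  using measurable_compose[OF assms measurable_emeasure_weak_topology] by simp

section \<open>Equidistribution of rotations\<close>

definition visits :: "real \<Rightarrow> real \<Rightarrow> real \<Rightarrow> real \<Rightarrow> nat \<Rightarrow> real" where
  "visits \<beta> t a b k = indicator {a..<b} (frac (t + real k * \<beta>))"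

lemma card_naturals_between:
  fixes u v :: real
  shows "finite {s::nat. u \<le> real s \<and> real s < v}"
    and "real (card {s::nat. u \<le> real s \<and> real s < v}) \<le> max 0 (v - u) + 1"
proof -
  let ?A = "{s::nat. u \<le> real s \<and> real s < v}"
  have sub: "int ` ?A \<subseteq> {\<lceil>u\<rceil>..<\<lceil>v\<rceil>}"
    by (auto simp: ceiling_le_iff less_ceiling_iff)
  then have "finite (int ` ?A)" by (rule finite_subset) simp
  then show fin: "finite ?A" by (rule finite_imageD) simp
  have "card ?A = card (int ` ?A)" by (simp add: card_image)
  also have "\<dots> \<le> card {\<lceil>u\<rceil>..<\<lceil>v\<rceil>}" using sub by (intro card_mono) auto
  finally have "card ?A \<le> nat (\<lceil>v\<rceil> - \<lceil>u\<rceil>)" by simp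
  moreover have "real (nat (\<lceil>v\<rceil> - \<lceil>u\<rceil>)) \<le> max 0 (v - u) + 1"
    by linarith
  ultimately show "real (card ?A) \<le> max 0 (v - u) + 1" by linarith
qed

text \<open>Walking once around the circle in steps of length \<open>e\<close>, the arc \<open>[a,b)\<close> is met in at most two
  pieces of total length \<open>b - a\<close>.\<close>

lemma short_step_visits:
  fixes a b e x :: real
  assumes ab: "0 \<le> a" "a \<le> b" "b \<le> 1" and e: "0 < e" "real S * e \<le> 1"
  shows "(\<Sum>s<S. indicator {a..<b} (frac (x + real s * e))) \<le> (b - a) / e + 2"
proof -
  define c where "c = real_of_int \<lfloor>x\<rfloor>"
  have c: "c \<le> x" "x < c + 1" by (auto simp: c_def)
  define A1 where "A1 = {s::nat. (max x (c + a) - x) / e \<le> real s \<and> real s < (c + b - x) / e}"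
  define A2 where "A2 = {s::nat. (c + 1 + a - x) / e \<le> real s \<and> real s < (min (x + 1) (c + 1 + b) - x) / e}"
  let ?A = "{s \<in> {..<S}. frac (x + real s * e) \<in> {a..<b}}"
  have "?A \<subseteq> A1 \<union> A2"
  proof
    fix s assume s: "s \<in> ?A"
    let ?y = "x + real s * e"
    have "real s * e < real S * e" using s e by auto
    then have "real s * e < 1" using e(2) by linarith
    then have y: "x \<le> ?y" "?y < x + 1" using e by auto
    have "\<lfloor>?y\<rfloor> = \<lfloor>x\<rfloor> \<or> \<lfloor>?y\<rfloor> = \<lfloor>x\<rfloor> + 1"
      using y by linarith
    then show "s \<in> A1 \<union> A2"
    proof
      assume "\<lfloor>?y\<rfloor> = \<lfloor>x\<rfloor>"
      then have "?y - c \<in> {a..<b}" using s by (auto simp: frac_def c_def)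
      then have "s \<in> A1" using y e by (auto simp: A1_def field_simps)
      then show ?thesis by simp
    next
      assume "\<lfloor>?y\<rfloor> = \<lfloor>x\<rfloor> + 1"
      then have "?y - c - 1 \<in> {a..<b}" using s by (auto simp: frac_def c_def)
      then have "s \<in> A2" using y e by (auto simp: A2_def field_simps)
      then show ?thesis by simp
    qed
  qed
  moreover have fin: "finite A1" "finite A2" unfolding A1_def A2_def by (rule card_naturals_between)+
  ultimately have "card ?A \<le> card (A1 \<union> A2)" by (intro card_mono) auto
  also have "\<dots> \<le> card A1 + card A2" by (rule card_Un_le)
  finally have "real (card ?A) \<le> real (card A1) + real (card A2)" by linarith
  also have "\<dots> \<le> (max 0 ((c + b - x) / e - (max x (c + a) - x) / e) + 1) +
      (max 0 ((min (x + 1) (c + 1 + b) - x) / e - (c + 1 + a - x) / e) + 1)"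
    unfolding A1_def A2_def by (intro add_mono card_naturals_between)
  also have "\<dots> = max 0 (c + b - max x (c + a)) / e + max 0 (min (x + 1) (c + 1 + b) - (c + 1 + a)) / e + 2"
  proof -
    have "max 0 (u / e - v / e) = max 0 (u - v) / e" for u v
      using e by (simp add: max_def diff_divide_distrib[symmetric] zero_le_divide_iff)
    then show ?thesis by (simp add: algebra_simps)
  qed
  also have "\<dots> = (max 0 (c + b - max x (c + a)) + max 0 (min (x + 1) (c + 1 + b) - (c + 1 + a))) / e + 2"
    by (simp add: add_divide_distrib)
  also have "max 0 (c + b - max x (c + a)) + max 0 (min (x + 1) (c + 1 + b) - (c + 1 + a)) = b - a"
    using ab c by (auto simp: max_def min_def)
  finally show ?thesis
    by (simp add: indicator_def of_bool_def sum.If_cases Int_def)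
qed

lemma frac_add_int: "x - y \<in> \<int> \<Longrightarrow> frac x = frac (y::real)"
proof -
  assume "x - y \<in> \<int>"
  then obtain k where "x = y + of_int k" by (metis Ints_cases add.commute diff_add_cancel)
  then show ?thesis by (simp add: frac_def)
qed

lemma sum_shift_window: "(\<Sum>k\<in>{i..<i + L}. f k) = (\<Sum>k<L. f (i + k :: nat))"
  using sum.shift_bounds_nat_ivl[of f 0 i L] by (simp add: lessThan_atLeast0 add.commute)

lemma sum_blocks_le:
  fixes f :: "nat \<Rightarrow> real"
  assumes "\<And>j. (\<Sum>k\<in>{j..<j + L}. f k) \<le> C" and "\<And>k. 0 \<le> f k" and L: "0 < L"
  shows "(\<Sum>k<N. f k) \<le> (real N / real L + 1) * C"
proof -
  have C: "0 \<le> C" using assms(1)[of 0] sum_nonneg[of "{0..<0+L}" f] assms(2) by force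
  have "(\<Sum>k<N. f k) \<le> (\<Sum>k<(N div L + 1) * L. f k)"
  proof (rule sum_mono2)
    have "N < (N div L + 1) * L"
      using L by (metis Suc_eq_plus1 dividend_less_div_times mult.commute add.commute mult_Suc)
    then show "{..<N} \<subseteq> {..<(N div L + 1) * L}" by auto
  qed (use assms in auto)
  also have "\<dots> = (\<Sum>q<N div L + 1. \<Sum>k\<in>{q * L..<q * L + L}. f k)"
    by (rule sum.nat_group[symmetric])
  also have "\<dots> \<le> (\<Sum>q<N div L + 1. C)"
    using assms(1) by (intro sum_mono)
  also have "\<dots> = (real (N div L) + 1) * C" by simp
  also have "\<dots> \<le> (real N / real L + 1) * C"
    using C by (intro mult_right_mono add_right_mono) (auto simp: of_nat_div_le_of_nat)
  finally show ?thesis .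
qed

lemma irrational_visits_upper:
  assumes irr: "\<beta> \<notin> \<rat>" and ab: "0 \<le> a" "a \<le> b" "b \<le> 1" and d: "d > 0"
  shows "\<forall>\<^sub>F N in sequentially. (\<Sum>k<N. visits \<beta> t a b k) / real N \<le> b - a + d"
proof -
  define \<delta> where "\<delta> = min (1/2) (d / (6 + d))"
  have \<delta>: "0 < \<delta>" "\<delta> \<le> 1/2" "\<delta> * (6 + d) \<le> d" proof -
    show "0 < \<delta>" "\<delta> \<le> 1/2" using d by (simp_all add: \<delta>_def min_def)
    have "\<delta> \<le> d / (6 + d)" by (simp add: \<delta>_def)
    then show "\<delta> * (6 + d) \<le> d" using d by (simp add: pos_le_divide_eq)
  qed
  obtain h where h: "h > 0" "\<bar>frac (real h * \<beta>) - \<delta>/2\<bar> < \<delta>/2"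
    using Kronecker_approx_1_explicit[OF irr, of "\<delta>/2" "\<delta>/2"] \<delta> by auto
  define e where "e = frac (real h * \<beta>)"
  have e: "0 < e" "e < \<delta>" using h(2) unfolding e_def by linarith+
  define S where "S = nat \<lfloor>1 / e\<rfloor>"
  have S: "real S * e \<le> 1" "real S \<ge> 1 / e - 1"
  proof -
    have "real S \<le> 1 / e" using e by (simp add: S_def)
    then show "real S * e \<le> 1" using e by (simp add: field_simps)
    show "real S \<ge> 1 / e - 1" unfolding S_def using e by linarith
  qed
  have "1 / e > 2" using e \<delta> by (simp add: field_simps)
  then have S0: "S > 0" using S(2) by (intro gr0I) auto
  define C where "C = real h * ((b - a) / e + 2)"
  have block: "(\<Sum>k\<in>{j..<j + S * h}. visits \<beta> t a b k) \<le> C" for j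
  proof -
    have "(\<Sum>k\<in>{j..<j + S * h}. visits \<beta> t a b k) = (\<Sum>k<S * h. visits \<beta> t a b (j + k))"
      by (rule sum_shift_window)
    also have "\<dots> = (\<Sum>s<S. \<Sum>k\<in>{s * h..<s * h + h}. visits \<beta> t a b (j + k))"
      by (rule sum.nat_group[symmetric])
    also have "\<dots> = (\<Sum>s<S. \<Sum>r<h. visits \<beta> t a b (j + (r + s * h)))"
      by (subst sum_shift_window) (simp only: add.commute[of "_ * h"])
    also have "\<dots> = (\<Sum>r<h. \<Sum>s<S. visits \<beta> t a b (j + (r + s * h)))"
      by (rule sum.swap)
    also have "\<dots> = (\<Sum>r<h. \<Sum>s<S. indicator {a..<b} (frac ((t + real (j + r) * \<beta>) + real s * e)))"
    proof (intro sum.cong refl)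
      fix r s
      have "(t + real (j + (r + s * h)) * \<beta>) - ((t + real (j + r) * \<beta>) + real s * e) = of_int (int s * \<lfloor>real h * \<beta>\<rfloor>)"
        by (simp add: e_def frac_def algebra_simps)
      then have "frac (t + real (j + (r + s * h)) * \<beta>) = frac ((t + real (j + r) * \<beta>) + real s * e)"
        by (intro frac_add_int) auto
      then show "visits \<beta> t a b (j + (r + s * h)) = indicator {a..<b} (frac ((t + real (j + r) * \<beta>) + real s * e))"
        by (simp add: visits_def)
    qed
    also have "\<dots> \<le> (\<Sum>r<h. (b - a) / e + 2)"
      using ab e S by (intro sum_mono short_step_visits) auto
    finally show ?thesis by (simp add: C_def)
  qed
  have up: "(\<Sum>k<N. visits \<beta> t a b k) / real N \<le> C / real (S * h) + C / real N" if "N > 0" for N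
  proof -
    have "(\<Sum>k<N. visits \<beta> t a b k) \<le> (real N / real (S * h) + 1) * C"
      using block S0 h by (intro sum_blocks_le) (auto simp: visits_def)
    then have "(\<Sum>k<N. visits \<beta> t a b k) / real N \<le> (real N / real (S * h) + 1) * C / real N"
      by (rule divide_right_mono) simp
    also have "\<dots> = C / real (S * h) + C / real N"
      using that S0 h by (simp add: field_simps)
    finally show ?thesis .
  qed
  have "C / real (S * h) = ((b - a) / e + 2) / real S"
    using h by (simp add: C_def)
  also have "\<dots> \<le> ((b - a) / e + 2) / (1 / e - 1)"
    using S e \<delta> ab \<open>1 / e > 2\<close> by (intro divide_left_mono mult_pos_pos) auto
  also have "\<dots> = (b - a + 2 * e) / (1 - e)"
    using e \<delta> by (simp add: field_simps)
  also have "\<dots> \<le> b - a + d / 2"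
  proof -
    have "e * (6 + d) \<le> \<delta> * (6 + d)" using e d by (intro mult_right_mono) auto
    then have "6 * e + e * d \<le> d" using \<delta> by (simp add: algebra_simps)
    moreover have "e * (b - a) \<le> e * 1" using e ab by (intro mult_left_mono) auto
    moreover have "(b - a + d / 2) * (1 - e) = b - a + d / 2 - e * (b - a) - e * d / 2"
      by (simp add: field_simps)
    ultimately have "b - a + 2 * e \<le> (b - a + d / 2) * (1 - e)"
      by linarith
    then show ?thesis using e \<delta> by (simp add: pos_divide_le_eq)
  qed
  finally have C1: "C / real (S * h) \<le> b - a + d / 2" .
  have "(\<lambda>N. C / real N) \<longlonglongrightarrow> 0" by (rule lim_const_over_n)
  then have "\<forall>\<^sub>F N in sequentially. C / real N < d / 2"
    using d by (intro order_tendstoD) auto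
  with eventually_gt_at_top[of 0] show ?thesis
  proof eventually_elim
    case (elim N)
    then show ?case using up[of N] C1 by linarith
  qed
qed

lemma irrational_visits:
  assumes irr: "\<beta> \<notin> \<rat>" and ab: "0 \<le> a" "a \<le> b" "b \<le> 1"
  shows "(\<lambda>N. (\<Sum>k<N. visits \<beta> t a b k) / real N) \<longlonglongrightarrow> b - a"
proof (rule tendstoI)
  fix e :: real assume e: "e > 0"
  note up = irrational_visits_upper[OF irr, where t=t and d="e/3"]
  have "\<forall>\<^sub>F N in sequentially. (\<Sum>k<N. visits \<beta> t a b k) / real N \<le> b - a + e/3"
    "\<forall>\<^sub>F N in sequentially. (\<Sum>k<N. visits \<beta> t 0 a k) / real N \<le> a - 0 + e/3"
    "\<forall>\<^sub>F N in sequentially. (\<Sum>k<N. visits \<beta> t b 1 k) / real N \<le> 1 - b + e/3"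
    using up[of a b] up[of 0 a] up[of b 1] ab e by auto
  with eventually_gt_at_top[of 0]
  show "\<forall>\<^sub>F N in sequentially. dist ((\<Sum>k<N. visits \<beta> t a b k) / real N) (b - a) < e"
  proof eventually_elim
    case (elim N)
    have "visits \<beta> t 0 a k + visits \<beta> t a b k + visits \<beta> t b 1 k = 1" for k
      using ab frac_ge_0[of "t + real k * \<beta>"] frac_lt_1[of "t + real k * \<beta>"]
      by (auto simp: visits_def indicator_def)
    then have "(\<Sum>k<N. visits \<beta> t 0 a k) + (\<Sum>k<N. visits \<beta> t a b k) + (\<Sum>k<N. visits \<beta> t b 1 k) = real N"
      by (simp flip: sum.distrib)
    then have "(\<Sum>k<N. visits \<beta> t 0 a k) / real N + (\<Sum>k<N. visits \<beta> t a b k) / real N + (\<Sum>k<N. visits \<beta> t b 1 k) / real N = 1"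
      using elim(1) by (simp flip: add_divide_distrib)
    then show ?case using elim e by (auto simp: dist_real_def)
  qed
qed

lemma periodic_average:
  fixes f :: "nat \<Rightarrow> real"
  assumes per: "\<And>k. f (k + q) = f k" and q: "0 < q" and b: "\<And>k. \<bar>f k\<bar> \<le> 1"
  shows "(\<lambda>N. (\<Sum>k<N. f (j + k)) / real N) \<longlonglongrightarrow> (\<Sum>k<q. f k) / real q"
proof -
  define s where "s = (\<Sum>k<q. f k)"
  have per': "f (k + i * q) = f k" for k i
  proof (induction i)
    case (Suc i)
    have "k + Suc i * q = (k + i * q) + q" by simp
    then show ?case using Suc per[of "k + i * q"] by presburger
  qed simp
  have win: "(\<Sum>k\<in>{i..<i + q}. f k) = s" for i
  proof (induction i)
    case 0
    then show ?case by (simp add: s_def lessThan_atLeast0)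
  next
    case (Suc i)
    have "(\<Sum>k\<in>{Suc i..<Suc i + q}. f k) + f i = (\<Sum>k\<in>{i..<i + q}. f k) + f (i + q)"
    proof -
      have "(\<Sum>k\<in>{i..<i + q}. f k) = f i + (\<Sum>k\<in>{Suc i..<i + q}. f k)"
        by (rule sum.atLeast_Suc_lessThan) (use q in simp)
      moreover have "(\<Sum>k\<in>{Suc i..<Suc (i + q)}. f k) = (\<Sum>k\<in>{Suc i..<i + q}. f k) + f (i + q)"
        by (rule sum.atLeastLessThan_Suc) (use q in simp)
      ultimately show ?thesis by simp
    qed
    then show ?case using Suc per by simp
  qed
  have "\<bar>(\<Sum>k<N. f (j + k)) - real N * (s / real q)\<bar> \<le> 2 * real q" for N
  proof -
    have "(\<Sum>k<N. f (j + k)) = (\<Sum>k<N div q * q. f (j + k)) + (\<Sum>k\<in>{N div q * q..<N}. f (j + k))"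
      by (simp add: lessThan_atLeast0 sum.atLeastLessThan_concat)
    also have "(\<Sum>k<N div q * q. f (j + k)) = (\<Sum>i<N div q. \<Sum>k\<in>{i * q..<i * q + q}. f (j + k))"
      by (rule sum.nat_group[symmetric])
    also have "\<dots> = (\<Sum>i<N div q. s)"
    proof (intro sum.cong refl)
      fix i
      have "(\<Sum>k\<in>{i * q..<i * q + q}. f (j + k)) = (\<Sum>k\<in>{j + i * q..<(j + i * q) + q}. f k)"
        unfolding sum_shift_window by (simp add: add.assoc)
      then show "(\<Sum>k\<in>{i * q..<i * q + q}. f (j + k)) = s" using win by simp
    qed
    finally have eq: "(\<Sum>k<N. f (j + k)) = real (N div q) * s + (\<Sum>k\<in>{N div q * q..<N}. f (j + k))" by simp
    have "\<bar>\<Sum>k\<in>{N div q * q..<N}. f (j + k)\<bar> \<le> (\<Sum>k\<in>{N div q * q..<N}. 1)"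
      using b by (intro order_trans[OF sum_abs] sum_mono) auto
    also have "\<dots> = real (N mod q)" by (simp add: minus_div_mult_eq_mod)
    finally have "\<bar>\<Sum>k\<in>{N div q * q..<N}. f (j + k)\<bar> \<le> real (N mod q)" .
    then have r: "\<bar>\<Sum>k\<in>{N div q * q..<N}. f (j + k)\<bar> \<le> real q"
    proof -
      have "real (N mod q) \<le> real q" using q by (intro of_nat_mono) (simp add: less_imp_le)
      with \<open>\<bar>\<Sum>k\<in>{N div q * q..<N}. f (j + k)\<bar> \<le> real (N mod q)\<close> show ?thesis by linarith
    qed
    have sq: "\<bar>s\<bar> \<le> real q"
    proof -
      have "\<bar>s\<bar> \<le> (\<Sum>k<q. \<bar>f k\<bar>)" unfolding s_def by (rule sum_abs)
      also have "\<dots> \<le> (\<Sum>k<q. 1)" using b by (intro sum_mono)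
      finally show ?thesis by simp
    qed
    have "real N = real (N div q) * real q + real (N mod q)"
      unfolding of_nat_mult[symmetric] of_nat_add[symmetric] by simp
    then have "real N * (s / real q) - real (N div q) * s = real (N mod q) / real q * s"
      using q by (simp add: field_simps)
    moreover have "\<bar>real (N mod q) / real q * s\<bar> \<le> 1 * real q"
      unfolding abs_mult using q sq by (intro mult_mono) (auto simp: field_simps)
    ultimately show ?thesis using r eq by linarith
  qed
  note bound = this
  have "(\<lambda>N. (\<Sum>k<N. f (j + k)) / real N - s / real q) \<longlonglongrightarrow> 0"
  proof (rule Lim_null_comparison)
    show "(\<lambda>N. 2 * real q / real N) \<longlonglongrightarrow> 0" by (rule lim_const_over_n)
    show "\<forall>\<^sub>F N in sequentially. norm ((\<Sum>k<N. f (j + k)) / real N - s / real q) \<le> 2 * real q / real N"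
      using eventually_gt_at_top[of 0]
    proof eventually_elim
      case (elim N)
      then have "(\<Sum>k<N. f (j + k)) / real N - s / real q = ((\<Sum>k<N. f (j + k)) - real N * (s / real q)) / real N"
        by (simp add: field_simps)
      then show ?case using divide_right_mono[OF bound[of N], of "real N"] by simp
    qed
  qed
  then show ?thesis unfolding s_def by (rule LIM_zero_cancel)
qed

lemma emeasure_atomic_measure:
  assumes "finite I" "A \<in> sets M"
  shows "emeasure (atomic_measure M I w x) A = (\<Sum>i\<in>I. w i * indicator A (x i))"
proof -
  have "emeasure (atomic_measure M I w x) A = (\<lambda>C. \<Sum>i\<in>I. w i * indicator C (x i)) A"
    unfolding atomic_measure_def
  proof (rule emeasure_measure_of_sigma)
    show "sigma_algebra (space M) (sets M)" ..
    show "positive (sets M) (\<lambda>C. \<Sum>i\<in>I. w i * indicator C (x i))"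
      by (simp add: positive_def)
    show "countably_additive (sets M) (\<lambda>C. \<Sum>i\<in>I. w i * indicator C (x i))"
    proof (rule countably_additiveI)
      fix A :: "nat \<Rightarrow> 'b set" assume "disjoint_family A"
      then have "indicator (\<Union>i. A i) y = (\<Sum>i. indicator (A i) y :: ennreal)" for y
        by (simp add: suminf_indicator)
      then show "(\<Sum>i. \<Sum>j\<in>I. w j * indicator (A i) (x j)) = (\<Sum>i\<in>I. w i * indicator (\<Union>i. A i) (x i))"
        by (subst suminf_sum) (auto intro!: sum.cong)
    qed
  qed fact
  then show ?thesis by simp
qed

lemma sets_atomic_measure [simp, measurable_cong]: "sets (atomic_measure M I w x) = sets M"
  and space_atomic_measure [simp]: "space (atomic_measure M I w x) = space M"
  unfolding atomic_measure_def by (auto simp: sets.space_closed)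

lemma phase_measure_rational:
  assumes "\<beta> \<in> \<rat>"
  obtains q :: nat where "0 < q" "real q * \<beta> \<in> \<int>"
    "phase_measure \<beta> = atomic_measure borel {..<q} (\<lambda>k. 1 / of_nat q) (\<lambda>k. frac (real k * \<beta>))"
proof -
  let ?P = "\<lambda>q::nat. 0 < q \<and> (\<exists>p :: int. coprime p (int q) \<and> \<beta> = of_int p / real q)"
  have ex1: "\<exists>!q. ?P q"
  proof -
    obtain r where r: "\<beta> = of_rat r" using assms by (auto simp: Rats_def)
    obtain p q where pq: "quotient_of r = (p, q)" by (cases "quotient_of r")
    have q: "q > 0" "coprime p q" "r = of_int p / of_int q"
      using quotient_of_denom_pos[OF pq] quotient_of_coprime[OF pq] quotient_of_div[OF pq] by auto
    have "?P (nat q)" using q by (intro conjI exI[of _ p]) (auto simp: r of_rat_divide)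
    moreover have "q1 = q2" if "?P q1" "?P q2" for q1 q2
    proof -
      obtain p1 p2 where 1: "coprime p1 (int q1)" "\<beta> = of_int p1 / real q1" "0 < q1"
        and 2: "coprime p2 (int q2)" "\<beta> = of_int p2 / real q2" "0 < q2" using \<open>?P q1\<close> \<open>?P q2\<close> by blast
      have "real_of_int (p1 * int q2) = real_of_int (p2 * int q1)"
        using 1 2 by (simp add: field_simps)
      then have eq: "p1 * int q2 = p2 * int q1" by linarith
      have "int q1 dvd int q2"
        using 1(1) eq by (metis coprime_commute coprime_dvd_mult_right_iff dvd_triv_right)
      moreover have "int q2 dvd int q1"
        using 2(1) eq by (metis coprime_commute coprime_dvd_mult_right_iff dvd_triv_right)
      ultimately show ?thesis by (simp add: dvd_antisym)
    qed
    ultimately show ?thesis by blast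
  qed
  define q where "q = (THE q. ?P q)"
  have P: "?P q" unfolding q_def by (rule theI'[OF ex1])
  show ?thesis
  proof
    show "0 < q" using P by simp
    show "real q * \<beta> \<in> \<int>" using P by auto
    show "phase_measure \<beta> = atomic_measure borel {..<q} (\<lambda>k. 1 / of_nat q) (\<lambda>k. frac (real k * \<beta>))"
      unfolding phase_measure_def q_def Let_def using assms by simp
  qed
qed

lemma sets_phase_measure [simp, measurable_cong]: "sets (phase_measure \<beta>) = sets borel"
  by (simp add: phase_measure_def Let_def)

lemma space_phase_measure [simp]: "space (phase_measure \<beta>) = UNIV"
  using sets_eq_imp_space_eq[OF sets_phase_measure] by simp

lemma ennreal_sum_inverse: "0 < q \<Longrightarrow> (\<Sum>k<q. 1 / of_nat q :: ennreal) = 1"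
  by (simp add: ennreal_times_divide) (rule ennreal_divide_self, auto simp: of_nat_less_top)

lemma prob_space_phase_measure: "prob_space (phase_measure \<beta>)"
proof (cases "\<beta> \<in> \<rat>")
  case True
  then obtain q :: nat where q: "0 < q" "phase_measure \<beta> = atomic_measure borel {..<q} (\<lambda>k. 1 / of_nat q) (\<lambda>k. frac (real k * \<beta>))"
    by (rule phase_measure_rational)
  show ?thesis
    by (rule prob_spaceI) (use q ennreal_sum_inverse[OF q(1)] in \<open>simp add: emeasure_atomic_measure\<close>)
next
  case False
  then show ?thesis
    unfolding phase_measure_def by (auto intro!: prob_space_uniform_measure)
qed

definition typical_phase :: "real \<Rightarrow> real \<Rightarrow> bool" where
  "typical_phase \<beta> t \<longleftrightarrow> 0 \<le> t \<and> t < 1 \<and> (\<beta> \<in> \<rat> \<longrightarrow> (\<exists>j::nat. t = frac (real j * \<beta>)))"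

lemma typical_phase_0: "typical_phase \<beta> 0"
  unfolding typical_phase_def by (auto intro!: exI[of _ 0])

lemma AE_typical_phase: "AE t in phase_measure \<beta>. typical_phase \<beta> t"
proof (cases "\<beta> \<in> \<rat>")
  case True
  then obtain q :: nat where q: "0 < q" "phase_measure \<beta> = atomic_measure borel {..<q} (\<lambda>k. 1 / of_nat q) (\<lambda>k. frac (real k * \<beta>))"
    by (rule phase_measure_rational)
  let ?N = "UNIV - (\<lambda>k. frac (real k * \<beta>)) ` {..<q}"
  have "emeasure (phase_measure \<beta>) ?N = 0"
    unfolding q(2) by (subst emeasure_atomic_measure) (auto intro!: borel_open open_Diff finite_imp_closed)
  then show ?thesis
    by (intro AE_I[of _ _ ?N])
       (auto simp: typical_phase_def frac_lt_1 intro!: borel_open open_Diff finite_imp_closed)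
next
  case False
  have "AE t in uniform_measure lborel {0..<1::real}. t \<in> {0..<1}"
    by (rule AE_uniform_measureI) auto
  then show ?thesis unfolding phase_measure_def if_not_P[OF False] using False by (simp add: typical_phase_def)
qed

theorem rotation_equidistribution:
  assumes t: "typical_phase \<beta> t" and ab: "0 \<le> a" "a \<le> b" "b \<le> 1"
  shows "(\<lambda>N. (\<Sum>k<N. visits \<beta> t a b k) / real N) \<longlonglongrightarrow> measure (phase_measure \<beta>) {a..<b}"
proof (cases "\<beta> \<in> \<rat>")
  case True
  then obtain q :: nat where q: "0 < q" "real q * \<beta> \<in> \<int>"
    "phase_measure \<beta> = atomic_measure borel {..<q} (\<lambda>k. 1 / of_nat q) (\<lambda>k. frac (real k * \<beta>))"
    by (rule phase_measure_rational)
  obtain j :: nat where j: "t = frac (real j * \<beta>)" using t True by (auto simp: typical_phase_def)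
  let ?f = "\<lambda>k. indicator {a..<b} (frac (real k * \<beta>)) :: real"
  have "(\<lambda>N. (\<Sum>k<N. ?f (j + k)) / real N) \<longlonglongrightarrow> (\<Sum>k<q. ?f k) / real q"
  proof (rule periodic_average)
    fix k
    have "frac (real (k + q) * \<beta>) = frac (real k * \<beta>)"
      using q(2) by (intro frac_add_int) (simp add: algebra_simps)
    then show "?f (k + q) = ?f k" by simp
  qed (use q in auto)
  moreover have "?f (j + k) = visits \<beta> t a b k" for k
  proof -
    have "real (j + k) * \<beta> - (t + real k * \<beta>) = of_int \<lfloor>real j * \<beta>\<rfloor>"
      by (simp add: j frac_def algebra_simps)
    then have "frac (real (j + k) * \<beta>) = frac (t + real k * \<beta>)"
      by (intro frac_add_int) auto
    then show ?thesis by (simp add: visits_def)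
  qed
  moreover have "measure (phase_measure \<beta>) {a..<b} = (\<Sum>k<q. ?f k) / real q"
  proof -
    have "emeasure (phase_measure \<beta>) {a..<b} = (\<Sum>k<q. 1 / of_nat q * indicator {a..<b} (frac (real k * \<beta>)))"
      unfolding q(3) by (subst emeasure_atomic_measure) auto
    also have "\<dots> = (\<Sum>k<q. ennreal (1 / real q * ?f k))"
    proof (intro sum.cong refl)
      fix k
      have "(1 / of_nat q :: ennreal) = ennreal (1 / real q)"
        using q(1) by (metis divide_ennreal ennreal_1 ennreal_of_nat_eq_real_of_nat of_nat_0_less_iff zero_le_one)
      then show "1 / of_nat q * indicator {a..<b} (frac (real k * \<beta>)) = ennreal (1 / real q * ?f k)"
        by (simp add: indicator_def)
    qed
    also have "\<dots> = ennreal (\<Sum>k<q. 1 / real q * ?f k)" by (simp add: sum_ennreal)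
    finally show ?thesis
      by (simp add: measure_def sum_nonneg flip: sum_divide_distrib)
  qed
  ultimately show ?thesis by simp
next
  case False
  have "measure (phase_measure \<beta>) {a..<b} = b - a"
  proof -
    have "{0..<1} \<inter> {a..<b} = {a..<b}" using ab by auto
    then show ?thesis using False ab by (simp add: phase_measure_def measure_def divide_ennreal_def)
  qed
  with irrational_visits[OF False ab] show ?thesis by simp
qed

corollary rotation_equidistribution_interval:
  assumes t: "typical_phase \<beta> t"
  shows "(\<lambda>N. (\<Sum>k<N. visits \<beta> t a b k) / real N) \<longlonglongrightarrow> measure (phase_measure \<beta>) {a..<b}"
proof -
  define a' where "a' = min 1 (max 0 a)"
  define b' where "b' = max a' (min 1 b)"
  have ab': "0 \<le> a'" "a' \<le> b'" "b' \<le> 1" by (auto simp: a'_def b'_def)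
  have eq: "x \<in> {a..<b} \<longleftrightarrow> x \<in> {a'..<b'}" if "0 \<le> x" "x < 1" for x
    using that by (auto simp: a'_def b'_def)
  have "visits \<beta> t a b k = visits \<beta> t a' b' k" for k
    unfolding visits_def indicator_def by (subst eq) (auto simp: frac_lt_1)
  moreover have "measure (phase_measure \<beta>) {a..<b} = measure (phase_measure \<beta>) {a'..<b'}"
  proof (rule measure_eq_AE)
    show "AE x in phase_measure \<beta>. x \<in> {a..<b} \<longleftrightarrow> x \<in> {a'..<b'}"
      using AE_typical_phase[of \<beta>]
    proof eventually_elim
      case (elim x)
      then show ?case using eq[of x] by (simp only: typical_phase_def)
    qed
  qed simp_all
  ultimately show ?thesis using rotation_equidistribution[OF t ab'] by simp
qed

lemma sum_rotate:
  fixes f :: "nat \<Rightarrow> 'a::comm_monoid_add"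
  assumes "0 < q" "f q = f 0"
  shows "(\<Sum>k<q. f (Suc k)) = (\<Sum>k<q. f k)"
proof -
  obtain r where r: "q = Suc r" using assms(1) by (cases q) auto
  show ?thesis
    using assms(2) unfolding r sum.lessThan_Suc_shift[of f r] by (simp add: add.commute)
qed

theorem rotation_preserves_phase_measure:
  "distr (phase_measure \<beta>) (phase_measure \<beta>) (\<lambda>t. frac (t + \<beta>)) = phase_measure \<beta>"
proof (rule measure_eqI)
  have fm[measurable]: "(\<lambda>t. frac (t + \<beta>)) \<in> borel_measurable borel"
    unfolding frac_def by measurable
  fix A assume "A \<in> sets (distr (phase_measure \<beta>) (phase_measure \<beta>) (\<lambda>t. frac (t + \<beta>)))"
  then have A[measurable]: "A \<in> sets borel" by simp
  have eq: "emeasure (distr (phase_measure \<beta>) (phase_measure \<beta>) (\<lambda>t. frac (t + \<beta>))) A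
     = emeasure (phase_measure \<beta>) ((\<lambda>t. frac (t + \<beta>)) -` A)"
    by (subst emeasure_distr) (auto simp: measurable_cong_sets[OF sets_phase_measure sets_phase_measure])
  have pre[measurable]: "(\<lambda>t. frac (t + \<beta>)) -` A \<in> sets borel"
    using measurable_sets[OF fm A] by simp
  show "emeasure (distr (phase_measure \<beta>) (phase_measure \<beta>) (\<lambda>t. frac (t + \<beta>))) A = emeasure (phase_measure \<beta>) A"
  proof (cases "\<beta> \<in> \<rat>")
    case True
    then obtain q :: nat where q: "0 < q" "real q * \<beta> \<in> \<int>"
      "phase_measure \<beta> = atomic_measure borel {..<q} (\<lambda>k. 1 / of_nat q) (\<lambda>k. frac (real k * \<beta>))"
      by (rule phase_measure_rational)
    let ?f = "\<lambda>k. 1 / of_nat q * indicator A (frac (real k * \<beta>)) :: ennreal"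
    have step: "frac (frac (real k * \<beta>) + \<beta>) = frac (real (Suc k) * \<beta>)" for k
    proof (rule frac_add_int)
      have "frac (real k * \<beta>) + \<beta> - real (Suc k) * \<beta> = of_int (- \<lfloor>real k * \<beta>\<rfloor>)"
        by (simp add: frac_def algebra_simps)
      then show "frac (real k * \<beta>) + \<beta> - real (Suc k) * \<beta> \<in> \<int>" by (metis Ints_of_int)
    qed
    have "emeasure (phase_measure \<beta>) ((\<lambda>t. frac (t + \<beta>)) -` A) = (\<Sum>k<q. 1 / of_nat q * indicator ((\<lambda>t. frac (t + \<beta>)) -` A) (frac (real k * \<beta>)))"
      unfolding q(3) by (rule emeasure_atomic_measure) (use pre in auto)
    also have "\<dots> = (\<Sum>k<q. ?f (Suc k))"
      by (intro sum.cong refl) (simp only: indicator_vimage[unfolded comp_def] step)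
    also have "\<dots> = (\<Sum>k<q. ?f k)"
    proof -
      have "frac (real q * \<beta>) = 0" using q(2) by (simp add: frac_eq_0_iff)
      moreover have "frac (real 0 * \<beta>) = 0" by simp
      ultimately have "?f q = ?f 0" by (simp only:)
      with q(1) show ?thesis by (rule sum_rotate)
    qed
    also have "\<dots> = emeasure (phase_measure \<beta>) A"
      unfolding q(3) by (subst emeasure_atomic_measure) auto
    finally show ?thesis using eq by simp
  next
    case False
    define c where "c = frac \<beta>"
    have c: "0 \<le> c" "c < 1" by (auto simp: c_def frac_lt_1)
    have fr: "frac (t + \<beta>) = (if t + c < 1 then c + t else (c - 1) + t)" if "t \<in> {0..<1}" for t
    proof -
      have "frac (t + \<beta>) = frac (t + c)"
        by (rule frac_add_int) (simp add: c_def frac_def)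
      also have "\<dots> = (if t + c < 1 then c + t else (c - 1) + t)"
        using that c by (auto simp: frac_unique_iff)
      finally show ?thesis .
    qed
    have tr: "emeasure lborel ((\<lambda>t. d + t) -` X) = emeasure lborel X" if "X \<in> sets borel" for d and X :: "real set"
      using arg_cong[OF lborel_distr_plus[of d], of "\<lambda>M. emeasure M X"] that by (subst (asm) emeasure_distr) auto
    have "{0..<1} \<inter> ((\<lambda>t. frac (t + \<beta>)) -` A) = ((\<lambda>t. c + t) -` (A \<inter> {c..<1})) \<union> ((\<lambda>t. (c - 1) + t) -` (A \<inter> {0..<c}))"
      (is "_ = ?L \<union> ?R")
      using c by (auto simp: fr split: if_splits)
    moreover have "emeasure lborel (?L \<union> ?R) = emeasure lborel ?L + emeasure lborel ?R"
      using c by (intro plus_emeasure[symmetric]) (auto intro!: measurable_sets_borel[of _ borel])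
    moreover have "emeasure lborel ?L + emeasure lborel ?R = emeasure lborel (A \<inter> {c..<1}) + emeasure lborel (A \<inter> {0..<c})"
      by (subst (1 2) tr) auto
    moreover have "\<dots> = emeasure lborel ((A \<inter> {c..<1}) \<union> (A \<inter> {0..<c}))"
      by (rule plus_emeasure) auto
    moreover have "(A \<inter> {c..<1}) \<union> (A \<inter> {0..<c}) = {0..<1} \<inter> A" using c by auto
    ultimately have "emeasure lborel ({0..<1} \<inter> ((\<lambda>t. frac (t + \<beta>)) -` A)) = emeasure lborel ({0..<1} \<inter> A)"
      by simp
    then show ?thesis using False eq by (simp add: phase_measure_def)
  qed
qed simp

section \<open>Averages of weakly dependent variables, and ergodicity\<close>

lemma separated_pairs_count:
  fixes H :: nat
  shows "card {j \<in> {..<N}. \<not> (i + H \<le> j) \<and> \<not> (j + H \<le> i)} \<le> 2 * H"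
proof -
  have "{j \<in> {..<N}. \<not> (i + H \<le> j) \<and> \<not> (j + H \<le> i)} \<subseteq> {i + 1 - H..<i + H}" by auto
  then have "card {j \<in> {..<N}. \<not> (i + H \<le> j) \<and> \<not> (j + H \<le> i)} \<le> card {i + 1 - H..<i + H}"
    by (intro card_mono) auto
  then show ?thesis by simp
qed

lemma (in prob_space) second_moment_bound:
  fixes X :: "nat \<Rightarrow> 'a \<Rightarrow> real"
  assumes [measurable]: "\<And>k. X k \<in> borel_measurable M" and b: "\<And>k x. \<bar>X k x\<bar> \<le> 1"
    and unc: "\<And>i j. i + H \<le> j \<Longrightarrow> expectation (\<lambda>x. X i x * X j x) = 0"
  shows "expectation (\<lambda>x. (\<Sum>k<N. X k x)\<^sup>2) \<le> real N * (2 * real H)"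
proof -
  have b2: "\<bar>X i x * X j x\<bar> \<le> 1" for i j x
    unfolding abs_mult using b by (intro mult_le_one) auto
  have int: "integrable M (\<lambda>x. X i x * X j x)" for i j
    by (rule integrable_const_bound[of _ 1]) (use b2 in auto)
  have le1: "expectation (\<lambda>x. X i x * X j x) \<le> 1" for i j
  proof -
    have "expectation (\<lambda>x. X i x * X j x) \<le> expectation (\<lambda>x. 1)"
      by (intro integral_mono int) (use abs_le_D1[OF b2] in auto)
    then show ?thesis by (simp add: prob_space)
  qed
  have "expectation (\<lambda>x. (\<Sum>k<N. X k x)\<^sup>2) = (\<Sum>i<N. \<Sum>j<N. expectation (\<lambda>x. X i x * X j x))"
    using int by (simp add: power2_eq_square sum_product Bochner_Integration.integral_sum)
  also have "\<dots> \<le> (\<Sum>i<N. \<Sum>j<N. if \<not> (i + H \<le> j) \<and> \<not> (j + H \<le> i) then 1 else 0)"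
  proof (intro sum_mono)
    fix i j
    show "expectation (\<lambda>x. X i x * X j x) \<le> (if \<not> (i + H \<le> j) \<and> \<not> (j + H \<le> i) then 1 else 0)"
      using le1[of i j] unc[of i j] unc[of j i] by (auto simp: mult.commute)
  qed
  also have "\<dots> = (\<Sum>i<N. real (card {j \<in> {..<N}. \<not> (i + H \<le> j) \<and> \<not> (j + H \<le> i)}))"
    by (simp add: sum.If_cases Int_def)
  also have "\<dots> \<le> (\<Sum>i<N. 2 * real H)"
    using separated_pairs_count[of N _ H] by (intro sum_mono) (metis of_nat_le_iff of_nat_mult of_nat_numeral)
  finally show ?thesis by simp
qed

lemma average_along_squares:
  fixes x :: "nat \<Rightarrow> real"
  assumes b: "\<And>k. \<bar>x k\<bar> \<le> 1"
    and sq: "(\<lambda>j. (\<Sum>k<(Suc j)\<^sup>2. x k) / real ((Suc j)\<^sup>2)) \<longlonglongrightarrow> 0"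
  shows "(\<lambda>N. (\<Sum>k<N. x k) / real N) \<longlonglongrightarrow> 0"
proof -
  define s where "s N = (\<Sum>k<N. x k)" for N
  define a where "a j = s (j\<^sup>2) / real (j\<^sup>2)" for j
  have a: "a \<longlonglongrightarrow> 0" using sq filterlim_sequentially_Suc[of a "nhds 0"] unfolding a_def s_def by simp
  have fl: "filterlim floor_sqrt at_top sequentially"
    unfolding filterlim_at_top
  proof
    fix Z :: nat
    show "\<forall>\<^sub>F N in sequentially. Z \<le> floor_sqrt N"
      using eventually_ge_at_top[of "Z\<^sup>2"]
      by eventually_elim (metis floor_sqrt_inverse_power2 mono_floor_sqrt')
  qed
  have bound: "\<bar>s N / real N\<bar> \<le> \<bar>a (floor_sqrt N)\<bar> + 2 / real (floor_sqrt N)" if N: "N > 0" for N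
  proof -
    define j where "j = floor_sqrt N"
    have j: "j > 0" "j\<^sup>2 \<le> N" "N < (Suc j)\<^sup>2"
      using N by (auto simp: j_def Suc_floor_sqrt_power2_gt)
    have N2: "N - j\<^sup>2 \<le> 2 * j" using j by (auto simp: power2_eq_square)
    have "s N = s (j\<^sup>2) + (\<Sum>k\<in>{j\<^sup>2..<N}. x k)"
      unfolding s_def using j by (simp add: lessThan_atLeast0 sum.atLeastLessThan_concat)
    moreover have "\<bar>\<Sum>k\<in>{j\<^sup>2..<N}. x k\<bar> \<le> real (N - j\<^sup>2)"
    proof -
      have "\<bar>\<Sum>k\<in>{j\<^sup>2..<N}. x k\<bar> \<le> (\<Sum>k\<in>{j\<^sup>2..<N}. \<bar>x k\<bar>)" by (rule sum_abs)
      also have "\<dots> \<le> (\<Sum>k\<in>{j\<^sup>2..<N}. 1)" by (intro sum_mono b)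
      finally show ?thesis by simp
    qed
    moreover have "real (N - j\<^sup>2) \<le> 2 * real j" using N2 by (metis of_nat_le_iff of_nat_mult of_nat_numeral)
    ultimately have "\<bar>s N\<bar> \<le> \<bar>s (j\<^sup>2)\<bar> + 2 * real j" by linarith
    then have "\<bar>s N / real N\<bar> \<le> (\<bar>s (j\<^sup>2)\<bar> + 2 * real j) / real N"
      by (simp add: divide_right_mono)
    also have "\<dots> \<le> (\<bar>s (j\<^sup>2)\<bar> + 2 * real j) / real (j\<^sup>2)"
      using j N by (intro divide_left_mono mult_pos_pos) auto
    also have "\<dots> = \<bar>a j\<bar> + 2 / real j"
      using j by (simp add: a_def add_divide_distrib power2_eq_square)
    finally show ?thesis by (simp add: j_def)
  qed
  have "(\<lambda>j. \<bar>a j\<bar> + 2 / real j) \<longlonglongrightarrow> \<bar>0\<bar> + 0"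
    by (intro tendsto_add tendsto_rabs a lim_const_over_n)
  then have "(\<lambda>N. \<bar>a (floor_sqrt N)\<bar> + 2 / real (floor_sqrt N)) \<longlonglongrightarrow> 0"
    using filterlim_compose[OF _ fl, of "\<lambda>j. \<bar>a j\<bar> + 2 / real j"] by simp
  then show ?thesis unfolding s_def[symmetric]
    by (rule Lim_null_comparison[rotated]) (use bound in \<open>auto intro: eventually_mono[OF eventually_gt_at_top[of 0]]\<close>)
qed

theorem (in prob_space) averages_tendsto_0:
  fixes X :: "nat \<Rightarrow> 'a \<Rightarrow> real"
  assumes meas[measurable]: "\<And>k. X k \<in> borel_measurable M" and b: "\<And>k x. \<bar>X k x\<bar> \<le> 1"
    and unc: "\<And>i j. i + H \<le> j \<Longrightarrow> expectation (\<lambda>x. X i x * X j x) = 0"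
  shows "AE x in M. (\<lambda>N. (\<Sum>k<N. X k x) / real N) \<longlonglongrightarrow> 0"
proof -
  define Y where "Y j x = ((\<Sum>k<(Suc j)\<^sup>2. X k x) / real ((Suc j)\<^sup>2))\<^sup>2" for j x
  have [measurable]: "Y j \<in> borel_measurable M" for j unfolding Y_def by measurable
  have sb: "\<bar>\<Sum>k<N. X k x\<bar> \<le> real N" for N x
  proof -
    have "\<bar>\<Sum>k<N. X k x\<bar> \<le> (\<Sum>k<N. \<bar>X k x\<bar>)" by (rule sum_abs)
    also have "\<dots> \<le> (\<Sum>k<N. 1)" by (intro sum_mono b)
    finally show ?thesis by simp
  qed
  have EY: "(\<integral>\<^sup>+x. ennreal (Y j x) \<partial>M) \<le> ennreal (2 * real H / (real (Suc j))\<^sup>2)" for j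
  proof -
    let ?N = "(Suc j)\<^sup>2"
    have "(\<integral>\<^sup>+x. ennreal (Y j x) \<partial>M) = ennreal (expectation (Y j))"
    proof (rule nn_integral_eq_integral)
      have "\<bar>Y j x\<bar> \<le> 1" for x
      proof -
        have "\<bar>(\<Sum>k<?N. X k x) / real ?N\<bar> \<le> 1" using sb[of x ?N] by (simp add: field_simps del: of_nat_power)
        then show ?thesis unfolding Y_def by (simp add: power_le_one_iff abs_square_le_1)
      qed
      then show "integrable M (Y j)" by (intro integrable_const_bound[of _ 1]) auto
    qed (simp add: Y_def)
    also have "expectation (Y j) = expectation (\<lambda>x. (\<Sum>k<?N. X k x)\<^sup>2) / (real ?N)\<^sup>2"
      unfolding Y_def power_divide by simp
    also have "\<dots> \<le> real ?N * (2 * real H) / (real ?N)\<^sup>2"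
      by (intro divide_right_mono second_moment_bound meas b unc) auto
    also have "\<dots> = 2 * real H / (real (Suc j))\<^sup>2"
    proof -
      have "a * b / a\<^sup>2 = b / a" if "0 < a" for a b :: real using that by (simp add: power2_eq_square)
      from this[of "real ?N" "2 * real H"] show ?thesis by (simp only: of_nat_power) simp
    qed
    finally show ?thesis by (simp add: ennreal_leI)
  qed
  have sm: "summable (\<lambda>j. 2 * real H / (real (Suc j))\<^sup>2)"
    using summable_mult[OF summable_Suc_iff[THEN iffD2, OF inverse_power_summable[of 2, where 'a=real]], of "2 * real H"]
    by (simp add: field_simps)
  have "(\<integral>\<^sup>+x. (\<Sum>j. ennreal (Y j x)) \<partial>M) = (\<Sum>j. \<integral>\<^sup>+x. ennreal (Y j x) \<partial>M)"
    by (intro nn_integral_suminf) auto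
  also have "\<dots> \<le> (\<Sum>j. ennreal (2 * real H / (real (Suc j))\<^sup>2))"
    by (intro suminf_le EY) auto
  also have "\<dots> = ennreal (\<Sum>j. 2 * real H / (real (Suc j))\<^sup>2)"
    using sm by (intro suminf_ennreal2) auto
  finally have "(\<integral>\<^sup>+x. (\<Sum>j. ennreal (Y j x)) \<partial>M) \<noteq> \<infinity>"
    by (auto simp: top_unique)
  then have "AE x in M. (\<Sum>j. ennreal (Y j x)) \<noteq> \<infinity>"
    by (intro nn_integral_PInf_AE) auto
  then show ?thesis
  proof eventually_elim
    case (elim x)
    have "summable (\<lambda>j. Y j x)"
      using elim by (intro summable_suminf_not_top) (auto simp: Y_def)
    then have "(\<lambda>j. Y j x) \<longlonglongrightarrow> 0" by (rule summable_LIMSEQ_zero)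
    then have "(\<lambda>j. \<bar>(\<Sum>k<(Suc j)\<^sup>2. X k x) / real ((Suc j)\<^sup>2)\<bar>) \<longlonglongrightarrow> 0"
      unfolding Y_def using tendsto_real_sqrt by fastforce
    then show ?case
      by (intro average_along_squares b) (rule tendsto_rabs_zero_cancel)
  qed
qed

theorem ergodic_of_averages:
  assumes M: "prob_space M" and G[measurable]: "G \<in> M \<rightarrow>\<^sub>M M" and inv: "distr M M G = M"
    and C: "Int_stable C" "C \<subseteq> Pow (space M)" "sets M = sigma_sets (space M) C"
    and avg: "\<And>c. c \<in> C \<Longrightarrow> AE x in M. (\<lambda>N. (\<Sum>k<N. indicator c ((G ^^ k) x)) / real N) \<longlonglongrightarrow> measure M c"
    and A[measurable]: "A \<in> sets M" and GA: "G -` A \<inter> space M = A"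
  shows "emeasure M A = 0 \<or> emeasure M A = 1"
proof -
  interpret prob_space M by fact
  have Gk[measurable]: "(G ^^ k) \<in> M \<rightarrow>\<^sub>M M" for k
    by (induction k) (auto intro: measurable_comp[OF _ G, unfolded comp_def] simp: comp_def)
  have invk: "distr M M (G ^^ k) = M" for k
  proof (induction k)
    case 0
    then show ?case by (simp add: distr_id[unfolded id_def] id_def)
  next
    case (Suc k)
    have "distr M M (G ^^ Suc k) = distr (distr M M (G ^^ k)) M G"
      by (simp add: distr_distr comp_def)
    also have "\<dots> = M" by (simp only: Suc inv)
    finally show ?case .
  qed
  have A_iff: "(G ^^ k) x \<in> A \<longleftrightarrow> x \<in> A" if "x \<in> space M" for k x
  proof (induction k)
    case (Suc k)
    have "(G ^^ k) x \<in> space M" using measurable_space[OF Gk that] .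
    then have "G ((G ^^ k) x) \<in> A \<longleftrightarrow> (G ^^ k) x \<in> A" using GA by blast
    then show ?case using Suc by simp
  qed simp
  have CM: "c \<in> sets M" if "c \<in> C" for c using that C(3) by auto
  have basic: "measure M (A \<inter> c) = measure M A * measure M c" if c: "c \<in> C" for c
  proof -
    have [measurable]: "c \<in> sets M" using CM[OF c] .
    have ind: "(\<integral>x. indicat_real A x * indicator c ((G ^^ k) x) \<partial>M) = measure M (A \<inter> c)" for k
    proof -
      have "(\<integral>x. indicat_real A x * indicator c ((G ^^ k) x) \<partial>M) = (\<integral>x. indicator (A \<inter> c) ((G ^^ k) x) \<partial>M)"
        by (intro Bochner_Integration.integral_cong refl) (auto simp: indicator_def A_iff)
      also have "\<dots> = (\<integral>x. indicator (A \<inter> c) x \<partial>distr M M (G ^^ k))"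
        by (subst integral_distr) auto
      finally show ?thesis by (simp add: invk)
    qed
    let ?a = "\<lambda>N x. (\<Sum>k<N. indicator c ((G ^^ k) x)) / real N"
    have "(\<integral>x. indicator A x * ?a N x \<partial>M) = measure M (A \<inter> c)" if "N > 0" for N
    proof -
      have "(\<integral>x. indicator A x * ?a N x \<partial>M) = (\<integral>x. (\<Sum>k<N. indicator A x * indicator c ((G ^^ k) x)) / real N \<partial>M)"
        by (simp add: sum_distrib_left)
      also have "\<dots> = (\<Sum>k<N. \<integral>x. indicator A x * indicator c ((G ^^ k) x) \<partial>M) / real N"
        by (subst Bochner_Integration.integral_divide_zero, subst Bochner_Integration.integral_sum)
           (auto intro!: integrable_const_bound[of _ 1] simp: indicator_def)
      finally show ?thesis using that by (simp add: ind)
    qed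
    then have 1: "(\<lambda>N. \<integral>x. indicator A x * ?a N x \<partial>M) \<longlonglongrightarrow> measure M (A \<inter> c)"
      by (intro tendsto_eventually eventually_mono[OF eventually_gt_at_top[of 0]])
    have "(\<lambda>N. \<integral>x. indicator A x * ?a N x \<partial>M) \<longlonglongrightarrow> (\<integral>x. indicator A x * measure M c \<partial>M)"
    proof (rule integral_dominated_convergence[where w="\<lambda>_. 1"])
      show "AE x in M. (\<lambda>N. indicator A x * ?a N x) \<longlonglongrightarrow> indicator A x * measure M c"
        using avg[OF c] by eventually_elim (intro tendsto_intros)
      have "0 \<le> ?a N x \<and> ?a N x \<le> 1" for N x
      proof -
        have "(\<Sum>k<N. indicator c ((G ^^ k) x)) \<le> (\<Sum>k<N. 1 :: real)" by (intro sum_mono) (auto simp: indicator_def)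
        then show ?thesis by (auto simp: divide_le_eq sum_nonneg)
      qed
      then show "AE x in M. norm (indicator A x * ?a N x) \<le> 1" for N
        by (auto simp: indicator_def)
    qed auto
    with 1 have "measure M (A \<inter> c) = (\<integral>x. indicator A x * measure M c \<partial>M)"
      by (rule LIMSEQ_unique)
    then show ?thesis by simp
  qed
  have all: "measure M (A \<inter> B) = measure M A * measure M B" if "B \<in> sigma_sets (space M) C" for B
    using C(1,2) that
  proof (induction rule: sigma_sets_induct_disjoint)
    case (basic B)
    then show ?case by fact
  next
    case (compl B)
    then have [measurable]: "B \<in> sets M" using C(3) by auto
    have "A \<inter> (space M - B) = A - (A \<inter> B)" using sets.sets_into_space[OF A] by auto
    then have "measure M (A \<inter> (space M - B)) = measure M A - measure M (A \<inter> B)"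
      by (simp add: finite_measure_Diff)
    then show ?case using compl by (simp add: prob_compl algebra_simps)
  next
    case (union B)
    then have r[measurable]: "range B \<subseteq> sets M" "\<And>i. B i \<in> sets M" using C(3) by auto
    have "(\<lambda>i. measure M (A \<inter> B i)) sums measure M (\<Union>i. A \<inter> B i)"
      using union(1) by (intro finite_measure_UNION) (auto simp: disjoint_family_on_def)
    moreover have "(\<lambda>i. measure M A * measure M (B i)) sums (measure M A * measure M (\<Union>i. B i))"
      using union(1) r by (intro sums_mult finite_measure_UNION) auto
    ultimately have "measure M (\<Union>i. A \<inter> B i) = measure M A * measure M (\<Union>i. B i)"
      unfolding union(3) by (rule sums_unique2)
    then show ?case by (simp only: Int_UN_distrib)
  qed simp
  have "measure M A = measure M A * measure M A" using all[of A] A C(3) by simp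
  then have "measure M A = 0 \<or> measure M A = 1" by auto
  then show ?thesis by (auto simp: emeasure_eq_measure)
qed

section \<open>Independent identically distributed sequences\<close>

definition iid :: "'a pmf \<Rightarrow> (nat \<Rightarrow> 'a) measure" where
  "iid p = (\<Pi>\<^sub>M r\<in>UNIV. measure_pmf p)"

abbreviation seq_space :: "(nat \<Rightarrow> 'a) measure" where
  "seq_space \<equiv> (\<Pi>\<^sub>M r\<in>UNIV. count_space UNIV)"

definition cyl :: "nat \<Rightarrow> (nat \<Rightarrow> 'a set) \<Rightarrow> (nat \<Rightarrow> 'a) set" where
  "cyl L X = {z. \<forall>r<L. z r \<in> X r}"

abbreviation (input) seq_drop :: "nat \<Rightarrow> (nat \<Rightarrow> 'a) \<Rightarrow> nat \<Rightarrow> 'a" where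
  "seq_drop k z \<equiv> (\<lambda>r. z (k + r))"

lemma sets_iid [measurable_cong]: "sets (iid p) = sets seq_space"
  unfolding iid_def by (intro sets_PiM_cong) auto

lemma space_iid [simp]: "space (iid p) = UNIV"
  by (simp add: iid_def space_PiM)

lemma space_seq_space [simp]: "space (seq_space :: (nat \<Rightarrow> 'a) measure) = UNIV"
  by (simp add: space_PiM)

lemma prob_space_iid: "prob_space (iid p)"
  unfolding iid_def by (intro prob_space_PiM measure_pmf.prob_space_axioms)

lemma sets_Collect_coordinate [measurable]:
  "{z :: nat \<Rightarrow> 'a. z r \<in> X} \<in> sets seq_space"
proof -
  have "(\<lambda>z. z r) -` X \<inter> space (seq_space :: (nat \<Rightarrow> 'a) measure) \<in> sets seq_space"
    by (rule measurable_sets[of _ _ "count_space UNIV"]) auto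
  then show ?thesis by (simp add: vimage_def)
qed

lemma measurable_seq_drop [measurable]:
  "(\<lambda>z. seq_drop k z) \<in> seq_space \<rightarrow>\<^sub>M (seq_space :: (nat \<Rightarrow> 'a) measure)"
  by (rule measurable_PiM_single') (auto simp: space_PiM)

lemma emeasure_iid_coordinates:
  assumes "finite J"
  shows "emeasure (iid p) {z. \<forall>r\<in>J. z r \<in> X r} = (\<Prod>r\<in>J. emeasure (measure_pmf p) (X r))"
proof -
  interpret product_prob_space "\<lambda>_. measure_pmf p" "UNIV :: nat set" ..
  have "emeasure (iid p) {z \<in> space (iid p). \<forall>r\<in>J. z r \<in> X r} = (\<Prod>r\<in>J. emeasure (measure_pmf p) (X r))"
    unfolding iid_def using assms by (intro emeasure_PiM_Collect) auto
  then show ?thesis by simp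
qed

lemma emeasure_iid_cyl: "emeasure (iid p) (cyl L X) = (\<Prod>r<L. emeasure (measure_pmf p) (X r))"
  using emeasure_iid_coordinates[of "{..<L}" p X] unfolding cyl_def Ball_def lessThan_iff by simp

lemma sets_cyl [measurable]: "cyl L (X :: nat \<Rightarrow> 'a set) \<in> sets seq_space"
proof -
  have "cyl L X = (\<Inter>r\<in>{..<L}. {z. z r \<in> X r})" by (auto simp: cyl_def)
  also have "\<dots> \<in> sets seq_space"
    by (cases "L = 0") (auto simp: sets.top[of "seq_space :: (nat \<Rightarrow> 'a) measure", simplified])
  finally show ?thesis .
qed

lemma nn_integral_iid_split:
  assumes [measurable]: "f \<in> borel_measurable (seq_space :: (nat \<Rightarrow> 'a) measure)"
  shows "(\<integral>\<^sup>+z. indicator (cyl k X) z * f (seq_drop k z) \<partial>iid p) =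
    (\<Prod>r<k. emeasure (measure_pmf p) (X r)) * (\<integral>\<^sup>+z. f z \<partial>iid p)"
proof -
  interpret sequence_space "measure_pmf p" ..
  interpret I: prob_space "iid p" by (rule prob_space_iid)
  have comb: "distr (iid p \<Otimes>\<^sub>M iid p) (iid p) (\<lambda>(\<omega>, \<omega>'). comb_seq k \<omega> \<omega>') = iid p"
    using PiM_comb_seq[of k] by (simp add: iid_def)
  have meas[measurable]: "f \<in> borel_measurable (iid p)" "cyl k X \<in> sets (iid p)"
    "(\<lambda>z. seq_drop k z) \<in> iid p \<rightarrow>\<^sub>M iid p"
    by measurable
  have g: "(\<lambda>z. indicator (cyl k X) z * f (seq_drop k z)) \<in> borel_measurable (iid p)"
    by (intro borel_measurable_times_ennreal borel_measurable_indicator meas(2) measurable_compose[OF meas(3,1)])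
  have m[measurable]: "(\<lambda>(\<omega>, \<omega>'). comb_seq k \<omega> \<omega>') \<in> iid p \<Otimes>\<^sub>M iid p \<rightarrow>\<^sub>M iid p"
    unfolding iid_def by (rule measurable_comb_seq)
  have "(\<integral>\<^sup>+z. indicator (cyl k X) z * f (seq_drop k z) \<partial>iid p) =
    (\<integral>\<^sup>+z. indicator (cyl k X) z * f (seq_drop k z) \<partial>distr (iid p \<Otimes>\<^sub>M iid p) (iid p) (\<lambda>(\<omega>, \<omega>'). comb_seq k \<omega> \<omega>'))"
    by (simp only: comb)
  also have "\<dots> = (\<integral>\<^sup>+(\<omega>, \<omega>'). indicator (cyl k X) \<omega> * f \<omega>' \<partial>(iid p \<Otimes>\<^sub>M iid p))"
  proof (subst nn_integral_distr[OF m])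
    have "indicator (cyl k X) (comb_seq k \<omega> \<omega>') = (indicator (cyl k X) \<omega> :: ennreal)" for \<omega> \<omega>'
      by (auto simp: cyl_def indicator_def comb_seq_def)
    moreover have "seq_drop k (comb_seq k \<omega> \<omega>') = \<omega>'" for \<omega> \<omega>' :: "nat \<Rightarrow> 'a"
      by (auto simp: comb_seq_def)
    ultimately show "(\<integral>\<^sup>+x. indicator (cyl k X) (case x of (\<omega>, \<omega>') \<Rightarrow> comb_seq k \<omega> \<omega>') *
        f (seq_drop k (case x of (\<omega>, \<omega>') \<Rightarrow> comb_seq k \<omega> \<omega>')) \<partial>(iid p \<Otimes>\<^sub>M iid p)) =
      (\<integral>\<^sup>+(\<omega>, \<omega>'). indicator (cyl k X) \<omega> * f \<omega>' \<partial>(iid p \<Otimes>\<^sub>M iid p))"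
      by (intro nn_integral_cong) (simp add: split_beta)
  qed (use g in \<open>simp only: measurable_distr_eq1\<close>)
  also have "\<dots> = (\<integral>\<^sup>+\<omega>. \<integral>\<^sup>+\<omega>'. indicator (cyl k X) \<omega> * f \<omega>' \<partial>iid p \<partial>iid p)"
  proof -
    have "(\<lambda>x. indicator (cyl k X) (fst x) * f (snd x)) \<in> borel_measurable (iid p \<Otimes>\<^sub>M iid p)"
      by (intro borel_measurable_times_ennreal measurable_compose[OF measurable_fst borel_measurable_indicator]
          measurable_compose[OF measurable_snd] meas)
    from I.nn_integral_fst[OF this] show ?thesis by (simp add: split_beta')
  qed
  also have "\<dots> = (\<integral>\<^sup>+\<omega>. indicator (cyl k X) \<omega> * (\<integral>\<^sup>+\<omega>'. f \<omega>' \<partial>iid p) \<partial>iid p)"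
    by (intro nn_integral_cong nn_integral_cmult meas)
  also have "\<dots> = emeasure (iid p) (cyl k X) * (\<integral>\<^sup>+z. f z \<partial>iid p)"
    by (subst nn_integral_multc) (simp_all only: meas nn_integral_indicator borel_measurable_indicator)
  finally show ?thesis by (simp add: emeasure_iid_cyl)
qed

lemma distr_seq_drop_iid: "distr (iid p) (iid p) (seq_drop k) = iid p"
proof (rule measure_eqI)
  fix A assume "A \<in> sets (distr (iid p) (iid p) (seq_drop k))"
  then have A: "A \<in> sets (iid p)" "A \<in> sets seq_space" by (auto simp: sets_iid)
  have m: "(\<lambda>z. seq_drop k z) \<in> iid p \<rightarrow>\<^sub>M iid p" by measurable
  have "emeasure (distr (iid p) (iid p) (seq_drop k)) A = (\<integral>\<^sup>+z. indicator A z \<partial>distr (iid p) (iid p) (seq_drop k))"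
    by (rule nn_integral_indicator[symmetric]) (simp add: A)
  also have "\<dots> = (\<integral>\<^sup>+z. indicator A (seq_drop k z) \<partial>iid p)"
    by (rule nn_integral_distr[OF m borel_measurable_indicator]) fact
  also have "\<dots> = (\<integral>\<^sup>+z. indicator (cyl k (\<lambda>_. UNIV)) z * indicator A (seq_drop k z) \<partial>iid p)"
    by (simp add: cyl_def)
  also have "\<dots> = (\<Prod>r<k. emeasure (measure_pmf p) UNIV) * (\<integral>\<^sup>+z. indicator A z \<partial>iid p)"
    by (rule nn_integral_iid_split) (rule borel_measurable_indicator, fact)
  also have "\<dots> = emeasure (iid p) A"
    using A by simp
  finally show "emeasure (distr (iid p) (iid p) (seq_drop k)) A = emeasure (iid p) A" .
qed (rule sets_distr)

lemma cyl_Int: "cyl K X \<inter> cyl L Y = cyl (max K L) (\<lambda>r. (if r < K then X r else UNIV) \<inter> (if r < L then Y r else UNIV))"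
  by (auto simp: cyl_def less_max_iff_disj)

lemma Int_stable_cyl: "Int_stable {cyl L X | L X. True}"
  unfolding Int_stable_def using cyl_Int by blast

lemma sets_seq_space_cyl: "sets seq_space = sigma_sets UNIV {cyl L (X :: nat \<Rightarrow> 'a set) | L X. True}"
proof
  show "sets seq_space \<subseteq> sigma_sets UNIV {cyl L (X :: nat \<Rightarrow> 'a set) | L X. True}"
  proof -
    have "{z. z i \<in> A} = cyl (Suc i) (\<lambda>r. if r = i then A else UNIV)" for i and A :: "'a set"
      by (auto simp: cyl_def)
    then have "{z. z i \<in> A} \<in> {cyl L (X :: nat \<Rightarrow> 'a set) | L X. True}" for i and A :: "'a set"
      by blast
    then show ?thesis
      by (simp add: sets_PiM_single) (auto intro!: sigma_sets_mono)
  qed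
  show "sigma_sets UNIV {cyl L (X :: nat \<Rightarrow> 'a set) | L X. True} \<subseteq> sets seq_space"
  proof -
    have "{cyl L (X :: nat \<Rightarrow> 'a set) | L X. True} \<subseteq> sets seq_space" using sets_cyl by blast
    from sets.sigma_sets_subset[OF this] show ?thesis by (simp only: space_seq_space)
  qed
qed

lemma word_cylinders_determine:
  fixes M N :: "(nat \<Rightarrow> 'a::countable) measure"
  assumes M: "prob_space M" "sets M = sets seq_space" and N: "sets N = sets seq_space"
    and eq: "\<And>k w. emeasure M {z. \<forall>r<k. z r = w r} = emeasure N {z. \<forall>r<k. z r = w r}"
  shows "M = N"
proof (rule measure_eqI_generator_eq[where E="insert {} {{z. \<forall>r<k. z r = w r} | k w. True}" and \<Omega>=UNIV and A="\<lambda>_. UNIV"])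
  let ?E = "insert {} {{z. \<forall>r<k. z r = w r} | k (w :: nat \<Rightarrow> 'a). True}"
  show "Int_stable ?E"
  proof -
    have "{z. \<forall>r<k. z r = w r} \<inter> {z. \<forall>r<l. z r = v r} \<in> ?E" if "k \<le> l" for k l and w v :: "nat \<Rightarrow> 'a"
    proof (cases "\<forall>r<k. w r = v r")
      case True
      then have "{z. \<forall>r<k. z r = w r} \<inter> {z. \<forall>r<l. z r = v r} = {z. \<forall>r<l. z r = v r}" using that by auto
      then show ?thesis by blast
    next
      case False
      then have "{z. \<forall>r<k. z r = w r} \<inter> {z. \<forall>r<l. z r = v r} = {}" using that by fastforce
      then show ?thesis by blast
    qed
    note le = this
    have "{z. \<forall>r<k. z r = w r} \<inter> {z. \<forall>r<l. z r = v r} \<in> ?E" for k l and w v :: "nat \<Rightarrow> 'a"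
    proof (cases "k \<le> l")
      case False
      then show ?thesis using le[of l k v w] by (simp only: Int_commute nat_le_linear)
    qed (rule le)
    then show ?thesis unfolding Int_stable_def by blast
  qed
  have gen: "sets seq_space = sigma_sets UNIV ?E"
  proof
    show "sets seq_space \<subseteq> sigma_sets UNIV ?E"
    proof -
      have "{z. z i \<in> A} \<in> sigma_sets UNIV ?E" for i and A :: "'a set"
      proof -
        have "{z. z i \<in> A} = (\<Union>l\<in>{l. length l = Suc i \<and> l ! i \<in> A}. {z. \<forall>r<Suc i. z r = l ! r})" (is "?L = ?R")
        proof
          show "?L \<subseteq> ?R"
          proof
            fix z assume "z \<in> ?L"
            then have "map z [0..<Suc i] \<in> {l. length l = Suc i \<and> l ! i \<in> A}" 
              by (auto simp del: upt_Suc)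
            moreover have "z \<in> {y. \<forall>r<Suc i. y r = map z [0..<Suc i] ! r}" by (auto simp del: upt_Suc)
            ultimately show "z \<in> ?R" by blast
          qed
        qed auto
        also have "\<dots> \<in> sigma_sets UNIV ?E"
          by (rule sigma_sets_UNION) (auto intro!: sigma_sets.Basic)
        finally show ?thesis .
      qed
      then show ?thesis
        by (simp add: sets_PiM_single) (auto intro!: sigma_sets_mono)
    qed
    have "{z. \<forall>r<k. z r = w r} \<in> sets seq_space" for k and w :: "nat \<Rightarrow> 'a"
      using sets_cyl[of k "\<lambda>r. {w r}"] by (simp add: cyl_def)
    then show "sigma_sets UNIV ?E \<subseteq> sets seq_space"
    proof -
      have "?E \<subseteq> sets seq_space" using \<open>\<And>k w. {z. \<forall>r<k. z r = w r} \<in> sets seq_space\<close> by blast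
      from sets.sigma_sets_subset[OF this] show ?thesis by (simp only: space_seq_space)
    qed
  qed
  then show "sets M = sigma_sets UNIV ?E" "sets N = sigma_sets UNIV ?E"
    using M N by auto
  show "range (\<lambda>_::nat. UNIV) \<subseteq> ?E" by (auto intro!: exI[of _ 0])
  show "emeasure M X = emeasure N X" if "X \<in> ?E" for X
  proof (rule insertE[OF that])
    assume "X \<in> {{z. \<forall>r<k. z r = w r} | k w. True}"
    then obtain k w where "X = {z. \<forall>r<k. z r = w r}" by blast
    then show ?thesis using eq by (simp only:)
  qed simp
  show "?E \<subseteq> Pow UNIV" by simp
  show "emeasure M UNIV \<noteq> \<infinity>" 
    using prob_space.emeasure_space_1[OF M(1)] sets_eq_imp_space_eq[OF M(2)] by simp
qed simp_all

lemma sets_pair_generated: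
  assumes A: "sets A = sigma_sets (space A) E" "E \<subseteq> Pow (space A)" "space A \<in> E"
    and B: "sets B = sigma_sets (space B) F" "F \<subseteq> Pow (space B)" "space B \<in> F"
  shows "sets (A \<Otimes>\<^sub>M B) = sigma_sets (space (A \<Otimes>\<^sub>M B)) {a \<times> b | a b. a \<in> E \<and> b \<in> F}"
proof
  let ?G = "{a \<times> b | a b. a \<in> E \<and> b \<in> F}"
  have GP: "?G \<subseteq> Pow (space A \<times> space B)" using A(2) B(2) by auto
  let ?S = "sigma (space A \<times> space B) ?G"
  have EA: "E \<subseteq> sets A" "F \<subseteq> sets B" using A(1) B(1) by auto
  have "fst \<in> ?S \<rightarrow>\<^sub>M A"
  proof (rule measurable_sigma_sets[OF A(1,2)])
    fix a assume "a \<in> E"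
    then have "fst -` a \<inter> space ?S = a \<times> space B" using A(2) GP by (auto simp: space_measure_of)
    then show "fst -` a \<inter> space ?S \<in> sets ?S" using \<open>a \<in> E\<close> B(3) GP by (auto simp: sets_measure_of)
  qed (use GP in \<open>auto simp: space_measure_of\<close>)
  moreover have "snd \<in> ?S \<rightarrow>\<^sub>M B"
  proof (rule measurable_sigma_sets[OF B(1,2)])
    fix b assume "b \<in> F"
    then have "snd -` b \<inter> space ?S = space A \<times> b" using B(2) GP by (auto simp: space_measure_of)
    then show "snd -` b \<inter> space ?S \<in> sets ?S" using \<open>b \<in> F\<close> A(3) GP by (auto simp: sets_measure_of)
  qed (use GP in \<open>auto simp: space_measure_of\<close>)
  ultimately have "(\<lambda>x. (fst x, snd x)) \<in> ?S \<rightarrow>\<^sub>M A \<Otimes>\<^sub>M B"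
    by (rule measurable_Pair)
  then have id: "(\<lambda>x. x) \<in> ?S \<rightarrow>\<^sub>M A \<Otimes>\<^sub>M B"
    by (simp only: prod.collapse)
  have S: "space ?S = space (A \<Otimes>\<^sub>M B)" "sets ?S = sigma_sets (space (A \<Otimes>\<^sub>M B)) ?G"
    by (simp_all only: space_measure_of[OF GP] sets_measure_of[OF GP] space_pair_measure)
  show "sets (A \<Otimes>\<^sub>M B) \<subseteq> sigma_sets (space (A \<Otimes>\<^sub>M B)) ?G"
  proof
    fix X assume X: "X \<in> sets (A \<Otimes>\<^sub>M B)"
    have "(\<lambda>x. x) -` X \<inter> space ?S = X"
      using sets.sets_into_space[OF X] by (simp only: S vimage_ident Int_absorb2)
    with measurable_sets[OF id X] show "X \<in> sigma_sets (space (A \<Otimes>\<^sub>M B)) ?G" by (simp only: S)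
  qed
  show "sigma_sets (space (A \<Otimes>\<^sub>M B)) ?G \<subseteq> sets (A \<Otimes>\<^sub>M B)"
    using EA by (intro sets.sigma_sets_subset) auto
qed

section \<open>Digit expansions\<close>

definition digit_value :: "nat \<Rightarrow> (nat \<Rightarrow> nat) \<Rightarrow> real" where
  "digit_value b z = (\<Sum>r. real (z r) / real b ^ (r + 1))"

definition prefix_value :: "nat \<Rightarrow> nat \<Rightarrow> (nat \<Rightarrow> nat) \<Rightarrow> real" where
  "prefix_value b k z = (\<Sum>r<k. real (z r) / real b ^ (r + 1))"

text \<open>An interval given by its end points and by which of them belong to it.\<close>

fun ivl :: "real \<times> real \<times> bool \<times> bool \<Rightarrow> real set" where
  "ivl (a, b, p, q) = {x. (a < x \<or> p \<and> x = a) \<and> (x < b \<or> q \<and> x = b)}"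

definition adapted :: "nat \<Rightarrow> bool \<Rightarrow> (nat \<Rightarrow> nat) \<Rightarrow> bool" where
  "adapted b f z \<longleftrightarrow> (\<forall>r. z r < b) \<and> (if f then \<forall>r. z r = b - 1 else \<forall>k. \<exists>r\<ge>k. z r \<noteq> b - 1)"

lemma adapted_seq_drop:
  assumes "adapted b f z"
  shows "adapted b f (seq_drop k z)"
proof (cases f)
  case False
  have "\<exists>r\<ge>j. z (k + r) \<noteq> b - 1" for j
  proof -
    obtain r where "r \<ge> k + j" "z r \<noteq> b - 1"
      using assms False unfolding adapted_def by (simp only: if_False simp_thms) blast
    then show ?thesis by (intro exI[of _ "r - k"]) simp
  qed
  then show ?thesis using assms False by (simp add: adapted_def)
next
  case True
  then show ?thesis using assms unfolding adapted_def if_P[OF True] by blast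
qed

context
  fixes b :: nat
  assumes b: "2 \<le> b"
begin

lemma sums_maximal_digits: "(\<lambda>r. real (b - 1) / real b ^ (r + 1)) sums 1"
proof -
  have "(\<lambda>r. (real (b - 1) / real b) * (1 / real b) ^ r) sums ((real (b - 1) / real b) * (1 / (1 - 1 / real b)))"
    using b by (intro sums_mult geometric_sums) auto
  moreover have "(real (b - 1) / real b) * (1 / (1 - 1 / real b)) = 1"
    using b by (auto simp: field_simps of_nat_diff)
  moreover have "(real (b - 1) / real b) * (1 / real b) ^ r = real (b - 1) / real b ^ (r + 1)" for r
    by (simp add: power_one_over field_simps)
  ultimately show ?thesis by (simp only:)
qed

lemma digit_le: "z < b \<Longrightarrow> real z / real b ^ (r + 1) \<le> real (b - 1) / real b ^ (r + 1)"
  by (intro divide_right_mono) auto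

lemma summable_digits:
  assumes "\<And>r. z r < b"
  shows "summable (\<lambda>r. real (z r) / real b ^ (r + 1))"
  using sums_summable[OF sums_maximal_digits]
  by (rule summable_comparison_test') (use digit_le[OF assms] in auto)

lemma digit_value_nonneg: "(\<And>r. z r < b) \<Longrightarrow> 0 \<le> digit_value b z"
  unfolding digit_value_def by (intro suminf_nonneg summable_digits) auto

lemma digit_value_le_1:
  assumes "\<And>r. z r < b"
  shows "digit_value b z \<le> 1"
proof -
  have "digit_value b z \<le> (\<Sum>r. real (b - 1) / real b ^ (r + 1))"
    unfolding digit_value_def
    using digit_le[OF assms] summable_digits[of z, OF assms] sums_summable[OF sums_maximal_digits]
    by (intro suminf_le)
  then show ?thesis using sums_unique[OF sums_maximal_digits] by simp
qed

lemma digit_value_split: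
  assumes "\<And>r. z r < b"
  shows "digit_value b z = prefix_value b k z + digit_value b (seq_drop k z) / real b ^ k"
proof -
  have "digit_value b z = (\<Sum>r. real (z (r + k)) / real b ^ (r + k + 1)) + prefix_value b k z"
    unfolding digit_value_def prefix_value_def by (rule suminf_split_initial_segment[OF summable_digits[of z, OF assms]])
  also have "(\<lambda>r. real (z (r + k)) / real b ^ (r + k + 1)) = (\<lambda>r. real (z (k + r)) / real b ^ (r + 1) / real b ^ k)"
    by (auto simp: power_add field_simps)
  also have "(\<Sum>r. real (z (k + r)) / real b ^ (r + 1) / real b ^ k) = digit_value b (seq_drop k z) / real b ^ k"
    unfolding digit_value_def by (intro suminf_divide summable_digits assms)
  finally show ?thesis by simp
qed

lemma digit_value_step:
  assumes "\<And>r. z r < b"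
  shows "digit_value b z = (real (z 0) + digit_value b (seq_drop 1 z)) / real b"
  using digit_value_split[of z 1, OF assms] by (simp add: prefix_value_def add_divide_distrib)

lemma prefix_value_Suc: "prefix_value b (Suc k) z = (real (z 0) + prefix_value b k (seq_drop 1 z)) / real b"
  unfolding prefix_value_def sum.lessThan_Suc_shift by (simp add: add_divide_distrib sum_divide_distrib mult_ac)

lemma prefix_value_cong: "(\<And>r. r < k \<Longrightarrow> z r = y r) \<Longrightarrow> prefix_value b k z = prefix_value b k y"
  unfolding prefix_value_def by (intro sum.cong) auto

lemma digit_value_close:
  assumes "\<And>r. z r < b" "\<And>r. y r < b" "\<And>r. r < k \<Longrightarrow> z r = y r"
  shows "\<bar>digit_value b z - digit_value b y\<bar> \<le> 1 / real b ^ k"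
proof -
  have "digit_value b z - digit_value b y = (digit_value b (seq_drop k z) - digit_value b (seq_drop k y)) / real b ^ k"
    using digit_value_split[of z k, OF assms(1)] digit_value_split[of y k, OF assms(2)] prefix_value_cong[of k z y, OF assms(3)]
    by (simp add: diff_divide_distrib)
  moreover have "\<bar>digit_value b (seq_drop k z) - digit_value b (seq_drop k y)\<bar> \<le> 1"
    using digit_value_nonneg[of "seq_drop k z"] digit_value_nonneg[of "seq_drop k y"]
      digit_value_le_1[of "seq_drop k z"] digit_value_le_1[of "seq_drop k y"] assms(1,2) by force
  ultimately show ?thesis using b by (simp add: divide_right_mono)
qed

lemma digit_value_tendsto:
  assumes "\<forall>\<^sub>F j in F. \<forall>r. z j r < b" "\<And>r. y r < b"
    and "\<And>L. \<forall>\<^sub>F j in F. \<forall>r<L. z j r = y r"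
  shows "((\<lambda>j. digit_value b (z j)) \<longlongrightarrow> digit_value b y) F"
proof (rule tendstoI)
  fix e :: real assume e: "e > 0"
  obtain k where "(1 / real b) ^ k < e" using real_arch_pow_inv[of e "1 / real b"] e b by auto
  then have k: "1 / real b ^ k < e" by (simp add: power_one_over)
  show "\<forall>\<^sub>F j in F. dist (digit_value b (z j)) (digit_value b y) < e"
    using assms(1) assms(3)[of k]
  proof eventually_elim
    case (elim j)
    then show ?case using digit_value_close[of "z j" y k] assms(2) k by (auto simp: dist_real_def)
  qed
qed

lemma digit_value_maximal: "(\<And>r. z r = b - 1) \<Longrightarrow> digit_value b z = 1"
  unfolding digit_value_def using sums_unique[OF sums_maximal_digits] by simp

lemma digit_value_less_1:
  assumes z: "\<And>r. z r < b" and r: "z r \<noteq> b - 1"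
  shows "digit_value b z < 1"
proof -
  have "prefix_value b (Suc r) z < prefix_value b (Suc r) (\<lambda>_. b - 1)"
    unfolding prefix_value_def
  proof (rule sum_strict_mono_ex1)
    show "\<forall>s\<in>{..<Suc r}. real (z s) / real b ^ (s + 1) \<le> real (b - 1) / real b ^ (s + 1)"
      using digit_le[OF z] by blast
    have "real (z r) / real b ^ (r + 1) < real (b - 1) / real b ^ (r + 1)"
      using z[of r] r b by (intro divide_strict_right_mono) auto
    then show "\<exists>s\<in>{..<Suc r}. real (z s) / real b ^ (s + 1) < real (b - 1) / real b ^ (s + 1)"
      by blast
  qed simp
  moreover have "digit_value b (seq_drop (Suc r) z) / real b ^ (Suc r) \<le> 1 / real b ^ Suc r"
    using digit_value_le_1[of "seq_drop (Suc r) z"] z by (intro divide_right_mono) auto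
  moreover have "1 = prefix_value b (Suc r) (\<lambda>_. b - 1) + 1 / real b ^ Suc r"
    using digit_value_split[of "\<lambda>_. b - 1" "Suc r"] digit_value_maximal[of "\<lambda>_. b - 1"] b by simp
  ultimately show ?thesis
    using digit_value_split[of z "Suc r", OF z] by linarith
qed

lemma adapted_value:
  assumes "adapted b f z"
  shows "0 \<le> digit_value b z" "digit_value b z \<le> 1" "f \<Longrightarrow> digit_value b z = 1" "\<not> f \<Longrightarrow> digit_value b z < 1"
proof -
  have z: "\<And>r. z r < b" using assms by (auto simp: adapted_def)
  then show "0 \<le> digit_value b z" "digit_value b z \<le> 1"
    by (auto intro: digit_value_nonneg digit_value_le_1)
  show "digit_value b z = 1" if f
    using assms that by (auto simp: adapted_def intro!: digit_value_maximal)
  show "digit_value b z < 1" if nf: "\<not> f"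
  proof -
    obtain r where "z r \<noteq> b - 1" using assms nf unfolding adapted_def by (simp only: if_False simp_thms) blast
    with z show ?thesis by (rule digit_value_less_1)
  qed
qed

text \<open>The adapted sequences are those for which no ambiguity of expansions can occur.\<close>

lemma mem_digit_interval:
  assumes "adapted b f z" "\<And>r. r < k \<Longrightarrow> w r < b" "f \<Longrightarrow> q"
  shows "digit_value b z \<in> ivl (prefix_value b k w, prefix_value b k w + 1 / real b ^ k, True, q \<and> (\<forall>r<k. w r = b - 1))
    \<longleftrightarrow> (\<forall>r<k. z r = w r)"
  using assms
proof (induction k arbitrary: z w q)
  case 0
  then show ?case using adapted_value[OF 0(1)] by (cases f) (auto simp: prefix_value_def)
next
  case (Suc k)
  have z: "\<And>r. z r < b" using Suc.prems(1) by (auto simp: adapted_def)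
  let ?v = "digit_value b (seq_drop 1 z)" and ?p = "prefix_value b k (seq_drop 1 w)"
  have v: "digit_value b z = (real (z 0) + ?v) / real b" using z by (rule digit_value_step)
  have ad: "adapted b f (seq_drop 1 z)" by (rule adapted_seq_drop) fact
  note av = adapted_value[OF ad]
  have p0: "0 \<le> ?p" unfolding prefix_value_def by (intro sum_nonneg) auto
  have p1: "?p + 1 / real b ^ k \<le> 1"
  proof -
    have "?p \<le> prefix_value b k (\<lambda>_. b - 1)"
      unfolding prefix_value_def using Suc.prems(2) by (intro sum_mono digit_le) auto
    also have "\<dots> = 1 - 1 / real b ^ k"
      using digit_value_split[of "\<lambda>_. b - 1" k] digit_value_maximal[of "\<lambda>_. b - 1"] b by simp
    finally show ?thesis by simp
  qed
  have b0: "real b > 0" using b by simp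
  have scale: "x / real b \<in> ivl (y / real b, y' / real b, True, q') \<longleftrightarrow> x \<in> ivl (y, y', True, q')" for x y y' q'
    using b0 by (auto simp: divide_less_cancel)
  have shift: "real c + x \<in> ivl (real c + y, real c + y', True, q') \<longleftrightarrow> x \<in> ivl (y, y', True, q')" for x y y' q' and c :: nat
    by auto
  have q_all: "(q \<and> (\<forall>r<Suc k. w r = b - 1)) = ((q \<and> w 0 = b - 1) \<and> (\<forall>r<k. seq_drop 1 w r = b - 1))"
    by (auto simp: less_Suc_eq_0_disj)
  have "prefix_value b (Suc k) w + 1 / real b ^ Suc k = (real (w 0) + (?p + 1 / real b ^ k)) / real b"
    unfolding prefix_value_Suc by (simp add: add_divide_distrib)
  then have "digit_value b z \<in> ivl (prefix_value b (Suc k) w, prefix_value b (Suc k) w + 1 / real b ^ Suc k, True, q \<and> (\<forall>r<Suc k. w r = b - 1))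
    \<longleftrightarrow> real (z 0) + ?v \<in> ivl (real (w 0) + ?p, real (w 0) + (?p + 1 / real b ^ k), True, (q \<and> w 0 = b - 1) \<and> (\<forall>r<k. seq_drop 1 w r = b - 1))"
    unfolding v prefix_value_Suc q_all by (simp only: scale)
  also have "\<dots> \<longleftrightarrow> (\<forall>r<Suc k. z r = w r)"
  proof (cases "z 0" "w 0" rule: linorder_cases)
    case equal
    have "f \<Longrightarrow> q \<and> w 0 = b - 1" using Suc.prems equal by (auto simp: adapted_def)
    then have "?v \<in> ivl (?p, ?p + 1 / real b ^ k, True, (q \<and> w 0 = b - 1) \<and> (\<forall>r<k. seq_drop 1 w r = b - 1)) \<longleftrightarrow> (\<forall>r<k. seq_drop 1 z r = seq_drop 1 w r)"
      using Suc.prems(2) by (intro Suc.IH ad) auto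
    then show ?thesis using equal by (simp only: shift) (auto simp: less_Suc_eq_0_disj)
  next
    case less
    then have nf: "\<not> f" using Suc.prems(1) Suc.prems(2)[of 0] by (auto simp: adapted_def)
    have "real (z 0) + ?v < real (w 0) + ?p" using av(4)[OF nf] less p0 by linarith
    moreover have "\<not> (\<forall>r<Suc k. z r = w r)" using less by auto
    ultimately show ?thesis by auto
  next
    case greater
    then have "w 0 \<noteq> b - 1" using z[of 0] by auto
    moreover have "real (z 0) + ?v \<ge> real (w 0) + (?p + 1 / real b ^ k)" using av(1) greater p1 by linarith
    moreover have "\<not> (\<forall>r<Suc k. z r = w r)" using greater by auto
    ultimately show ?thesis by auto
  qed
  finally show ?case .
qed

end

lemma borel_measurable_digit_value [measurable]: "digit_value b \<in> borel_measurable seq_space"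
proof -
  have "(\<lambda>z. real (z r) / real b ^ (r + 1)) \<in> borel_measurable seq_space" for r
    by measurable
  then show ?thesis unfolding digit_value_def[abs_def] by (rule borel_measurable_suminf)
qed

lemma digit_map_eq:
  assumes "2 \<le> m" "2 \<le> n" "\<And>r. i r < m" "\<And>r. j r < n"
  shows "digit_map m n (i, j) = (digit_value m i, digit_value n j)"
proof -
  have "(\<lambda>r. (real (i r) / real m ^ (r + 1), real (j r) / real n ^ (r + 1))) sums (digit_value m i, digit_value n j)"
  proof -
    have "(\<lambda>r. real (i r) / real m ^ (r + 1)) sums digit_value m i" "(\<lambda>r. real (j r) / real n ^ (r + 1)) sums digit_value n j"
      unfolding digit_value_def using assms by (intro summable_sums summable_digits; simp)+
    moreover have "(\<Sum>r<k. (real (i r) / real m ^ (r + 1), real (j r) / real n ^ (r + 1))) =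
      (\<Sum>r<k. real (i r) / real m ^ (r + 1), \<Sum>r<k. real (j r) / real n ^ (r + 1))" for k
      by (induction k) (auto simp: zero_prod_def)
    ultimately show ?thesis unfolding sums_def by (simp only: tendsto_Pair)
  qed
  then show ?thesis unfolding digit_map_def by (simp add: sums_iff)
qed

lemma digit_sequences_subsequence:
  fixes z :: "nat \<Rightarrow> nat \<Rightarrow> nat" and m :: nat
  assumes "\<And>j r. z j r < m"
  obtains s and y :: "nat \<Rightarrow> nat" where "strict_mono s" "\<And>r. y r < m" "\<And>L. \<forall>\<^sub>F j in sequentially. \<forall>r<L. z (s j) r = y r"
proof -
  have "compactin (product_topology (\<lambda>_. euclidean) UNIV) (PiE UNIV (\<lambda>_::nat. {..<m}))"
    by (subst compactin_PiE) (auto simp: finite_imp_compact)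
  then have "compact (PiE UNIV (\<lambda>_::nat. {..<m}))"
    by (simp add: euclidean_product_topology)
  then have "seq_compact (PiE UNIV (\<lambda>_::nat. {..<m}))"
    by (rule compact_imp_seq_compact)
  moreover have "\<forall>j. z j \<in> PiE UNIV (\<lambda>_. {..<m})" using assms by auto
  ultimately obtain y :: "nat \<Rightarrow> nat" and s where y: "y \<in> PiE UNIV (\<lambda>_::nat. {..<m})" and s: "strict_mono s" "(z \<circ> s) \<longlonglongrightarrow> y"
    by (rule seq_compactE)
  have co: "\<forall>\<^sub>F j in sequentially. z (s j) r = y r" for r
  proof -
    have "open ((\<lambda>x :: nat \<Rightarrow> nat. x r) -` {y r})"
      by (rule open_vimage[OF discrete_topology_class.open_discrete continuous_on_product_coordinates])
    from topological_tendstoD[OF s(2) this] show ?thesis by simp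
  qed
  have "\<forall>\<^sub>F j in sequentially. \<forall>r<L. z (s j) r = y r" for L
  proof -
    have "\<forall>\<^sub>F j in sequentially. \<forall>r\<in>{..<L}. z (s j) r = y r"
      by (rule eventually_ball_finite) (auto intro: co)
    then show ?thesis by (simp only: Ball_def lessThan_iff)
  qed
  with y s(1) show ?thesis by (intro that[of s y]) auto
qed

section \<open>Random points with prescribed first digits\<close>

declare measurable_seq_drop [measurable del] sets_Collect_coordinate [measurable del]

definition ysel :: "(nat \<Rightarrow> nat) \<Rightarrow> (nat \<Rightarrow> nat \<Rightarrow> nat) \<Rightarrow> nat \<Rightarrow> nat" where
  "ysel c u = (\<lambda>r. u r (c r))"

lemma measurable_coordinate: "(\<lambda>z. z r) \<in> seq_space \<rightarrow>\<^sub>M count_space UNIV"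
  by (rule measurable_component_singleton) simp

lemma measurable_ysel:
  assumes c: "c \<in> M \<rightarrow>\<^sub>M seq_space" and u: "u \<in> M \<rightarrow>\<^sub>M seq_space"
  shows "(\<lambda>x. ysel (c x) (u x)) \<in> M \<rightarrow>\<^sub>M seq_space"
  unfolding ysel_def
proof (rule measurable_PiM_single')
  fix r
  show "(\<lambda>x. u x r (c x r)) \<in> M \<rightarrow>\<^sub>M count_space UNIV"
  proof (rule measurable_compose_countable[where f="\<lambda>i x. u x r i" and g="\<lambda>x. c x r"])
    show "(\<lambda>x. u x r i) \<in> M \<rightarrow>\<^sub>M count_space UNIV" for i
    proof (rule measurable_compose[where f="\<lambda>x. u x r" and g="\<lambda>g. g i"])
      show "(\<lambda>x. u x r) \<in> M \<rightarrow>\<^sub>M count_space UNIV" by (rule measurable_compose[OF u measurable_coordinate])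
    qed (rule measurable_count_space)
    show "(\<lambda>x. c x r) \<in> M \<rightarrow>\<^sub>M count_space UNIV"
      by (rule measurable_compose[OF c measurable_coordinate])
  qed
qed auto

lemma ysel_drop: "(\<lambda>r. ysel c u (k + r)) = ysel (seq_drop k c) (seq_drop k u)"
  by (simp add: ysel_def)

lemma measurable_comb_seq_right: "comb_seq d \<omega> \<in> seq_space \<rightarrow>\<^sub>M (seq_space :: (nat \<Rightarrow> 'a) measure)"
  unfolding comb_seq_def[abs_def]
proof (rule measurable_PiM_single')
  show "(\<lambda>\<omega>'. if r < d then \<omega> r else \<omega>' (r - d)) \<in> seq_space \<rightarrow>\<^sub>M count_space (UNIV :: 'a set)" for r
    by (cases "r < d") (simp_all add: measurable_coordinate)
qed auto

lemma AE_iid_set_pmf: "AE z in iid p. \<forall>r. z r \<in> set_pmf p"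
proof -
  have "AE z in iid p. z r \<in> set_pmf p" for r :: nat
    unfolding iid_def
    by (rule AE_PiM_component[of UNIV "\<lambda>_. measure_pmf p" r "\<lambda>x. x \<in> set_pmf p"])
       (auto intro: measure_pmf.prob_space_axioms AE_measure_pmf)
  then show ?thesis by (simp add: AE_all_countable)
qed

lemma AE_adapted:
  fixes p :: "'a pmf" and \<phi> :: "'a \<Rightarrow> nat"
  assumes \<phi>: "\<And>x. x \<in> set_pmf p \<Longrightarrow> \<phi> x < b"
  shows "AE z in iid p. adapted b (measure (measure_pmf p) {x. \<phi> x = b - 1} = 1) (\<lambda>r. \<phi> (z r))"
proof (cases "measure (measure_pmf p) {x. \<phi> x = b - 1} = 1")
  case True
  then have "AE x in measure_pmf p. x \<in> {x. \<phi> x = b - 1}"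
    by (subst (asm) measure_pmf.prob_eq_1) auto
  then have eq: "\<phi> x = b - 1" if "x \<in> set_pmf p" for x using that by (auto simp: AE_measure_pmf_iff)
  show ?thesis
    using AE_iid_set_pmf[of p]
  proof eventually_elim
    case (elim z)
    then have "\<phi> (z r) < b" "\<phi> (z r) = b - 1" for r using \<phi> eq by blast+
    then show ?case unfolding adapted_def if_P[OF True] by blast
  qed
next
  case False
  define X where "X = {x. \<phi> x = b - 1}"
  define \<rho> where "\<rho> = measure (measure_pmf p) X"
  have \<rho>: "0 \<le> \<rho>" "\<rho> < 1"
    using False measure_pmf.prob_le_1[of p X] by (auto simp: \<rho>_def X_def less_le)
  interpret prob_space "iid p" by (rule prob_space_iid)
  have null: "AE z in iid p. \<not> (\<forall>r\<ge>k. z r \<in> X)" for k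
  proof (rule AE_I)
    let ?N = "{z. \<forall>r\<ge>k. z r \<in> X}"
    have meas: "?N \<in> sets (iid p)"
    proof -
      have "?N = (\<Inter>r\<in>{k..}. {z. z r \<in> X})" by auto
      also have "\<dots> \<in> sets (iid p)"
        using sets.top[of "seq_space :: (nat \<Rightarrow> 'a) measure"]
        by (intro sets.countable_INT'') (simp_all add: sets_iid sets_Collect_coordinate)
      finally show ?thesis .
    qed
    then show "?N \<in> sets (iid p)" .
    have "emeasure (iid p) ?N \<le> ennreal (\<rho> ^ L)" for L
    proof -
      have "emeasure (iid p) ?N \<le> emeasure (iid p) {z. \<forall>r\<in>{k..<k + L}. z r \<in> X}"
      proof (rule emeasure_mono)
        have "{z. \<forall>r\<in>{k..<k + L}. z r \<in> X} = cyl (k + L) (\<lambda>r. if r < k then UNIV else X)"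
          by (auto simp: cyl_def)
        then show "{z. \<forall>r\<in>{k..<k + L}. z r \<in> X} \<in> sets (iid p)" by (simp add: sets_iid sets_cyl)
      qed auto
      also have "\<dots> = (\<Prod>r\<in>{k..<k + L}. emeasure (measure_pmf p) X)"
        by (rule emeasure_iid_coordinates) simp
      also have "\<dots> = ennreal (\<rho> ^ L)"
        by (simp add: \<rho>_def measure_pmf.emeasure_eq_measure ennreal_power)
      finally show ?thesis .
    qed
    then have "measure (iid p) ?N \<le> \<rho> ^ L" for L
      using \<rho> by (simp add: emeasure_eq_measure)
    moreover have "(\<lambda>L. \<rho> ^ L) \<longlonglongrightarrow> 0" using \<rho> by (intro LIMSEQ_realpow_zero) auto
    ultimately have "measure (iid p) ?N \<le> 0"
      by (intro LIMSEQ_le_const) auto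
    then show "emeasure (iid p) ?N = 0" by (simp add: emeasure_eq_measure measure_le_0_iff)
    show "{z \<in> space (iid p). \<not> \<not> (\<forall>r\<ge>k. z r \<in> X)} \<subseteq> ?N" by auto
  qed
  then have "AE z in iid p. \<forall>k. \<not> (\<forall>r\<ge>k. z r \<in> X)" by (simp add: AE_all_countable)
  with AE_iid_set_pmf[of p] show ?thesis
  proof eventually_elim
    case (elim z)
    then have "\<phi> (z r) < b" for r using \<phi> by blast
    moreover have "\<exists>r\<ge>k. \<phi> (z r) \<noteq> b - 1" for k using elim(2) by (auto simp: X_def)
    ultimately show ?case unfolding adapted_def if_not_P[OF False] by blast
  qed
qed

locale digit_system =
  fixes m n :: nat and P :: "(nat \<times> nat) pmf"
  assumes m2: "2 \<le> m" and mn: "m < n" and P_digits: "set_pmf P \<subseteq> {..<m} \<times> {..<n}"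
begin

lemma n2: "2 \<le> n" using m2 mn by simp

definition P1 :: "nat pmf" where "P1 = map_pmf fst P"

definition K :: "nat \<Rightarrow> nat pmf" where
  "K i = (if i \<in> set_pmf P1 then map_pmf snd (cond_pmf P {x. fst x = i}) else return_pmf 0)"

definition G :: "(nat \<Rightarrow> nat) pmf" where "G = Pi_pmf {..<m} 0 K"

definition right_closed :: bool where
  "right_closed \<longleftrightarrow> measure (measure_pmf P) {x. fst x = m - 1} = 1"

definition top_closed :: bool where
  "top_closed \<longleftrightarrow> measure (measure_pmf P) {x. snd x = n - 1} = 1"

lemma P1_digits: "i \<in> set_pmf P1 \<Longrightarrow> i < m"
  using P_digits by (auto simp: P1_def)

lemma pmf_P: "pmf P (i, j) = pmf P1 i * pmf (K i) j"
proof (cases "i \<in> set_pmf P1")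
  case True
  then have ne: "set_pmf P \<inter> {x. fst x = i} \<noteq> {}" by (auto simp: P1_def)
  let ?C = "cond_pmf P {x. fst x = i}"
  have P1i: "pmf P1 i = measure (measure_pmf P) {x. fst x = i}"
    by (simp add: P1_def pmf_map vimage_def)
  have "pmf (K i) j = measure (measure_pmf ?C) {x. snd x = j}"
    using True by (simp add: K_def pmf_map vimage_def)
  also have "\<dots> = measure (measure_pmf ?C) {(i, j)}"
    by (rule measure_eq_AE) (auto simp: AE_measure_pmf_iff set_cond_pmf[OF ne])
  also have "\<dots> = pmf P (i, j) / pmf P1 i"
    by (simp add: measure_pmf_single pmf_cond[OF ne] P1i)
  finally show ?thesis using True by (simp add: set_pmf_iff)
next
  case False
  then have "pmf P1 i = 0" by (simp add: set_pmf_iff)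
  moreover have "(i, j) \<notin> set_pmf P" using False by (force simp: P1_def)
  ultimately show ?thesis by (simp add: set_pmf_iff)
qed

lemma K_digits: "j \<in> set_pmf (K i) \<Longrightarrow> j < n"
proof (cases "i \<in> set_pmf P1")
  case True
  assume "j \<in> set_pmf (K i)"
  then have "pmf P (i, j) \<noteq> 0" using True by (simp add: pmf_P set_pmf_iff)
  then have "(i, j) \<in> set_pmf P" by (simp add: set_pmf_iff)
  then show ?thesis using P_digits by auto
qed (use m2 mn in \<open>auto simp: K_def\<close>)

lemma emeasure_G: "i < m \<Longrightarrow> emeasure (measure_pmf G) {g. g i = b} = ennreal (pmf (K i) b)"
proof -
  assume i: "i < m"
  have "map_pmf (\<lambda>g. g i) G = K i"
    unfolding G_def using i by (subst Pi_pmf_component) auto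
  then have "emeasure (measure_pmf (map_pmf (\<lambda>g. g i) G)) {b} = ennreal (pmf (K i) b)"
    by (simp add: emeasure_pmf_single)
  then show ?thesis by (simp add: vimage_def)
qed

lemma G_digits: "g \<in> set_pmf G \<Longrightarrow> i < m \<Longrightarrow> g i < n"
  unfolding G_def by (subst (asm) set_Pi_pmf) (auto simp: PiE_dflt_def intro: K_digits)

definition sample :: "((nat \<Rightarrow> nat) \<times> (nat \<Rightarrow> nat \<Rightarrow> nat)) measure" where
  "sample = iid P1 \<Otimes>\<^sub>M iid G"

lemma sets_sample [measurable_cong]: "sets sample = sets (seq_space \<Otimes>\<^sub>M seq_space)"
  unfolding sample_def by (intro sets_pair_measure_cong sets_iid)

lemma space_sample [simp]: "space sample = UNIV"
  by (simp add: sample_def space_pair_measure)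

sublocale I1: prob_space "iid P1" by (rule prob_space_iid)
sublocale IG: prob_space "iid G" by (rule prob_space_iid)
sublocale sample_pair: pair_prob_space "iid P1" "iid G" ..
sublocale sample: prob_space sample
  unfolding sample_def by (rule sample_pair.P.prob_space_axioms)

lemma measurable_sample_iff: "measurable sample N = measurable (seq_space \<Otimes>\<^sub>M seq_space) N"
  by (rule measurable_cong_sets[OF sets_sample refl])

lemma measurable_zip: "(\<lambda>(i, u) r. (i r, ysel i u r)) \<in> sample \<rightarrow>\<^sub>M (seq_space :: (nat \<Rightarrow> nat \<times> nat) measure)"
proof -
  have "(\<lambda>x r. (fst x r, ysel (fst x) (snd x) r)) \<in> sample \<rightarrow>\<^sub>M seq_space"
    unfolding measurable_sample_iff
  proof (rule measurable_PiM_single')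
    fix r
    have 1: "(\<lambda>x. fst x r) \<in> seq_space \<Otimes>\<^sub>M (seq_space :: (nat \<Rightarrow> nat \<Rightarrow> nat) measure) \<rightarrow>\<^sub>M count_space (UNIV :: nat set)"
      by (rule measurable_compose[OF measurable_fst measurable_coordinate])
    have 2: "(\<lambda>x. ysel (fst x) (snd x) r) \<in> seq_space \<Otimes>\<^sub>M seq_space \<rightarrow>\<^sub>M count_space UNIV"
      by (rule measurable_compose[OF measurable_ysel[OF measurable_fst measurable_snd] measurable_coordinate])
    show "(\<lambda>x. (fst x r, ysel (fst x) (snd x) r)) \<in> seq_space \<Otimes>\<^sub>M seq_space \<rightarrow>\<^sub>M count_space UNIV"
      using measurable_Pair[OF 1 2]
      by (simp only: pair_measure_countable[OF countableI_type countableI_type] UNIV_Times_UNIV)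
  qed auto
  then show ?thesis by (simp add: split_beta')
qed

lemma iid_P_eq: "distr sample seq_space (\<lambda>(i, u) r. (i r, ysel i u r)) = iid P"
proof (rule word_cylinders_determine)
  note meas = measurable_zip
  show "prob_space (distr sample seq_space (\<lambda>(i, u) r. (i r, ysel i u r)))"
    by (rule sample.prob_space_distr[OF meas])
  show "sets (iid P) = sets seq_space" by (rule sets_iid)
  fix k and w :: "nat \<Rightarrow> nat \<times> nat"
  let ?W = "{z. \<forall>r<k. z r = w r}"
  have W: "?W = cyl k (\<lambda>r. {w r})" by (auto simp: cyl_def)
  have "emeasure (distr sample seq_space (\<lambda>(i, u) r. (i r, ysel i u r))) ?W =
    emeasure sample ((\<lambda>(i, u) r. (i r, ysel i u r)) -` ?W \<inter> space sample)"
    by (rule emeasure_distr[OF meas]) (simp add: W sets_cyl)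
  also have "(\<lambda>(i, u) r. (i r, ysel i u r)) -` ?W \<inter> space sample =
    cyl k (\<lambda>r. {fst (w r)}) \<times> cyl k (\<lambda>r. {g. g (fst (w r)) = snd (w r)})"
    by (auto simp: cyl_def ysel_def prod_eq_iff)
  also have "emeasure sample \<dots> = emeasure (iid P1) (cyl k (\<lambda>r. {fst (w r)})) * emeasure (iid G) (cyl k (\<lambda>r. {g. g (fst (w r)) = snd (w r)}))"
    unfolding sample_def by (rule IG.emeasure_pair_measure_Times) (simp_all add: sets_iid sets_cyl)
  also have "\<dots> = (\<Prod>r<k. emeasure (measure_pmf P1) {fst (w r)} * emeasure (measure_pmf G) {g. g (fst (w r)) = snd (w r)})"
    unfolding emeasure_iid_cyl by (rule prod.distrib[symmetric])
  also have "\<dots> = (\<Prod>r<k. emeasure (measure_pmf P) {w r})"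
  proof (intro prod.cong refl)
    fix r
    obtain a b where w: "w r = (a, b)" by (cases "w r")
    show "emeasure (measure_pmf P1) {fst (w r)} * emeasure (measure_pmf G) {g. g (fst (w r)) = snd (w r)} = emeasure (measure_pmf P) {w r}"
    proof (cases "a < m")
      case True
      then show ?thesis by (simp add: w emeasure_pmf_single emeasure_G pmf_P ennreal_mult)
    next
      case False
      then have "pmf P1 a = 0" using P1_digits by (auto simp: set_pmf_iff)
      then show ?thesis by (simp add: w emeasure_pmf_single pmf_P)
    qed
  qed
  also have "\<dots> = emeasure (iid P) ?W" unfolding W by (rule emeasure_iid_cyl[symmetric])
  finally show "emeasure (distr sample seq_space (\<lambda>(i, u) r. (i r, ysel i u r))) ?W = emeasure (iid P) ?W" .
qed (rule sets_distr)


lemma AE_sample_adapted: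
  "AE x in sample. adapted m right_closed (fst x) \<and> adapted n top_closed (ysel (fst x) (snd x))"
proof -
  have "AE z in iid P. adapted m right_closed (\<lambda>r. fst (z r))"
    unfolding right_closed_def by (rule AE_adapted) (use P_digits in auto)
  moreover have "AE z in iid P. adapted n top_closed (\<lambda>r. snd (z r))"
    unfolding top_closed_def by (rule AE_adapted) (use P_digits in auto)
  ultimately have "AE z in iid P. adapted m right_closed (\<lambda>r. fst (z r)) \<and> adapted n top_closed (\<lambda>r. snd (z r))"
    by eventually_elim blast
  then have "AE z in distr sample seq_space (\<lambda>(i, u) r. (i r, ysel i u r)).
      adapted m right_closed (\<lambda>r. fst (z r)) \<and> adapted n top_closed (\<lambda>r. snd (z r))"
    by (simp only: iid_P_eq)
  from AE_distrD[OF measurable_zip this] show ?thesis by (simp add: split_beta')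
qed

definition fibre_regular :: "(nat \<Rightarrow> nat) \<Rightarrow> bool" where
  "fibre_regular \<omega> \<longleftrightarrow> adapted m right_closed \<omega> \<and> (AE u in iid G. adapted n top_closed (ysel \<omega> u))"

lemma AE_fibre_regular: "AE \<omega> in iid P1. fibre_regular \<omega>"
proof -
  have "AE \<omega> in iid P1. AE u in iid G. adapted m right_closed \<omega> \<and> adapted n top_closed (ysel \<omega> u)"
    using sample_pair.AE_pair[OF AE_sample_adapted[unfolded sample_def]] by simp
  then show ?thesis
  proof eventually_elim
    case (elim \<omega>)
    then show ?case unfolding fibre_regular_def
      using IG.AE_const[of "adapted m right_closed \<omega>"] by (simp add: AE_conj_iff)
  qed
qed

lemma AE_fibre_regular_drop: "AE \<omega> in iid P1. \<forall>k. fibre_regular (seq_drop k \<omega>)"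
proof -
  have "AE \<omega> in iid P1. fibre_regular (seq_drop k \<omega>)" for k
  proof -
    have "AE \<omega> in distr (iid P1) (iid P1) (seq_drop k). fibre_regular \<omega>"
      using AE_fibre_regular by (simp only: distr_seq_drop_iid)
    moreover have "seq_drop k \<in> iid P1 \<rightarrow>\<^sub>M iid P1"
      by (simp only: measurable_cong_sets[OF sets_iid sets_iid] measurable_seq_drop)
    ultimately show ?thesis by (rule AE_distrD[rotated])
  qed
  then show ?thesis by (simp add: AE_all_countable)
qed

text \<open>Conditioning on finitely many digits leaves the later digits untouched.\<close>

lemma emeasure_sample_split:
  assumes D: "D \<in> sets (seq_space \<Otimes>\<^sub>M seq_space)"
  shows "emeasure sample {x. fst x \<in> cyl k X \<and> snd x \<in> cyl l Y \<and> (seq_drop k (fst x), seq_drop l (snd x)) \<in> D} =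
    (\<Prod>r<k. emeasure (measure_pmf P1) (X r)) * (\<Prod>r<l. emeasure (measure_pmf G) (Y r)) * emeasure sample D"
proof -
  let ?A = "{x. fst x \<in> cyl k X \<and> snd x \<in> cyl l Y \<and> (seq_drop k (fst x), seq_drop l (snd x)) \<in> D}"
  let ?Y = "\<Prod>r<l. emeasure (measure_pmf G) (Y r)"
  have drop: "(\<lambda>x. (seq_drop k (fst x), seq_drop l (snd x))) \<in> seq_space \<Otimes>\<^sub>M seq_space \<rightarrow>\<^sub>M seq_space \<Otimes>\<^sub>M seq_space"
    by (rule measurable_Pair[OF measurable_compose[OF measurable_fst measurable_seq_drop]
          measurable_compose[OF measurable_snd measurable_seq_drop]])
  have "?A = (cyl k X \<times> cyl l Y) \<inter> ((\<lambda>x. (seq_drop k (fst x), seq_drop l (snd x))) -` D \<inter> space (seq_space \<Otimes>\<^sub>M seq_space))"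
    by (auto simp: space_pair_measure)
  also have "\<dots> \<in> sets (seq_space \<Otimes>\<^sub>M seq_space)"
    by (intro sets.Int pair_measureI sets_cyl measurable_sets[OF drop D])
  finally have A: "?A \<in> sets (iid P1 \<Otimes>\<^sub>M iid G)"
    by (simp only: sets_sample[unfolded sample_def])
  have D': "D \<in> sets (iid P1 \<Otimes>\<^sub>M iid G)" using D by (simp only: sets_sample[unfolded sample_def])
  have sec: "Pair i -` D \<in> sets (iid G)" for i by (rule sets_Pair1[OF D'])
  have secm: "(\<lambda>u. indicator D (i, u) :: ennreal) \<in> borel_measurable seq_space" for i
  proof -
    have "(\<lambda>u. indicator D (i, u)) = (indicator (Pair i -` D) :: _ \<Rightarrow> ennreal)"
      by (auto simp: indicator_def)
    moreover have "Pair i -` D \<in> sets seq_space" using sec by (simp only: sets_iid)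
    ultimately show ?thesis by (simp only: borel_measurable_indicator)
  qed
  have fm: "(\<lambda>i. emeasure (iid G) (Pair i -` D)) \<in> borel_measurable seq_space"
    using IG.measurable_emeasure_Pair[OF D'] by (simp only: measurable_cong_sets[OF sets_iid refl])
  have "emeasure sample ?A = (\<integral>\<^sup>+i. \<integral>\<^sup>+u. indicator ?A (i, u) \<partial>iid G \<partial>iid P1)"
    unfolding sample_def by (rule IG.emeasure_pair_measure[OF A])
  also have "\<dots> = (\<integral>\<^sup>+i. \<integral>\<^sup>+u. indicator (cyl k X) i * (indicator (cyl l Y) u * indicator D (seq_drop k i, seq_drop l u)) \<partial>iid G \<partial>iid P1)"
    by (intro nn_integral_cong) (simp add: indicator_def)
  also have "\<dots> = (\<integral>\<^sup>+i. indicator (cyl k X) i * (?Y * emeasure (iid G) (Pair (seq_drop k i) -` D)) \<partial>iid P1)"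
  proof (intro nn_integral_cong)
    fix i
    have "(\<integral>\<^sup>+u. indicator (cyl l Y) u * indicator D (seq_drop k i, seq_drop l u) \<partial>iid G) = ?Y * (\<integral>\<^sup>+u. indicator D (seq_drop k i, u) \<partial>iid G)"
      by (rule nn_integral_iid_split[OF secm])
    also have "(\<integral>\<^sup>+u. indicator D (seq_drop k i, u) \<partial>iid G) = (\<integral>\<^sup>+u. indicator (Pair (seq_drop k i) -` D) u \<partial>iid G)"
      by (intro nn_integral_cong) (simp add: indicator_def)
    also have "\<dots> = emeasure (iid G) (Pair (seq_drop k i) -` D)"
      by (rule nn_integral_indicator[OF sec])
    finally have eq: "(\<integral>\<^sup>+u. indicator (cyl l Y) u * indicator D (seq_drop k i, seq_drop l u) \<partial>iid G) = ?Y * emeasure (iid G) (Pair (seq_drop k i) -` D)" .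
    show "(\<integral>\<^sup>+u. indicator (cyl k X) i * (indicator (cyl l Y) u * indicator D (seq_drop k i, seq_drop l u)) \<partial>iid G) =
      indicator (cyl k X) i * (?Y * emeasure (iid G) (Pair (seq_drop k i) -` D))"
      unfolding eq[symmetric] by (cases "i \<in> cyl k X") simp_all
  qed
  also have "\<dots> = (\<Prod>r<k. emeasure (measure_pmf P1) (X r)) * (\<integral>\<^sup>+i. ?Y * emeasure (iid G) (Pair i -` D) \<partial>iid P1)"
    by (rule nn_integral_iid_split) (intro borel_measurable_times_ennreal borel_measurable_const fm)
  also have "(\<integral>\<^sup>+i. ?Y * emeasure (iid G) (Pair i -` D) \<partial>iid P1) = ?Y * (\<integral>\<^sup>+i. emeasure (iid G) (Pair i -` D) \<partial>iid P1)"
    by (rule nn_integral_cmult) (simp only: measurable_cong_sets[OF sets_iid refl] fm)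
  also have "(\<integral>\<^sup>+i. emeasure (iid G) (Pair i -` D) \<partial>iid P1) = emeasure sample D"
    unfolding sample_def by (rule IG.emeasure_pair_measure_alt[OF D', symmetric])
  finally show ?thesis by (simp add: mult.assoc)
qed

lemma conditional_law:
  fixes f :: "(nat \<Rightarrow> nat) \<times> (nat \<Rightarrow> nat \<Rightarrow> nat) \<Rightarrow> real \<times> real"
  assumes f: "f \<in> borel_measurable sample" and A: "A \<in> sets borel"
    and T: "T \<in> borel_measurable borel" and h: "h \<in> borel_measurable sample"
    and ae: "AE x in sample. (f x \<in> A \<longleftrightarrow> fst x \<in> cyl k X \<and> snd x \<in> cyl l Y) \<and>
      (fst x \<in> cyl k X \<longrightarrow> snd x \<in> cyl l Y \<longrightarrow> T (f x) = h (seq_drop k (fst x), seq_drop l (snd x)))"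
    and w: "w = (\<Prod>r<k. emeasure (measure_pmf P1) (X r)) * (\<Prod>r<l. emeasure (measure_pmf G) (Y r))"
  shows "emeasure (distr sample borel f) A = w"
    and "w \<noteq> 0 \<Longrightarrow> distr (uniform_measure (distr sample borel f) A) borel T = distr sample borel h"
proof -
  let ?N = "distr sample borel f"
  have key: "emeasure ?N (A \<inter> T -` D) = w * emeasure sample (h -` D)" if D: "D \<in> sets borel" for D
  proof -
    have TD: "T -` D \<in> sets borel" using measurable_sets[OF T D] by simp
    have hD: "h -` D \<in> sets (seq_space \<Otimes>\<^sub>M seq_space)" using measurable_sets[OF h D] by (simp add: sets_sample)
    have "emeasure ?N (A \<inter> T -` D) = emeasure sample (f -` (A \<inter> T -` D) \<inter> space sample)"
      using A TD by (intro emeasure_distr f) auto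
    also have "\<dots> = emeasure sample {x. fst x \<in> cyl k X \<and> snd x \<in> cyl l Y \<and> (seq_drop k (fst x), seq_drop l (snd x)) \<in> h -` D}"
    proof (rule emeasure_eq_AE)
      show "AE x in sample. x \<in> f -` (A \<inter> T -` D) \<inter> space sample \<longleftrightarrow>
        x \<in> {x. fst x \<in> cyl k X \<and> snd x \<in> cyl l Y \<and> (seq_drop k (fst x), seq_drop l (snd x)) \<in> h -` D}"
        using ae by eventually_elim auto
      show "f -` (A \<inter> T -` D) \<inter> space sample \<in> sets sample"
        using A TD by (intro measurable_sets[OF f]) auto
      have drop: "(\<lambda>x. (seq_drop k (fst x), seq_drop l (snd x))) \<in> seq_space \<Otimes>\<^sub>M seq_space \<rightarrow>\<^sub>M seq_space \<Otimes>\<^sub>M (seq_space :: (nat \<Rightarrow> nat \<Rightarrow> nat) measure)"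
        by (rule measurable_Pair[OF measurable_compose[OF measurable_fst measurable_seq_drop]
              measurable_compose[OF measurable_snd measurable_seq_drop]])
      have "{x. fst x \<in> cyl k X \<and> snd x \<in> cyl l Y \<and> (seq_drop k (fst x), seq_drop l (snd x)) \<in> h -` D} =
        (cyl k X \<times> cyl l Y) \<inter> ((\<lambda>x. (seq_drop k (fst x), seq_drop l (snd x))) -` (h -` D) \<inter> space (seq_space \<Otimes>\<^sub>M seq_space))"
        by (auto simp: space_pair_measure)
      also have "\<dots> \<in> sets sample"
        unfolding sets_sample by (intro sets.Int pair_measureI sets_cyl measurable_sets[OF drop hD])
      finally show "{x. fst x \<in> cyl k X \<and> snd x \<in> cyl l Y \<and> (seq_drop k (fst x), seq_drop l (snd x)) \<in> h -` D} \<in> sets sample" .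
    qed
    also have "\<dots> = w * emeasure sample (h -` D)"
      unfolding w by (rule emeasure_sample_split[OF hD])
    finally show ?thesis .
  qed
  show 1: "emeasure ?N A = w"
    using key[of UNIV] sample.emeasure_space_1 by simp
  assume w0: "w \<noteq> 0"
  have wfin: "w \<noteq> \<top>"
  proof -
    have "prob_space ?N" using f by (rule sample.prob_space_distr)
    then show ?thesis using 1 prob_space.emeasure_le_1[of ?N A] by (auto simp: top_unique)
  qed
  show "distr (uniform_measure ?N A) borel T = distr sample borel h"
  proof (rule measure_eqI)
    fix D assume "D \<in> sets (distr (uniform_measure ?N A) borel T)"
    then have D: "D \<in> sets borel" by simp
    have TD: "T -` D \<in> sets borel" using measurable_sets[OF T D] by simp
    have Tm: "T \<in> uniform_measure ?N A \<rightarrow>\<^sub>M borel"     proof -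
      have eq: "sets (uniform_measure ?N A) = sets borel" by simp
      show ?thesis unfolding measurable_cong_sets[OF eq refl] by (rule T)
    qed
    have "emeasure (distr (uniform_measure ?N A) borel T) D = emeasure (uniform_measure ?N A) (T -` D)"
      using emeasure_distr[OF Tm D] by simp
    also have "\<dots> = emeasure ?N (A \<inter> T -` D) / emeasure ?N A"
      using A TD by (intro emeasure_uniform_measure) auto
    also have "\<dots> = w * emeasure sample (h -` D) / w" by (simp only: key[OF D] 1)
    also have "\<dots> = emeasure sample (h -` D)"
      using w0 wfin by (subst mult.commute) (rule ennreal_mult_divide_eq)
    also have "\<dots> = emeasure (distr sample borel h) D"
      using emeasure_distr[OF h D] by simp
    finally show "emeasure (distr (uniform_measure ?N A) borel T) D = emeasure (distr sample borel h) D" .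
  qed simp
qed

section \<open>The limiting random measures\<close>

definition sample_point :: "((nat \<Rightarrow> nat) \<Rightarrow> nat \<Rightarrow> nat) \<Rightarrow> (nat \<Rightarrow> nat) \<times> (nat \<Rightarrow> nat \<Rightarrow> nat) \<Rightarrow> real \<times> real" where
  "sample_point c x = (digit_value m (fst x), digit_value n (ysel (c (fst x)) (snd x)))"

definition law :: "real \<Rightarrow> ((nat \<Rightarrow> nat) \<Rightarrow> nat \<Rightarrow> nat) \<Rightarrow> (real \<times> real) measure" where
  "law t c = distr sample borel (\<lambda>x. stretch n t (sample_point c x))"

abbreviation limit_law :: "real \<Rightarrow> (nat \<Rightarrow> nat) \<Rightarrow> (real \<times> real) measure" where
  "limit_law t \<omega> \<equiv> law t (\<lambda>_. \<omega>)"

lemma measurable_stretch [measurable]: "stretch n t \<in> borel_measurable borel"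
  unfolding stretch_def borel_prod[symmetric] by measurable

lemma measurable_sample_point:
  assumes c: "c \<in> seq_space \<rightarrow>\<^sub>M seq_space"
  shows "sample_point c \<in> borel_measurable sample"
proof -
  have "(\<lambda>x. digit_value m (fst x)) \<in> borel_measurable sample"
    unfolding measurable_sample_iff by (rule measurable_compose[OF measurable_fst borel_measurable_digit_value])
  moreover have "(\<lambda>x. digit_value n (ysel (c (fst x)) (snd x))) \<in> borel_measurable sample"
    unfolding measurable_sample_iff
    by (rule measurable_compose[OF measurable_ysel[OF measurable_compose[OF measurable_fst c] measurable_snd] borel_measurable_digit_value])
  ultimately show ?thesis unfolding sample_point_def[abs_def] by (rule borel_measurable_Pair)
qed

lemma measurable_stretched_point:
  "c \<in> seq_space \<rightarrow>\<^sub>M seq_space \<Longrightarrow> (\<lambda>x. stretch n t (sample_point c x)) \<in> borel_measurable sample"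
  by (rule measurable_compose[OF measurable_sample_point measurable_stretch])

lemma law_prob_measures: "c \<in> seq_space \<rightarrow>\<^sub>M seq_space \<Longrightarrow> law t c \<in> prob_measures euclidean"
  unfolding law_def prob_measures_euclidean
  using sample.prob_space_distr[OF measurable_stretched_point] by auto

lemma limit_law_prob_measures: "limit_law t \<omega> \<in> prob_measures euclidean"
  by (rule law_prob_measures) simp

lemma AE_sample_digits: "AE x in sample. (\<forall>r. fst x r < m) \<and> (\<forall>r i. i < m \<longrightarrow> snd x r i < n)"
proof -
  have 1: "AE i in iid P1. \<forall>r. i r < m"
    using AE_iid_set_pmf[of P1] by eventually_elim (use P1_digits in blast)
  have 2: "AE u in iid G. \<forall>r i. i < m \<longrightarrow> u r i < n"
    using AE_iid_set_pmf[of G] by eventually_elim (use G_digits in blast)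
  obtain N1 where N1: "N1 \<in> null_sets (iid P1)" "{i. \<not> (\<forall>r. i r < m)} \<subseteq> N1"
    using 1 by (auto simp: eventually_ae_filter)
  obtain N2 where N2: "N2 \<in> null_sets (iid G)" "{u. \<not> (\<forall>r i. i < m \<longrightarrow> u r i < n)} \<subseteq> N2"
    using 2 by (auto simp: eventually_ae_filter)
  have "N1 \<times> UNIV \<in> null_sets sample" "UNIV \<times> N2 \<in> null_sets sample"
    unfolding sample_def
    using N1(1) N2(1) sets.top[of "iid G"] sets.top[of "iid P1"]
    by (auto intro!: null_setsI simp: IG.emeasure_pair_measure_Times null_setsD1 null_setsD2)
  then have "(N1 \<times> UNIV) \<union> (UNIV \<times> N2) \<in> null_sets sample" by (rule null_sets.Un)
  then show ?thesis
  proof (rule AE_I')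
    show "{x \<in> space sample. \<not> ((\<forall>r. fst x r < m) \<and> (\<forall>r i. i < m \<longrightarrow> snd x r i < n))} \<subseteq> (N1 \<times> UNIV) \<union> (UNIV \<times> N2)"
    proof
      fix x assume "x \<in> {x \<in> space sample. \<not> ((\<forall>r. fst x r < m) \<and> (\<forall>r i. i < m \<longrightarrow> snd x r i < n))}"
      then have "fst x \<in> N1 \<or> snd x \<in> N2" using N1(2) N2(2) by blast
      then show "x \<in> (N1 \<times> UNIV) \<union> (UNIV \<times> N2)" by (cases x) auto
    qed
  qed
qed

end

context digit_system
begin

lemma isCont_stretch_coordinates:
  assumes "(tt \<longlongrightarrow> t) F" "(xx \<longlongrightarrow> x) F" "(yy \<longlongrightarrow> y) F"
  shows "((\<lambda>j. stretch n (tt j) (xx j, yy j)) \<longlongrightarrow> stretch n t (x, y)) F"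
  unfolding stretch_def prod.case using assms n2 by (intro tendsto_intros) auto

lemma law_tendsto:
  fixes t :: real
  assumes t: "tt \<longlonglongrightarrow> t" and c: "\<And>j. c j \<in> seq_space \<rightarrow>\<^sub>M seq_space"
    and cd: "\<And>j i r. (\<And>r. i r < m) \<Longrightarrow> c j i r < m" and \<omega>: "\<And>r. \<omega> r < m"
    and conv: "\<And>i L. (\<And>r. i r < m) \<Longrightarrow> \<forall>\<^sub>F j in sequentially. \<forall>r<L. c j i r = \<omega> r"
  shows "limitin (weak_topology euclidean) (\<lambda>j. law (tt j) (c j)) (limit_law t \<omega>) sequentially"
proof (rule limitin_weak_topology_euclidean)
  show "\<forall>\<^sub>F j in sequentially. law (tt j) (c j) \<in> prob_measures euclidean"
    using law_prob_measures[OF c] by simp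
  show "limit_law t \<omega> \<in> prob_measures euclidean" by (rule limit_law_prob_measures)
  fix f :: "real \<times> real \<Rightarrow> real" assume f: "continuous_on UNIV f" "bounded (range f)"
  have fm: "f \<in> borel_measurable borel" using f(1) by (rule borel_measurable_continuous_onI)
  obtain C where C: "\<And>x. \<bar>f x\<bar> \<le> C" using f(2) by (auto simp: bounded_iff)
  have cm: "(\<lambda>_. \<omega>) \<in> seq_space \<rightarrow>\<^sub>M seq_space" by simp
  have eq: "(\<integral>x. f x \<partial>law s d) = (\<integral>x. f (stretch n s (sample_point d x)) \<partial>sample)"
    if d: "d \<in> seq_space \<rightarrow>\<^sub>M seq_space" for s d
    unfolding law_def by (rule integral_distr[OF measurable_stretched_point[OF d] fm])
  have meas: "(\<lambda>x. f (stretch n s (sample_point d x))) \<in> borel_measurable sample"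
    if d: "d \<in> seq_space \<rightarrow>\<^sub>M seq_space" for s d
    by (rule measurable_compose[OF measurable_stretched_point[OF d] fm])
  have "(\<lambda>j. \<integral>x. f (stretch n (tt j) (sample_point (c j) x)) \<partial>sample) \<longlonglongrightarrow>
    (\<integral>x. f (stretch n t (sample_point (\<lambda>_. \<omega>) x)) \<partial>sample)"
  proof (rule integral_dominated_convergence[where w="\<lambda>_. C"])
    show "AE x in sample. (\<lambda>j. f (stretch n (tt j) (sample_point (c j) x))) \<longlonglongrightarrow> f (stretch n t (sample_point (\<lambda>_. \<omega>) x))"
      using AE_sample_digits
    proof eventually_elim
      case (elim x)
      then have i: "\<And>r. fst x r < m" and u: "\<And>r i. i < m \<Longrightarrow> snd x r i < n" by auto
      have "(\<lambda>j. digit_value n (ysel (c j (fst x)) (snd x))) \<longlonglongrightarrow> digit_value n (ysel \<omega> (snd x))"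
      proof (rule digit_value_tendsto[OF n2])
        show "\<forall>\<^sub>F j in sequentially. \<forall>r. ysel (c j (fst x)) (snd x) r < n"
        proof -
          have "c j (fst x) r < m" for j r using i by (rule cd)
          with u show ?thesis by (simp add: ysel_def)
        qed
        show "ysel \<omega> (snd x) r < n" for r unfolding ysel_def using u \<omega> by simp
        show "\<forall>\<^sub>F j in sequentially. \<forall>r<L. ysel (c j (fst x)) (snd x) r = ysel \<omega> (snd x) r" for L
          using conv[of "fst x" L, OF i] by eventually_elim (simp add: ysel_def)
      qed
      then have "(\<lambda>j. stretch n (tt j) (digit_value m (fst x), digit_value n (ysel (c j (fst x)) (snd x)))) \<longlonglongrightarrow>
        stretch n t (digit_value m (fst x), digit_value n (ysel \<omega> (snd x)))"
        by (intro isCont_stretch_coordinates t tendsto_const)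
      then show ?case
        unfolding sample_point_def
        by (rule isCont_tendsto_compose[rotated]) (use f(1) in \<open>simp only: continuous_on_eq_continuous_at[OF open_UNIV] UNIV_I ball_UNIV\<close>)
    qed
    show "AE x in sample. norm (f (stretch n (tt j) (sample_point (c j) x))) \<le> C" for j
      using C by simp
    show "integrable sample (\<lambda>_. C)" by simp
  qed (intro meas c cm)+
  then show "(\<lambda>j. \<integral>x. f x \<partial>law (tt j) (c j)) \<longlonglongrightarrow> (\<integral>x. f x \<partial>limit_law t \<omega>)"
    by (simp only: eq[OF c] eq[OF cm])
qed

lemma limitin_continuous_real:
  assumes "continuous_map X euclideanreal f" "limitin X g l F"
  shows "((\<lambda>j. f (g j)) \<longlongrightarrow> f l) F"
  using continuous_map_limit[OF assms] by (simp add: comp_def)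

text \<open>Compactness of the parameters \<open>(t, \<omega>)\<close> turns the continuity above into a uniform estimate.\<close>

lemma law_uniformly_close:
  assumes f: "continuous_map planar_measures euclideanreal f" and e: "0 < e"
  obtains D where "\<And>d t t' \<omega> \<omega>'. D \<le> d \<Longrightarrow> t \<in> {0..1} \<Longrightarrow> t' \<in> {0..1} \<Longrightarrow> \<bar>t - t'\<bar> \<le> 1 / real (Suc D) \<Longrightarrow>
    (\<And>r. \<omega> r < m) \<Longrightarrow> (\<And>r. \<omega>' r < m) \<Longrightarrow> (\<And>r. r < D \<Longrightarrow> \<omega> r = \<omega>' r) \<Longrightarrow>
    \<bar>f (law t (comb_seq d \<omega>)) - f (limit_law t' \<omega>')\<bar> < e"
proof (rule ccontr)
  assume "\<not> thesis"
  then have "\<forall>D. \<exists>d t t' \<omega> \<omega>'. D \<le> d \<and> t \<in> {0..1} \<and> t' \<in> {0..1} \<and> \<bar>t - t'\<bar> \<le> 1 / real (Suc D) \<and>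
    (\<forall>r. \<omega> r < m) \<and> (\<forall>r. \<omega>' r < m) \<and> (\<forall>r<D. \<omega> r = \<omega>' r) \<and>
    \<not> \<bar>f (law t (comb_seq d \<omega>)) - f (limit_law t' \<omega>')\<bar> < e"
    using that by meson
  then obtain d t t' \<omega> \<omega>' where
    d: "\<And>D. D \<le> d D" and t: "\<And>D. t D \<in> {0..1}" and t': "\<And>D. t' D \<in> {0..1}"
    and tt': "\<And>D. \<bar>t D - t' D\<bar> \<le> 1 / real (Suc D)" and \<omega>: "\<And>D r. \<omega> D r < m" and \<omega>': "\<And>D r. \<omega>' D r < m"
    and \<omega>\<omega>': "\<And>D r. r < D \<Longrightarrow> \<omega> D r = \<omega>' D r"
    and far: "\<And>D. \<not> \<bar>f (law (t D) (comb_seq (d D) (\<omega> D))) - f (limit_law (t' D) (\<omega>' D))\<bar> < e"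
    by metis
  obtain s y where s: "strict_mono s" and y: "\<And>r. y r < m"
    and conv: "\<And>L. \<forall>\<^sub>F j in sequentially. \<forall>r<L. \<omega>' (s j) r = y r"
    by (rule digit_sequences_subsequence[of \<omega>' m, OF \<omega>']) blast
  have "seq_compact {0..1::real}" by (simp add: compact_imp_seq_compact)
  moreover have "\<forall>j. (t' \<circ> s) j \<in> {0..1}" using t' by simp
  ultimately obtain t0 s' where t0: "t0 \<in> {0..1}" and s': "strict_mono s'" "((t' \<circ> s) \<circ> s') \<longlonglongrightarrow> t0"
    by (rule seq_compactE)
  define r where "r = s \<circ> s'"
  have r: "strict_mono r" unfolding r_def by (rule strict_mono_o[OF s s'(1)])
  have rj: "j \<le> r j" for j by (rule strict_mono_imp_increasing[OF r, rule_format])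
  have lim': "(\<lambda>j. t' (r j)) \<longlonglongrightarrow> t0" using s'(2) by (simp add: r_def comp_def)
  have "(\<lambda>j. t (r j) - t' (r j)) \<longlonglongrightarrow> 0"
  proof (rule Lim_null_comparison)
    show "\<forall>\<^sub>F j in sequentially. norm (t (r j) - t' (r j)) \<le> 1 / real (Suc (r j))"
      using tt' by simp
    show "(\<lambda>j. 1 / real (Suc (r j))) \<longlonglongrightarrow> 0"
      using LIMSEQ_subseq_LIMSEQ[OF LIMSEQ_Suc[OF lim_1_over_n] r] by (simp add: comp_def)
  qed
  from tendsto_add[OF this lim'] have lim: "(\<lambda>j. t (r j)) \<longlonglongrightarrow> t0" by simp
  have conv': "\<forall>\<^sub>F j in sequentially. \<forall>q<L. \<omega>' (r j) q = y q" for L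
    using eventually_subseq[OF s'(1) conv[of L]] by (simp add: r_def)
  have "limitin planar_measures (\<lambda>j. limit_law (t' (r j)) (\<omega>' (r j))) (limit_law t0 y) sequentially"
    by (rule law_tendsto[OF lim']) (use \<omega>' y conv' in auto)
  moreover have "limitin planar_measures (\<lambda>j. law (t (r j)) (comb_seq (d (r j)) (\<omega> (r j)))) (limit_law t0 y) sequentially"
  proof (rule law_tendsto[OF lim])
    show "comb_seq (d (r j)) (\<omega> (r j)) \<in> seq_space \<rightarrow>\<^sub>M seq_space" for j by (rule measurable_comb_seq_right)
    show "comb_seq (d (r j)) (\<omega> (r j)) i q < m" if "\<And>r. i r < m" for j i q
      using \<omega> that by (simp add: comb_seq_def)
    show "\<forall>\<^sub>F j in sequentially. \<forall>q<L. comb_seq (d (r j)) (\<omega> (r j)) i q = y q" for i L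
      using conv'[of L] eventually_ge_at_top[of L]
    proof eventually_elim
      case (elim j)
      have "comb_seq (d (r j)) (\<omega> (r j)) i q = y q" if "q < L" for q
      proof -
        have "q < r j" "q < d (r j)" using that elim(2) rj[of j] d[of "r j"] by linarith+
        then show ?thesis using \<omega>\<omega>'[of q "r j"] elim(1) that by (simp add: comb_seq_def)
      qed
      then show ?case by blast
    qed
  qed (rule y)
  ultimately have "(\<lambda>j. f (law (t (r j)) (comb_seq (d (r j)) (\<omega> (r j)))) - f (limit_law (t' (r j)) (\<omega>' (r j)))) \<longlonglongrightarrow> f (limit_law t0 y) - f (limit_law t0 y)"
    by (intro tendsto_diff limitin_continuous_real[OF f])
  then have "\<forall>\<^sub>F j in sequentially. dist (f (law (t (r j)) (comb_seq (d (r j)) (\<omega> (r j)))) - f (limit_law (t' (r j)) (\<omega>' (r j)))) 0 < e"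
    using e by (simp add: tendsto_iff)
  then obtain j where "dist (f (law (t (r j)) (comb_seq (d (r j)) (\<omega> (r j)))) - f (limit_law (t' (r j)) (\<omega>' (r j)))) 0 < e"
    by (auto simp: eventually_sequentially)
  then show False using far[of "r j"] by (simp add: dist_real_def)
qed

text \<open>The law depends measurably on phase and fibre.\<close>

lemma measurable_limit_law:
  "(\<lambda>p. limit_law (fst p) (snd p)) \<in> borel \<Otimes>\<^sub>M seq_space \<rightarrow>\<^sub>M prob_algebra borel"
proof (rule measurable_prob_algebraI)
  fix p :: "real \<times> (nat \<Rightarrow> nat)"
  show "prob_space (limit_law (fst p) (snd p))"
    using limit_law_prob_measures[of "fst p" "snd p"] by (simp add: prob_measures_euclidean)
next
  let ?L = "borel \<Otimes>\<^sub>M seq_space :: (real \<times> (nat \<Rightarrow> nat)) measure"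
  let ?S = "seq_space \<Otimes>\<^sub>M seq_space :: ((nat \<Rightarrow> nat) \<times> (nat \<Rightarrow> nat \<Rightarrow> nat)) measure"
  have x: "(\<lambda>q. digit_value m (fst (snd q))) \<in> borel_measurable (?L \<Otimes>\<^sub>M ?S)"
    by (rule measurable_compose[OF measurable_compose[OF measurable_snd measurable_fst] borel_measurable_digit_value])
  have y: "(\<lambda>q. digit_value n (ysel (snd (fst q)) (snd (snd q)))) \<in> borel_measurable (?L \<Otimes>\<^sub>M ?S)"
    by (rule measurable_compose[OF measurable_ysel[OF measurable_compose[OF measurable_fst measurable_snd]
          measurable_compose[OF measurable_snd measurable_snd]] borel_measurable_digit_value])
  have t: "(\<lambda>q. fst (fst q)) \<in> borel_measurable (?L \<Otimes>\<^sub>M ?S)"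
    by (rule measurable_compose[OF measurable_fst measurable_fst])
  have joint: "(\<lambda>q. stretch n (fst (fst q)) (sample_point (\<lambda>_. snd (fst q)) (snd q))) \<in> borel_measurable (?L \<Otimes>\<^sub>M ?S)"
    unfolding stretch_def sample_point_def prod.case
  proof (intro borel_measurable_Pair borel_measurable_times x y)
    have "(\<lambda>s. real n powr (- s / 2)) \<in> borel_measurable borel" "(\<lambda>s. real n powr (s / 2)) \<in> borel_measurable borel"
      using n2 by (auto intro!: borel_measurable_continuous_onI continuous_intros)
    from this[THEN measurable_compose[OF t]]
    show "(\<lambda>q. real n powr (- fst (fst q) / 2)) \<in> borel_measurable (?L \<Otimes>\<^sub>M ?S)"
      "(\<lambda>q. real n powr (fst (fst q) / 2)) \<in> borel_measurable (?L \<Otimes>\<^sub>M ?S)" by simp_all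
  qed
  have "(\<lambda>p. distr sample borel (\<lambda>x. stretch n (fst p) (sample_point (\<lambda>_. snd p) x))) \<in> ?L \<rightarrow>\<^sub>M subprob_algebra borel"
  proof (rule measurable_distr2[where M="?S"])
    show "(\<lambda>_. sample) \<in> ?L \<rightarrow>\<^sub>M subprob_algebra ?S"
      by (rule measurable_const) (auto simp: space_subprob_algebra sets_sample sample.prob_space_axioms prob_space_imp_subprob_space)
    show "(\<lambda>(x, y). stretch n (fst x) (sample_point (\<lambda>_. snd x) y)) \<in> ?L \<Otimes>\<^sub>M ?S \<rightarrow>\<^sub>M borel"
      using joint by (simp only: split_beta')
  qed
  then show "(\<lambda>p. limit_law (fst p) (snd p)) \<in> ?L \<rightarrow>\<^sub>M subprob_algebra borel"
    by (simp only: law_def)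
qed

end

section \<open>Boxes and the approximate-square operator\<close>

lemma ivl_nonempty_interior:
  assumes "a < b"
  shows "{a<..<b} \<subseteq> ivl (a, b, p, q)" "ivl (a, b, p, q) \<subseteq> {a..b}"
  using assms by auto

lemma closure_ivl: "a < b \<Longrightarrow> closure (ivl (a, b, p, q)) = {a..b}"
proof
  assume ab: "a < b"
  show "closure (ivl (a, b, p, q)) \<subseteq> {a..b}"
    using ivl_nonempty_interior(2)[OF ab] by (intro closure_minimal) auto
  show "{a..b} \<subseteq> closure (ivl (a, b, p, q))"
    using closure_mono[OF ivl_nonempty_interior(1)[OF ab, of p q]] ab by simp
qed

lemma interval_code_ivl: "a < b \<Longrightarrow> interval_code (ivl (a, b, p, q)) = (a, b, p, q)"
proof -
  assume ab: "a < b"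
  have "{a<..<b} \<noteq> {}" using ab by simp
  note S = ivl_nonempty_interior[OF ab, of p q]
  have ne: "ivl (a, b, p, q) \<noteq> {}" using S(1) ab by (metis \<open>{a<..<b} \<noteq> {}\<close> subset_empty)
  have bdd: "bdd_below (ivl (a, b, p, q))" "bdd_above (ivl (a, b, p, q))"
    using S(2) by (meson bdd_below_Icc bdd_below_mono bdd_above_Icc bdd_above_mono)+
  have inf: "Inf (ivl (a, b, p, q)) = a"
  proof (rule antisym)
    have "Inf (ivl (a, b, p, q)) \<le> Inf {a<..<b}"
      using S(1) bdd ab by (intro cInf_superset_mono) auto
    then show "Inf (ivl (a, b, p, q)) \<le> a" using ab by simp
    show "a \<le> Inf (ivl (a, b, p, q))" using ne S(2) by (intro cInf_greatest) auto
  qed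
  have sup: "Sup (ivl (a, b, p, q)) = b"
  proof (rule antisym)
    have "Sup {a<..<b} \<le> Sup (ivl (a, b, p, q))"
      using S(1) bdd ab by (intro cSup_subset_mono) auto
    then show "b \<le> Sup (ivl (a, b, p, q))" using ab by simp
    show "Sup (ivl (a, b, p, q)) \<le> b" using ne S(2) by (intro cSup_least) auto
  qed
  show ?thesis unfolding interval_code_def inf sup using ab by auto
qed

lemma interval_eq_ivl:
  fixes X :: "real set"
  assumes "is_interval X" "bounded X" "interior X \<noteq> {}"
  shows "\<exists>a b p q. a < b \<and> X = ivl (a, b, p, q)"
proof -
  obtain c e where ce: "e > 0" "ball c e \<subseteq> X"
    using assms(3) by (auto simp: mem_interior)
  have X: "c \<in> X" "c - e / 2 \<in> X" "c + e / 2 \<in> X" using ce by (auto simp: subset_iff dist_real_def)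
  have bdd: "bdd_below X" "bdd_above X"
    using assms(2) by (auto intro: bounded_imp_bdd_below bounded_imp_bdd_above)
  let ?a = "Inf X" and ?b = "Sup X"
  have "?a \<le> c - e / 2" "c + e / 2 \<le> ?b"
    using bdd X by (auto intro: cInf_lower cSup_upper)
  then have ab: "?a < ?b" using ce by simp
  have "X = ivl (?a, ?b, ?a \<in> X, ?b \<in> X)"
  proof
    show "X \<subseteq> ivl (?a, ?b, ?a \<in> X, ?b \<in> X)"
    proof
      fix x assume x: "x \<in> X"
      have "?a \<le> x" "x \<le> ?b" using x bdd by (auto intro: cInf_lower cSup_upper)
      then show "x \<in> ivl (?a, ?b, ?a \<in> X, ?b \<in> X)" using x by (auto simp: less_le)
    qed
    show "ivl (?a, ?b, ?a \<in> X, ?b \<in> X) \<subseteq> X"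
    proof
      fix x assume x: "x \<in> ivl (?a, ?b, ?a \<in> X, ?b \<in> X)"
      show "x \<in> X"
      proof (cases "x = ?a \<or> x = ?b")
        case True
        then show ?thesis using x ab by auto
      next
        case False
        then have "?a < x" "x < ?b" using x by auto
        then obtain y z where "y \<in> X" "y < x" "z \<in> X" "x < z"
          using X(1) bdd by (metis cInf_less_iff empty_iff less_cSup_iff)
        then show ?thesis using assms(1) by (meson is_interval_1 less_imp_le)
      qed
    qed
  qed
  with ab show ?thesis by blast
qed

type_synonym side = "real \<times> real \<times> bool \<times> bool"

definition len :: "side \<Rightarrow> real" where "len c = fst (snd c) - fst c"

lemma len_code [simp]: "len (a, b, x) = b - a" by (simp add: len_def)

definition sub_side :: "nat \<Rightarrow> nat \<Rightarrow> side \<Rightarrow> side" where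
  "sub_side N k c = (fst c + real k * len c / real N, fst c + real (Suc k) * len c / real N,
     k > 0 \<or> fst (snd (snd c)), Suc k = N \<and> snd (snd (snd c)))"

definition move_side :: "real \<Rightarrow> real \<Rightarrow> side \<Rightarrow> side" where
  "move_side r v c = (r * fst c + v, r * fst (snd c) + v, snd (snd c))"

definition box_of :: "side \<times> side \<Rightarrow> (real \<times> real) set" where
  "box_of c = ivl (fst c) \<times> ivl (snd c)"

text \<open>Sides of boxes that are, up to similarity, some \<open>[0,1] \<times> [0,n\<^sup>t]\<close> with \<open>0 \<le> t < 1\<close>.\<close>

definition asq_sides :: "nat \<Rightarrow> side \<times> side \<Rightarrow> bool" where
  "asq_sides n c \<longleftrightarrow> 0 < len (fst c) \<and> len (fst c) \<le> len (snd c) \<and> len (snd c) < real n * len (fst c)"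

definition splits :: "nat \<Rightarrow> nat \<Rightarrow> side \<times> side \<Rightarrow> bool" where
  "splits m n c \<longleftrightarrow> real n * len (fst c) \<le> real m * len (snd c)"

definition sub_box :: "nat \<Rightarrow> nat \<Rightarrow> side \<times> side \<Rightarrow> nat \<Rightarrow> nat \<Rightarrow> side \<times> side" where
  "sub_box m n c k l = (sub_side m k (fst c), if splits m n c then sub_side n l (snd c) else snd c)"

definition sub_indices :: "nat \<Rightarrow> nat \<Rightarrow> side \<times> side \<Rightarrow> (nat \<times> nat) set" where
  "sub_indices m n c = {..<m} \<times> (if splits m n c then {..<n} else {0})"

lemma len_sub_side: "len (sub_side N k c) = len c / real N"
  by (simp add: sub_side_def distrib_right add_divide_distrib)

lemma len_move_side: "len (move_side r v c) = r * len c"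
  by (simp add: len_def move_side_def algebra_simps)

lemma sub_side_move: "sub_side N k (move_side r v c) = move_side r v (sub_side N k c)"
  by (simp add: sub_side_def len_move_side) (simp add: move_side_def algebra_simps)

lemma ivl_move_side:
  assumes "r > 0"
  shows "ivl (move_side r v c) = (\<lambda>x. r * x + v) ` ivl c"
proof -
  obtain a b p q where c: "c = (a, b, p, q)" by (cases c)
  have "x \<in> (\<lambda>x. r * x + v) ` ivl c \<longleftrightarrow> (x - v) / r \<in> ivl c" for x
    using assms by (auto simp: image_iff intro!: bexI[of _ "(x - v) / r"])
  moreover have "(x - v) / r \<in> ivl c \<longleftrightarrow> x \<in> ivl (move_side r v c)" for x
    using assms by (auto simp: c move_side_def field_simps)
  ultimately show ?thesis by blast
qed

lemma homothety_Times: "homothety r v ` (X \<times> Y) = ((\<lambda>x. r * x + fst v) ` X) \<times> ((\<lambda>y. r * y + snd v) ` Y)"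
  by (force simp: homothety_def image_iff prod_eq_iff)

lemma box_of_move:
  "r > 0 \<Longrightarrow> box_of (move_side r (fst v) (fst c), move_side r (snd v) (snd c)) = homothety r v ` box_of c"
  unfolding box_of_def homothety_Times by (simp add: ivl_move_side)

lemma closure_box_of:
  "0 < len (fst c) \<Longrightarrow> 0 < len (snd c) \<Longrightarrow>
    closure (box_of c) = {fst (fst c)..fst (snd (fst c))} \<times> {fst (snd c)..fst (snd (snd c))}"
  by (cases c) (auto simp: box_of_def closure_Times closure_ivl len_def simp del: ivl.simps)

lemma is_box_box_of: "0 < len (fst c) \<Longrightarrow> 0 < len (snd c) \<Longrightarrow> is_box (box_of c)"
proof -
  have *: "is_interval (ivl d) \<and> bounded (ivl d) \<and> interior (ivl d) \<noteq> {}" if "0 < len d" for d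
  proof -
    obtain a b p q where d: "d = (a, b, p, q)" by (cases d)
    then have ab: "a < b" using that by (simp add: len_def)
    have "interior {a<..<b} \<subseteq> interior (ivl d)" unfolding d by (intro interior_mono ivl_nonempty_interior ab)
    then have "interior (ivl d) \<noteq> {}" using ab by (metis dense_le empty_subsetI greaterThanLessThan_empty_iff interior_open leD open_greaterThanLessThan subset_antisym)
    moreover have "bounded (ivl d)" using ivl_nonempty_interior(2)[OF ab, of p q] bounded_closed_interval bounded_subset unfolding d by blast
    moreover have "is_interval (ivl d)" unfolding d is_interval_1 by auto
    ultimately show ?thesis by blast
  qed
  assume "0 < len (fst c)" "0 < len (snd c)"
  then show ?thesis unfolding is_box_def box_of_def
    by (intro exI[of _ "ivl (fst c)"] exI[of _ "ivl (snd c)"]) (simp only: * simp_thms)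
qed

lemma box_eq_box_of: "is_box B \<Longrightarrow> \<exists>c. 0 < len (fst c) \<and> 0 < len (snd c) \<and> B = box_of c"
proof -
  assume "is_box B"
  then obtain X Y where "is_interval X" "bounded X" "interior X \<noteq> {}" "is_interval Y" "bounded Y" "interior Y \<noteq> {}" "B = X \<times> Y"
    unfolding is_box_def by blast
  then obtain a b p q a' b' p' q' where "a < b" "X = ivl (a, b, p, q)" "a' < b'" "Y = ivl (a', b', p', q')"
    using interval_eq_ivl by metis
  then show ?thesis using \<open>B = X \<times> Y\<close>
    by (intro exI[of _ "((a, b, p, q), (a', b', p', q'))"]) (simp add: box_of_def len_def)
qed

lemma closed_rect_eq_homothety:
  assumes "a < b" "c < d" "0 < r"
  shows "{a..b} \<times> {c..d} = homothety r v ` base_rect n t \<longleftrightarrow>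
    a = fst v \<and> c = snd v \<and> b - a = r \<and> d - c = r * real n powr t"
proof -
  have im: "(\<lambda>x. r * x + w) ` {0..L} = {w..r * L + w}" if "L \<ge> 0" for w L
  proof -
    have "(\<lambda>x. r * x + w) ` {0..L} = ivl (move_side r w (0, L, True, True))"
      using assms(3) by (subst ivl_move_side) (auto intro!: image_cong)
    also have "\<dots> = {w..r * L + w}" using that assms(3) by (auto simp: move_side_def mult_nonneg_nonneg)
    finally show ?thesis .
  qed
  have "homothety r v ` base_rect n t = {fst v..r + fst v} \<times> {snd v..r * real n powr t + snd v}"
    unfolding base_rect_def homothety_Times by (simp add: im)
  moreover have "{a..b} \<times> {c..d} = {a'..b'} \<times> {c'..d'} \<longleftrightarrow> a = a' \<and> b = b' \<and> c = c' \<and> d = d'" for a' b' c' d' :: real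
    using assms(1,2) by (auto simp: times_eq_iff)
  ultimately show ?thesis by auto
qed

lemma asq_boxes_eq:
  assumes "2 \<le> n"
  shows "asq_boxes n = box_of ` {c. asq_sides n c}"
proof
  show "asq_boxes n \<subseteq> box_of ` {c. asq_sides n c}"
  proof
    fix B assume "B \<in> asq_boxes n"
    then obtain t r v where B: "is_box B" and t: "0 \<le> t" "t < 1" "0 < r" "closure B = homothety r v ` base_rect n t"
      by (auto simp: asq_boxes_def)
    obtain c where c: "0 < len (fst c)" "0 < len (snd c)" "B = box_of c" using box_eq_box_of[OF B] by blast
    have eq: "len (fst c) = r" "len (snd c) = r * real n powr t"
      using t(4) c t(3) unfolding c(3) closure_box_of[OF c(1,2)]
      by (auto simp: closed_rect_eq_homothety len_def)
    have "1 \<le> real n powr t" "real n powr t < real n"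
      using t assms ge_one_powr_ge_zero[of "real n" t] powr_less_mono[of t 1 "real n"] by auto
    then have "asq_sides n c" unfolding asq_sides_def eq using t(3) by simp
    then show "B \<in> box_of ` {c. asq_sides n c}" using c by blast
  qed
  show "box_of ` {c. asq_sides n c} \<subseteq> asq_boxes n"
  proof clarify
    fix c1 c2 assume c: "asq_sides n (c1, c2)"
    let ?c = "(c1, c2)"
    have pos: "0 < len (fst ?c)" "0 < len (snd ?c)" using c by (auto simp: asq_sides_def)
    define t where "t = log (real n) (len c2 / len c1)"
    have "real n powr t = len c2 / len c1" using assms pos by (simp add: t_def)
    then have L: "len c2 = len c1 * real n powr t" using pos by simp
    have "1 \<le> len c2 / len c1" "len c2 / len c1 < real n" using c pos by (auto simp: asq_sides_def field_simps)
    moreover have "1 < real n" "0 < len c2 / len c1" using assms pos by auto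
    ultimately have t: "0 \<le> t" "t < 1" unfolding t_def
      by (simp_all only: zero_le_log_cancel_iff log_less_one_cancel_iff)
    have "closure (box_of ?c) = homothety (len c1) (fst c1, fst c2) ` base_rect n t"
      unfolding closure_box_of[OF pos] using pos L by (subst closed_rect_eq_homothety) (auto simp: len_def)
    then show "box_of (c1, c2) \<in> asq_boxes n"
      unfolding asq_boxes_def using t pos is_box_box_of[OF pos] by auto
  qed
qed

lemma box_of_inject:
  assumes "0 < len (fst c)" "0 < len (snd c)" "0 < len (fst d)" "0 < len (snd d)" "box_of c = box_of d"
  shows "c = d"
proof -
  have ne: "ivl x \<noteq> {}" if "0 < len x" for x
  proof -
    obtain a b p q where x: "x = (a, b, p, q)" by (cases x)
    then have "(a + b) / 2 \<in> ivl x" using that by (auto simp: len_def)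
    then show ?thesis by blast
  qed
  have code: "interval_code (ivl x) = x" if "0 < len x" for x
    using that by (cases x) (simp only: interval_code_ivl len_def fst_conv snd_conv diff_gt_0_iff_gt)
  have "ivl (fst c) = ivl (fst d)" "ivl (snd c) = ivl (snd d)"
    using assms(5) ne assms(1-4) unfolding box_of_def by (metis times_eq_iff)+
  then show ?thesis using code assms(1-4) by (metis prod_eqI)
qed

lemma box_codes: "0 < len (fst c) \<Longrightarrow> 0 < len (snd c) \<Longrightarrow>
  (interval_code (fst ` box_of c), interval_code (snd ` box_of c)) = c"
proof -
  assume l: "0 < len (fst c)" "0 < len (snd c)"
  have ne: "ivl x \<noteq> {}" if "0 < len x" for x
  proof -
    obtain a b p q where x: "x = (a, b, p, q)" by (cases x)
    then have "(a + b) / 2 \<in> ivl x" using that by (auto simp: len_def)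
    then show ?thesis by blast
  qed
  have code: "interval_code (ivl x) = x" if "0 < len x" for x
    using that by (cases x) (simp only: interval_code_ivl len_def fst_conv snd_conv diff_gt_0_iff_gt)
  show ?thesis using l ne code by (simp add: box_of_def)
qed

lemma ivl_Int_initial:
  assumes "lo < hi" "v \<le> lo" "hi \<le> w" "s \<longleftrightarrow> hi = w" "z \<longleftrightarrow> v < lo"
  shows "ivl (lo, hi, True, s) \<inter> ivl (v, w, p, q) = ivl (lo, hi, z \<or> p, s \<and> q)"
  using assms by auto

lemma split_interval_piece:
  assumes r: "0 < r" and L: "0 < L" and N: "k < N" and c: "fst c = v" "len c = r * L"
  shows "(\<lambda>x. r * x + v) ` (if Suc k = N then {real k * L / real N..L} else {real k * L / real N..<real (Suc k) * L / real N}) \<inter> ivl c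
    = ivl (sub_side N k c)"
proof -
  obtain a b p q where cc: "c = (a, b, p, q)" by (cases c)
  have av: "a = v" "b = v + r * L" using c by (auto simp: cc len_def)
  have N0: "real N > 0" using N by simp
  have "(if Suc k = N then {real k * L / real N..L} else {real k * L / real N..<real (Suc k) * L / real N}) =
    ivl (real k * L / real N, real (Suc k) * L / real N, True, Suc k = N)"
  proof -
    have "real k * L < real (Suc k) * L" using L by (intro mult_strict_right_mono) auto
    then have "real k * L / real N < real (Suc k) * L / real N" using N0 by (rule divide_strict_right_mono)
    moreover have "Suc k = N \<Longrightarrow> real (Suc k) * L / real N = L" using N0 by simp
    ultimately show ?thesis by auto
  qed
  then have "(\<lambda>x. r * x + v) ` (if Suc k = N then {real k * L / real N..L} else {real k * L / real N..<real (Suc k) * L / real N}) =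
    ivl (move_side r v (real k * L / real N, real (Suc k) * L / real N, True, Suc k = N))"
    using r by (simp only: ivl_move_side)
  also have "\<dots> = ivl (v + real k * (r * L) / real N, v + real (Suc k) * (r * L) / real N, True, Suc k = N)"
    by (simp add: move_side_def algebra_simps)
  also have "\<dots> \<inter> ivl c = ivl (sub_side N k c)"
  proof -
    let ?lo = "v + real k * (r * L) / real N" and ?hi = "v + real (Suc k) * (r * L) / real N"
    have rL: "0 < r * L" using r L by simp
    have "real k * (r * L) < real (Suc k) * (r * L)" using rL by (intro mult_strict_right_mono) auto
    then have "?lo < ?hi" using N0 by (simp only: add_less_cancel_left divide_strict_right_mono)
    moreover have "v \<le> ?lo" using rL N0 by simp
    moreover have "k = 0 \<longleftrightarrow> ?lo = v" using r L N0 by simp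
    moreover have "0 < k \<longleftrightarrow> v < ?lo"
      using \<open>v \<le> ?lo\<close> \<open>k = 0 \<longleftrightarrow> ?lo = v\<close> by linarith
    moreover have "?hi \<le> v + r * L" "Suc k = N \<longleftrightarrow> ?hi = v + r * L"
    proof -
      have "real (Suc k) * (r * L) \<le> real N * (r * L)" using N rL by (intro mult_right_mono) auto
      then show "?hi \<le> v + r * L" using N0 by (simp add: pos_divide_le_eq mult.commute)
      show "Suc k = N \<longleftrightarrow> ?hi = v + r * L" using rL N0 by (auto simp: divide_eq_eq simp del: of_nat_Suc)
    qed
    ultimately have "ivl (?lo, ?hi, True, Suc k = N) \<inter> ivl (v, v + r * L, p, q) = ivl (?lo, ?hi, 0 < k \<or> p, Suc k = N \<and> q)"
      by (intro ivl_Int_initial)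
    moreover have "c = (v, v + r * L, p, q)" using av cc by simp
    ultimately show ?thesis by (simp add: sub_side_def)
  qed
  finally show ?thesis .
qed


lemma exponent_facts:
  assumes "2 \<le> m" "m < n"
  shows "0 < asq_exponent m n" "asq_exponent m n < 1" "real n powr asq_exponent m n = real m"
proof -
  have "0 < ln (real m)" "ln (real m) < ln (real n)" using assms by auto
  then show "0 < asq_exponent m n" "asq_exponent m n < 1" by (auto simp: asq_exponent_def)
  have "asq_exponent m n = log (real n) (real m)" by (simp add: asq_exponent_def log_def)
  then show "real n powr asq_exponent m n = real m" using assms by simp
qed

lemma asq_sides_pos: "asq_sides n c \<Longrightarrow> 0 < len (fst c) \<and> 0 < len (snd c)"
  by (auto simp: asq_sides_def)

lemma asq_operator_box:
  assumes mn: "2 \<le> m" "m < n" and c: "asq_sides n c"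
  shows "asq_operator m n (box_of c) = (\<lambda>(k, l). box_of (sub_box m n c k l)) ` sub_indices m n c"
proof -
  note pos = asq_sides_pos[OF c, THEN conjunct1] asq_sides_pos[OF c, THEN conjunct2]
  define r where "r = len (fst c)"
  define v where "v = (fst (fst c), fst (snd c))"
  define t where "t = log (real n) (len (snd c) / len (fst c))"
  have n1: "1 < real n" using mn by simp
  have rt: "real n powr t = len (snd c) / len (fst c)" using mn pos by (simp add: t_def)
  then have L: "len (snd c) = r * real n powr t" using pos by (simp add: r_def)
  have r0: "0 < r" using pos by (simp add: r_def)
  have q: "1 \<le> len (snd c) / len (fst c)" "len (snd c) / len (fst c) < real n" "0 < len (snd c) / len (fst c)"
    using c pos by (auto simp: asq_sides_def field_simps)
  have t: "0 \<le> t" "t < 1" unfolding t_def using n1 q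
    by (simp_all only: zero_le_log_cancel_iff log_less_one_cancel_iff)
  have uniq: "closure (box_of c) = homothety r' v' ` base_rect n t' \<longleftrightarrow> t' = t \<and> r' = r \<and> v' = v" if "0 < r'" for r' v' t'
  proof -
    have "closure (box_of c) = homothety r' v' ` base_rect n t' \<longleftrightarrow>
      fst (fst c) = fst v' \<and> fst (snd c) = snd v' \<and> len (fst c) = r' \<and> len (snd c) = r' * real n powr t'"
      unfolding closure_box_of[OF pos] using pos that by (subst closed_rect_eq_homothety) (auto simp: len_def)
    also have "\<dots> \<longleftrightarrow> t' = t \<and> r' = r \<and> v' = v"
      using L r0 n1 powr_inj[of "real n" t t'] by (auto simp: r_def[symmetric] v_def prod_eq_iff)
    finally show ?thesis .
  qed
  have "1 - asq_exponent m n \<le> t \<longleftrightarrow> real n powr (1 - asq_exponent m n) \<le> real n powr t"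
    using n1 by simp
  also have "real n powr (1 - asq_exponent m n) = real n / real m"
    using exponent_facts[OF mn] n1 by (simp add: powr_diff)
  finally have sp: "1 - asq_exponent m n \<le> t \<longleftrightarrow> splits m n c"
    using pos mn by (simp add: splits_def rt field_simps)
  have "asq_operator m n (box_of c) = {homothety r v ` A \<inter> box_of c | A. A \<in> base_partition m n t}"
  proof -
    have "(\<exists>t' r' v' A. B = homothety r' v' ` A \<inter> box_of c \<and> 0 \<le> t' \<and> t' < 1 \<and> 0 < r' \<and>
        closure (box_of c) = homothety r' v' ` base_rect n t' \<and> A \<in> base_partition m n t') \<longleftrightarrow>
      (\<exists>A. B = homothety r v ` A \<inter> box_of c \<and> A \<in> base_partition m n t)" for B
      using uniq t r0 by metis
    then show ?thesis unfolding asq_operator_def by (rule Collect_cong)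
  qed
  also have "\<dots> = (\<lambda>(k, l). box_of (sub_box m n c k l)) ` sub_indices m n c"
  proof -
    let ?I = "\<lambda>N L k. if Suc k = N then {real k * L / real N..L} else {real k * L / real N..<real (Suc k) * L / real N}"
    have X: "(\<lambda>x. r * x + fst v) ` ?I m 1 k \<inter> ivl (fst c) = ivl (sub_side m k (fst c))" if "k < m" for k
      by (rule split_interval_piece[OF r0 zero_less_one that]) (simp_all add: v_def r_def)
    have Y: "(\<lambda>x. r * x + snd v) ` ?I n (real n powr t) k \<inter> ivl (snd c) = ivl (sub_side n k (snd c))" if "k < n" for k
      by (rule split_interval_piece[OF r0 _ that]) (use n1 L in \<open>simp_all add: v_def\<close>)
    have Y0: "(\<lambda>x. r * x + snd v) ` {0..real n powr t} \<inter> ivl (snd c) = ivl (snd c)"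
    proof -
      have sp1: "sub_side 1 0 (snd c) = snd c"
        by (cases "snd c") (simp add: sub_side_def len_def)
      show ?thesis
        using split_interval_piece[OF r0 _ zero_less_one, of "real n powr t" "snd c" "snd v"] L n1
        unfolding sp1 by (simp add: v_def)
    qed
    have prod: "homothety r v ` (A \<times> B) \<inter> box_of c = ((\<lambda>x. r * x + fst v) ` A \<inter> ivl (fst c)) \<times> ((\<lambda>x. r * x + snd v) ` B \<inter> ivl (snd c))" for A B
      unfolding box_of_def homothety_Times Times_Int_Times ..
    show ?thesis
    proof (cases "splits m n c")
      case True
      have "base_partition m n t = (\<lambda>(k, l). ?I m 1 k \<times> ?I n (real n powr t) l) ` ({..<m} \<times> {..<n})"
        using True sp unfolding base_partition_def split_interval_def by force
      then have "{homothety r v ` A \<inter> box_of c | A. A \<in> base_partition m n t} =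
        (\<lambda>(k, l). homothety r v ` (?I m 1 k \<times> ?I n (real n powr t) l) \<inter> box_of c) ` ({..<m} \<times> {..<n})"
        by (simp only: Setcompr_eq_image image_image split_beta')
      also have "\<dots> = (\<lambda>(k, l). box_of (sub_box m n c k l)) ` ({..<m} \<times> {..<n})"
      proof (rule image_cong[OF refl])
        fix x :: "nat \<times> nat" assume "x \<in> {..<m} \<times> {..<n}"
        then obtain k l where x: "x = (k, l)" "k < m" "l < n" by auto
        show "(case x of (k, l) \<Rightarrow> homothety r v ` (?I m 1 k \<times> ?I n (real n powr t) l) \<inter> box_of c) =
          (case x of (k, l) \<Rightarrow> box_of (sub_box m n c k l))"
          unfolding x(1) prod.case prod X[OF x(2)] Y[OF x(3)]
          by (simp only: box_of_def sub_box_def if_P[OF True] fst_conv snd_conv)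
      qed
      finally show ?thesis using True by (simp only: sub_indices_def if_True)
    next
      case False
      have "base_partition m n t = (\<lambda>k. ?I m 1 k \<times> {0..real n powr t}) ` {..<m}"
        using False sp unfolding base_partition_def split_interval_def by force
      then have "{homothety r v ` A \<inter> box_of c | A. A \<in> base_partition m n t} =
        (\<lambda>k. homothety r v ` (?I m 1 k \<times> {0..real n powr t}) \<inter> box_of c) ` {..<m}"
        by (simp only: Setcompr_eq_image image_image)
      also have "\<dots> = (\<lambda>k. box_of (sub_box m n c k 0)) ` {..<m}"
      proof (rule image_cong[OF refl])
        fix k assume "k \<in> {..<m}"
        then have k: "k < m" by simp
        show "homothety r v ` (?I m 1 k \<times> {0..real n powr t}) \<inter> box_of c = box_of (sub_box m n c k 0)"
          unfolding prod X[OF k] Y0 by (simp only: box_of_def sub_box_def if_not_P[OF False] fst_conv snd_conv)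
      qed
      also have "\<dots> = (\<lambda>(k, l). box_of (sub_box m n c k l)) ` ({..<m} \<times> {0})" by force
      finally show ?thesis using False by (simp only: sub_indices_def if_False)
    qed
  qed
  finally show ?thesis .
qed

lemma grid_cell_arith:
  fixes y k k' N :: real
  assumes "0 \<le> k" "k' = k + 1" "k' \<le> N" "z \<longleftrightarrow> 0 < k" "s \<longleftrightarrow> k' = N"
  shows "((k < y \<or> (z \<or> p) \<and> y = k) \<and> (y < k' \<or> (s \<and> q) \<and> y = k')) \<longleftrightarrow>
    ((0 < y \<or> p \<and> y = 0) \<and> (y < N \<or> q \<and> y = N)) \<and> k \<le> y \<and> (y < k' \<or> s)"
proof (cases z)
  case True
  with assms show ?thesis by (cases s; cases p; cases q) auto
next
  case False
  with assms have "k = 0" by auto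
  with assms False show ?thesis by (cases s; cases p; cases q) auto
qed

lemma mem_sub_side:
  assumes c: "0 < len c" and k: "k < N"
  defines "y \<equiv> \<lambda>x. (x - fst c) * real N / len c"
  shows "x \<in> ivl (sub_side N k c) \<longleftrightarrow> x \<in> ivl c \<and> real k \<le> y x \<and> (y x < real (Suc k) \<or> Suc k = N)"
proof -
  obtain a b p q where cc: "c = (a, b, p, q)" by (cases c)
  have ab: "a < b" "len c = b - a" using c by (auto simp: cc)
  have N: "real N > 0" using k by simp
  have lo: "x = a + real j * (b - a) / real N \<longleftrightarrow> y x = real j" "x < a + real j * (b - a) / real N \<longleftrightarrow> y x < real j"
    "a + real j * (b - a) / real N < x \<longleftrightarrow> real j < y x" for j x
    using ab N by (auto simp: y_def cc field_simps)
  have endp: "x = a \<longleftrightarrow> y x = 0" "a < x \<longleftrightarrow> 0 < y x" "x = b \<longleftrightarrow> y x = real N" "x < b \<longleftrightarrow> y x < real N"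
    using ab N by (auto simp: y_def cc field_simps)
  have "x \<in> ivl (sub_side N k c) \<longleftrightarrow> (real k < y x \<or> (0 < k \<or> p) \<and> y x = real k) \<and>
    (y x < real (Suc k) \<or> (Suc k = N \<and> q) \<and> y x = real (Suc k))"
    unfolding sub_side_def cc by (simp only: ivl.simps fst_conv snd_conv len_code mem_Collect_eq lo)
  moreover have "x \<in> ivl c \<longleftrightarrow> (0 < y x \<or> p \<and> y x = 0) \<and> (y x < real N \<or> q \<and> y x = real N)"
    unfolding cc by (simp only: ivl.simps mem_Collect_eq endp)
  moreover have "((real k < y x \<or> (0 < k \<or> p) \<and> y x = real k) \<and> (y x < real (Suc k) \<or> (Suc k = N \<and> q) \<and> y x = real (Suc k))) \<longleftrightarrow>
    ((0 < y x \<or> p \<and> y x = 0) \<and> (y x < real N \<or> q \<and> y x = real N)) \<and> real k \<le> y x \<and> (y x < real (Suc k) \<or> Suc k = N)"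
    by (rule grid_cell_arith) (use k in auto)
  ultimately show ?thesis by (simp only:)
qed

lemma sub_side_unique:
  assumes "0 < len c" "k < N" "l < N" "x \<in> ivl (sub_side N k c)" "x \<in> ivl (sub_side N l c)"
  shows "k = l"
proof -
  let ?y = "(x - fst c) * real N / len c"
  have "real k \<le> ?y \<and> (?y < real (Suc k) \<or> Suc k = N)" "real l \<le> ?y \<and> (?y < real (Suc l) \<or> Suc l = N)"
    using assms mem_sub_side by blast+
  then show ?thesis using assms(2,3) by (auto simp del: of_nat_Suc)
qed

lemma sub_side_cover:
  assumes c: "0 < len c" and N: "0 < N" and x: "x \<in> ivl c"
  shows "\<exists>k<N. x \<in> ivl (sub_side N k c)"
proof -
  let ?y = "(x - fst c) * real N / len c"
  have "fst c \<le> x" using x by (cases c) auto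
  then have y0: "0 \<le> ?y" using c by simp
  show ?thesis
  proof (cases "?y < real N")
    case True
    define k where "k = nat \<lfloor>?y\<rfloor>"
    have k: "real k \<le> ?y" "?y < real (Suc k)" using y0 by (auto simp: k_def) linarith+
    then have "k < N" using True by linarith
    then show ?thesis using mem_sub_side[OF c, of k N x] k x by auto
  next
    case False
    then have "real (N - 1) \<le> ?y" using N by linarith
    then show ?thesis using mem_sub_side[OF c, of "N - 1" N x] x N by (intro exI[of _ "N - 1"]) auto
  qed
qed

lemma ivl_nonempty: "0 < len c \<Longrightarrow> ivl c \<noteq> {}"
proof -
  assume "0 < len c"
  moreover obtain a b p q where "c = (a, b, p, q)" by (cases c)
  ultimately have "(a + b) / 2 \<in> ivl c" by auto
  then show ?thesis by blast
qed

context
  fixes m n :: nat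
  assumes mn: "2 \<le> m" "m < n"
begin

lemma asq_sides_sub_box: "asq_sides n c \<Longrightarrow> asq_sides n (sub_box m n c k l)"
proof -
  assume c: "asq_sides n c"
  have m: "0 < real m" "0 < real n" "real m < real n" "1 \<le> real m" using mn by auto
  note c' = c[unfolded asq_sides_def]
  show ?thesis
  proof (cases "splits m n c")
    case True
    have "len (fst c) / real m \<le> len (snd c) / real n"
      using True m by (simp add: splits_def field_simps)
    moreover have "len (snd c) / real n < real n * (len (fst c) / real m)"
    proof -
      have "len (snd c) / real n < len (fst c)" using c' m by (simp add: field_simps)
      also have "len (fst c) * 1 \<le> len (fst c) * (real n / real m)" using c' m by (intro mult_left_mono) auto
      finally show ?thesis by (simp add: field_simps)
    qed
    ultimately show ?thesis using c' m True by (simp add: asq_sides_def sub_box_def len_sub_side)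
  next
    case False
    have "len (fst c) / real m \<le> len (fst c) / 1" using c' m by (intro divide_left_mono) auto
    moreover have "len (snd c) < real n * (len (fst c) / real m)"
      using False m by (simp add: splits_def field_simps)
    ultimately show ?thesis using c' m False by (auto simp: asq_sides_def sub_box_def len_sub_side)
  qed
qed

lemma sub_box_unique:
  assumes c: "asq_sides n c" and kl: "(k, l) \<in> sub_indices m n c" "(k', l') \<in> sub_indices m n c"
    and x: "x \<in> box_of (sub_box m n c k l)" "x \<in> box_of (sub_box m n c k' l')"
  shows "k = k' \<and> l = l'"
proof
  note pos = asq_sides_pos[OF c]
  show "k = k'"
    using kl x pos by (intro sub_side_unique[of "fst c" k m k' "fst x"]) (auto simp: sub_indices_def box_of_def sub_box_def)
  show "l = l'"
  proof (cases "splits m n c")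
    case True
    then show ?thesis
      using kl x pos by (intro sub_side_unique[of "snd c" l n l' "snd x"]) (auto simp: sub_indices_def box_of_def sub_box_def)
  qed (use kl in \<open>auto simp: sub_indices_def\<close>)
qed

lemma sub_side_subset: "0 < len d \<Longrightarrow> k < N \<Longrightarrow> ivl (sub_side N k d) \<subseteq> ivl d"
  using mem_sub_side by blast

lemma sub_box_cover:
  assumes c: "asq_sides n c"
  shows "(\<Union>(k, l)\<in>sub_indices m n c. box_of (sub_box m n c k l)) = box_of c"
proof
  note pos = asq_sides_pos[OF c]
  have m0: "0 < m" "0 < n" using mn by auto
  show "(\<Union>(k, l)\<in>sub_indices m n c. box_of (sub_box m n c k l)) \<subseteq> box_of c"
  proof clarify
    fix k l x y assume kl: "(k, l) \<in> sub_indices m n c" and x: "(x, y) \<in> box_of (sub_box m n c k l)"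
    have "x \<in> ivl (fst c)" using x kl pos sub_side_subset[of "fst c" k m] by (auto simp: box_of_def sub_box_def sub_indices_def)
    moreover have "y \<in> ivl (snd c)"
      using x kl pos sub_side_subset[of "snd c" l n] by (auto simp: box_of_def sub_box_def sub_indices_def split: if_splits)
    ultimately show "(x, y) \<in> box_of c" by (simp add: box_of_def)
  qed
  show "box_of c \<subseteq> (\<Union>(k, l)\<in>sub_indices m n c. box_of (sub_box m n c k l))"
  proof clarify
    fix x y assume "(x, y) \<in> box_of c"
    then have xy: "x \<in> ivl (fst c)" "y \<in> ivl (snd c)" by (auto simp: box_of_def)
    obtain k where k: "k < m" "x \<in> ivl (sub_side m k (fst c))" using sub_side_cover[of "fst c" m x] pos m0 xy by blast
    obtain l where l: "l < n" "y \<in> ivl (sub_side n l (snd c))" using sub_side_cover[of "snd c" n y] pos m0 xy by blast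
    show "(x, y) \<in> (\<Union>(k, l)\<in>sub_indices m n c. box_of (sub_box m n c k l))"
    proof (cases "splits m n c")
      case True
      then show ?thesis using k l by (intro UN_I[of "(k, l)"]) (auto simp: sub_indices_def box_of_def sub_box_def)
    next
      case False
      then show ?thesis using k xy by (intro UN_I[of "(k, 0)"]) (auto simp: sub_indices_def box_of_def sub_box_def)
    qed
  qed
qed

lemma box_of_nonempty: "asq_sides n c \<Longrightarrow> box_of c \<noteq> {}"
  using ivl_nonempty asq_sides_pos unfolding box_of_def by blast

lemma partition_on_asq_operator:
  assumes c: "asq_sides n c"
  shows "partition_on (box_of c) (asq_operator m n (box_of c))"
proof (rule partition_onI)
  show "\<Union>(asq_operator m n (box_of c)) = box_of c"
    unfolding asq_operator_box[OF mn c] using sub_box_cover[OF c] by (simp add: split_beta')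
  fix A B assume AB: "A \<in> asq_operator m n (box_of c)" "B \<in> asq_operator m n (box_of c)" "A \<noteq> B"
  then obtain k l k' l' where kl: "(k, l) \<in> sub_indices m n c" "(k', l') \<in> sub_indices m n c"
    "A = box_of (sub_box m n c k l)" "B = box_of (sub_box m n c k' l')"
    unfolding asq_operator_box[OF mn c] by auto
  show "disjnt A B"
    unfolding disjnt_iff using sub_box_unique[OF c kl(1,2)] AB(3) kl(3,4) by blast
next
  show "{} \<notin> asq_operator m n (box_of c)"
    unfolding asq_operator_box[OF mn c] using box_of_nonempty[OF asq_sides_sub_box[OF c]] by force
qed

lemma n_ge_2: "2 \<le> n" using mn by simp

lemma asq_operator_subset: "B \<in> asq_boxes n \<Longrightarrow> asq_operator m n B \<subseteq> asq_boxes n"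
  unfolding asq_boxes_eq[OF n_ge_2] using asq_sides_sub_box by (auto simp: asq_operator_box[OF mn])

lemma partition_operator_asq: "partition_operator (asq_boxes n) (asq_operator m n)"
  unfolding partition_operator_def
proof (intro conjI ballI allI impI)
  fix B assume B: "B \<in> asq_boxes n"
  then show "is_box B" by (simp add: asq_boxes_def)
  obtain c where c: "asq_sides n c" "B = box_of c" using B asq_boxes_eq[OF n_ge_2] by auto
  show "asq_operator m n B \<subseteq> asq_boxes n" by (rule asq_operator_subset[OF B])
  show "partition_on B (asq_operator m n B)" unfolding c(2) by (rule partition_on_asq_operator[OF c(1)])
  fix r :: real and v assume r: "0 < r"
  let ?mv = "\<lambda>c. (move_side r (fst v) (fst c), move_side r (snd v) (snd c))"
  have mv: "homothety r v ` box_of d = box_of (?mv d)" for d using box_of_move[OF r] by simp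
  have asq: "asq_sides n (?mv d) \<longleftrightarrow> asq_sides n d" for d
    using r by (auto simp: asq_sides_def len_move_side zero_less_mult_iff)
  show "homothety r v ` B \<in> asq_boxes n"
    unfolding asq_boxes_eq[OF n_ge_2] c(2) mv using asq c(1) by blast
  have sp: "splits m n (?mv c) \<longleftrightarrow> splits m n c"
    using r by (simp add: splits_def len_move_side mult.left_commute)
  have sub: "sub_box m n (?mv c) k l = ?mv (sub_box m n c k l)" for k l
    unfolding sub_box_def sp by (simp add: sub_side_move)
  have "asq_operator m n (homothety r v ` B) = (\<lambda>(k, l). box_of (sub_box m n (?mv c) k l)) ` sub_indices m n (?mv c)"
    unfolding c(2) mv by (rule asq_operator_box[OF mn]) (simp only: asq c(1))
  also have "sub_indices m n (?mv c) = sub_indices m n c" by (simp only: sub_indices_def sp)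
  also have "(\<lambda>(k, l). box_of (sub_box m n (?mv c) k l)) ` sub_indices m n c = (\<lambda>A. homothety r v ` A) ` asq_operator m n B"
    unfolding c(2) asq_operator_box[OF mn c(1)] image_image split_beta' sub mv ..
  finally show "asq_operator m n (homothety r v ` B) = (\<lambda>A. homothety r v ` A) ` asq_operator m n B" .
qed

lemma partition_iter_sides:
  assumes "asq_sides n c" "A \<in> partition_iter (asq_operator m n) k (box_of c)"
  shows "\<exists>d. asq_sides n d \<and> A = box_of d \<and> len (fst d) = len (fst c) / real m ^ k"
  using assms(2)
proof (induction k arbitrary: A)
  case 0
  then show ?case using assms(1) by (intro exI[of _ c]) auto
next
  case (Suc k)
  then obtain B where B: "B \<in> partition_iter (asq_operator m n) k (box_of c)" "A \<in> asq_operator m n B" by auto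
  obtain d where d: "asq_sides n d" "B = box_of d" "len (fst d) = len (fst c) / real m ^ k" using Suc.IH[OF B(1)] by blast
  obtain i j where "A = box_of (sub_box m n d i j)" using B(2) unfolding d(2) asq_operator_box[OF mn d(1)] by auto
  then show ?case using asq_sides_sub_box[OF d(1)] d(3)
    by (intro exI[of _ "sub_box m n d i j"]) (simp add: sub_box_def len_sub_side)
qed

lemma asq_box_balls:
  assumes d: "asq_sides n d"
  shows "\<exists>x. ball x (len (fst d) / 2) \<subseteq> box_of d" "\<exists>x. box_of d \<subseteq> ball x (3 * real n * len (fst d))"
proof -
  obtain a b p q a' b' p' q' where dd: "d = ((a, b, p, q), (a', b', p', q'))" by (metis prod.exhaust)
  have L: "0 < b - a" "b - a \<le> b' - a'" "b' - a' < real n * (b - a)" using d by (auto simp: asq_sides_def dd)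
  have comp: "\<bar>fst x - fst y\<bar> \<le> dist x y" "\<bar>snd x - snd y\<bar> \<le> dist x y" for x y :: "real \<times> real"
    using dist_fst_le[of x y] dist_snd_le[of x y] by (auto simp: dist_real_def)
  have "ball ((a + b) / 2, (a' + b') / 2) (len (fst d) / 2) \<subseteq> box_of d"
  proof
    fix z assume "z \<in> ball ((a + b) / 2, (a' + b') / 2) (len (fst d) / 2)"
    then have "\<bar>(a + b) / 2 - fst z\<bar> < (b - a) / 2" "\<bar>(a' + b') / 2 - snd z\<bar> < (b - a) / 2"
      using comp[of "((a + b) / 2, (a' + b') / 2)" z] by (auto simp: dd)
    then have "a < fst z \<and> fst z < b" "a' < snd z \<and> snd z < b'" using L by (auto simp: abs_less_iff field_simps)
    then show "z \<in> box_of d" by (cases z) (auto simp: box_of_def dd)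
  qed
  then show "\<exists>x. ball x (len (fst d) / 2) \<subseteq> box_of d" by blast
  have "box_of d \<subseteq> ball (a, a') (3 * real n * len (fst d))"
  proof
    fix z assume "z \<in> box_of d"
    then have z: "a \<le> fst z" "fst z \<le> b" "a' \<le> snd z" "snd z \<le> b'" by (auto simp: box_of_def dd)
    have "dist (a, a') z \<le> \<bar>a - fst z\<bar> + \<bar>a' - snd z\<bar>"
      unfolding dist_prod_def by (simp add: dist_real_def) (rule sqrt_sum_squares_le_sum_abs)
    also have "\<dots> \<le> (b - a) + (b' - a')" using z by linarith
    also have "\<dots> < 1 * (b - a) + real n * (b - a)" using L by simp
    also have "\<dots> \<le> real n * (b - a) + real n * (b - a)" using L mn by (intro add_mono mult_right_mono) auto
    also have "\<dots> \<le> 3 * real n * (b - a)" using L by simp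
    finally show "z \<in> ball (a, a') (3 * real n * len (fst d))" by (simp add: dd)
  qed
  then show "\<exists>x. box_of d \<subseteq> ball x (3 * real n * len (fst d))" by blast
qed

lemma regular_operator_asq: "regular_operator (asq_boxes n) (1 / real m) (asq_operator m n)"
  unfolding regular_operator_def
proof (intro conjI ballI)
  show "0 < 1 / real m" "1 / real m < 1" using mn by auto
  fix B assume "B \<in> asq_boxes n"
  then obtain c where c: "asq_sides n c" "B = box_of c" using asq_boxes_eq[OF n_ge_2] by auto
  define r where "r = len (fst c)"
  have r: "r > 0" using asq_sides_pos[OF c(1)] by (simp add: r_def)
  define C where "C = 1 + 2 / r + 3 * real n * r"
  have C: "C > 1" "2 / r \<le> C" "3 * real n * r \<le> C" using r n_ge_2 by (auto simp: C_def add_pos_pos)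
  show "\<exists>C>1. \<forall>k. \<forall>A\<in>partition_iter (asq_operator m n) k B.
    (\<exists>x. ball x ((1 / real m) ^ k / C) \<subseteq> A) \<and> (\<exists>x. A \<subseteq> ball x (C * (1 / real m) ^ k))"
  proof (intro exI[of _ C] conjI allI ballI C(1))
    fix k A assume "A \<in> partition_iter (asq_operator m n) k B"
    then obtain d where d: "asq_sides n d" "A = box_of d" "len (fst d) = r / real m ^ k"
      using partition_iter_sides[OF c(1)] unfolding c(2) r_def by blast
    have p: "0 < (1 / real m) ^ k" using mn by simp
    have l: "len (fst d) = r * (1 / real m) ^ k" by (simp add: d(3) power_one_over field_simps)
    have "1 / C \<le> r / 2" using C r by (simp add: field_simps)
    then have 1: "(1 / real m) ^ k / C \<le> len (fst d) / 2"
      using mult_right_mono[of "1 / C" "r / 2" "(1 / real m) ^ k"] p unfolding l by simp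
    have 2: "3 * real n * len (fst d) \<le> C * (1 / real m) ^ k"
      using mult_right_mono[OF C(3), of "(1 / real m) ^ k"] p unfolding l by simp
    obtain x where "ball x (len (fst d) / 2) \<subseteq> A" using asq_box_balls(1)[OF d(1)] d(2) by blast
    then have "ball x ((1 / real m) ^ k / C) \<subseteq> A" using subset_ball[OF 1, of x] by blast
    then show "\<exists>x. ball x ((1 / real m) ^ k / C) \<subseteq> A" by blast
    obtain y where "A \<subseteq> ball y (3 * real n * len (fst d))" using asq_box_balls(2)[OF d(1)] d(2) by blast
    then have "A \<subseteq> ball y (C * (1 / real m) ^ k)" using subset_ball[OF 2, of y] by blast
    then show "\<exists>x. A \<subseteq> ball x (C * (1 / real m) ^ k)" by blast
  qed
qed

end

section \<open>Normalisation of boxes\<close>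

definition norm_scale :: "side \<times> side \<Rightarrow> real" where
  "norm_scale c = (len (fst c) * len (snd c)) powr (- 1 / 2)"

definition norm_sides :: "side \<times> side \<Rightarrow> side \<times> side" where
  "norm_sides c = (move_side (norm_scale c) (- norm_scale c * fst (fst c)) (fst c),
     move_side (norm_scale c) (- norm_scale c * fst (snd c)) (snd c))"

lemma measure_lborel_box_of:
  assumes "0 < len (fst c)" "0 < len (snd c)"
  shows "measure lborel (box_of c) = len (fst c) * len (snd c)"
proof -
  obtain a b p q a' b' p' q' where cc: "c = ((a, b, p, q), (a', b', p', q'))" by (metis prod.exhaust)
  have ab: "a < b" "a' < b'" using assms by (auto simp: cc)
  have em: "emeasure lborel (ivl (x, y, s, t)) = ennreal (y - x)" if "x < y" for x y s t
  proof (rule antisym)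
    have meas: "ivl (x, y, s, t) \<in> sets borel" by (cases s; cases t) auto
    show "emeasure lborel (ivl (x, y, s, t)) \<le> ennreal (y - x)"
      using emeasure_mono[OF ivl_nonempty_interior(2)[OF that, of s t], of lborel] that by simp
    show "ennreal (y - x) \<le> emeasure lborel (ivl (x, y, s, t))"
      using emeasure_mono[OF ivl_nonempty_interior(1)[OF that, of s t], of lborel] that meas by simp
  qed
  have meas: "ivl (x, y, s, t) \<in> sets lborel" for x y s t by (cases s; cases t) auto
  have "emeasure lborel (box_of c) = emeasure (lborel \<Otimes>\<^sub>M lborel) (ivl (a, b, p, q) \<times> ivl (a', b', p', q'))"
    by (simp add: box_of_def cc lborel_prod)
  also have "\<dots> = ennreal (b - a) * ennreal (b' - a')"
    by (subst lborel.emeasure_pair_measure_Times) (simp_all only: meas em ab)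
  also have "\<dots> = ennreal (len (fst c) * len (snd c))" using ab by (simp add: cc ennreal_mult)
  finally show ?thesis using assms by (simp add: measure_def)
qed

lemma lex_min_rect: "a \<le> b \<Longrightarrow> c \<le> d \<Longrightarrow> lex_min ({a..b} \<times> {c..d}) = (a, c)"
  unfolding lex_min_def
proof (rule the_equality)
  assume ab: "a \<le> b" "c \<le> d"
  then show "(a, c) \<in> {a..b} \<times> {c..d} \<and> (\<forall>q\<in>{a..b} \<times> {c..d}. fst (a, c) < fst q \<or> fst (a, c) = fst q \<and> snd (a, c) \<le> snd q)"
    by auto
  fix p assume p: "p \<in> {a..b} \<times> {c..d} \<and> (\<forall>q\<in>{a..b} \<times> {c..d}. fst p < fst q \<or> fst p = fst q \<and> snd p \<le> snd q)"
  then have "fst p < a \<or> fst p = a \<and> snd p \<le> c" using ab by (auto dest: bspec[of _ _ "(a, c)"])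
  then show "p = (a, c)" using p by (cases p) auto
qed

lemma box_map_box_of:
  assumes "0 < len (fst c)" "0 < len (snd c)"
  shows "box_map (box_of c) = homothety (norm_scale c) (- norm_scale c * fst (fst c), - norm_scale c * fst (snd c))"
proof -
  have "fst (fst c) \<le> fst (snd (fst c))" "fst (snd c) \<le> fst (snd (snd c))" using assms by (auto simp: len_def)
  then have "lex_min (closure (box_of c)) = (fst (fst c), fst (snd c))"
    unfolding closure_box_of[OF assms] by (rule lex_min_rect)
  then show ?thesis
    unfolding box_map_def measure_lborel_box_of[OF assms] homothety_def norm_scale_def
    by (auto simp: fun_eq_iff prod_eq_iff algebra_simps)
qed

lemma norm_scale_pos: "0 < len (fst c) \<Longrightarrow> 0 < len (snd c) \<Longrightarrow> 0 < norm_scale c"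
  by (simp add: norm_scale_def)

lemma normal_box_box_of:
  assumes "0 < len (fst c)" "0 < len (snd c)"
  shows "normal_box (box_of c) = box_of (norm_sides c)"
  unfolding normal_box_def box_map_box_of[OF assms] norm_sides_def
  using box_of_move[OF norm_scale_pos[OF assms], of "(- norm_scale c * fst (fst c), - norm_scale c * fst (snd c))" c] by simp

lemma len_norm_sides:
  "len (fst (norm_sides c)) = norm_scale c * len (fst c)" "len (snd (norm_sides c)) = norm_scale c * len (snd c)"
  by (simp_all add: norm_sides_def len_move_side)

lemma asq_sides_norm: "asq_sides n c \<Longrightarrow> asq_sides n (norm_sides c)"
  using norm_scale_pos[of c] by (auto simp: asq_sides_def len_norm_sides)

section \<open>Measurability of the transition kernel\<close>

abbreviation side_space :: "side measure" where
  "side_space \<equiv> borel \<Otimes>\<^sub>M borel \<Otimes>\<^sub>M count_space UNIV \<Otimes>\<^sub>M count_space UNIV"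

definition code :: "(real \<times> real) set \<Rightarrow> side \<times> side" where
  "code B = (interval_code (fst ` B), interval_code (snd ` B))"

lemma box_space_eq: "box_space E = vimage_algebra E code (side_space \<Otimes>\<^sub>M side_space)"
  by (simp add: box_space_def Let_def code_def[abs_def])

lemma space_box_space [simp]: "space (box_space E) = E"
  by (simp add: box_space_eq)

lemma measurable_code: "code \<in> box_space E \<rightarrow>\<^sub>M side_space \<Otimes>\<^sub>M side_space"
  unfolding box_space_eq by (rule measurable_vimage_algebra1) (auto simp: space_pair_measure)

lemma measurable_into_box_space:
  assumes "\<And>x. x \<in> space M \<Longrightarrow> g x \<in> E" "(\<lambda>x. code (g x)) \<in> M \<rightarrow>\<^sub>M side_space \<Otimes>\<^sub>M side_space"
  shows "g \<in> M \<rightarrow>\<^sub>M box_space E"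
  unfolding box_space_eq by (rule measurable_vimage_algebra2) (use assms in auto)

context
  fixes f :: "'a \<Rightarrow> side" and M :: "'a measure"
  assumes f: "f \<in> M \<rightarrow>\<^sub>M side_space"
begin

lemma measurable_lo: "(\<lambda>x. fst (f x)) \<in> borel_measurable M"
  and measurable_hi: "(\<lambda>x. fst (snd (f x))) \<in> borel_measurable M"
  and measurable_flag1: "Measurable.pred M (\<lambda>x. fst (snd (snd (f x))))"
  and measurable_flag2: "Measurable.pred M (\<lambda>x. snd (snd (snd (f x))))"
  by (rule measurable_compose[OF f], measurable)+

lemma measurable_len: "(\<lambda>x. len (f x)) \<in> borel_measurable M"
  unfolding len_def by (intro borel_measurable_diff measurable_lo measurable_hi)

lemma measurable_sub_side: "(\<lambda>x. sub_side N k (f x)) \<in> M \<rightarrow>\<^sub>M side_space"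
  unfolding sub_side_def
  by (intro measurable_Pair borel_measurable_add borel_measurable_times borel_measurable_divide borel_measurable_const
      measurable_lo measurable_len pred_intros_logic measurable_flag1 measurable_flag2 measurable_const) auto

lemma measurable_move_side:
  assumes "r \<in> borel_measurable M" "v \<in> borel_measurable M"
  shows "(\<lambda>x. move_side (r x) (v x) (f x)) \<in> M \<rightarrow>\<^sub>M side_space"
  unfolding move_side_def
  by (intro measurable_Pair borel_measurable_add borel_measurable_times assms measurable_lo measurable_hi
      measurable_compose[OF f, of "\<lambda>c. snd (snd c)"] measurable_compose[OF measurable_snd measurable_snd])

lemma pred_mem_ivl:
  assumes "y \<in> borel_measurable M"
  shows "Measurable.pred M (\<lambda>x. y x \<in> ivl (f x))"
proof -
  have eq: "y x \<in> ivl (f x) \<longleftrightarrow> (fst (f x) < y x \<or> fst (snd (snd (f x))) \<and> y x = fst (f x)) \<and>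
    (y x < fst (snd (f x)) \<or> snd (snd (snd (f x))) \<and> y x = fst (snd (f x)))" for x
    by (cases "f x") auto
  note [measurable] = measurable_lo measurable_hi measurable_flag1 measurable_flag2 assms
  show ?thesis unfolding eq by measurable
qed

end

context
  fixes c :: "'a \<Rightarrow> side \<times> side" and M :: "'a measure"
  assumes c: "c \<in> M \<rightarrow>\<^sub>M side_space \<Otimes>\<^sub>M side_space"
begin

lemma measurable_side1: "(\<lambda>x. fst (c x)) \<in> M \<rightarrow>\<^sub>M side_space"
  and measurable_side2: "(\<lambda>x. snd (c x)) \<in> M \<rightarrow>\<^sub>M side_space"
  by (rule measurable_compose[OF c measurable_fst] measurable_compose[OF c measurable_snd])+

lemma pred_mem_box_of:
  assumes "z \<in> borel_measurable M"
  shows "Measurable.pred M (\<lambda>x. z x \<in> box_of (c x))"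
proof -
  have z: "(\<lambda>x. fst (z x)) \<in> borel_measurable M" "(\<lambda>x. snd (z x)) \<in> borel_measurable M"
  proof -
    have "fst \<in> borel_measurable (borel :: (real \<times> real) measure)" "snd \<in> borel_measurable (borel :: (real \<times> real) measure)"
      by (intro borel_measurable_continuous_onI continuous_intros)+
    then show "(\<lambda>x. fst (z x)) \<in> borel_measurable M" "(\<lambda>x. snd (z x)) \<in> borel_measurable M"
      by (auto intro: measurable_compose[OF assms])
  qed
  have "z x \<in> box_of (c x) \<longleftrightarrow> fst (z x) \<in> ivl (fst (c x)) \<and> snd (z x) \<in> ivl (snd (c x))" for x
    by (simp add: box_of_def mem_Times_iff)
  then show ?thesis
    using pred_intros_logic(3)[OF pred_mem_ivl[OF measurable_side1 z(1)] pred_mem_ivl[OF measurable_side2 z(2)]]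
    by simp
qed

lemma pred_splits: "Measurable.pred M (\<lambda>x. splits m n (c x))"
proof -
  note [measurable] = measurable_len[OF measurable_side1] measurable_len[OF measurable_side2]
  show ?thesis unfolding splits_def by measurable
qed

lemma measurable_sub_box: "(\<lambda>x. sub_box m n (c x) k l) \<in> M \<rightarrow>\<^sub>M side_space \<Otimes>\<^sub>M side_space"
  unfolding sub_box_def
  by (intro measurable_Pair measurable_If measurable_sub_side measurable_side1 measurable_side2)
     (use pred_splits in \<open>simp add: pred_def\<close>)

lemma measurable_norm_scale: "(\<lambda>x. norm_scale (c x)) \<in> borel_measurable M"
  unfolding norm_scale_def
  by (intro powr_real_measurable borel_measurable_times borel_measurable_const
      measurable_len[OF measurable_side1] measurable_len[OF measurable_side2])

lemma measurable_norm_sides: "(\<lambda>x. norm_sides (c x)) \<in> M \<rightarrow>\<^sub>M side_space \<Otimes>\<^sub>M side_space"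
  unfolding norm_sides_def
  by (intro measurable_Pair measurable_move_side measurable_side1 measurable_side2 measurable_norm_scale
      borel_measurable_times borel_measurable_uminus measurable_lo)

lemma measurable_normalising_map:
  assumes "z \<in> borel_measurable M"
  shows "(\<lambda>x. homothety (norm_scale (c x)) (- norm_scale (c x) * fst (fst (c x)), - norm_scale (c x) * fst (snd (c x))) (z x)) \<in> borel_measurable M"
  unfolding homothety_def
  by (intro borel_measurable_add borel_measurable_scaleR borel_measurable_Pair measurable_norm_scale assms
      borel_measurable_times borel_measurable_uminus measurable_lo measurable_side1 measurable_side2)

end

lemma box_of_borel [measurable]: "box_of c \<in> sets borel"
proof -
  have "ivl d \<in> sets borel" for d
  proof -
    obtain a b p q where "d = (a, b, p, q)" by (cases d)
    then show ?thesis by (cases p; cases q) auto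
  qed
  then show ?thesis unfolding box_of_def borel_prod[symmetric] by (intro pair_measureI)
qed

lemma homothety_borel: "homothety r v \<in> borel_measurable borel"
  unfolding homothety_def[abs_def] by (intro borel_measurable_continuous_onI continuous_intros)

lemma box_map_borel: "0 < len (fst c) \<Longrightarrow> 0 < len (snd c) \<Longrightarrow> box_map (box_of c) \<in> borel_measurable borel"
  by (simp add: box_map_box_of homothety_borel)

lemma emeasure_rescale:
  assumes \<nu>: "\<nu> \<in> prob_measures euclidean" and c: "0 < len (fst c)" "0 < len (snd c)" and D: "D \<in> sets borel"
  shows "emeasure (rescale \<nu> (box_of c)) D = emeasure \<nu> (box_of c \<inter> box_map (box_of c) -` D) / emeasure \<nu> (box_of c)"
proof -
  have s: "sets \<nu> = sets borel" using \<nu> by (simp add: prob_measures_euclidean)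
  have eq: "sets (uniform_measure \<nu> (box_of c)) = sets borel" using s by simp
  have T: "box_map (box_of c) \<in> uniform_measure \<nu> (box_of c) \<rightarrow>\<^sub>M borel"
    unfolding measurable_cong_sets[OF eq refl] by (rule box_map_borel[OF c])
  have TD: "box_map (box_of c) -` D \<in> sets borel" using measurable_sets[OF box_map_borel[OF c] D] by simp
  have "space (uniform_measure \<nu> (box_of c)) = UNIV" using sets_eq_imp_space_eq[OF eq] by simp
  then have "emeasure (rescale \<nu> (box_of c)) D = emeasure (uniform_measure \<nu> (box_of c)) (box_map (box_of c) -` D)"
    unfolding rescale_def using emeasure_distr[OF T D] by simp
  also have "\<dots> = emeasure \<nu> (box_of c \<inter> box_map (box_of c) -` D) / emeasure \<nu> (box_of c)"
    by (rule emeasure_uniform_measure) (simp_all add: s TD)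
  finally show ?thesis .
qed

lemma rescale_prob:
  assumes \<nu>: "\<nu> \<in> prob_measures euclidean" and c: "0 < len (fst c)" "0 < len (snd c)" and p: "emeasure \<nu> (box_of c) \<noteq> 0"
  shows "rescale \<nu> (box_of c) \<in> measures_on (normal_box (box_of c))"
proof -
  interpret \<nu>: prob_space \<nu> using \<nu> by (simp add: prob_measures_euclidean)
  have fin: "emeasure \<nu> (box_of c) \<noteq> \<top>" by (simp add: \<nu>.emeasure_eq_measure)
  have sets: "sets (rescale \<nu> (box_of c)) = sets borel" by (simp add: rescale_def)
  have one: "emeasure (rescale \<nu> (box_of c)) D = 1" if "D \<in> sets borel" "box_of c \<subseteq> box_map (box_of c) -` D" for D
    unfolding emeasure_rescale[OF \<nu> c that(1)] using that(2) p fin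
    by (simp add: Int_absorb2) (rule ennreal_divide_self, auto simp: \<nu>.emeasure_eq_measure)
  have "prob_space (rescale \<nu> (box_of c))"
    by (rule prob_spaceI) (use one[of UNIV] sets_eq_imp_space_eq[OF sets] in simp)
  moreover have "emeasure (rescale \<nu> (box_of c)) (normal_box (box_of c)) = 1"
  proof (rule one)
    show "normal_box (box_of c) \<in> sets borel" unfolding normal_box_box_of[OF c] by (rule box_of_borel)
    show "box_of c \<subseteq> box_map (box_of c) -` normal_box (box_of c)" unfolding normal_box_def by (intro subsetI vimageI2 imageI)
  qed
  ultimately show ?thesis using sets by (simp add: measures_on_def prob_measures_euclidean)
qed

context
  fixes m n :: nat
  assumes mn: "2 \<le> m" "m < n"
begin

abbreviation "asq_space \<equiv> cp_space (asq_boxes n)"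

abbreviation state_sides :: "cp_state \<Rightarrow> side \<times> side" where
  "state_sides x \<equiv> norm_sides (code (fst x))"

lemma measures_on_prob: "\<nu> \<in> measures_on B \<Longrightarrow> \<nu> \<in> prob_measures euclidean"
  by (simp add: measures_on_def)

lemma space_asq_space: "space asq_space = {x. fst x \<in> asq_boxes n \<and> snd x \<in> measures_on (normal_box (fst x))}"
  unfolding cp_space_def space_restrict_space space_pair_measure
  by (auto simp: topspace_weak_topology measures_on_prob)

lemma asq_box_code: "B \<in> asq_boxes n \<Longrightarrow> asq_sides n (code B) \<and> B = box_of (code B)"
proof -
  assume "B \<in> asq_boxes n"
  then obtain c where c: "asq_sides n c" "B = box_of c" using asq_boxes_eq[OF n_ge_2[OF mn]] by auto
  have "code B = c" unfolding code_def c(2) using asq_sides_pos[OF c(1)] by (intro box_codes) auto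
  with c show ?thesis by simp
qed

lemma code_box_of: "asq_sides n c \<Longrightarrow> code (box_of c) = c"
  unfolding code_def using asq_sides_pos by (intro box_codes) auto

lemma state_sides:
  assumes "x \<in> space asq_space"
  shows "asq_sides n (state_sides x)" "normal_box (fst x) = box_of (state_sides x)" "snd x \<in> measures_on (box_of (state_sides x))"
proof -
  have x: "fst x \<in> asq_boxes n" "snd x \<in> measures_on (normal_box (fst x))" using assms by (auto simp: space_asq_space)
  note c = asq_box_code[OF x(1)]
  show "asq_sides n (state_sides x)" by (rule asq_sides_norm) (use c in simp)
  have "normal_box (box_of (code (fst x))) = box_of (state_sides x)"
    using asq_sides_pos[OF conjunct1[OF c]] by (intro normal_box_box_of) blast+
  then show "normal_box (fst x) = box_of (state_sides x)" using c by simp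
  with x(2) show "snd x \<in> measures_on (box_of (state_sides x))" by simp
qed

definition kernel_term :: "cp_state set \<Rightarrow> nat \<Rightarrow> nat \<Rightarrow> cp_state \<Rightarrow> ennreal" where
  "kernel_term C k l x = (if (k, l) \<in> sub_indices m n (state_sides x) \<and> emeasure (snd x) (box_of (sub_box m n (state_sides x) k l)) \<noteq> 0
    then emeasure (snd x) (box_of (sub_box m n (state_sides x) k l)) *
      indicator C (box_of (sub_box m n (state_sides x) k l), rescale (snd x) (box_of (sub_box m n (state_sides x) k l)))
    else 0)"

lemma sub_indices_subset: "sub_indices m n c \<subseteq> {..<m} \<times> {..<n}"
  using mn by (auto simp: sub_indices_def)

lemma inj_on_sub_box:
  assumes c: "asq_sides n c"
  shows "inj_on (\<lambda>(k, l). box_of (sub_box m n c k l)) (sub_indices m n c)"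
proof (rule inj_onI)
  fix p q assume p: "p \<in> sub_indices m n c" and q: "q \<in> sub_indices m n c"
    and eq: "(case p of (k, l) \<Rightarrow> box_of (sub_box m n c k l)) = (case q of (k, l) \<Rightarrow> box_of (sub_box m n c k l))"
  obtain k l k' l' where kl: "p = (k, l)" "q = (k', l')" by (cases p, cases q)
  obtain z where "z \<in> box_of (sub_box m n c k l)"
    using box_of_nonempty[OF mn asq_sides_sub_box[OF mn c]] by blast
  then show "p = q" using sub_box_unique[OF mn c, of k l k' l' z] p q eq by (simp add: kl)
qed

lemma sum_over_pieces:
  assumes c: "asq_sides n c"
  shows "(\<Sum>A\<in>asq_operator m n (box_of c). h A) =
    (\<Sum>(k, l)\<in>sub_indices m n c. h (box_of (sub_box m n c k l)))"
  unfolding asq_operator_box[OF mn c] by (subst sum.reindex[OF inj_on_sub_box[OF c]]) (simp add: split_beta' comp_def)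

lemma finite_sub_indices: "finite (sub_indices m n c)"
  using finite_subset[OF sub_indices_subset] by simp

lemma emeasure_cp_kernel:
  assumes x: "x \<in> space asq_space" and C: "C \<in> sets asq_space"
  shows "emeasure (cp_kernel (asq_boxes n) (asq_operator m n) x) C = (\<Sum>(k, l)\<in>{..<m} \<times> {..<n}. kernel_term C k l x)"
proof -
  note st = state_sides[OF x]
  let ?h = "\<lambda>A. emeasure (snd x) A * indicator C (A, rescale (snd x) A)"
  have fin: "finite (asq_operator m n (normal_box (fst x)))"
    unfolding st(2) asq_operator_box[OF mn st(1)] using finite_sub_indices by simp
  have "emeasure (cp_kernel (asq_boxes n) (asq_operator m n) x) C = (\<Sum>A\<in>asq_operator m n (normal_box (fst x)). ?h A)"
    unfolding cp_kernel_def split_beta' by (rule emeasure_atomic_measure[OF fin C])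
  also have "\<dots> = (\<Sum>(k, l)\<in>sub_indices m n (state_sides x). ?h (box_of (sub_box m n (state_sides x) k l)))"
    unfolding st(2) by (rule sum_over_pieces[OF st(1)])
  also have "\<dots> = (\<Sum>(k, l)\<in>{..<m} \<times> {..<n}. kernel_term C k l x)"
    by (rule sum.mono_neutral_cong_left) (use sub_indices_subset in \<open>auto simp: kernel_term_def\<close>)
  finally show ?thesis .
qed

lemma piece_state:
  assumes x: "x \<in> space asq_space" and p: "emeasure (snd x) (box_of (sub_box m n (state_sides x) k l)) \<noteq> 0"
  shows "(box_of (sub_box m n (state_sides x) k l), rescale (snd x) (box_of (sub_box m n (state_sides x) k l))) \<in> space asq_space"
proof -
  note st = state_sides[OF x]
  have s: "asq_sides n (sub_box m n (state_sides x) k l)" by (rule asq_sides_sub_box[OF mn st(1)])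
  show ?thesis unfolding space_asq_space
    using s asq_sides_pos[OF s] rescale_prob[OF measures_on_prob[OF st(3)] _ _ p]
    by (auto simp: asq_boxes_eq[OF n_ge_2[OF mn]])
qed

lemma prob_cp_kernel:
  assumes x: "x \<in> space asq_space"
  shows "prob_space (cp_kernel (asq_boxes n) (asq_operator m n) x)"
proof (rule prob_spaceI)
  note st = state_sides[OF x]
  interpret \<nu>: prob_space "snd x" using measures_on_prob[OF st(3)] by (simp add: prob_measures_euclidean)
  have sb: "sets (snd x) = sets borel" using measures_on_prob[OF st(3)] by (simp add: prob_measures_euclidean)
  let ?A = "\<lambda>(k, l). box_of (sub_box m n (state_sides x) k l)"
  have "space (cp_kernel (asq_boxes n) (asq_operator m n) x) = space asq_space"
    by (simp add: cp_kernel_def split_beta')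
  then have "emeasure (cp_kernel (asq_boxes n) (asq_operator m n) x) (space (cp_kernel (asq_boxes n) (asq_operator m n) x)) =
    (\<Sum>(k, l)\<in>{..<m} \<times> {..<n}. kernel_term (space asq_space) k l x)"
    using emeasure_cp_kernel[OF x sets.top] by simp
  also have "\<dots> = (\<Sum>p\<in>sub_indices m n (state_sides x). emeasure (snd x) (?A p))"
    by (rule sum.mono_neutral_cong_right)
       (use sub_indices_subset piece_state[OF x] in \<open>auto simp: kernel_term_def\<close>)
  also have "\<dots> = emeasure (snd x) (\<Union>p\<in>sub_indices m n (state_sides x). ?A p)"
  proof (rule sum_emeasure)
    show "disjoint_family_on ?A (sub_indices m n (state_sides x))"
      unfolding disjoint_family_on_def using sub_box_unique[OF mn st(1)] by fastforce
  qed (auto simp: sb finite_sub_indices)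
  also have "\<dots> = 1"
    using sub_box_cover[OF mn st(1)] st(3) by (simp add: measures_on_def)
  finally show "emeasure (cp_kernel (asq_boxes n) (asq_operator m n) x) (space (cp_kernel (asq_boxes n) (asq_operator m n) x)) = 1" .
qed

lemma measurable_state:
  shows "fst \<in> asq_space \<rightarrow>\<^sub>M box_space (asq_boxes n)" and "snd \<in> asq_space \<rightarrow>\<^sub>M prob_algebra borel"
    and "(\<lambda>x. state_sides x) \<in> asq_space \<rightarrow>\<^sub>M side_space \<Otimes>\<^sub>M side_space"
proof -
  show 1: "fst \<in> asq_space \<rightarrow>\<^sub>M box_space (asq_boxes n)"
    unfolding cp_space_def by (intro measurable_restrict_space1 measurable_fst)
  show "snd \<in> asq_space \<rightarrow>\<^sub>M prob_algebra borel"
    unfolding cp_space_def by (intro measurable_prob_algebra_of_weak measurable_restrict_space1 measurable_snd)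
  show "(\<lambda>x. state_sides x) \<in> asq_space \<rightarrow>\<^sub>M side_space \<Otimes>\<^sub>M side_space"
    by (rule measurable_norm_sides[OF measurable_compose[OF 1 measurable_code]])
qed

lemma measurable_into_asq_space:
  assumes "\<And>x. x \<in> space M \<Longrightarrow> f x \<in> space asq_space"
    and "(\<lambda>x. code (fst (f x))) \<in> M \<rightarrow>\<^sub>M side_space \<Otimes>\<^sub>M side_space"
    and "(\<lambda>x. snd (f x)) \<in> M \<rightarrow>\<^sub>M prob_algebra borel"
  shows "f \<in> M \<rightarrow>\<^sub>M asq_space"
  unfolding cp_space_def
proof (rule measurable_restrict_space2)
  show "f \<in> space M \<rightarrow> {(B, \<nu>). B \<in> asq_boxes n \<and> \<nu> \<in> measures_on (normal_box B)}"
  proof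
    fix x assume "x \<in> space M"
    from assms(1)[OF this] show "f x \<in> {(B, \<nu>). B \<in> asq_boxes n \<and> \<nu> \<in> measures_on (normal_box B)}"
      by (cases "f x") (simp add: space_asq_space)
  qed
  have "(\<lambda>x. fst (f x)) \<in> M \<rightarrow>\<^sub>M box_space (asq_boxes n)"
    by (rule measurable_into_box_space[OF _ assms(2)]) (use assms(1) in \<open>auto simp: space_asq_space\<close>)
  from measurable_Pair[OF this measurable_into_weak_topology[OF assms(3)]]
  show "f \<in> M \<rightarrow>\<^sub>M box_space (asq_boxes n) \<Otimes>\<^sub>M borel_of planar_measures" by simp
qed

lemma measurable_emeasure_box:
  assumes N: "\<nu> \<in> M \<rightarrow>\<^sub>M prob_algebra (borel :: (real \<times> real) measure)"
    and P: "Measurable.pred (M \<Otimes>\<^sub>M borel) (\<lambda>q. P (fst q) (snd q))"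
  shows "(\<lambda>x. emeasure (\<nu> x) {z. P x z}) \<in> borel_measurable M"
proof (rule emeasure_measurable_subprob_algebra2[OF _ measurable_prob_algebraD[OF N]])
  have "(SIGMA x:space M. {z. P x z}) = {q \<in> space (M \<Otimes>\<^sub>M borel). P (fst q) (snd q)}"
    by (auto simp: space_pair_measure)
  then show "(SIGMA x:space M. {z. P x z}) \<in> sets (M \<Otimes>\<^sub>M borel)" using P by (simp add: pred_def)
qed

lemma measurable_rescale:
  assumes c: "c \<in> M \<rightarrow>\<^sub>M side_space \<Otimes>\<^sub>M side_space" and N: "\<nu> \<in> M \<rightarrow>\<^sub>M prob_algebra borel"
    and pos: "\<And>x. x \<in> space M \<Longrightarrow> 0 < len (fst (c x)) \<and> 0 < len (snd (c x)) \<and> emeasure (\<nu> x) (box_of (c x)) \<noteq> 0"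
  shows "(\<lambda>x. rescale (\<nu> x) (box_of (c x))) \<in> M \<rightarrow>\<^sub>M prob_algebra borel"
proof (rule measurable_prob_algebraI)
  have \<nu>: "\<nu> x \<in> prob_measures euclidean" if "x \<in> space M" for x
    using measurable_space[OF N that] by (simp add: space_prob_algebra_borel)
  have rp: "rescale (\<nu> x) (box_of (c x)) \<in> prob_measures euclidean" if "x \<in> space M" for x
    using rescale_prob[OF \<nu>[OF that]] pos[OF that] measures_on_prob by blast
  then show "prob_space (rescale (\<nu> x) (box_of (c x)))" if "x \<in> space M" for x
    using that by (simp add: prob_measures_euclidean)
  show "(\<lambda>x. rescale (\<nu> x) (box_of (c x))) \<in> M \<rightarrow>\<^sub>M subprob_algebra borel"
  proof (rule measurable_subprob_algebra)
    fix x assume "x \<in> space M"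
    then show "subprob_space (rescale (\<nu> x) (box_of (c x)))" "sets (rescale (\<nu> x) (box_of (c x))) = sets borel"
      using rp by (auto simp: prob_measures_euclidean prob_space_imp_subprob_space)
  next
    fix D :: "(real \<times> real) set" assume D: "D \<in> sets borel"
    let ?T = "\<lambda>x. homothety (norm_scale (c x)) (- norm_scale (c x) * fst (fst (c x)), - norm_scale (c x) * fst (snd (c x)))"
    have c': "(\<lambda>q. c (fst q)) \<in> M \<Otimes>\<^sub>M borel \<rightarrow>\<^sub>M side_space \<Otimes>\<^sub>M side_space"
      by (rule measurable_compose[OF measurable_fst c])
    have p1: "Measurable.pred (M \<Otimes>\<^sub>M borel) (\<lambda>q. snd q \<in> box_of (c (fst q)))"
      by (rule pred_mem_box_of[OF c' measurable_snd])
    have p2: "Measurable.pred (M \<Otimes>\<^sub>M borel) (\<lambda>q. ?T (fst q) (snd q) \<in> D)"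
      using measurable_compose[OF measurable_normalising_map[OF c' measurable_snd] pred_sets2[of D borel "\<lambda>x. x"]] D by simp
    have "(\<lambda>x. emeasure (\<nu> x) {z. z \<in> box_of (c x) \<and> ?T x z \<in> D} / emeasure (\<nu> x) {z. z \<in> box_of (c x)}) \<in> borel_measurable M"
      by (intro borel_measurable_divide_ennreal measurable_emeasure_box N pred_intros_logic p1 p2)
    moreover have "emeasure (rescale (\<nu> x) (box_of (c x))) D =
      emeasure (\<nu> x) {z. z \<in> box_of (c x) \<and> ?T x z \<in> D} / emeasure (\<nu> x) {z. z \<in> box_of (c x)}" if x: "x \<in> space M" for x
      using emeasure_rescale[OF \<nu>[OF x] _ _ D, of "c x"] pos[OF x] by (simp add: box_map_box_of Int_def vimage_def)
    ultimately show "(\<lambda>x. emeasure (rescale (\<nu> x) (box_of (c x))) D) \<in> borel_measurable M"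
      by (simp cong: measurable_cong)
  qed
qed

lemma measurable_kernel_term:
  assumes C: "C \<in> sets asq_space"
  shows "kernel_term C k l \<in> borel_measurable asq_space"
proof -
  let ?c = "\<lambda>x. sub_box m n (state_sides x) k l"
  let ?P = "\<lambda>x. (k, l) \<in> sub_indices m n (state_sides x) \<and> emeasure (snd x) (box_of (?c x)) \<noteq> 0"
  have c: "?c \<in> asq_space \<rightarrow>\<^sub>M side_space \<Otimes>\<^sub>M side_space"
    by (rule measurable_sub_box[OF measurable_state(3)])
  have e: "(\<lambda>x. emeasure (snd x) (box_of (?c x))) \<in> borel_measurable asq_space"
    using measurable_emeasure_box[OF measurable_state(2), of "\<lambda>x z. z \<in> box_of (?c x)"]
      pred_mem_box_of[OF measurable_compose[OF measurable_fst c] measurable_snd] by simp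
  have idx: "Measurable.pred asq_space (\<lambda>x. (k, l) \<in> sub_indices m n (state_sides x))"
  proof -
    have "(k, l) \<in> sub_indices m n (state_sides x) \<longleftrightarrow> k < m \<and> (splits m n (state_sides x) \<and> l < n \<or> \<not> splits m n (state_sides x) \<and> l = 0)" for x
      by (auto simp: sub_indices_def)
    moreover have "Measurable.pred asq_space (\<lambda>x. k < m \<and> (splits m n (state_sides x) \<and> l < n \<or> \<not> splits m n (state_sides x) \<and> l = 0))"
      by (intro pred_intros_logic pred_splits[OF measurable_state(3)]) simp_all
    ultimately show ?thesis by (simp only:)
  qed
  have "Measurable.pred asq_space (\<lambda>x. emeasure (snd x) (box_of (?c x)) \<noteq> 0)"
    using measurable_sets[OF e, of "- {0}"] by (simp add: pred_def vimage_def Int_def conj_commute)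
  with idx have P: "{x \<in> space asq_space. ?P x} \<in> sets asq_space"
    unfolding pred_def by - (rule sets.sets_Collect_conj)
  let ?R = "restrict_space asq_space {x. ?P x}"
  have g: "(\<lambda>x. (box_of (?c x), rescale (snd x) (box_of (?c x)))) \<in> ?R \<rightarrow>\<^sub>M asq_space"
  proof (rule measurable_into_asq_space)
    fix x assume "x \<in> space ?R"
    then show "(box_of (?c x), rescale (snd x) (box_of (?c x))) \<in> space asq_space"
      by (intro piece_state) (auto simp: space_restrict_space)
  next
    have "code (fst (box_of (?c x), rescale (snd x) (box_of (?c x)))) = ?c x" if "x \<in> space ?R" for x
      using that asq_sides_sub_box[OF mn state_sides(1)] by (simp add: code_box_of space_restrict_space)
    with measurable_restrict_space1[OF c]
    show "(\<lambda>x. code (fst (box_of (?c x), rescale (snd x) (box_of (?c x))))) \<in> ?R \<rightarrow>\<^sub>M side_space \<Otimes>\<^sub>M side_space"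
      by (simp cong: measurable_cong)
  next
    have "(\<lambda>x. rescale (snd x) (box_of (?c x))) \<in> ?R \<rightarrow>\<^sub>M prob_algebra borel"
    proof (rule measurable_rescale[OF measurable_restrict_space1[OF c] measurable_restrict_space1[OF measurable_state(2)]])
      fix x assume "x \<in> space ?R"
      then have "x \<in> space asq_space" "?P x" by (auto simp: space_restrict_space)
      then show "0 < len (fst (?c x)) \<and> 0 < len (snd (?c x)) \<and> emeasure (snd x) (box_of (?c x)) \<noteq> 0"
        using asq_sides_pos[OF asq_sides_sub_box[OF mn state_sides(1)]] by blast
    qed
    then show "(\<lambda>x. snd (box_of (?c x), rescale (snd x) (box_of (?c x)))) \<in> ?R \<rightarrow>\<^sub>M prob_algebra borel" by simp
  qed
  show ?thesis
    unfolding kernel_term_def[abs_def] measurable_If_restrict_space_iff[OF P]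
    by (intro conjI borel_measurable_times_ennreal measurable_restrict_space1[OF e] borel_measurable_const
        measurable_compose[OF g borel_measurable_indicator] C)
qed

theorem measurable_cp_kernel:
  "cp_kernel (asq_boxes n) (asq_operator m n) \<in> asq_space \<rightarrow>\<^sub>M prob_algebra asq_space"
proof (rule measurable_prob_algebraI[OF prob_cp_kernel])
  show "cp_kernel (asq_boxes n) (asq_operator m n) \<in> asq_space \<rightarrow>\<^sub>M subprob_algebra asq_space"
  proof (rule measurable_subprob_algebra)
    fix x assume "x \<in> space asq_space"
    then show "subprob_space (cp_kernel (asq_boxes n) (asq_operator m n) x)"
      by (intro prob_space_imp_subprob_space prob_cp_kernel)
    show "sets (cp_kernel (asq_boxes n) (asq_operator m n) x) = sets asq_space"
      by (simp add: cp_kernel_def split_beta')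
  next
    fix C assume C: "C \<in> sets asq_space"
    have "(\<lambda>x. \<Sum>(k, l)\<in>{..<m} \<times> {..<n}. kernel_term C k l x) \<in> borel_measurable asq_space"
      unfolding split_beta' by (intro borel_measurable_sum measurable_kernel_term C)
    then show "(\<lambda>x. emeasure (cp_kernel (asq_boxes n) (asq_operator m n) x) C) \<in> borel_measurable asq_space"
      using emeasure_cp_kernel[OF _ C] by (simp cong: measurable_cong)
  qed
qed

end

section \<open>Conditional laws on digit cells\<close>

definition digit_side :: "nat \<Rightarrow> nat \<Rightarrow> (nat \<Rightarrow> nat) \<Rightarrow> bool \<Rightarrow> side" where
  "digit_side b k w q = (prefix_value b k w, prefix_value b k w + 1 / real b ^ k, True, q \<and> (\<forall>r<k. w r = b - 1))"

lemma len_digit_side: "len (digit_side b k w q) = 1 / real b ^ k"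
  by (simp add: digit_side_def)

context digit_system
begin

abbreviation "\<alpha> \<equiv> asq_exponent m n"

lemmas \<alpha>_facts = exponent_facts[OF m2 mn]

lemma AE_sample_fst: "AE i in iid P1. R i \<Longrightarrow> AE x in sample. R (fst x)"
proof -
  assume "AE i in iid P1. R i"
  then obtain N where N: "N \<in> null_sets (iid P1)" "{i. \<not> R i} \<subseteq> N" by (auto simp: eventually_ae_filter)
  have "N \<times> UNIV \<in> null_sets sample"
    unfolding sample_def using N(1) sets.top[of "iid G"]
    by (auto intro!: null_setsI simp: IG.emeasure_pair_measure_Times null_setsD1 null_setsD2)
  then show ?thesis by (rule AE_I') (use N(2) in auto)
qed

lemma AE_sample_snd: "AE u in iid G. R u \<Longrightarrow> AE x in sample. R (snd x)"
proof -
  assume "AE u in iid G. R u"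
  then obtain N where N: "N \<in> null_sets (iid G)" "{i. \<not> R i} \<subseteq> N" by (auto simp: eventually_ae_filter)
  have "UNIV \<times> N \<in> null_sets sample"
    unfolding sample_def using N(1) sets.top[of "iid P1"]
    by (auto intro!: null_setsI simp: IG.emeasure_pair_measure_Times null_setsD1 null_setsD2)
  then show ?thesis by (rule AE_I') (use N(2) in auto)
qed

lemma mem_move_side: "0 < r \<Longrightarrow> r * x \<in> ivl (move_side r 0 c) \<longleftrightarrow> x \<in> ivl c"
  by (subst ivl_move_side) auto

lemma AE_sample_adapted_fst: "AE x in sample. adapted m right_closed (fst x)"
  using AE_sample_adapted by eventually_elim blast

lemma law_on_digit_cell:
  fixes t :: real and k l :: nat and a b c0 :: "nat \<Rightarrow> nat" and q1 q2 :: bool and c c' :: "(nat \<Rightarrow> nat) \<Rightarrow> nat \<Rightarrow> nat"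
  defines "A \<equiv> box_of (move_side (real n powr (- t / 2)) 0 (digit_side m k a q1), move_side (real n powr (t / 2)) 0 (digit_side n l b q2))"
  assumes c: "c \<in> seq_space \<rightarrow>\<^sub>M seq_space" "c' \<in> seq_space \<rightarrow>\<^sub>M seq_space"
    and q: "right_closed \<Longrightarrow> q1" "top_closed \<Longrightarrow> q2"
    and ab: "\<And>r. r < k \<Longrightarrow> a r < m" "\<And>r. r < l \<Longrightarrow> b r < n" "\<And>r. r < l \<Longrightarrow> c0 r < m"
    and ad: "AE x in sample. adapted n top_closed (ysel (c (fst x)) (snd x))"
    and cc: "\<And>i r. (\<And>r. r < k \<Longrightarrow> i r = a r) \<Longrightarrow> r < l \<Longrightarrow> c i r = c0 r"
      "\<And>i r. (\<And>r. r < k \<Longrightarrow> i r = a r) \<Longrightarrow> c i (l + r) = c' (seq_drop k i) r"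
    and w: "w = ennreal ((\<Prod>r<k. pmf P1 (a r)) * (\<Prod>r<l. pmf (K (c0 r)) (b r)))"
  shows "emeasure (law t c) A = w"
    and "w \<noteq> 0 \<Longrightarrow> rescale (law t c) A = law (t + real k * \<alpha> - real l) c'"
proof -
  let ?f = "\<lambda>x. stretch n t (sample_point c x)"
  let ?t' = "t + real k * \<alpha> - real l"
  let ?h = "\<lambda>x. stretch n ?t' (sample_point c' x)"
  let ?X = "\<lambda>r. {a r}" and ?Y = "\<lambda>r. {g. g (c0 r) = b r}"
  let ?W = "real n powr (- t / 2)" and ?H = "real n powr (t / 2)"
  let ?c = "(move_side ?W 0 (digit_side m k a q1), move_side ?H 0 (digit_side n l b q2))"
  have n0: "0 < real n" "real n \<noteq> 1" using n2 by auto
  have m0: "0 < real m" using m2 by simp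
  have WH: "0 < ?W" "0 < ?H" using n0 by auto
  have lens: "len (fst ?c) = ?W / real m ^ k" "len (snd ?c) = ?H / real n ^ l"
    by (simp_all add: len_move_side len_digit_side)
  have pos: "0 < len (fst ?c)" "0 < len (snd ?c)" unfolding lens using WH n0 m0 by auto
  have mk: "real m ^ k = real n powr (real k * \<alpha>)"
  proof -
    have "real n powr (real k * \<alpha>) = (real n powr \<alpha>) powr real k" by (simp add: powr_powr mult.commute)
    then show ?thesis using \<alpha>_facts m0 by (simp add: powr_realpow)
  qed
  have nl: "real n ^ l = real n powr real l" using n0 by (simp add: powr_realpow)
  have sc: "norm_scale ?c = real n powr ((real k * \<alpha> + real l) / 2)"
  proof -
    have "len (fst ?c) * len (snd ?c) = real n powr (- t / 2 - real k * \<alpha> + (t / 2 - real l))"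
      unfolding lens mk nl using n0 by (simp only: powr_add powr_diff)
    also have "\<dots> = real n powr (- (real k * \<alpha> + real l))" by (rule arg_cong[where f="\<lambda>x. real n powr x"]) simp
    finally have "norm_scale ?c = (real n powr (- (real k * \<alpha> + real l))) powr (- 1 / 2)"
      by (simp add: norm_scale_def)
    also have "\<dots> = real n powr ((real k * \<alpha> + real l) / 2)"
      unfolding powr_powr by (rule arg_cong[where f="\<lambda>x. real n powr x"]) (simp add: field_simps)
    finally show ?thesis .
  qed
  have s1: "norm_scale ?c * ?W / real m ^ k = real n powr (- ?t' / 2)"
    unfolding sc mk powr_add[symmetric] powr_diff[symmetric]
    by (rule arg_cong[where f="\<lambda>x. real n powr x"]) (simp add: field_simps)
  have s2: "norm_scale ?c * ?H / real n ^ l = real n powr (?t' / 2)"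
    unfolding sc nl powr_add[symmetric] powr_diff[symmetric]
    by (rule arg_cong[where f="\<lambda>x. real n powr x"]) (simp add: field_simps)
  have meas: "?f \<in> borel_measurable sample" "?h \<in> borel_measurable sample"
    by (rule measurable_stretched_point[OF c(1)], rule measurable_stretched_point[OF c(2)])
  have T: "box_map A \<in> borel_measurable borel" unfolding A_def by (rule box_map_borel[OF pos])
  have ae: "AE x in sample. (?f x \<in> A \<longleftrightarrow> fst x \<in> cyl k ?X \<and> snd x \<in> cyl l ?Y) \<and>
      (fst x \<in> cyl k ?X \<longrightarrow> snd x \<in> cyl l ?Y \<longrightarrow> box_map A (?f x) = ?h (seq_drop k (fst x), seq_drop l (snd x)))"
    using AE_sample_adapted_fst ad
  proof eventually_elim
    case (elim x)
    obtain i u where x: "x = (i, u)" by (cases x)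
    let ?z = "ysel (c i) u"
    have ai: "adapted m right_closed i" and az: "adapted n top_closed ?z" using elim by (auto simp: x)
    have im: "\<And>r. i r < m" and zn: "\<And>r. ?z r < n" using ai az by (auto simp: adapted_def)
    have "?f x \<in> A \<longleftrightarrow> digit_value m i \<in> ivl (digit_side m k a q1) \<and> digit_value n ?z \<in> ivl (digit_side n l b q2)"
      unfolding A_def box_of_def using mem_move_side[OF WH(1)] mem_move_side[OF WH(2)] by (simp add: x stretch_def sample_point_def)
    also have "\<dots> \<longleftrightarrow> (\<forall>r<k. i r = a r) \<and> (\<forall>r<l. ?z r = b r)"
      unfolding digit_side_def
      by (intro arg_cong2[where f="(\<and>)"] mem_digit_interval[OF m2 ai ab(1) q(1)] mem_digit_interval[OF n2 az ab(2) q(2)])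
    also have "\<dots> \<longleftrightarrow> i \<in> cyl k ?X \<and> u \<in> cyl l ?Y"
      using cc(1)[of i] by (auto simp: cyl_def ysel_def)
    finally have iff: "?f x \<in> A \<longleftrightarrow> i \<in> cyl k ?X \<and> u \<in> cyl l ?Y" .
    have "box_map A (?f x) = ?h (seq_drop k i, seq_drop l u)" if pre: "i \<in> cyl k ?X" "u \<in> cyl l ?Y"
    proof -
      have ia: "i r = a r" if "r < k" for r using pre(1) that by (auto simp: cyl_def)
      have zb: "?z r = b r" if "r < l" for r using pre(2) that cc(1)[of i r] ia by (auto simp: cyl_def ysel_def)
      have dz: "(\<lambda>r. ?z (l + r)) = ysel (c' (seq_drop k i)) (seq_drop l u)"
        using cc(2)[of i] ia by (auto simp: ysel_def)
      have v1: "digit_value m i - prefix_value m k a = digit_value m (seq_drop k i) / real m ^ k"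
        using digit_value_split[OF m2, of i k] im prefix_value_cong[OF m2, of k i a] ia by simp
      have v2: "digit_value n ?z - prefix_value n l b = digit_value n (ysel (c' (seq_drop k i)) (seq_drop l u)) / real n ^ l"
        using digit_value_split[OF n2, of ?z l] zn prefix_value_cong[OF n2, of l ?z b] zb unfolding dz by simp
      have "box_map A (?f x) = (norm_scale ?c * ?W * (digit_value m i - prefix_value m k a), norm_scale ?c * ?H * (digit_value n ?z - prefix_value n l b))"
        unfolding A_def box_map_box_of[OF pos]
        by (simp add: homothety_def x stretch_def sample_point_def move_side_def digit_side_def algebra_simps)
      also have "\<dots> = (norm_scale ?c * ?W / real m ^ k * digit_value m (seq_drop k i), norm_scale ?c * ?H / real n ^ l * digit_value n (ysel (c' (seq_drop k i)) (seq_drop l u)))"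
        unfolding v1 v2 by simp
      also have "\<dots> = ?h (seq_drop k i, seq_drop l u)"
        unfolding s1 s2 by (simp add: stretch_def sample_point_def)
      finally show ?thesis .
    qed
    with iff show ?case by (simp add: x)
  qed
  have w': "w = (\<Prod>r<k. emeasure (measure_pmf P1) (?X r)) * (\<Prod>r<l. emeasure (measure_pmf G) (?Y r))"
  proof -
    have "(\<Prod>r<l. emeasure (measure_pmf G) (?Y r)) = (\<Prod>r<l. ennreal (pmf (K (c0 r)) (b r)))"
      using ab(3) by (intro prod.cong refl emeasure_G) auto
    then show ?thesis unfolding w by (simp add: emeasure_pmf_single prod_ennreal ennreal_mult prod_nonneg)
  qed
  have Ab: "A \<in> sets borel" unfolding A_def by (rule box_of_borel)
  show "emeasure (law t c) A = w"
    unfolding law_def by (rule conditional_law(1)[OF meas(1) Ab T meas(2) ae w'])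
  show "rescale (law t c) A = law ?t' c'" if "w \<noteq> 0"
    unfolding rescale_def law_def by (rule conditional_law(2)[OF meas(1) Ab T meas(2) ae w' that])
qed

definition canon :: "real \<Rightarrow> side \<times> side" where
  "canon t = ((0, real n powr (- t / 2), True, right_closed), (0, real n powr (t / 2), True, top_closed))"

definition phase_step :: "real \<Rightarrow> real" where "phase_step t = frac (t + \<alpha>)"
definition split_count :: "real \<Rightarrow> nat" where "split_count t = nat \<lfloor>t + \<alpha>\<rfloor>"

lemma phase_step_eq: "0 \<le> t \<Longrightarrow> phase_step t = t + \<alpha> - real (split_count t)"
  using \<alpha>_facts by (simp add: phase_step_def split_count_def frac_def)

lemma phase_step_range: "0 \<le> phase_step t" "phase_step t < 1"
  by (auto simp: phase_step_def frac_lt_1)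

lemma split_count_cases:
  assumes "0 \<le> t" "t < 1"
  shows "split_count t = (if 1 \<le> t + \<alpha> then 1 else 0)"
proof -
  have "0 < t + \<alpha>" "t + \<alpha> < 2" using assms \<alpha>_facts by auto
  then have "\<lfloor>t + \<alpha>\<rfloor> = (if 1 \<le> t + \<alpha> then 1 else 0)"
    by (cases "1 \<le> t + \<alpha>") (simp_all add: floor_eq_iff)
  then show ?thesis by (simp add: split_count_def)
qed

lemma asq_sides_canon: "0 \<le> t \<Longrightarrow> t < 1 \<Longrightarrow> asq_sides n (canon t)"
proof -
  assume t: "0 \<le> t" "t < 1"
  have n1: "1 < real n" using n2 by simp
  have "real n powr (t / 2) < real n powr (1 - t / 2)" using t n1 by simp
  also have "\<dots> = real n * real n powr (- t / 2)" using powr_mult_base[of "real n" "- t / 2"] by simp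
  finally show ?thesis using t n1 by (simp add: asq_sides_def canon_def)
qed

lemma norm_sides_canon: "norm_sides (canon t) = canon t"
proof -
  have "real n powr (- t / 2) * real n powr (t / 2) = 1" using n2 by (simp add: powr_add[symmetric])
  then have "norm_scale (canon t) = 1" by (simp add: norm_scale_def canon_def)
  then show ?thesis by (simp add: norm_sides_def move_side_def canon_def)
qed

lemma splits_canon:
  assumes "0 \<le> t" "t < 1"
  shows "splits m n (canon t) \<longleftrightarrow> split_count t = 1"
proof -
  have n1: "1 < real n" using n2 by simp
  have "real n * real n powr (- t / 2) = real n powr (1 - t / 2)" using powr_mult_base[of "real n" "- t / 2"] by simp
  moreover have "real m * real n powr (t / 2) = real n powr (\<alpha> + t / 2)" using \<alpha>_facts by (simp add: powr_add)
  ultimately have "splits m n (canon t) \<longleftrightarrow> real n powr (1 - t / 2) \<le> real n powr (\<alpha> + t / 2)"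
    by (simp add: splits_def canon_def)
  also have "\<dots> \<longleftrightarrow> 1 \<le> t + \<alpha>" using n1 by (auto simp: field_simps)
  finally show ?thesis using split_count_cases[OF assms] by simp
qed

lemma sub_box_canon:
  assumes t: "0 \<le> t" "t < 1" and a: "a < m" and b: "b < n"
  shows "sub_box m n (canon t) a b =
    (move_side (real n powr (- t / 2)) 0 (digit_side m 1 (\<lambda>_. a) right_closed),
     move_side (real n powr (t / 2)) 0 (digit_side n (split_count t) (\<lambda>_. b) top_closed))"
proof -
  have 1: "sub_side N k (0, L, True, q) = move_side L 0 (digit_side N 1 (\<lambda>_. k) q)" if "k < N" for N k L q
    using that by (auto simp: sub_side_def move_side_def digit_side_def prefix_value_def field_simps)
  have 0: "(0, L, True, q) = move_side L 0 (digit_side N 0 w q)" for N L q w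
    by (simp add: move_side_def digit_side_def prefix_value_def)
  show ?thesis
  proof (cases "split_count t = 1")
    case True
    then show ?thesis unfolding sub_box_def splits_canon[OF t] using 1[OF a] 1[OF b] by (simp add: canon_def)
  next
    case False
    then have "split_count t = 0" using split_count_cases[OF t] by (simp split: if_splits)
    then show ?thesis unfolding sub_box_def splits_canon[OF t]
      using 1[OF a] 0[of "real n powr (t / 2)" top_closed n "\<lambda>_. b"] by (simp add: canon_def)
  qed
qed

lemma norm_sides_sub_canon:
  assumes t: "0 \<le> t" "t < 1" and a: "a < m" "right_closed \<Longrightarrow> a = m - 1" and b: "b < n" "top_closed \<Longrightarrow> b = n - 1"
  shows "norm_sides (sub_box m n (canon t) a b) = canon (phase_step t)"
proof -
  let ?l = "split_count t"
  let ?W = "real n powr (- t / 2)" and ?H = "real n powr (t / 2)"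
  let ?c = "(move_side ?W 0 (digit_side m 1 (\<lambda>_. a) right_closed), move_side ?H 0 (digit_side n ?l (\<lambda>_. b) top_closed))"
  have n0: "0 < real n" "real n \<noteq> 1" using n2 by auto
  have lens: "len (fst ?c) = ?W / real m" "len (snd ?c) = ?H / real n ^ ?l"
    by (simp_all add: len_move_side len_digit_side)
  have m: "real m = real n powr \<alpha>" using \<alpha>_facts by simp
  have nl: "real n ^ ?l = real n powr real ?l" using n0 by (simp add: powr_realpow)
  have "len (fst ?c) * len (snd ?c) = real n powr (- t / 2 - \<alpha> + (t / 2 - real ?l))"
    unfolding lens m nl powr_add powr_diff ..
  also have "\<dots> = real n powr (- (\<alpha> + real ?l))" by (rule arg_cong[where f="\<lambda>x. real n powr x"]) simp
  finally have "norm_scale ?c = (real n powr (- (\<alpha> + real ?l))) powr (- 1 / 2)"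
    by (simp only: norm_scale_def)
  also have "\<dots> = real n powr ((\<alpha> + real ?l) / 2)"
    unfolding powr_powr by (rule arg_cong[where f="\<lambda>x. real n powr x"]) (simp add: field_simps)
  finally have sc: "norm_scale ?c = real n powr ((\<alpha> + real ?l) / 2)" .
  have s1: "norm_scale ?c * (?W / real m) = real n powr (- phase_step t / 2)"
    unfolding sc m phase_step_eq[OF t(1)] powr_add[symmetric] powr_diff[symmetric]
    by (rule arg_cong[where f="\<lambda>x. real n powr x"]) (simp add: field_simps)
  have s2: "norm_scale ?c * (?H / real n ^ ?l) = real n powr (phase_step t / 2)"
    unfolding sc nl phase_step_eq[OF t(1)] powr_add[symmetric] powr_diff[symmetric]
    by (rule arg_cong[where f="\<lambda>x. real n powr x"]) (simp add: field_simps)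
  have norm: "move_side s (- s * fst d) d = (0, s * len d, snd (snd d))" for s d
    by (cases d) (simp add: move_side_def algebra_simps)
  have flags: "snd (snd (fst ?c)) = (True, right_closed)" "snd (snd (snd ?c)) = (True, top_closed)"
    using a(2) b(2) by (auto simp: move_side_def digit_side_def)
  show ?thesis
    unfolding sub_box_canon[OF t a(1) b(1)] norm_sides_def norm flags unfolding lens s1 s2 canon_def ..
qed

lemma fibre_regular_AE: "fibre_regular \<omega> \<Longrightarrow> AE x in sample. adapted n top_closed (ysel \<omega> (snd x))"
  by (rule AE_sample_snd) (simp add: fibre_regular_def)

lemma fibre_regular_digits: "fibre_regular \<omega> \<Longrightarrow> \<omega> r < m"
  by (simp add: fibre_regular_def adapted_def)

lemma limit_law_canon:
  assumes "fibre_regular \<omega>"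
  shows "emeasure (limit_law t \<omega>) (box_of (canon t)) = 1"
proof -
  have "canon t = (move_side (real n powr (- t / 2)) 0 (digit_side m 0 \<omega> right_closed), move_side (real n powr (t / 2)) 0 (digit_side n 0 \<omega> top_closed))"
    by (simp add: canon_def move_side_def digit_side_def prefix_value_def)
  then show ?thesis
    using law_on_digit_cell(1)[where c="\<lambda>_. \<omega>" and c'="\<lambda>_. \<omega>" and ?q1.0=right_closed and ?q2.0=top_closed and k=0 and l=0
        and a=\<omega> and b=\<omega> and ?c0.0=\<omega> and w=1 and t=t] fibre_regular_AE[OF assms] by simp
qed

lemma limit_law_piece:
  assumes t: "0 \<le> t" "t < 1" and \<omega>: "fibre_regular \<omega>" and ab: "a < m" "b < n"
    and w: "w = ennreal (pmf P1 a * (if split_count t = 1 then pmf (K (\<omega> 0)) b else 1))"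
  shows "emeasure (limit_law t \<omega>) (box_of (sub_box m n (canon t) a b)) = w"
    and "w \<noteq> 0 \<Longrightarrow> rescale (limit_law t \<omega>) (box_of (sub_box m n (canon t) a b)) = limit_law (phase_step t) (seq_drop (split_count t) \<omega>)"
proof -
  let ?l = "split_count t"
  have l: "?l = 0 \<or> ?l = 1" using split_count_cases[OF t] by auto
  have w': "w = ennreal ((\<Prod>r<(1::nat). pmf P1 a) * (\<Prod>r<?l. pmf (K (\<omega> 0)) b))" using l w by auto
  have ph: "phase_step t = t + real 1 * \<alpha> - real ?l" using phase_step_eq[OF t(1)] by simp
  note cell = law_on_digit_cell[where c="\<lambda>_. \<omega>" and c'="\<lambda>_. seq_drop ?l \<omega>" and ?q1.0=right_closed and ?q2.0=top_closed
      and k=1 and l="?l" and a="\<lambda>_. a" and b="\<lambda>_. b" and ?c0.0="\<lambda>_. \<omega> 0" and w=w and t=t]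
  have c0: "r < ?l \<Longrightarrow> r = 0" for r using l by auto
  show "emeasure (limit_law t \<omega>) (box_of (sub_box m n (canon t) a b)) = w"
    unfolding sub_box_canon[OF t ab]
    by (rule cell(1)) (use ab fibre_regular_AE[OF \<omega>] fibre_regular_digits[OF \<omega>] w' in \<open>auto dest: c0\<close>)
  show "rescale (limit_law t \<omega>) (box_of (sub_box m n (canon t) a b)) = limit_law (phase_step t) (seq_drop ?l \<omega>)" if "w \<noteq> 0"
    unfolding sub_box_canon[OF t ab] ph
    by (rule cell(2)) (use ab fibre_regular_AE[OF \<omega>] fibre_regular_digits[OF \<omega>] w' that in \<open>auto dest: c0\<close>)
qed

end

section \<open>Averages along a random sequence sampled by a rotation\<close>

lemma drop_cyl_eq: "{z. seq_drop k z \<in> cyl L X} = cyl (k + L) (\<lambda>r. if r < k then UNIV else X (r - k))"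
proof (rule set_eqI, rule iffI)
  fix z assume z: "z \<in> {z. seq_drop k z \<in> cyl L X}"
  have "z r \<in> X (r - k)" if "r < k + L" "k \<le> r" for r
    using z that by (auto simp: cyl_def dest!: spec[of _ "r - k"])
  then show "z \<in> cyl (k + L) (\<lambda>r. if r < k then UNIV else X (r - k))" by (auto simp: cyl_def)
next
  fix z assume z: "z \<in> cyl (k + L) (\<lambda>r. if r < k then UNIV else X (r - k))"
  have "z (k + r) \<in> X r" if "r < L" for r
    using z that by (auto simp: cyl_def dest!: spec[of _ "k + r"])
  then show "z \<in> {z. seq_drop k z \<in> cyl L X}" by (simp add: cyl_def)
qed

lemma sets_drop_cyl: "{z. seq_drop k z \<in> cyl L X} \<in> sets (iid p)"
  unfolding drop_cyl_eq sets_iid by (rule sets_cyl)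

lemma measure_drop_cyl_Int:
  assumes "k + L \<le> j"
  shows "measure (iid p) ({z. seq_drop k z \<in> cyl L X} \<inter> {z. seq_drop j z \<in> cyl L' X'}) =
    (\<Prod>r<L. measure (measure_pmf p) (X r)) * (\<Prod>r<L'. measure (measure_pmf p) (X' r))"
proof -
  let ?J = "{k..<k + L} \<union> {j..<j + L'}" and ?Y = "\<lambda>r. if r < j then X (r - k) else X' (r - j)"
  interpret prob_space "iid p" by (rule prob_space_iid)
  have "{z. seq_drop k z \<in> cyl L X} \<inter> {z. seq_drop j z \<in> cyl L' X'} = {z. \<forall>r\<in>?J. z r \<in> ?Y r}" (is "?A \<inter> ?B = ?C")
  proof
    show "?A \<inter> ?B \<subseteq> ?C"
    proof (rule subsetI, rule CollectI, rule ballI)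
      fix z r assume z: "z \<in> ?A \<inter> ?B" and r: "r \<in> ?J"
      show "z r \<in> ?Y r"
      proof (cases "r < j")
        case True
        then have "k \<le> r" "r - k < L" using r by auto
        then show ?thesis using z True by (auto simp: cyl_def dest: spec[of _ "r - k"])
      next
        case False
        then have "j \<le> r" "r - j < L'" using r assms by auto
        then show ?thesis using z False by (auto simp: cyl_def dest: spec[of _ "r - j"])
      qed
    qed
    show "?C \<subseteq> ?A \<inter> ?B"
    proof (rule subsetI)
      fix z assume z: "z \<in> ?C"
      have "z (k + r) \<in> X r" if "r < L" for r using z that assms by (auto dest!: bspec[of _ _ "k + r"])
      moreover have "z (j + r) \<in> X' r" if "r < L'" for r using z that by (auto dest!: bspec[of _ _ "j + r"])
      ultimately show "z \<in> ?A \<inter> ?B" by (auto simp: cyl_def)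
    qed
  qed
  then have "emeasure (iid p) (?A \<inter> ?B) = (\<Prod>r\<in>?J. emeasure (measure_pmf p) (?Y r))"
    by (simp only: emeasure_iid_coordinates[of ?J p ?Y] finite_Un finite_atLeastLessThan)
  also have "\<dots> = (\<Prod>r\<in>{k..<k + L}. emeasure (measure_pmf p) (?Y r)) * (\<Prod>r\<in>{j..<j + L'}. emeasure (measure_pmf p) (?Y r))"
    by (rule prod.union_disjoint) (use assms in auto)
  also have "(\<Prod>r\<in>{k..<k + L}. emeasure (measure_pmf p) (?Y r)) = (\<Prod>r<L. emeasure (measure_pmf p) (X r))"
    unfolding prod.atLeastLessThan_shift_0[of _ k] atLeast0LessThan using assms by (intro prod.cong) auto
  also have "(\<Prod>r\<in>{j..<j + L'}. emeasure (measure_pmf p) (?Y r)) = (\<Prod>r<L'. emeasure (measure_pmf p) (X' r))"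
    unfolding prod.atLeastLessThan_shift_0[of _ j] atLeast0LessThan by (intro prod.cong) auto
  finally show ?thesis
    by (simp add: emeasure_eq_measure measure_pmf.emeasure_eq_measure prod_ennreal ennreal_mult[symmetric] prod_nonneg)
qed

lemma measure_drop_cyl:
  "measure (iid p) {z. seq_drop k z \<in> cyl L X} = (\<Prod>r<L. measure (measure_pmf p) (X r))"
  using measure_drop_cyl_Int[of k L "k + L" p X 0 "\<lambda>_. UNIV"] by (simp add: cyl_def)

theorem weighted_averages:
  fixes a :: "nat \<Rightarrow> real"
  assumes l: "\<And>i j. i + H \<le> j \<Longrightarrow> l i + L \<le> l j" and a: "\<And>k. \<bar>a k\<bar> \<le> 1"
    and lim: "(\<lambda>N. (\<Sum>k<N. a k) / real N) \<longlonglongrightarrow> A"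
  shows "AE z in iid p. (\<lambda>N. (\<Sum>k<N. a k * indicator (cyl L X) (seq_drop (l k) z)) / real N) \<longlonglongrightarrow>
    A * (\<Prod>r<L. measure (measure_pmf p) (X r))"
proof -
  interpret prob_space "iid p" by (rule prob_space_iid)
  define c where "c = (\<Prod>r<L. measure (measure_pmf p) (X r))"
  have c: "0 \<le> c" "c \<le> 1" unfolding c_def by (auto intro!: prod_nonneg prod_le_1)
  let ?E = "\<lambda>k. {z. seq_drop (l k) z \<in> cyl L X}"
  let ?X = "\<lambda>k z. a k * (indicator (?E k) z - c)"
  have E: "?E k \<in> sets (iid p)" for k by (rule sets_drop_cyl)
  have ind: "indicator (?E k) \<in> borel_measurable (iid p)" for k by (rule borel_measurable_indicator[OF E])
  have mE: "measure (iid p) (?E k) = c" for k unfolding c_def by (rule measure_drop_cyl)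
  have "AE z in iid p. (\<lambda>N. (\<Sum>k<N. ?X k z) / real N) \<longlonglongrightarrow> 0"
  proof (rule averages_tendsto_0[where H=H])
    show "?X k \<in> borel_measurable (iid p)" for k
      by (intro borel_measurable_times borel_measurable_const borel_measurable_diff ind)
    show "\<bar>?X k z\<bar> \<le> 1" for k z
      unfolding abs_mult by (intro mult_le_one a) (use c in \<open>auto simp: indicator_def\<close>)
    fix i j assume ij: "i + H \<le> j"
    have AB: "measure (iid p) (?E i \<inter> ?E j) = c * c" unfolding c_def by (rule measure_drop_cyl_Int[OF l[OF ij]])
    have int: "integrable (iid p) (\<lambda>z. indicator (?E i \<inter> ?E j) z :: real)" "integrable (iid p) (\<lambda>z. indicator (?E k) z :: real)" for k
      by (intro integrable_real_indicator sets.Int E emeasure_finite[THEN order_neq_le_trans] top_greatest; simp add: less_top[symmetric])+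
    have "expectation (\<lambda>z. ?X i z * ?X j z) =
      expectation (\<lambda>z. a i * a j * (indicator (?E i \<inter> ?E j) z - c * indicator (?E i) z - c * indicator (?E j) z + c * c))"
      by (rule Bochner_Integration.integral_cong) (auto simp: indicator_def algebra_simps)
    also have "\<dots> = a i * a j * (measure (iid p) (?E i \<inter> ?E j) - c * measure (iid p) (?E i) - c * measure (iid p) (?E j) + c * c)"
      using int prob_space by simp
    also have "\<dots> = 0" unfolding AB mE by simp
    finally show "expectation (\<lambda>z. ?X i z * ?X j z) = 0" .
  qed
  then show ?thesis
  proof eventually_elim
    case (elim z)
    have "(\<lambda>N. (\<Sum>k<N. ?X k z) / real N + (\<Sum>k<N. a k) / real N * c) \<longlonglongrightarrow> 0 + A * c"
      by (intro tendsto_add elim tendsto_mult lim tendsto_const)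
    moreover have "(\<Sum>k<N. ?X k z) / real N + (\<Sum>k<N. a k) / real N * c = (\<Sum>k<N. a k * indicator (cyl L X) (seq_drop (l k) z)) / real N" for N
    proof -
      have "(\<Sum>k<N. ?X k z) + (\<Sum>k<N. a k) * c = (\<Sum>k<N. a k * indicator (cyl L X) (seq_drop (l k) z))"
        unfolding sum_distrib_right sum.distrib[symmetric] by (intro sum.cong) (auto simp: indicator_def algebra_simps)
      then show ?thesis by (simp add: add_divide_distrib[symmetric])
    qed
    ultimately show ?case by (simp add: c_def)
  qed
qed

theorem sampled_averages:
  fixes \<beta> t :: real
  assumes t: "typical_phase \<beta> t" and \<beta>: "0 < \<beta>"
  shows "AE z in iid p. (\<lambda>N. (\<Sum>k<N. indicator {a..<b} (frac (t + real k * \<beta>)) *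
      indicator (cyl L X) (seq_drop (nat \<lfloor>t + real k * \<beta>\<rfloor>) z)) / real N) \<longlonglongrightarrow>
    measure (phase_measure \<beta>) {a..<b} * (\<Prod>r<L. measure (measure_pmf p) (X r))"
proof -
  obtain H :: nat where H: "real L + 1 < real H * \<beta>" using reals_Archimedean3[OF \<beta>] by blast
  have l: "nat \<lfloor>t + real i * \<beta>\<rfloor> + L \<le> nat \<lfloor>t + real j * \<beta>\<rfloor>" if "i + H \<le> j" for i j
  proof -
    have "real H * \<beta> \<le> (real j - real i) * \<beta>" using that \<beta> by (intro mult_right_mono) auto
    then have "t + real i * \<beta> + real L \<le> t + real j * \<beta>" using H by (simp add: algebra_simps)
    then have "\<lfloor>t + real i * \<beta>\<rfloor> + int L \<le> \<lfloor>t + real j * \<beta>\<rfloor>"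
      by (metis floor_add_int floor_mono of_int_of_nat_eq)
    moreover have "0 \<le> \<lfloor>t + real i * \<beta>\<rfloor>" using t \<beta> by (simp add: typical_phase_def)
    ultimately show ?thesis by linarith
  qed
  from weighted_averages[where a="visits \<beta> t a b" and l="\<lambda>k. nat \<lfloor>t + real k * \<beta>\<rfloor>" and H=H and L=L and X=X and p=p,
      OF l _ rotation_equidistribution_interval[OF t]]
  show ?thesis by (simp add: visits_def)
qed

context digit_system
begin

section \<open>The skew product driving the chain\<close>

definition advance :: "real \<times> (nat \<Rightarrow> nat) \<Rightarrow> real \<times> (nat \<Rightarrow> nat)" where
  "advance y = (phase_step (fst y), seq_drop (split_count (fst y)) (snd y))"

definition driver :: "(real \<times> (nat \<Rightarrow> nat)) measure" where
  "driver = phase_measure \<alpha> \<Otimes>\<^sub>M iid P1"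

abbreviation driver_space :: "(real \<times> (nat \<Rightarrow> nat)) measure" where
  "driver_space \<equiv> borel \<Otimes>\<^sub>M seq_space"

lemma sets_driver: "sets driver = sets driver_space"
  unfolding driver_def by (intro sets_pair_measure_cong sets_iid sets_phase_measure)

lemma space_driver [simp]: "space driver = UNIV" by (simp add: driver_def space_pair_measure)

sublocale phase: prob_space "phase_measure \<alpha>" by (rule prob_space_phase_measure)
sublocale driver_pair: pair_prob_space "phase_measure \<alpha>" "iid P1" ..
sublocale driver: prob_space driver unfolding driver_def by (rule driver_pair.P.prob_space_axioms)

lemma advance_funpow:
  assumes "0 \<le> t" "t < 1"
  shows "(advance ^^ k) (t, \<omega>) = (frac (t + real k * \<alpha>), seq_drop (nat \<lfloor>t + real k * \<alpha>\<rfloor>) \<omega>)"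
proof (induction k)
  case 0
  have "\<lfloor>t\<rfloor> = 0" using assms by (simp add: floor_eq_iff)
  then show ?case by (simp add: frac_def)
next
  case (Suc k)
  let ?s = "t + real k * \<alpha>"
  have s0: "0 \<le> ?s" using assms \<alpha>_facts by simp
  have fs: "frac ?s + \<alpha> = (t + real (Suc k) * \<alpha>) - of_int \<lfloor>?s\<rfloor>" by (simp add: frac_def algebra_simps)
  have 1: "phase_step (frac ?s) = frac (t + real (Suc k) * \<alpha>)"
    unfolding phase_step_def fs by (rule frac_add_int) simp
  have "0 \<le> \<lfloor>?s\<rfloor>" "\<lfloor>?s\<rfloor> \<le> \<lfloor>t + real (Suc k) * \<alpha>\<rfloor>" using s0 \<alpha>_facts by (auto intro!: floor_mono simp: algebra_simps)
  moreover have "\<lfloor>frac ?s + \<alpha>\<rfloor> = \<lfloor>t + real (Suc k) * \<alpha>\<rfloor> - \<lfloor>?s\<rfloor>" unfolding fs by linarith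
  ultimately have 2: "nat \<lfloor>?s\<rfloor> + split_count (frac ?s) = nat \<lfloor>t + real (Suc k) * \<alpha>\<rfloor>"
    unfolding split_count_def by linarith
  have "(advance ^^ Suc k) (t, \<omega>) = (phase_step (frac ?s), \<lambda>r. \<omega> (nat \<lfloor>?s\<rfloor> + split_count (frac ?s) + r))"
    by (simp add: Suc.IH advance_def add.assoc)
  then show ?case unfolding 1 2 .
qed

lemma measurable_split_count: "split_count \<in> borel \<rightarrow>\<^sub>M count_space UNIV"
proof -
  have "(\<lambda>t::real. \<lfloor>t + \<alpha>\<rfloor>) \<in> borel \<rightarrow>\<^sub>M count_space UNIV"
    by measurable
  then show ?thesis unfolding split_count_def[abs_def] by (rule measurable_compose) simp
qed

lemma borel_measurable_phase_step: "phase_step \<in> borel_measurable borel"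
  unfolding phase_step_def frac_def by measurable

lemma measurable_advance: "advance \<in> driver_space \<rightarrow>\<^sub>M driver_space"
  unfolding advance_def[abs_def]
proof (rule measurable_Pair)
  show "(\<lambda>y. phase_step (fst y)) \<in> borel_measurable driver_space"
    by (rule measurable_compose[OF measurable_fst borel_measurable_phase_step])
  show "(\<lambda>y. seq_drop (split_count (fst y)) (snd y)) \<in> driver_space \<rightarrow>\<^sub>M seq_space"
  proof (rule measurable_PiM_single')
    fix r
    show "(\<lambda>y. snd y (split_count (fst y) + r)) \<in> driver_space \<rightarrow>\<^sub>M count_space UNIV"
      by (rule measurable_compose_countable[where f="\<lambda>i y. snd y (i + r)" and g="\<lambda>y. split_count (fst y)"])
         (rule measurable_compose[OF measurable_snd measurable_coordinate] measurable_compose[OF measurable_fst measurable_split_count])+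
  qed auto
qed

lemma measurable_advance_driver: "advance \<in> driver \<rightarrow>\<^sub>M driver"
  unfolding measurable_cong_sets[OF sets_driver sets_driver] by (rule measurable_advance)

lemma advance_preserves_driver: "distr driver driver advance = driver"
proof (rule measure_eqI)
  fix D assume "D \<in> sets (distr driver driver advance)"
  then have D: "D \<in> sets (phase_measure \<alpha> \<Otimes>\<^sub>M iid P1)" by (simp add: driver_def)
  have pre: "advance -` D \<in> sets (phase_measure \<alpha> \<Otimes>\<^sub>M iid P1)"
    using measurable_sets[OF measurable_advance_driver[unfolded driver_def] D] by (simp add: space_pair_measure)
  let ?h = "\<lambda>t. emeasure (iid P1) (Pair t -` D)"
  have h: "?h \<in> borel_measurable (phase_measure \<alpha>)" by (rule I1.measurable_emeasure_Pair[OF D])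
  have drop: "seq_drop k \<in> iid P1 \<rightarrow>\<^sub>M iid P1" for k
    by (simp only: measurable_cong_sets[OF sets_iid sets_iid] measurable_seq_drop)
  have "emeasure (distr driver driver advance) D = emeasure driver (advance -` D)"
    using emeasure_distr[OF measurable_advance_driver, of D] D by (simp add: driver_def space_pair_measure)
  also have "\<dots> = (\<integral>\<^sup>+t. emeasure (iid P1) (Pair t -` (advance -` D)) \<partial>phase_measure \<alpha>)"
    unfolding driver_def by (rule I1.emeasure_pair_measure_alt[OF pre])
  also have "\<dots> = (\<integral>\<^sup>+t. ?h (phase_step t) \<partial>phase_measure \<alpha>)"
  proof (rule nn_integral_cong)
    fix t
    have "Pair t -` (advance -` D) = seq_drop (split_count t) -` (Pair (phase_step t) -` D) \<inter> space (iid P1)"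
      by (auto simp: advance_def)
    then have "emeasure (iid P1) (Pair t -` (advance -` D)) = emeasure (distr (iid P1) (iid P1) (seq_drop (split_count t))) (Pair (phase_step t) -` D)"
      using emeasure_distr[OF drop sets_Pair1[OF D]] by simp
    then show "emeasure (iid P1) (Pair t -` (advance -` D)) = ?h (phase_step t)"
      by (simp only: distr_seq_drop_iid)
  qed
  also have "\<dots> = (\<integral>\<^sup>+t. ?h t \<partial>distr (phase_measure \<alpha>) (phase_measure \<alpha>) phase_step)"
  proof (rule nn_integral_distr[symmetric])
    show "?h \<in> borel_measurable (distr (phase_measure \<alpha>) (phase_measure \<alpha>) phase_step)" using h by simp
    show "phase_step \<in> phase_measure \<alpha> \<rightarrow>\<^sub>M phase_measure \<alpha>"
      unfolding measurable_cong_sets[OF sets_phase_measure sets_phase_measure] by (rule borel_measurable_phase_step)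
  qed
  also have "\<dots> = (\<integral>\<^sup>+t. ?h t \<partial>phase_measure \<alpha>)"
    using rotation_preserves_phase_measure[of \<alpha>] by (simp add: phase_step_def[abs_def])
  also have "\<dots> = emeasure driver D"
    unfolding driver_def by (rule I1.emeasure_pair_measure_alt[OF D, symmetric])
  finally show "emeasure (distr driver driver advance) D = emeasure driver D" .
qed simp

end

context digit_system
begin

section \<open>The states of the chain\<close>

lemma right_closed_digit: "right_closed \<Longrightarrow> i \<in> set_pmf P1 \<Longrightarrow> i = m - 1"
proof -
  assume rc: "right_closed" and i: "i \<in> set_pmf P1"
  have "AE x in measure_pmf P. x \<in> {x. fst x = m - 1}"
    using rc unfolding right_closed_def by (subst (asm) measure_pmf.prob_eq_1) auto
  then show ?thesis using i by (auto simp: AE_measure_pmf_iff P1_def)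
qed

lemma top_closed_digit: "top_closed \<Longrightarrow> i \<in> set_pmf P1 \<Longrightarrow> j \<in> set_pmf (K i) \<Longrightarrow> j = n - 1"
proof -
  assume tc: "top_closed" and i: "i \<in> set_pmf P1" and j: "j \<in> set_pmf (K i)"
  have "AE x in measure_pmf P. x \<in> {x. snd x = n - 1}"
    using tc unfolding top_closed_def by (subst (asm) measure_pmf.prob_eq_1) auto
  moreover have "(i, j) \<in> set_pmf P" using i j by (simp add: set_pmf_iff pmf_P)
  ultimately show ?thesis by (auto simp: AE_measure_pmf_iff)
qed

abbreviation box_law :: "real \<times> (nat \<Rightarrow> nat) \<Rightarrow> (real \<times> real) measure" where
  "box_law y \<equiv> limit_law (fst y) (snd y)"

definition admissible :: "nat \<Rightarrow> nat \<Rightarrow> real \<times> (nat \<Rightarrow> nat) \<Rightarrow> bool" where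
  "admissible a b y \<longleftrightarrow> 0 \<le> fst y \<and> fst y < 1 \<and>
     emeasure (box_law (advance y)) (box_of (canon (phase_step (fst y)))) = 1 \<and>
     a \<in> set_pmf P1 \<and> snd y 0 \<in> set_pmf P1 \<and> b \<in> set_pmf (K (snd y 0))"

definition piece :: "nat \<Rightarrow> nat \<Rightarrow> real \<times> (nat \<Rightarrow> nat) \<Rightarrow> cp_state" where
  "piece a b y = (if admissible a b y then (box_of (sub_box m n (canon (fst y)) a b), box_law (advance y))
     else (box_of (canon 0), return borel (0, 0)))"

definition emit :: "real \<times> (nat \<Rightarrow> nat) \<Rightarrow> nat \<times> (nat \<Rightarrow> nat) \<Rightarrow> cp_state" where
  "emit y e = piece (fst e) (snd e (snd y 0)) y"

lemma canon_state: "0 \<le> t \<Longrightarrow> t < 1 \<Longrightarrow> normal_box (box_of (canon t)) = box_of (canon t)"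
  using asq_sides_pos[OF asq_sides_canon] by (simp add: normal_box_box_of norm_sides_canon)

lemma default_state: "(box_of (canon 0), return borel (0, 0)) \<in> space (cp_space (asq_boxes n))"
proof -
  have "(0, 0) \<in> box_of (canon 0)" using n2 by (simp add: box_of_def canon_def)
  then show ?thesis
    unfolding space_asq_space[OF m2 mn] using asq_sides_canon[of 0] canon_state[of 0]
    by (auto simp: asq_boxes_eq[OF n2] measures_on_def prob_measures_euclidean prob_space_return)
qed

lemma admissible_digits:
  assumes "admissible a b y"
  shows "a < m" "b < n" "right_closed \<Longrightarrow> a = m - 1" "top_closed \<Longrightarrow> b = n - 1"
  using assms P1_digits K_digits right_closed_digit top_closed_digit by (auto simp: admissible_def)

lemma piece_sides:
  assumes "admissible a b y"
  shows "asq_sides n (sub_box m n (canon (fst y)) a b)"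
    "norm_sides (sub_box m n (canon (fst y)) a b) = canon (phase_step (fst y))"
proof -
  have t: "0 \<le> fst y" "fst y < 1" using assms by (auto simp: admissible_def)
  show "asq_sides n (sub_box m n (canon (fst y)) a b)" by (rule asq_sides_sub_box[OF m2 mn asq_sides_canon[OF t]])
  show "norm_sides (sub_box m n (canon (fst y)) a b) = canon (phase_step (fst y))"
    using admissible_digits[OF assms] by (intro norm_sides_sub_canon[OF t])
qed

lemma piece_in_space: "piece a b y \<in> space (cp_space (asq_boxes n))"
proof (cases "admissible a b y")
  case True
  note s = piece_sides[OF True]
  have "normal_box (box_of (sub_box m n (canon (fst y)) a b)) = box_of (canon (phase_step (fst y)))"
    using asq_sides_pos[OF s(1)] s(2) by (simp add: normal_box_box_of)
  then show ?thesis
    unfolding space_asq_space[OF m2 mn] piece_def using True s(1) limit_law_prob_measures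
    by (auto simp: asq_boxes_eq[OF n2] measures_on_def admissible_def)
next
  case False
  then show ?thesis using default_state by (simp add: piece_def)
qed

lemma measurable_box_law_advance: "(\<lambda>y. box_law (advance y)) \<in> driver_space \<rightarrow>\<^sub>M prob_algebra borel"
  by (rule measurable_compose[OF measurable_advance measurable_limit_law])

lemma measurable_canon: "canon \<in> borel \<rightarrow>\<^sub>M side_space \<Otimes>\<^sub>M side_space"
  unfolding canon_def[abs_def] by (intro measurable_Pair measurable_const powr_real_measurable) auto

lemma sets_admissible: "{y \<in> space driver_space. admissible a b y} \<in> sets driver_space"
proof -
  have c: "(\<lambda>y. canon (phase_step (fst y))) \<in> driver_space \<rightarrow>\<^sub>M side_space \<Otimes>\<^sub>M side_space"
    by (rule measurable_compose[OF measurable_compose[OF measurable_fst borel_measurable_phase_step] measurable_canon])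
  have e: "(\<lambda>y. emeasure (box_law (advance y)) (box_of (canon (phase_step (fst y))))) \<in> borel_measurable driver_space"
    using measurable_emeasure_box[OF m2 mn measurable_box_law_advance, of "\<lambda>y z. z \<in> box_of (canon (phase_step (fst y)))"]
      pred_mem_box_of[OF measurable_compose[OF measurable_fst c] measurable_snd] by simp
  have f: "(\<lambda>y. fst y) \<in> borel_measurable driver_space" by (rule measurable_fst)
  have s: "(\<lambda>y. snd y 0) \<in> driver_space \<rightarrow>\<^sub>M count_space UNIV" by (rule measurable_compose[OF measurable_snd measurable_coordinate])
  have p: "Measurable.pred driver_space (\<lambda>y. snd y 0 \<in> set_pmf P1 \<and> b \<in> set_pmf (K (snd y 0)))"
    using measurable_compose[OF s, of "\<lambda>i. i \<in> set_pmf P1 \<and> b \<in> set_pmf (K i)" "count_space UNIV"] by simp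
  have "Measurable.pred driver_space (\<lambda>y. (0 \<le> fst y \<and> fst y < 1) \<and>
     emeasure (box_law (advance y)) (box_of (canon (phase_step (fst y)))) = 1 \<and>
     a \<in> set_pmf P1 \<and> snd y 0 \<in> set_pmf P1 \<and> b \<in> set_pmf (K (snd y 0)))"
  proof (intro pred_intros_logic(3))
    show "Measurable.pred driver_space (\<lambda>y. 0 \<le> fst y)" "Measurable.pred driver_space (\<lambda>y. fst y < 1)"
      using f by measurable
    show "Measurable.pred driver_space (\<lambda>y. emeasure (box_law (advance y)) (box_of (canon (phase_step (fst y)))) = 1)"
      using e by measurable
    show "Measurable.pred driver_space (\<lambda>y. a \<in> set_pmf P1)" by simp
    show "Measurable.pred driver_space (\<lambda>y. snd y 0 \<in> set_pmf P1)"
      using measurable_compose[OF s, of "\<lambda>i. i \<in> set_pmf P1" "count_space UNIV"] by simp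
    show "Measurable.pred driver_space (\<lambda>y. b \<in> set_pmf (K (snd y 0)))"
      using measurable_compose[OF s, of "\<lambda>i. b \<in> set_pmf (K i)" "count_space UNIV"] by simp
  qed
  then show ?thesis unfolding pred_def admissible_def by (simp only: conj_assoc)
qed

lemma measurable_piece: "piece a b \<in> driver_space \<rightarrow>\<^sub>M cp_space (asq_boxes n)"
proof -
  let ?R = "restrict_space driver_space {y. admissible a b y}"
  have "(\<lambda>y. (box_of (sub_box m n (canon (fst y)) a b), box_law (advance y))) \<in> ?R \<rightarrow>\<^sub>M cp_space (asq_boxes n)"
  proof (rule measurable_into_asq_space[OF m2 mn])
    fix y assume "y \<in> space ?R"
    then have y: "admissible a b y" by (simp add: space_restrict_space)
    then show "(box_of (sub_box m n (canon (fst y)) a b), box_law (advance y)) \<in> space (cp_space (asq_boxes n))"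
      using piece_in_space[of a b y] by (simp add: piece_def)
  next
    have "(\<lambda>y. sub_box m n (canon (fst y)) a b) \<in> ?R \<rightarrow>\<^sub>M side_space \<Otimes>\<^sub>M side_space"
      by (rule measurable_restrict_space1, rule measurable_sub_box, rule measurable_compose[OF measurable_fst measurable_canon])
    moreover have "code (fst (box_of (sub_box m n (canon (fst y)) a b), box_law (advance y))) = sub_box m n (canon (fst y)) a b"
      if "y \<in> space ?R" for y
      using piece_sides(1) that by (simp add: code_box_of[OF m2 mn] space_restrict_space)
    ultimately show "(\<lambda>y. code (fst (box_of (sub_box m n (canon (fst y)) a b), box_law (advance y)))) \<in> ?R \<rightarrow>\<^sub>M side_space \<Otimes>\<^sub>M side_space"
      by (simp cong: measurable_cong)
    show "(\<lambda>y. snd (box_of (sub_box m n (canon (fst y)) a b), box_law (advance y))) \<in> ?R \<rightarrow>\<^sub>M prob_algebra borel"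
      using measurable_restrict_space1[OF measurable_box_law_advance] by simp
  qed
  then show ?thesis
    unfolding piece_def[abs_def] measurable_If_restrict_space_iff[OF sets_admissible]
    using default_state by simp
qed

lemma measurable_emit:
  assumes Y: "Y \<in> M \<rightarrow>\<^sub>M driver_space" and E: "E \<in> M \<rightarrow>\<^sub>M count_space UNIV"
  shows "(\<lambda>x. emit (Y x) (E x)) \<in> M \<rightarrow>\<^sub>M cp_space (asq_boxes n)"
proof -
  have a: "(\<lambda>x. fst (E x)) \<in> M \<rightarrow>\<^sub>M count_space UNIV" by (rule measurable_compose[OF E]) simp
  have b: "(\<lambda>x. snd (E x) (snd (Y x) 0)) \<in> M \<rightarrow>\<^sub>M count_space UNIV"
  proof (rule measurable_compose_countable[where f="\<lambda>i x. snd (E x) i" and g="\<lambda>x. snd (Y x) 0"])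
    show "(\<lambda>x. snd (E x) i) \<in> M \<rightarrow>\<^sub>M count_space UNIV" for i by (rule measurable_compose[OF E]) simp
    show "(\<lambda>x. snd (Y x) 0) \<in> M \<rightarrow>\<^sub>M count_space UNIV"
      by (rule measurable_compose[OF Y measurable_compose[OF measurable_snd measurable_coordinate]])
  qed
  show ?thesis unfolding emit_def
  proof (rule measurable_compose_countable[where f="\<lambda>i x. piece i (snd (E x) (snd (Y x) 0)) (Y x)" and g="\<lambda>x. fst (E x)", OF _ a])
    fix i
    show "(\<lambda>x. piece i (snd (E x) (snd (Y x) 0)) (Y x)) \<in> M \<rightarrow>\<^sub>M cp_space (asq_boxes n)"
      by (rule measurable_compose_countable[where f="\<lambda>j x. piece i j (Y x)" and g="\<lambda>x. snd (E x) (snd (Y x) 0)", OF _ b])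
         (rule measurable_compose[OF Y measurable_piece])
  qed
qed

section \<open>The transition kernel along the skew product\<close>

definition noise :: "(nat \<times> (nat \<Rightarrow> nat)) pmf" where "noise = pair_pmf P1 G"

definition regular_driver :: "real \<times> (nat \<Rightarrow> nat) \<Rightarrow> bool" where
  "regular_driver y \<longleftrightarrow> 0 \<le> fst y \<and> fst y < 1 \<and> (\<forall>j. fibre_regular (seq_drop j (snd y)) \<and> snd y j \<in> set_pmf P1)"

lemma regular_driver_advance: "regular_driver y \<Longrightarrow> regular_driver (advance y)"
  unfolding regular_driver_def advance_def using phase_step_range by (simp add: add.assoc[symmetric])

lemma regular_driver_funpow: "regular_driver y \<Longrightarrow> regular_driver ((advance ^^ k) y)"
  by (induction k) (auto intro: regular_driver_advance)

lemma AE_regular_driver: "AE y in driver. regular_driver y"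
proof -
  have 1: "AE \<omega> in iid P1. \<forall>j. fibre_regular (seq_drop j \<omega>) \<and> \<omega> j \<in> set_pmf P1"
    using AE_fibre_regular_drop AE_iid_set_pmf by eventually_elim blast
  have 2: "AE t in phase_measure \<alpha>. 0 \<le> t \<and> t < 1"
    using AE_typical_phase by eventually_elim (simp add: typical_phase_def)
  obtain N1 where N1: "N1 \<in> null_sets (iid P1)" "{\<omega>. \<not> (\<forall>j. fibre_regular (seq_drop j \<omega>) \<and> \<omega> j \<in> set_pmf P1)} \<subseteq> N1"
    using 1 by (auto simp: eventually_ae_filter)
  obtain N2 where N2: "N2 \<in> null_sets (phase_measure \<alpha>)" "{t. \<not> (0 \<le> t \<and> t < 1)} \<subseteq> N2"
    using 2 by (auto simp: eventually_ae_filter)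
  have "N2 \<times> UNIV \<in> null_sets driver" "UNIV \<times> N1 \<in> null_sets driver"
    unfolding driver_def
    using N1(1) N2(1) sets.top[of "phase_measure \<alpha>"] sets.top[of "iid P1"]
    by (auto intro!: null_setsI simp: I1.emeasure_pair_measure_Times null_setsD1 null_setsD2 simp del: sets_phase_measure)
  then have "(N2 \<times> UNIV) \<union> (UNIV \<times> N1) \<in> null_sets driver" by (rule null_sets.Un)
  then show ?thesis
  proof (rule AE_I')
    show "{y \<in> space driver. \<not> regular_driver y} \<subseteq> (N2 \<times> UNIV) \<union> (UNIV \<times> N1)"
    proof
      fix y assume "y \<in> {y \<in> space driver. \<not> regular_driver y}"
      then have "snd y \<in> N1 \<or> fst y \<in> N2" using N1(2) N2(2) unfolding regular_driver_def by blast
      then show "y \<in> (N2 \<times> UNIV) \<union> (UNIV \<times> N1)" by (cases y) auto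
    qed
  qed
qed

lemma admissible_of_regular:
  assumes y: "regular_driver y" and a: "a \<in> set_pmf P1" and b: "b \<in> set_pmf (K (snd y 0))"
  shows "admissible a b y"
proof -
  have "fibre_regular (snd (advance y))" using y by (simp add: regular_driver_def advance_def)
  from limit_law_canon[OF this] have "emeasure (box_law (advance y)) (box_of (canon (phase_step (fst y)))) = 1"
    by (simp add: advance_def)
  then show ?thesis using y a b by (simp add: admissible_def regular_driver_def)
qed

lemma noise_digits: "e \<in> set_pmf noise \<Longrightarrow> i < m \<Longrightarrow> fst e \<in> set_pmf P1 \<and> snd e i \<in> set_pmf (K i)"
  unfolding noise_def G_def by (auto simp: set_Pi_pmf PiE_dflt_def)

lemma emeasure_emit:
  assumes y: "regular_driver y"
  shows "emeasure (measure_pmf noise) {e. emit y e \<in> C} =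
    (\<Sum>(k, l)\<in>{..<m} \<times> {..<n}. ennreal (pmf P1 k * pmf (K (snd y 0)) l) *
      indicator C (box_of (sub_box m n (canon (fst y)) k l), box_law (advance y)))"
proof -
  let ?i = "snd y 0"
  have i: "?i < m" using y P1_digits by (simp add: regular_driver_def)
  let ?f = "apsnd (\<lambda>g. g ?i) :: nat \<times> (nat \<Rightarrow> nat) \<Rightarrow> nat \<times> nat"
  have "map_pmf ?f noise = pair_pmf P1 (map_pmf (\<lambda>g. g ?i) G)"
    unfolding noise_def by (rule pair_map_pmf2[symmetric])
  also have "map_pmf (\<lambda>g. g ?i) G = K ?i" unfolding G_def using i by (subst Pi_pmf_component) auto
  finally have map: "map_pmf ?f noise = pair_pmf P1 (K ?i)" .
  let ?S = "{(k, l). piece k l y \<in> C}"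
  have "{e. emit y e \<in> C} = ?f -` ?S" by (auto simp: emit_def)
  then have "emeasure (measure_pmf noise) {e. emit y e \<in> C} = emeasure (measure_pmf (map_pmf ?f noise)) ?S"
    by simp
  also have "\<dots> = (\<integral>\<^sup>+p. indicator ?S p \<partial>measure_pmf (pair_pmf P1 (K ?i)))" unfolding map by simp
  also have "\<dots> = (\<Sum>p\<in>{..<m} \<times> {..<n}. indicator ?S p * ennreal (pmf (pair_pmf P1 (K ?i)) p))"
    by (rule nn_integral_measure_pmf_support) (use P1_digits K_digits in auto)
  also have "\<dots> = (\<Sum>(k, l)\<in>{..<m} \<times> {..<n}. ennreal (pmf P1 k * pmf (K ?i) l) *
      indicator C (box_of (sub_box m n (canon (fst y)) k l), box_law (advance y)))"
  proof (intro sum.cong refl)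
    fix p assume "p \<in> {..<m} \<times> {..<n}"
    obtain k l where p: "p = (k, l)" by (cases p)
    show "indicator ?S p * ennreal (pmf (pair_pmf P1 (K ?i)) p) = (case p of (k, l) \<Rightarrow> ennreal (pmf P1 k * pmf (K ?i) l) *
      indicator C (box_of (sub_box m n (canon (fst y)) k l), box_law (advance y)))"
    proof (cases "k \<in> set_pmf P1 \<and> l \<in> set_pmf (K ?i)")
      case True
      then have "piece k l y = (box_of (sub_box m n (canon (fst y)) k l), box_law (advance y))"
        using admissible_of_regular[OF y] by (simp add: piece_def)
      then show ?thesis by (simp add: p pmf_pair indicator_def)
    next
      case False
      then have 0: "pmf P1 k * pmf (K ?i) l = 0" by (auto simp: set_pmf_iff)
      show ?thesis unfolding p prod.case pmf_pair 0 by simp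
    qed
  qed
  finally show ?thesis .
qed

lemma sum_K: "i < m \<Longrightarrow> (\<Sum>l<n. pmf (K i) l) = 1"
proof -
  have "(\<Sum>l<n. pmf (K i) l) = measure (measure_pmf (K i)) {..<n}" by (simp add: measure_measure_pmf_finite)
  also have "\<dots> = 1" by (subst measure_pmf.prob_eq_1) (auto simp: AE_measure_pmf_iff intro: K_digits)
  finally show ?thesis .
qed

lemma kernel_of_emit:
  assumes y: "regular_driver y" and e: "e \<in> set_pmf noise" and C: "C \<in> sets (cp_space (asq_boxes n))"
  shows "emeasure (cp_kernel (asq_boxes n) (asq_operator m n) (emit y e)) C =
    emeasure (measure_pmf noise) {e'. emit (advance y) e' \<in> C}"
proof -
  let ?y = "advance y" and ?x = "emit y e"
  let ?i = "snd ?y 0"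
  have y': "regular_driver ?y" by (rule regular_driver_advance[OF y])
  have i0: "snd y 0 < m" using y P1_digits by (simp add: regular_driver_def)
  have t: "0 \<le> fst ?y" "fst ?y < 1" and i: "?i < m" using y' P1_digits by (auto simp: regular_driver_def)
  have fr: "fibre_regular (snd ?y)" using y'[unfolded regular_driver_def, THEN conjunct2, THEN conjunct2, THEN spec, of 0] by simp
  let ?a = "fst e" and ?b = "snd e (snd y 0)"
  have adm: "admissible ?a ?b y" using noise_digits[OF e i0] by (intro admissible_of_regular[OF y]) auto
  have x: "?x = (box_of (sub_box m n (canon (fst y)) ?a ?b), box_law ?y)" using adm by (simp add: emit_def piece_def)
  have st: "state_sides ?x = canon (fst ?y)"
    unfolding x using piece_sides[OF adm] by (simp add: code_box_of[OF m2 mn] advance_def)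
  let ?w = "\<lambda>k l. ennreal (pmf P1 k * (if split_count (fst ?y) = 1 then pmf (K ?i) l else 1))"
  let ?J = "\<lambda>k l. indicator C (box_of (sub_box m n (canon (fst ?y)) k l), box_law (advance ?y)) :: ennreal"
  have kt: "kernel_term m n C k l ?x = (if (k, l) \<in> sub_indices m n (canon (fst ?y)) then ?w k l * ?J k l else 0)"
    if "k < m" "l < n" for k l
  proof -
    note lp = limit_law_piece[OF t fr that refl]
    have sx: "snd ?x = limit_law (fst ?y) (snd ?y)" by (simp add: x)
    have r: "rescale (limit_law (fst ?y) (snd ?y)) (box_of (sub_box m n (canon (fst ?y)) k l)) = box_law (advance ?y)"
      if "?w k l \<noteq> 0" using lp(2)[OF that] by (simp add: advance_def)
    have gen: "(if A \<and> W \<noteq> 0 then W * indicator C (B, R) else 0) = (if A then W * indicator C (B, R') else (0 :: ennreal))"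
      if "W \<noteq> 0 \<Longrightarrow> R = R'" for A W B R R' using that by auto
    show ?thesis
      unfolding kernel_term_def[OF m2 mn] st sx lp(1) by (rule gen) (rule r)
  qed
  have xs: "?x \<in> space (cp_space (asq_boxes n))" by (simp add: emit_def piece_in_space)
  have "emeasure (cp_kernel (asq_boxes n) (asq_operator m n) ?x) C = (\<Sum>(k, l)\<in>{..<m} \<times> {..<n}. kernel_term m n C k l ?x)"
    by (rule emeasure_cp_kernel[OF m2 mn xs C])
  also have "\<dots> = (\<Sum>(k, l)\<in>{..<m} \<times> {..<n}. if (k, l) \<in> sub_indices m n (canon (fst ?y)) then ?w k l * ?J k l else 0)"
    by (intro sum.cong refl) (use kt in auto)
  also have "\<dots> = (\<Sum>(k, l)\<in>{..<m} \<times> {..<n}. ennreal (pmf P1 k * pmf (K ?i) l) * ?J k l)"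
  proof (cases "split_count (fst ?y) = 1")
    case True
    then have "splits m n (canon (fst ?y))" using splits_canon[OF t] by simp
    then show ?thesis using True by (intro sum.cong refl) (auto simp: sub_indices_def)
  next
    case False
    then have ns: "\<not> splits m n (canon (fst ?y))" using splits_canon[OF t] by simp
    have "(\<Sum>(k, l)\<in>{..<m} \<times> {..<n}. if (k, l) \<in> sub_indices m n (canon (fst ?y)) then ?w k l * ?J k l else 0) =
      (\<Sum>k<m. \<Sum>l<n. if l = 0 then ennreal (pmf P1 k) * ?J k 0 else 0)"
      unfolding sum.cartesian_product using False ns by (intro sum.cong refl) (auto simp: sub_indices_def)
    also have "\<dots> = (\<Sum>k<m. ennreal (pmf P1 k) * ?J k 0)"
      using n2 by (intro sum.cong refl) (simp add: sum.delta)
    also have "\<dots> = (\<Sum>k<m. \<Sum>l<n. ennreal (pmf P1 k * pmf (K ?i) l) * ?J k 0)"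
    proof (intro sum.cong refl)
      fix k
      have "(\<Sum>l<n. ennreal (pmf P1 k * pmf (K ?i) l)) = ennreal (pmf P1 k * (\<Sum>l<n. pmf (K ?i) l))"
        by (simp add: sum_ennreal sum_distrib_left)
      then show "ennreal (pmf P1 k) * ?J k 0 = (\<Sum>l<n. ennreal (pmf P1 k * pmf (K ?i) l) * ?J k 0)"
        unfolding sum_K[OF i] by (simp add: sum_distrib_right[symmetric])
    qed
    also have "\<dots> = (\<Sum>(k, l)\<in>{..<m} \<times> {..<n}. ennreal (pmf P1 k * pmf (K ?i) l) * ?J k l)"
      unfolding sum.cartesian_product by (intro sum.cong refl) (auto simp: sub_box_def ns)
    finally show ?thesis .
  qed
  also have "\<dots> = emeasure (measure_pmf noise) {e'. emit ?y e' \<in> C}" by (rule emeasure_emit[OF y', symmetric])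
  finally show ?thesis .
qed

end

section \<open>The chain\<close>

lemma sets_LIMSEQ:
  fixes f :: "nat \<Rightarrow> 'a \<Rightarrow> real"
  assumes f: "\<And>N. f N \<in> borel_measurable M"
  shows "{x \<in> space M. (\<lambda>N. f N x) \<longlonglongrightarrow> A} \<in> sets M"
proof -
  have eq: "(\<lambda>N. f N x) \<longlonglongrightarrow> A \<longleftrightarrow> (\<forall>j. \<exists>N0. \<forall>N. N0 \<le> N \<longrightarrow> \<bar>f N x - A\<bar> < inverse (real (Suc j)))" for x
  proof
    assume "(\<lambda>N. f N x) \<longlonglongrightarrow> A"
    then show "\<forall>j. \<exists>N0. \<forall>N. N0 \<le> N \<longrightarrow> \<bar>f N x - A\<bar> < inverse (real (Suc j))"
      by (simp add: lim_sequentially dist_real_def)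
  next
    assume *: "\<forall>j. \<exists>N0. \<forall>N. N0 \<le> N \<longrightarrow> \<bar>f N x - A\<bar> < inverse (real (Suc j))"
    show "(\<lambda>N. f N x) \<longlonglongrightarrow> A"
      unfolding lim_sequentially dist_real_def
    proof (intro allI impI)
      fix r :: real assume "0 < r"
      then obtain j where "inverse (real (Suc j)) < r" using reals_Archimedean by blast
      then show "\<exists>N0. \<forall>N\<ge>N0. \<bar>f N x - A\<bar> < r" using *[THEN spec, of j] by (meson less_trans)
    qed
  qed
  note [measurable] = f
  have "Measurable.pred M (\<lambda>x. \<forall>j. \<exists>N0. \<forall>N. N0 \<le> N \<longrightarrow> \<bar>f N x - A\<bar> < inverse (real (Suc j)))"
    by measurable
  then show ?thesis unfolding pred_def eq .
qed

lemma Int_stable_Times: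
  assumes "Int_stable E" "Int_stable F"
  shows "Int_stable {a \<times> b | a b. a \<in> E \<and> b \<in> F}"
proof (rule Int_stableI)
  fix p q assume "p \<in> {a \<times> b | a b. a \<in> E \<and> b \<in> F}" "q \<in> {a \<times> b | a b. a \<in> E \<and> b \<in> F}"
  then obtain a b c d where "p = a \<times> b" "q = c \<times> d" "a \<in> E" "b \<in> F" "c \<in> E" "d \<in> F" by auto
  moreover have "a \<inter> c \<in> E" "b \<inter> d \<in> F" using assms calculation by (auto dest: Int_stableD)
  ultimately show "p \<inter> q \<in> {a \<times> b | a b. a \<in> E \<and> b \<in> F}" by (auto simp: Times_Int_Times)
qed

context digit_system
begin

definition base :: "((real \<times> (nat \<Rightarrow> nat)) \<times> (nat \<Rightarrow> nat \<times> (nat \<Rightarrow> nat))) measure" where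
  "base = driver \<Otimes>\<^sub>M iid noise"

definition advance_base where
  "advance_base x = (advance (fst x), seq_drop 1 (snd x))" for x :: "(real \<times> (nat \<Rightarrow> nat)) \<times> (nat \<Rightarrow> nat \<times> (nat \<Rightarrow> nat))"

definition path :: "(real \<times> (nat \<Rightarrow> nat)) \<times> (nat \<Rightarrow> nat \<times> (nat \<Rightarrow> nat)) \<Rightarrow> nat \<Rightarrow> cp_state" where
  "path x k = emit ((advance ^^ k) (fst x)) (snd x k)"

abbreviation path_space :: "(nat \<Rightarrow> cp_state) measure" where
  "path_space \<equiv> (\<Pi>\<^sub>M k\<in>UNIV. cp_space (asq_boxes n))"

definition chain :: "(nat \<Rightarrow> cp_state) measure" where "chain = distr base path_space path"

sublocale IN: prob_space "iid noise" by (rule prob_space_iid)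
sublocale base_pair: pair_prob_space driver "iid noise" ..
sublocale base: prob_space base unfolding base_def by (rule base_pair.P.prob_space_axioms)

lemma space_base [simp]: "space base = UNIV" by (simp add: base_def space_pair_measure)

lemma measurable_coordinate_iid: "(\<lambda>z. z r) \<in> iid p \<rightarrow>\<^sub>M count_space UNIV"
  unfolding measurable_cong_sets[OF sets_iid refl] by (rule measurable_coordinate)

lemma measurable_advance_funpow: "advance ^^ k \<in> driver_space \<rightarrow>\<^sub>M driver_space"
proof (induction k)
  case (Suc k)
  show ?case using measurable_compose[OF Suc measurable_advance] by (simp add: comp_def)
qed (simp add: id_def)

lemma measurable_path_component: "(\<lambda>x. path x k) \<in> base \<rightarrow>\<^sub>M cp_space (asq_boxes n)"
  unfolding path_def base_def
proof (rule measurable_emit)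
  have "advance ^^ k \<in> driver \<rightarrow>\<^sub>M driver_space"
    unfolding measurable_cong_sets[OF sets_driver refl] by (rule measurable_advance_funpow)
  then show "(\<lambda>x. (advance ^^ k) (fst x)) \<in> driver \<Otimes>\<^sub>M iid noise \<rightarrow>\<^sub>M driver_space"
    by (rule measurable_compose[OF measurable_fst])
  show "(\<lambda>x. snd x k) \<in> driver \<Otimes>\<^sub>M iid noise \<rightarrow>\<^sub>M count_space UNIV"
    by (rule measurable_compose[OF measurable_snd measurable_coordinate_iid])
qed

lemma measurable_path: "path \<in> base \<rightarrow>\<^sub>M path_space"
  by (rule measurable_PiM_single') (use measurable_path_component in \<open>auto intro: measurable_space\<close>)

lemma path_advance_base: "path (advance_base x) = shift (path x)"
  by (rule ext) (simp add: path_def advance_base_def shift_def funpow_swap1)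

lemma measurable_advance_base: "advance_base \<in> base \<rightarrow>\<^sub>M base"
  unfolding advance_base_def[abs_def] base_def
proof (rule measurable_Pair)
  show "(\<lambda>x. advance (fst x)) \<in> driver \<Otimes>\<^sub>M iid noise \<rightarrow>\<^sub>M driver"
    by (rule measurable_compose[OF measurable_fst measurable_advance_driver])
  have "seq_drop 1 \<in> iid noise \<rightarrow>\<^sub>M iid noise"
    by (simp only: measurable_cong_sets[OF sets_iid sets_iid] measurable_seq_drop)
  then show "(\<lambda>x. seq_drop 1 (snd x)) \<in> driver \<Otimes>\<^sub>M iid noise \<rightarrow>\<^sub>M iid noise"
    by (rule measurable_compose[OF measurable_snd])
qed

lemma advance_base_preserves: "distr base base advance_base = base"
proof -
  have d: "seq_drop 1 \<in> iid noise \<rightarrow>\<^sub>M iid noise"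
    by (simp only: measurable_cong_sets[OF sets_iid sets_iid] measurable_seq_drop)
  have "distr driver driver advance \<Otimes>\<^sub>M distr (iid noise) (iid noise) (seq_drop 1) =
      distr (driver \<Otimes>\<^sub>M iid noise) (driver \<Otimes>\<^sub>M iid noise) (\<lambda>(y, e). (advance y, seq_drop 1 e))"
    by (rule pair_measure_distr[OF measurable_advance_driver d]) (simp only: distr_seq_drop_iid IN.sigma_finite_measure_axioms)
  then show ?thesis
    unfolding advance_preserves_driver distr_seq_drop_iid
    by (simp add: base_def advance_base_def[abs_def] split_beta')
qed

lemma measurable_shift: "shift \<in> path_space \<rightarrow>\<^sub>M path_space"
  unfolding shift_def[abs_def]
  by (rule measurable_PiM_single') (auto intro: measurable_component_singleton simp: space_PiM)

lemma prob_space_chain: "prob_space chain"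
  unfolding chain_def by (rule base.prob_space_distr[OF measurable_path])

lemma sets_chain: "sets chain = sets path_space" by (simp add: chain_def)

lemma chain_stationary: "distr chain chain shift = chain"
proof -
  have "distr chain chain shift = distr chain path_space shift"
    by (rule distr_cong) (simp_all add: sets_chain)
  also have "\<dots> = distr base path_space (shift \<circ> path)"
    unfolding chain_def by (rule distr_distr[OF measurable_shift measurable_path])
  also have "shift \<circ> path = path \<circ> advance_base" by (auto simp: path_advance_base)
  also have "distr base path_space (path \<circ> advance_base) = distr (distr base base advance_base) path_space path"
    by (rule distr_distr[OF measurable_path measurable_advance_base, symmetric])
  finally show ?thesis unfolding advance_base_preserves by (simp only: chain_def)
qed

lemma AE_base_fst: "AE y in driver. R y \<Longrightarrow> AE x in base. R (fst x)"
proof -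
  assume "AE y in driver. R y"
  then obtain N where N: "N \<in> null_sets driver" "{y. \<not> R y} \<subseteq> N" by (auto simp: eventually_ae_filter)
  have "N \<times> UNIV \<in> null_sets base"
    unfolding base_def using N(1) sets.top[of "iid noise"]
    by (auto intro!: null_setsI simp: IN.emeasure_pair_measure_Times null_setsD1 null_setsD2)
  then show ?thesis by (rule AE_I') (use N(2) in auto)
qed

lemma AE_base_snd: "AE e in iid noise. R e \<Longrightarrow> AE x in base. R (snd x)"
proof -
  assume "AE e in iid noise. R e"
  then obtain N where N: "N \<in> null_sets (iid noise)" "{e. \<not> R e} \<subseteq> N" by (auto simp: eventually_ae_filter)
  have "UNIV \<times> N \<in> null_sets base"
    unfolding base_def using N(1) sets.top[of driver]
    by (auto intro!: null_setsI simp: IN.emeasure_pair_measure_Times null_setsD1 null_setsD2)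
  then show ?thesis by (rule AE_I') (use N(2) in auto)
qed

lemma measurable_path_coordinate: "(\<lambda>\<omega>. \<omega> k) \<in> path_space \<rightarrow>\<^sub>M cp_space (asq_boxes n)"
  by (rule measurable_component_singleton) simp

lemma sets_path_cylinder:
  assumes A: "\<And>l. A l \<in> sets (cp_space (asq_boxes n))"
  shows "{\<omega> \<in> space path_space. \<forall>l\<le>k. \<omega> l \<in> A l} \<in> sets path_space"
proof -
  have 1: "{\<omega> \<in> space path_space. \<omega> l \<in> A l} \<in> sets path_space" for l :: nat
  proof -
    have "(\<lambda>\<omega>. \<omega> l) -` A l \<inter> space path_space \<in> sets path_space"
      by (rule measurable_sets[OF measurable_path_coordinate A])
    then show ?thesis by (simp add: vimage_def Int_def conj_commute)
  qed
  have "{\<omega> \<in> space path_space. \<forall>l\<in>{..k}. \<omega> l \<in> A l} \<in> sets path_space"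
    by (rule sets.sets_Collect_finite_All'[OF 1]) auto
  then show ?thesis by (simp only: Ball_def atMost_iff)
qed

lemma path_cylinder_measure:
  assumes A: "\<And>l. A l \<in> sets (cp_space (asq_boxes n))"
  shows "emeasure base {x. \<forall>l\<le>k. path x l \<in> A l} =
    (\<integral>\<^sup>+y. (\<Prod>l<Suc k. emeasure (measure_pmf noise) {e. emit ((advance ^^ l) y) e \<in> A l}) \<partial>driver)"
proof -
  let ?S = "{x. \<forall>l\<le>k. path x l \<in> A l}"
  have eq: "path -` {\<omega> \<in> space path_space. \<forall>l\<le>k. \<omega> l \<in> A l} \<inter> space base = ?S"
    using measurable_space[OF measurable_path] by auto
  have S: "?S \<in> sets base"
    unfolding eq[symmetric] by (rule measurable_sets[OF measurable_path sets_path_cylinder[OF A]])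
  have sec: "Pair y -` ?S = cyl (Suc k) (\<lambda>l. {e. emit ((advance ^^ l) y) e \<in> A l})" for y
    by (auto simp: cyl_def path_def less_Suc_eq_le)
  have "emeasure base ?S = (\<integral>\<^sup>+y. emeasure (iid noise) (Pair y -` ?S) \<partial>driver)"
    using S unfolding base_def by (rule IN.emeasure_pair_measure_alt)
  then show ?thesis by (simp only: sec emeasure_iid_cyl)
qed

lemma chain_markov: "markov_law (cp_space (asq_boxes n)) (cp_kernel (asq_boxes n) (asq_operator m n)) chain"
  unfolding markov_law_def
proof (intro conjI allI impI)
  let ?S = "cp_space (asq_boxes n)" and ?F = "cp_kernel (asq_boxes n) (asq_operator m n)"
  show F: "?F \<in> ?S \<rightarrow>\<^sub>M prob_algebra ?S" by (rule measurable_cp_kernel[OF m2 mn])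
  show "prob_space chain" by (rule prob_space_chain)
  show "sets chain = sets path_space" by (rule sets_chain)
  fix k and A :: "nat \<Rightarrow> cp_state set" assume "\<forall>l. A l \<in> sets ?S"
  then have A: "A l \<in> sets ?S" for l by blast
  have sp: "space chain = space path_space" by (simp add: chain_def)
  let ?N = "\<lambda>l y. emeasure (measure_pmf noise) {e. emit ((advance ^^ l) y) e \<in> A l}"
  let ?I = "indicator {\<omega>. \<forall>l\<le>k. \<omega> l \<in> A l} :: (nat \<Rightarrow> cp_state) \<Rightarrow> ennreal"
  let ?g = "\<lambda>\<omega>. ?I \<omega> * emeasure (?F (\<omega> k)) (A (Suc k))"
  have Fk: "(\<lambda>\<omega>. emeasure (?F (\<omega> k)) (A (Suc k))) \<in> borel_measurable path_space"
    by (rule measurable_compose[OF measurable_compose[OF measurable_path_coordinate measurable_prob_algebraD[OF F]] measurable_emeasure_subprob_algebra[OF A]])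
  have eq: "{\<omega>. \<forall>l\<le>k. \<omega> l \<in> A l} \<inter> space path_space = {\<omega> \<in> space path_space. \<forall>l\<le>k. \<omega> l \<in> A l}" by auto
  have "?I \<in> borel_measurable path_space"
    unfolding borel_measurable_indicator_iff eq by (rule sets_path_cylinder[OF A])
  then have g: "?g \<in> borel_measurable path_space" by (rule borel_measurable_times_ennreal[OF _ Fk])
  have gp: "(\<lambda>x. ?g (path x)) \<in> borel_measurable (driver \<Otimes>\<^sub>M iid noise)"
    unfolding base_def[symmetric] by (rule measurable_compose[OF measurable_path g])
  have "(\<integral>\<^sup>+\<omega>. ?g \<omega> \<partial>chain) = (\<integral>\<^sup>+x. ?g (path x) \<partial>base)"
    unfolding chain_def by (rule nn_integral_distr[OF measurable_path]) (simp only: measurable_distr_eq1 g)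
  also have "\<dots> = (\<integral>\<^sup>+y. \<integral>\<^sup>+e. ?g (path (y, e)) \<partial>iid noise \<partial>driver)"
    unfolding base_def by (rule IN.nn_integral_fst[OF gp, symmetric])
  also have "\<dots> = (\<integral>\<^sup>+y. (\<Prod>l<Suc (Suc k). ?N l y) \<partial>driver)"
  proof (rule nn_integral_cong_AE)
    show "AE y in driver. (\<integral>\<^sup>+e. ?g (path (y, e)) \<partial>iid noise) = (\<Prod>l<Suc (Suc k). ?N l y)"
      using AE_regular_driver
    proof eventually_elim
      case (elim y)
      let ?X = "\<lambda>l. {e. emit ((advance ^^ l) y) e \<in> A l}"
      have ry: "regular_driver ((advance ^^ k) y)" by (rule regular_driver_funpow[OF elim])
      have "(\<integral>\<^sup>+e. ?g (path (y, e)) \<partial>iid noise) = (\<integral>\<^sup>+e. ?N (Suc k) y * indicator (cyl (Suc k) ?X) e \<partial>iid noise)"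
      proof (rule nn_integral_cong_AE)
        show "AE e in iid noise. ?g (path (y, e)) = ?N (Suc k) y * indicator (cyl (Suc k) ?X) e"
          using AE_iid_set_pmf[of noise]
        proof eventually_elim
          case (elim e)
          have "emeasure (?F (path (y, e) k)) (A (Suc k)) = ?N (Suc k) y"
            unfolding path_def fst_conv snd_conv using kernel_of_emit[OF ry elim[rule_format] A] by simp
          moreover have "?I (path (y, e)) = indicator (cyl (Suc k) ?X) e"
            by (simp add: indicator_def cyl_def path_def less_Suc_eq_le)
          ultimately show ?case by (simp only: mult.commute)
        qed
      qed
      also have "\<dots> = ?N (Suc k) y * emeasure (iid noise) (cyl (Suc k) ?X)"
        by (rule nn_integral_cmult_indicator) (simp only: sets_iid sets_cyl)
      also have "\<dots> = (\<Prod>l<Suc (Suc k). ?N l y)"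
        unfolding emeasure_iid_cyl prod.lessThan_Suc[of _ "Suc k"] by (rule mult.commute)
      finally show ?case .
    qed
  qed
  also have "\<dots> = emeasure base {x. \<forall>l\<le>Suc k. path x l \<in> A l}"
    by (rule path_cylinder_measure[OF A, symmetric])
  also have "\<dots> = emeasure chain {\<omega> \<in> space chain. \<forall>l\<le>Suc k. \<omega> l \<in> A l}"
  proof -
    have "emeasure chain {\<omega> \<in> space chain. \<forall>l\<le>Suc k. \<omega> l \<in> A l} =
        emeasure base (path -` {\<omega> \<in> space path_space. \<forall>l\<le>Suc k. \<omega> l \<in> A l} \<inter> space base)"
      unfolding sp unfolding chain_def by (rule emeasure_distr[OF measurable_path sets_path_cylinder[OF A]])
    also have "path -` {\<omega> \<in> space path_space. \<forall>l\<le>Suc k. \<omega> l \<in> A l} \<inter> space base = {x. \<forall>l\<le>Suc k. path x l \<in> A l}"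
      using measurable_space[OF measurable_path] by auto
    finally show ?thesis by (rule sym)
  qed
  finally show "emeasure chain {\<omega> \<in> space chain. \<forall>l\<le>Suc k. \<omega> l \<in> A l} = (\<integral>\<^sup>+\<omega>. ?g \<omega> \<partial>chain)" by (rule sym)
qed

lemma chain_component: "measure_component chain = distr driver (borel_of planar_measures) box_law"
proof -
  let ?B = "borel_of planar_measures"
  have sn: "snd \<in> cp_space (asq_boxes n) \<rightarrow>\<^sub>M ?B"
    by (rule measurable_into_weak_topology[OF measurable_state(2)[OF m2 mn]])
  have s0: "(\<lambda>\<omega>. snd (\<omega> 0)) \<in> path_space \<rightarrow>\<^sub>M ?B"
    by (rule measurable_compose[OF measurable_path_coordinate sn])
  have bl: "box_law \<in> driver \<rightarrow>\<^sub>M ?B"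
    unfolding measurable_cong_sets[OF sets_driver refl] by (rule measurable_into_weak_topology[OF measurable_limit_law])
  have "measure_component chain = distr base ?B ((\<lambda>\<omega>. snd (\<omega> 0)) \<circ> path)"
    unfolding measure_component_def chain_def by (rule distr_distr[OF s0 measurable_path])
  also have "\<dots> = distr base ?B (\<lambda>x. box_law (advance (fst x)))"
  proof (rule distr_cong_AE)
    show "AE x in base. ((\<lambda>\<omega>. snd (\<omega> 0)) \<circ> path) x = box_law (advance (fst x))"
      using AE_base_fst[OF AE_regular_driver] AE_base_snd[OF AE_iid_set_pmf[of noise]]
    proof eventually_elim
      case (elim x)
      have "snd (fst x) 0 < m" using elim(1) P1_digits by (simp add: regular_driver_def)
      then have "admissible (fst (snd x 0)) (snd (snd x 0) (snd (fst x) 0)) (fst x)"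
        using noise_digits elim by (intro admissible_of_regular) auto
      then show ?case by (simp add: path_def emit_def piece_def)
    qed
    show "(\<lambda>\<omega>. snd (\<omega> 0)) \<circ> path \<in> base \<rightarrow>\<^sub>M ?B"
      unfolding comp_def by (rule measurable_compose[OF measurable_path s0])
    show "(\<lambda>x. box_law (advance (fst x))) \<in> base \<rightarrow>\<^sub>M ?B"
      unfolding base_def by (rule measurable_compose[OF measurable_compose[OF measurable_fst measurable_advance_driver] bl])
  qed simp_all
  also have "\<dots> = distr (distr base driver fst) ?B (\<lambda>y. box_law (advance y))"
    unfolding base_def using distr_distr[OF measurable_compose[OF measurable_advance_driver bl] measurable_fst, of "iid noise"]
    by (simp add: comp_def)
  also have "distr base driver fst = driver" unfolding base_def by (rule IN.distr_pair_fst)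
  also have "distr driver ?B (\<lambda>y. box_law (advance y)) = distr (distr driver driver advance) ?B box_law"
    using distr_distr[OF bl measurable_advance_driver] by (simp add: comp_def)
  finally show ?thesis unfolding advance_preserves_driver .
qed

end

section \<open>Ergodicity\<close>

definition half_open :: "real set set" where "half_open = insert UNIV {{a..<b} | a b. True}"

lemma Int_stable_half_open: "Int_stable half_open"
proof (rule Int_stableI)
  fix S T assume ST: "S \<in> half_open" "T \<in> half_open"
  show "S \<inter> T \<in> half_open"
  proof (cases "S = UNIV \<or> T = UNIV")
    case False
    then obtain a b c d where "S = {a..<b}" "T = {c..<d}" using ST unfolding half_open_def by blast
    then show ?thesis by (auto simp only: half_open_def Int_atLeastLessThan)
  qed (use ST in auto)
qed

lemma UNIV_half_open: "UNIV \<in> half_open" by (simp add: half_open_def)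

lemma sets_borel_half_open: "sets borel = sigma_sets UNIV half_open"
proof -
  have "sets borel = sigma_sets UNIV (range (\<lambda>(a::real, b). {a..<b}))"
    using arg_cong[OF borel_eq_atLeastLessThan, of sets] by (simp add: sets_measure_of)
  also have "\<dots> = sigma_sets UNIV half_open"
  proof (rule antisym)
    show "sigma_sets UNIV (range (\<lambda>(a::real, b). {a..<b})) \<subseteq> sigma_sets UNIV half_open"
      by (rule sigma_sets_mono') (auto simp: half_open_def)
    show "sigma_sets UNIV half_open \<subseteq> sigma_sets UNIV (range (\<lambda>(a::real, b). {a..<b}))"
      by (rule sigma_sets_mono) (auto simp: half_open_def sigma_sets_top)
  qed
  finally show ?thesis .
qed

abbreviation cylinders :: "(nat \<Rightarrow> 'a) set set" where "cylinders \<equiv> {cyl L X | L X. True}"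

lemma UNIV_cylinder: "UNIV \<in> cylinders"
proof -
  have "UNIV = cyl 0 (\<lambda>_. UNIV :: 'a set)" by (simp add: cyl_def)
  then show ?thesis by blast
qed

context digit_system
begin

abbreviation driver_cylinders :: "(real \<times> (nat \<Rightarrow> nat)) set set" where
  "driver_cylinders \<equiv> {S \<times> Y | S Y. S \<in> half_open \<and> Y \<in> cylinders}"

lemma driver_cylinders: "sets driver = sigma_sets UNIV driver_cylinders" "UNIV \<in> driver_cylinders"
proof -
  have "sets (phase_measure \<alpha> \<Otimes>\<^sub>M iid P1) = sigma_sets (space (phase_measure \<alpha> \<Otimes>\<^sub>M iid P1)) driver_cylinders"
    by (rule sets_pair_generated)
       (simp_all only: sets_phase_measure space_phase_measure sets_borel_half_open space_iid sets_iid sets_seq_space_cyl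
          UNIV_cylinder UNIV_half_open Pow_UNIV subset_UNIV)
  then show "sets driver = sigma_sets UNIV driver_cylinders" by (simp only: driver_def space_pair_measure space_phase_measure space_iid UNIV_Times_UNIV)
  have "UNIV = UNIV \<times> UNIV \<and> UNIV \<in> half_open \<and> UNIV \<in> (cylinders :: (nat \<Rightarrow> nat) set set)"
    by (simp only: UNIV_Times_UNIV UNIV_cylinder UNIV_half_open)
  then show "UNIV \<in> driver_cylinders" by blast
qed

lemma base_cylinders: "sets base = sigma_sets UNIV {S \<times> Y | S Y. S \<in> driver_cylinders \<and> Y \<in> cylinders}"
proof -
  have "sets (driver \<Otimes>\<^sub>M iid noise) = sigma_sets (space (driver \<Otimes>\<^sub>M iid noise)) {S \<times> Y | S Y. S \<in> driver_cylinders \<and> Y \<in> cylinders}"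
    by (rule sets_pair_generated)
       (simp_all only: space_driver space_iid driver_cylinders sets_iid sets_seq_space_cyl UNIV_cylinder Pow_UNIV subset_UNIV)
  then show ?thesis by (simp add: base_def space_pair_measure)
qed

lemma driver_averages:
  assumes "E \<in> driver_cylinders"
  shows "AE y in driver. (\<lambda>N. (\<Sum>k<N. indicator E ((advance ^^ k) y)) / real N) \<longlonglongrightarrow> measure driver E"
proof -
  obtain S L X where E: "E = S \<times> cyl L X" and S: "S \<in> half_open" using assms by blast
  obtain a b where ab: "\<And>t. frac t \<in> S \<longleftrightarrow> frac t \<in> {a..<b}" "measure (phase_measure \<alpha>) S = measure (phase_measure \<alpha>) {a..<b}"
  proof (cases "S = UNIV")
    case True
    have "AE t in phase_measure \<alpha>. t \<in> {0..<1}"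
      using AE_typical_phase by eventually_elim (simp add: typical_phase_def)
    then have "measure (phase_measure \<alpha>) {0..<1} = 1" by (subst phase.prob_eq_1) simp_all
    then show ?thesis using that[of 0 1] True phase.prob_space by (simp add: frac_lt_1)
  next
    case False
    then obtain a b where "S = {a..<b}" using S unfolding half_open_def by blast
    then show ?thesis using that[of a b] by simp
  qed
  have Sb: "S \<in> sets (phase_measure \<alpha>)" using S by (auto simp: half_open_def)
  have mE: "measure driver E = measure (phase_measure \<alpha>) {a..<b} * (\<Prod>r<L. measure (measure_pmf P1) (X r))"
  proof -
    have "emeasure driver E = emeasure (phase_measure \<alpha>) S * emeasure (iid P1) (cyl L X)"
      unfolding driver_def E by (rule I1.emeasure_pair_measure_Times[OF Sb]) (simp only: sets_iid sets_cyl)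
    then show ?thesis
      by (simp add: driver.emeasure_eq_measure phase.emeasure_eq_measure emeasure_iid_cyl measure_pmf.emeasure_eq_measure
          prod_ennreal ennreal_mult[symmetric] prod_nonneg ab(2))
  qed
  have Es: "E \<in> sets driver" unfolding driver_cylinders(1) using assms by (rule sigma_sets.Basic)
  let ?P = "\<lambda>y. (\<lambda>N. (\<Sum>k<N. indicator E ((advance ^^ k) y)) / real N) \<longlonglongrightarrow> measure driver E"
  have ak: "advance ^^ k \<in> driver \<rightarrow>\<^sub>M driver" for k
    unfolding measurable_cong_sets[OF sets_driver sets_driver] by (rule measurable_advance_funpow)
  have "AE y in phase_measure \<alpha> \<Otimes>\<^sub>M iid P1. ?P y"
  proof (rule driver_pair.AE_pair_measure)
    have "{y \<in> space driver. ?P y} \<in> sets driver"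
      by (intro sets_LIMSEQ borel_measurable_divide borel_measurable_sum borel_measurable_const
          measurable_compose[OF ak borel_measurable_indicator[OF Es]])
    then show "{y \<in> space (phase_measure \<alpha> \<Otimes>\<^sub>M iid P1). ?P y} \<in> sets (phase_measure \<alpha> \<Otimes>\<^sub>M iid P1)"
      by (simp only: driver_def)
    show "AE t in phase_measure \<alpha>. AE \<omega> in iid P1. ?P (t, \<omega>)"
      using AE_typical_phase
    proof eventually_elim
      case (elim t)
      then have t: "0 \<le> t" "t < 1" by (auto simp: typical_phase_def)
      have ind: "indicator E ((advance ^^ k) (t, \<omega>)) = indicator {a..<b} (frac (t + real k * \<alpha>)) *
          (indicator (cyl L X) (seq_drop (nat \<lfloor>t + real k * \<alpha>\<rfloor>) \<omega>) :: real)" for k \<omega>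
        unfolding advance_funpow[OF t] E using ab(1)[of "t + real k * \<alpha>"] by (simp add: indicator_times indicator_def)
      show ?case
        unfolding ind mE by (rule sampled_averages[OF elim \<alpha>_facts(1)])
    qed
  qed
  then show ?thesis by (simp only: driver_def)
qed

lemma base_averages:
  assumes "E \<in> {S \<times> Y | S Y. S \<in> driver_cylinders \<and> Y \<in> cylinders}"
  shows "AE x in base. (\<lambda>N. (\<Sum>k<N. indicator E ((advance_base ^^ k) x)) / real N) \<longlonglongrightarrow> measure base E"
proof -
  obtain S L X where E: "E = S \<times> cyl L X" and S: "S \<in> driver_cylinders" using assms by blast
  have Ss: "S \<in> sets driver" unfolding driver_cylinders(1) using S by (rule sigma_sets.Basic)
  have Es: "E \<in> sets base" unfolding base_cylinders using assms by (rule sigma_sets.Basic)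
  have mE: "measure base E = measure driver S * (\<Prod>r<L. measure (measure_pmf noise) (X r))"
  proof -
    have "emeasure base E = emeasure driver S * emeasure (iid noise) (cyl L X)"
      unfolding base_def E by (rule IN.emeasure_pair_measure_Times[OF Ss]) (simp only: sets_iid sets_cyl)
    then show ?thesis
      by (simp add: base.emeasure_eq_measure driver.emeasure_eq_measure emeasure_iid_cyl measure_pmf.emeasure_eq_measure
          prod_ennreal ennreal_mult[symmetric] prod_nonneg)
  qed
  have pow: "(advance_base ^^ k) x = ((advance ^^ k) (fst x), seq_drop k (snd x))" for k x
    by (induction k) (auto simp: advance_base_def)
  have bk: "advance_base ^^ k \<in> base \<rightarrow>\<^sub>M base" for k
  proof (induction k)
    case (Suc k)
    show ?case using measurable_compose[OF Suc measurable_advance_base] by (simp add: comp_def)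
  qed (simp add: id_def)
  let ?P = "\<lambda>x. (\<lambda>N. (\<Sum>k<N. indicator E ((advance_base ^^ k) x)) / real N) \<longlonglongrightarrow> measure base E"
  have "AE x in driver \<Otimes>\<^sub>M iid noise. ?P x"
  proof (rule base_pair.AE_pair_measure)
    have "{x \<in> space base. ?P x} \<in> sets base"
      by (intro sets_LIMSEQ borel_measurable_divide borel_measurable_sum borel_measurable_const
          measurable_compose[OF bk borel_measurable_indicator[OF Es]])
    then show "{x \<in> space (driver \<Otimes>\<^sub>M iid noise). ?P x} \<in> sets (driver \<Otimes>\<^sub>M iid noise)"
      by (simp only: base_def)
    show "AE y in driver. AE e in iid noise. ?P (y, e)"
      using driver_averages[OF S]
    proof eventually_elim
      case (elim y)
      have ind: "indicator E ((advance_base ^^ k) (y, e)) = indicator S ((advance ^^ k) y) * (indicator (cyl L X) (seq_drop k e) :: real)" for k e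
        unfolding pow E by (simp add: indicator_times)
      show ?case
        unfolding ind mE
        by (rule weighted_averages[where H=L, OF _ _ elim]) (auto simp: indicator_def)
    qed
  qed
  then show ?thesis by (simp only: base_def)
qed

lemma chain_ergodic: "ergodic_law chain"
  unfolding ergodic_law_def
proof (intro ballI impI)
  fix A assume A: "A \<in> sets chain" and inv: "shift -` A \<inter> space chain = A"
  let ?A = "path -` A \<inter> space base"
  have A': "?A \<in> sets base" by (rule measurable_sets[OF measurable_path]) (use A sets_chain in simp)
  have sp: "path x \<in> space chain" for x using measurable_space[OF measurable_path, of x] by (simp add: chain_def)
  have inv': "path (advance_base x) \<in> A \<longleftrightarrow> path x \<in> A" for x
  proof -
    have "path (advance_base x) \<in> A \<longleftrightarrow> path x \<in> shift -` A \<inter> space chain"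
      using sp[of x] by (simp add: path_advance_base)
    then show ?thesis unfolding inv .
  qed
  have GA: "advance_base -` ?A \<inter> space base = ?A"
    by (rule set_eqI) (simp only: vimage_eq Int_iff space_base UNIV_I inv' simp_thms)
  have stab: "Int_stable {S \<times> Y | S Y. S \<in> driver_cylinders \<and> Y \<in> (cylinders :: (nat \<Rightarrow> nat \<times> (nat \<Rightarrow> nat)) set set)}"
    by (rule Int_stable_Times[OF Int_stable_Times[OF Int_stable_half_open Int_stable_cyl] Int_stable_cyl])
  have "emeasure base ?A = 0 \<or> emeasure base ?A = 1"
    by (rule ergodic_of_averages[OF base.prob_space_axioms measurable_advance_base advance_base_preserves stab _ _ base_averages A' GA])
       (simp_all only: space_base Pow_UNIV subset_UNIV base_cylinders)
  moreover have "emeasure chain A = emeasure base ?A"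
    unfolding chain_def by (rule emeasure_distr[OF measurable_path]) (use A sets_chain in simp)
  ultimately show "emeasure chain A = 0 \<or> emeasure chain A = 1" by simp
qed

end

section \<open>Convergence of empirical distributions\<close>

lemma empirical_distribution_eq:
  assumes N: "0 < N" and \<nu>: "\<And>k. \<nu> k \<in> prob_measures euclidean"
  shows "empirical_distribution N \<nu> = distr (measure_pmf (pmf_of_set {..<N})) (borel_of planar_measures) \<nu>"
proof (rule measure_eqI)
  show "sets (empirical_distribution N \<nu>) = sets (distr (measure_pmf (pmf_of_set {..<N})) (borel_of planar_measures) \<nu>)"
    by (simp add: empirical_distribution_def)
  fix A assume "A \<in> sets (empirical_distribution N \<nu>)"
  then have A: "A \<in> sets (borel_of planar_measures)" by (simp add: empirical_distribution_def)
  have m: "\<nu> \<in> measure_pmf (pmf_of_set {..<N}) \<rightarrow>\<^sub>M borel_of planar_measures"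
    using \<nu> by (simp add: topspace_weak_topology)
  have "emeasure (distr (measure_pmf (pmf_of_set {..<N})) (borel_of planar_measures) \<nu>) A = emeasure (measure_pmf (pmf_of_set {..<N})) (\<nu> -` A)"
    using emeasure_distr[OF m A] by simp
  also have "\<dots> = (\<integral>\<^sup>+k. indicator (\<nu> -` A) k \<partial>measure_pmf (pmf_of_set {..<N}))" by simp
  also have "\<dots> = (\<Sum>k<N. indicator (\<nu> -` A) k) / of_nat N"
    using N by (subst nn_integral_pmf_of_set) auto
  also have "\<dots> = (\<Sum>k<N. 1 / of_nat N * indicator A (\<nu> k))"
    by (simp add: divide_ennreal_def sum_distrib_right indicator_def mult.commute)
  also have "\<dots> = emeasure (empirical_distribution N \<nu>) A"
    unfolding empirical_distribution_def by (rule emeasure_atomic_measure[symmetric]) (simp_all add: A)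
  finally show "emeasure (empirical_distribution N \<nu>) A = emeasure (distr (measure_pmf (pmf_of_set {..<N})) (borel_of planar_measures) \<nu>) A"
    by (rule sym)
qed

lemma empirical_distribution_prob:
  assumes "0 < N" "\<And>k. \<nu> k \<in> prob_measures euclidean"
  shows "empirical_distribution N \<nu> \<in> prob_measures planar_measures"
proof -
  have m: "\<nu> \<in> measure_pmf (pmf_of_set {..<N}) \<rightarrow>\<^sub>M borel_of planar_measures"
    using assms(2) by (simp add: topspace_weak_topology)
  show ?thesis
    unfolding empirical_distribution_eq[OF assms] prob_measures_def using measure_pmf.prob_space_distr[OF m] by simp
qed

lemma integral_empirical_distribution:
  fixes f :: "(real \<times> real) measure \<Rightarrow> real"
  assumes "0 < N" "\<And>k. \<nu> k \<in> prob_measures euclidean" and f: "f \<in> borel_measurable (borel_of planar_measures)"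
  shows "(\<integral>x. f x \<partial>empirical_distribution N \<nu>) = (\<Sum>k<N. f (\<nu> k)) / real N"
proof -
  have m: "\<nu> \<in> measure_pmf (pmf_of_set {..<N}) \<rightarrow>\<^sub>M borel_of planar_measures"
    using assms(2) by (simp add: topspace_weak_topology)
  show ?thesis
    unfolding empirical_distribution_eq[OF assms(1,2)] integral_distr[OF m f]
    using assms(1) by (subst integral_pmf_of_set) auto
qed

lemma averages_eventually_small:
  fixes x :: "nat \<Rightarrow> real"
  assumes ev: "\<forall>\<^sub>F k in sequentially. \<bar>x k\<bar> \<le> e" and e: "0 < e"
  shows "\<forall>\<^sub>F N in sequentially. \<bar>(\<Sum>k<N. x k) / real N\<bar> \<le> 2 * e"
proof -
  obtain k0 where k0: "\<And>k. k0 \<le> k \<Longrightarrow> \<bar>x k\<bar> \<le> e" using ev by (auto simp: eventually_sequentially)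
  define C where "C = (\<Sum>k<k0. \<bar>x k\<bar>)"
  obtain N0 :: nat where N0: "C / e < real N0" using reals_Archimedean2 by blast
  show ?thesis unfolding eventually_sequentially
  proof (intro exI[of _ "Suc (max k0 N0)"] allI impI)
    fix N assume N: "Suc (max k0 N0) \<le> N"
    have "\<bar>\<Sum>k<N. x k\<bar> \<le> (\<Sum>k<N. \<bar>x k\<bar>)" by (rule sum_abs)
    also have "\<dots> = C + (\<Sum>k\<in>{k0..<N}. \<bar>x k\<bar>)"
      unfolding C_def lessThan_atLeast0 using N by (subst sum.atLeastLessThan_concat) auto
    also have "(\<Sum>k\<in>{k0..<N}. \<bar>x k\<bar>) \<le> (\<Sum>k\<in>{k0..<N}. e)" by (intro sum_mono k0) simp
    also have "\<dots> \<le> real N * e" using e by simp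
    also have "C < real N0 * e" using N0 e by (simp add: pos_divide_less_eq)
    then have "C \<le> real N * e" using N e by (smt (verit) Suc_le_eq max.strict_boundedE mult_right_mono of_nat_less_iff)
    finally have "\<bar>\<Sum>k<N. x k\<bar> \<le> 2 * e * real N" by (simp add: algebra_simps)
    then show "\<bar>(\<Sum>k<N. x k) / real N\<bar> \<le> 2 * e"
      using N by (simp add: abs_divide pos_divide_le_eq)
  qed
qed

context digit_system
begin

definition driver_law :: "real \<Rightarrow> (real \<times> real) measure measure" where
  "driver_law \<beta> = distr (phase_measure \<beta> \<Otimes>\<^sub>M iid P1) (borel_of planar_measures) box_law"

definition typical_digits :: "real \<Rightarrow> (nat \<Rightarrow> nat) \<Rightarrow> bool" where
  "typical_digits \<beta> i \<longleftrightarrow> (\<forall>r. i r < m) \<and> (\<forall>(s :: nat) (M :: nat) w.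
     (\<lambda>N. (\<Sum>k<N. indicator {real s / real M..<real (Suc s) / real M} (frac (real k * \<beta>)) *
       indicator (cyl (length w) (\<lambda>r. {w ! r})) (seq_drop (nat \<lfloor>real k * \<beta>\<rfloor>) i)) / real N) \<longlonglongrightarrow>
     measure (phase_measure \<beta>) {real s / real M..<real (Suc s) / real M} * (\<Prod>r<length w. measure (measure_pmf P1) {w ! r}))"

lemma AE_typical_digits: "0 < \<beta> \<Longrightarrow> AE i in iid P1. typical_digits \<beta> i"
proof -
  assume \<beta>: "0 < \<beta>"
  have 1: "AE i in iid P1. \<forall>r. i r < m"
    using AE_iid_set_pmf[of P1] by eventually_elim (use P1_digits in blast)
  have 2: "AE i in iid P1. \<forall>(s :: nat) (M :: nat) w.
     (\<lambda>N. (\<Sum>k<N. indicator {real s / real M..<real (Suc s) / real M} (frac (real k * \<beta>)) *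
       indicator (cyl (length w) (\<lambda>r. {w ! r})) (seq_drop (nat \<lfloor>real k * \<beta>\<rfloor>) i)) / real N) \<longlonglongrightarrow>
     measure (phase_measure \<beta>) {real s / real M..<real (Suc s) / real M} * (\<Prod>r<length w. measure (measure_pmf P1) {w ! r})"
    unfolding AE_all_countable
    using sampled_averages[OF typical_phase_0 \<beta>, where p=P1] by simp
  from 1 2 show ?thesis unfolding typical_digits_def by eventually_elim blast
qed

lemma measurable_box_law: "box_law \<in> phase_measure \<beta> \<Otimes>\<^sub>M iid P1 \<rightarrow>\<^sub>M borel_of planar_measures"
proof -
  have eq: "sets (phase_measure \<beta> \<Otimes>\<^sub>M iid P1) = sets driver_space"
    by (intro sets_pair_measure_cong sets_iid sets_phase_measure)
  show ?thesis
    unfolding measurable_cong_sets[OF eq refl] by (rule measurable_into_weak_topology[OF measurable_limit_law])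
qed

lemma prob_space_driver_law:
  shows "prob_space (phase_measure \<beta> \<Otimes>\<^sub>M iid P1)" and "driver_law \<beta> \<in> prob_measures planar_measures"
proof -
  interpret \<tau>: prob_space "phase_measure \<beta>" by (rule prob_space_phase_measure)
  interpret T: pair_prob_space "phase_measure \<beta>" "iid P1" ..
  show "prob_space (phase_measure \<beta> \<Otimes>\<^sub>M iid P1)" by (rule T.P.prob_space_axioms)
  show "driver_law \<beta> \<in> prob_measures planar_measures"
    unfolding driver_law_def prob_measures_def using T.P.prob_space_distr[OF measurable_box_law] by simp
qed

lemma step_function_value:
  fixes c :: "nat \<Rightarrow> nat list \<Rightarrow> real"
  assumes t: "0 \<le> t" "t < 1" and M: "0 < M" and \<omega>: "\<And>r. \<omega> r < m"
  shows "(\<Sum>s<M. \<Sum>w\<in>{w. set w \<subseteq> {..<m} \<and> length w = D}. c s w * (indicator {real s / real M..<real (Suc s) / real M} t *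
      indicator (cyl D (\<lambda>r. {w ! r})) \<omega>)) = c (nat \<lfloor>t * real M\<rfloor>) (map \<omega> [0..<D])"
proof -
  let ?s = "nat \<lfloor>t * real M\<rfloor>" and ?w = "map \<omega> [0..<D]"
  let ?W = "{w. set w \<subseteq> {..<m} \<and> length w = D}"
  have fin: "finite ?W" by (rule finite_lists_length_eq) simp
  have w: "?w \<in> ?W" using \<omega> by auto
  have "t * real M < real M" using t M by simp
  then have sM: "?s < M" using t by (simp add: nat_less_iff floor_less_iff)
  have inds: "indicator {real s / real M..<real (Suc s) / real M} t = (if s = ?s then 1 else (0 :: real))" for s
  proof -
    have "t \<in> {real s / real M..<real (Suc s) / real M} \<longleftrightarrow> real s \<le> t * real M \<and> t * real M < real s + 1"
      using M by (auto simp: field_simps)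
    also have "\<dots> \<longleftrightarrow> \<lfloor>t * real M\<rfloor> = int s" by (simp add: floor_eq_iff)
    also have "\<dots> \<longleftrightarrow> s = ?s" using t by auto
    finally show ?thesis by (simp add: indicator_def)
  qed
  have iw: "indicator (cyl D (\<lambda>r. {w ! r})) \<omega> = (if w = ?w then 1 else (0 :: real))" if "w \<in> ?W" for w
  proof -
    have "\<omega> \<in> cyl D (\<lambda>r. {w ! r}) \<longleftrightarrow> w = ?w"
      using that by (auto simp: cyl_def list_eq_iff_nth_eq)
    then show ?thesis by (simp add: indicator_def)
  qed
  have "(\<Sum>s<M. \<Sum>w\<in>?W. c s w * (indicator {real s / real M..<real (Suc s) / real M} t * indicator (cyl D (\<lambda>r. {w ! r})) \<omega>)) =
      (\<Sum>s<M. \<Sum>w\<in>?W. if w = ?w then (if s = ?s then c ?s ?w else 0) else 0)"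
    by (intro sum.cong refl) (simp add: inds iw del: of_nat_Suc)
  also have "\<dots> = c ?s ?w" using fin w sM by (simp add: sum.delta)
  finally show ?thesis .
qed

theorem empirical_convergence:
  fixes \<beta> :: real and d :: "nat \<Rightarrow> nat"
  assumes i: "typical_digits \<beta> i" and d: "filterlim d at_top sequentially"
  defines "\<nu> \<equiv> \<lambda>k. law (frac (real k * \<beta>)) (comb_seq (d k) (seq_drop (nat \<lfloor>real k * \<beta>\<rfloor>) i))"
  shows "limitin (weak_topology planar_measures) (\<lambda>N. empirical_distribution N \<nu>) (driver_law \<beta>) sequentially"
proof (rule limitin_weak_topology)
  have \<nu>p: "\<nu> k \<in> prob_measures euclidean" for k
    unfolding \<nu>_def by (rule law_prob_measures[OF measurable_comb_seq_right])
  show "\<forall>\<^sub>F N in sequentially. empirical_distribution N \<nu> \<in> prob_measures planar_measures"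
    using eventually_gt_at_top[of 0] by eventually_elim (rule empirical_distribution_prob[OF _ \<nu>p])
  show "driver_law \<beta> \<in> prob_measures planar_measures" by (rule prob_space_driver_law)
  fix f :: "(real \<times> real) measure \<Rightarrow> real"
  assume f: "continuous_map planar_measures euclideanreal f" and fb: "bounded (f ` topspace planar_measures)"
  let ?T = "phase_measure \<beta> \<Otimes>\<^sub>M iid P1"
  interpret T: prob_space ?T by (rule prob_space_driver_law)
  interpret \<tau>: prob_space "phase_measure \<beta>" by (rule prob_space_phase_measure)
  interpret TP: pair_prob_space "phase_measure \<beta>" "iid P1" ..
  have fm: "f \<in> borel_measurable (borel_of planar_measures)" by (rule borel_measurable_continuous_map[OF f])
  let ?F = "\<lambda>y. f (box_law y)"
  have Fm: "?F \<in> borel_measurable ?T" by (rule measurable_compose[OF measurable_box_law fm])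
  obtain B where B: "\<And>M. M \<in> prob_measures euclidean \<Longrightarrow> \<bar>f M\<bar> \<le> B"
    using fb by (auto simp: bounded_iff topspace_weak_topology)
  have Fi: "integrable ?T ?F"
    by (rule T.integrable_const_bound[OF _ Fm, of B]) (auto simp: B[OF limit_law_prob_measures])
  have im: "\<And>r. i r < m" using i by (simp add: typical_digits_def)
  define I where "I = (\<integral>y. ?F y \<partial>?T)"
  have I: "(\<integral>x. f x \<partial>driver_law \<beta>) = I"
    unfolding driver_law_def I_def by (rule integral_distr[OF measurable_box_law fm])
  let ?t = "\<lambda>k. frac (real k * \<beta>)" and ?\<omega> = "\<lambda>k. seq_drop (nat \<lfloor>real k * \<beta>\<rfloor>) i"
  have "(\<lambda>N. (\<Sum>k<N. f (\<nu> k)) / real N) \<longlonglongrightarrow> I"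
  proof (rule tendstoI)
    fix e0 :: real assume "0 < e0"
    define e where "e = e0 / 6"
    have e: "0 < e" using \<open>0 < e0\<close> by (simp add: e_def)
    obtain D where D: "\<And>d t t' \<omega> \<omega>'. D \<le> d \<Longrightarrow> t \<in> {0..1} \<Longrightarrow> t' \<in> {0..1} \<Longrightarrow> \<bar>t - t'\<bar> \<le> 1 / real (Suc D) \<Longrightarrow>
      (\<And>r. \<omega> r < m) \<Longrightarrow> (\<And>r. \<omega>' r < m) \<Longrightarrow> (\<And>r. r < D \<Longrightarrow> \<omega> r = \<omega>' r) \<Longrightarrow>
      \<bar>f (law t (comb_seq d \<omega>)) - f (limit_law t' \<omega>')\<bar> < e"
      using law_uniformly_close[OF f e] by metis
    let ?M = "Suc D" and ?W = "{w. set w \<subseteq> {..<m} \<and> length w = D}"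
    let ?J = "\<lambda>s. {real s / real ?M..<real (Suc s) / real ?M}" and ?C = "\<lambda>w. cyl D (\<lambda>r. {w ! r})"
    define c where "c s w = f (limit_law (real s / real ?M) (\<lambda>r. if r < D then w ! r else 0))" for s :: nat and w :: "nat list"
    define g where "g t \<omega> = (\<Sum>s<?M. \<Sum>w\<in>?W. c s w * (indicator (?J s) t * indicator (?C w) \<omega>))" for t :: real and \<omega>
    have fin: "finite ?W" by (rule finite_lists_length_eq) simp
    have close1: "\<bar>f (law t (comb_seq d \<omega>)) - g t \<omega>\<bar> < e" if "D \<le> d" "0 \<le> t" "t < 1" "\<And>r. \<omega> r < m" for d t \<omega>
    proof -
      let ?s = "nat \<lfloor>t * real ?M\<rfloor>"
      have "g t \<omega> = c ?s (map \<omega> [0..<D])"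
        unfolding g_def by (rule step_function_value) (use that in auto)
      also have "\<dots> = f (limit_law (real ?s / real ?M) (\<lambda>r. if r < D then \<omega> r else 0))"
        unfolding c_def by (intro arg_cong[where f=f] arg_cong2[where f=law] refl ext) simp
      finally have g: "g t \<omega> = f (limit_law (real ?s / real ?M) (\<lambda>r. if r < D then \<omega> r else 0))" .
      have tM: "0 \<le> t * real ?M" using that by simp
      have s: "real ?s \<le> t * real ?M" "t * real ?M < real ?s + 1" using tM by linarith+
      have "\<bar>t - real ?s / real ?M\<bar> = (t * real ?M - real ?s) / real ?M"
        using s(1) by (simp add: field_simps)
      also have "\<dots> \<le> 1 / real ?M" using s(2) by (intro divide_right_mono) auto
      finally have 1: "\<bar>t - real ?s / real ?M\<bar> \<le> 1 / real ?M" .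
      have "t * real ?M \<le> real ?M" using that by simp
      then have "real ?s \<le> real ?M" using s(1) by linarith
      then have "real ?s / real ?M \<le> 1" by (simp only: divide_le_eq_1_pos of_nat_0_less_iff zero_less_Suc)
      moreover have "0 \<le> real ?s / real ?M" by (rule divide_nonneg_nonneg; rule of_nat_0_le_iff)
      ultimately have 2: "real ?s / real ?M \<in> {0..1}" by (simp only: atLeastAtMost_iff)
      show ?thesis unfolding g
        by (rule D[OF that(1) _ 2 1]) (use that m2 in auto)
    qed
    have close2: "\<bar>f (limit_law t \<omega>) - g t \<omega>\<bar> \<le> 2 * e" if "0 \<le> t" "t < 1" "\<And>r. \<omega> r < m" for t \<omega>
    proof -
      have "\<bar>f (law t (comb_seq D \<omega>)) - f (limit_law t \<omega>)\<bar> < e"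
        by (rule D) (use that in auto)
      with close1[of D t \<omega>, OF order_refl that] show ?thesis by linarith
    qed
    have \<omega>m: "?\<omega> k r < m" for k r using im by simp
    have "\<forall>\<^sub>F k in sequentially. D \<le> d k" using d by (simp add: filterlim_at_top)
    then have "\<forall>\<^sub>F k in sequentially. \<bar>f (\<nu> k) - g (?t k) (?\<omega> k)\<bar> \<le> e"
    proof eventually_elim
      case (elim k)
      then show ?case unfolding \<nu>_def using close1[of "d k" "?t k" "?\<omega> k"] \<omega>m by (simp add: frac_lt_1)
    qed
    from averages_eventually_small[OF this e]
    have A: "\<forall>\<^sub>F N in sequentially. \<bar>(\<Sum>k<N. f (\<nu> k) - g (?t k) (?\<omega> k)) / real N\<bar> \<le> 2 * e" .
    define J where "J = (\<Sum>s<?M. \<Sum>w\<in>?W. c s w * (measure (phase_measure \<beta>) (?J s) * (\<Prod>r<D. measure (measure_pmf P1) {w ! r})))"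
    have avg: "(\<lambda>N. (\<Sum>k<N. g (?t k) (?\<omega> k)) / real N) \<longlonglongrightarrow> J"
    proof -
      have sw: "(\<lambda>N. (\<Sum>k<N. indicator (?J s) (?t k) * indicator (?C w) (?\<omega> k)) / real N) \<longlonglongrightarrow>
          measure (phase_measure \<beta>) (?J s) * (\<Prod>r<D. measure (measure_pmf P1) {w ! r})" if "w \<in> ?W" for s w
      proof -
        have lw: "length w = D" using that by simp
        show ?thesis
          using i[unfolded typical_digits_def, THEN conjunct2, THEN spec[of _ s], THEN spec[of _ ?M], THEN spec[of _ w]] unfolding lw .
      qed
      have "(\<lambda>N. \<Sum>s<?M. \<Sum>w\<in>?W. c s w * ((\<Sum>k<N. indicator (?J s) (?t k) * indicator (?C w) (?\<omega> k)) / real N)) \<longlonglongrightarrow> J"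
        unfolding J_def by (intro tendsto_sum tendsto_mult tendsto_const sw)
      moreover have "(\<Sum>s<?M. \<Sum>w\<in>?W. c s w * ((\<Sum>k<N. indicator (?J s) (?t k) * indicator (?C w) (?\<omega> k)) / real N)) =
          (\<Sum>k<N. g (?t k) (?\<omega> k)) / real N" for N
      proof -
        have "(\<Sum>k<N. g (?t k) (?\<omega> k)) = (\<Sum>s<?M. \<Sum>k<N. \<Sum>w\<in>?W. c s w * (indicator (?J s) (?t k) * indicator (?C w) (?\<omega> k)))"
          unfolding g_def by (rule sum.swap)
        also have "\<dots> = (\<Sum>s<?M. \<Sum>w\<in>?W. \<Sum>k<N. c s w * (indicator (?J s) (?t k) * indicator (?C w) (?\<omega> k)))"
          by (intro sum.cong refl sum.swap)
        finally show ?thesis by (simp only: sum_divide_distrib sum_distrib_left times_divide_eq_right)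
      qed
      ultimately show ?thesis by simp
    qed
    have rect: "?J s \<times> ?C w \<in> sets ?T" for s w
      by (rule pair_measureI) (simp_all only: sets_iid sets_cyl sets_phase_measure atLeastLessThan_borel)
    have mrect: "measure ?T (?J s \<times> ?C w) = measure (phase_measure \<beta>) (?J s) * (\<Prod>r<D. measure (measure_pmf P1) {w ! r})" for s w
    proof -
      have "emeasure ?T (?J s \<times> ?C w) = emeasure (phase_measure \<beta>) (?J s) * emeasure (iid P1) (?C w)"
        by (rule I1.emeasure_pair_measure_Times) (simp_all only: sets_iid sets_cyl sets_phase_measure atLeastLessThan_borel)
      then show ?thesis
        by (simp add: T.emeasure_eq_measure \<tau>.emeasure_eq_measure emeasure_iid_cyl measure_pmf.emeasure_eq_measure
            prod_ennreal ennreal_mult[symmetric] prod_nonneg)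
    qed
    let ?G = "\<lambda>y. \<Sum>s<?M. \<Sum>w\<in>?W. c s w * indicator (?J s \<times> ?C w) y"
    have ir: "integrable ?T (\<lambda>y. c s w * indicator (?J s \<times> ?C w) y)" for s w
      by (intro integrable_mult_right integrable_real_indicator rect) (simp add: T.emeasure_eq_measure)
    have Gi: "integrable ?T ?G" by (intro Bochner_Integration.integrable_sum ir)
    have GJ: "(\<integral>y. ?G y \<partial>?T) = J"
    proof -
      have "(\<integral>y. ?G y \<partial>?T) = (\<Sum>s<?M. \<Sum>w\<in>?W. \<integral>y. c s w * indicator (?J s \<times> ?C w) y \<partial>?T)"
        by (subst Bochner_Integration.integral_sum, intro Bochner_Integration.integrable_sum ir,
            intro sum.cong refl Bochner_Integration.integral_sum ir)
      also have "\<dots> = J"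
        unfolding J_def mrect[symmetric] using sets.sets_into_space[OF rect] by (simp add: Int_absorb2 del: of_nat_Suc)
      finally show ?thesis .
    qed
    have G: "?G y = g (fst y) (snd y)" for y
      unfolding g_def by (cases y) (simp add: indicator_times)
    have ae: "AE y in ?T. \<bar>?F y - ?G y\<bar> \<le> 2 * e"
    proof -
      have 1: "AE \<omega> in iid P1. \<forall>r. \<omega> r < m"
        using AE_iid_set_pmf[of P1] by eventually_elim (use P1_digits in blast)
      show ?thesis
      proof (rule TP.AE_pair_measure)
        have "(\<lambda>y. \<bar>?F y - ?G y\<bar>) \<in> borel_measurable ?T"
          by (intro borel_measurable_abs borel_measurable_diff Fm borel_measurable_integrable Gi)
        from borel_measurable_le[OF this borel_measurable_const[of "2 * e"]]
        show "{y \<in> space ?T. \<bar>?F y - ?G y\<bar> \<le> 2 * e} \<in> sets ?T" .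
        show "AE t in phase_measure \<beta>. AE \<omega> in iid P1. \<bar>?F (t, \<omega>) - ?G (t, \<omega>)\<bar> \<le> 2 * e"
          using AE_typical_phase
        proof eventually_elim
          case (elim t)
          show ?case using 1
          proof eventually_elim
            case (elim \<omega>)
            then show ?case unfolding G fst_conv snd_conv
              using \<open>typical_phase \<beta> t\<close> by (intro close2) (auto simp: typical_phase_def)
          qed
        qed
      qed
    qed
    have JI: "\<bar>J - I\<bar> \<le> 2 * e"
    proof -
      have "J \<le> (\<integral>y. ?F y + 2 * e \<partial>?T)"
        unfolding GJ[symmetric]
        by (rule integral_mono_AE[OF Gi]) (use ae Fi in auto)
      moreover have "I \<le> (\<integral>y. ?G y + 2 * e \<partial>?T)"
        unfolding I_def by (rule integral_mono_AE[OF Fi]) (use ae Gi in auto)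
      moreover have "(\<integral>y. ?F y + 2 * e \<partial>?T) = I + 2 * e"
        unfolding I_def using Fi T.prob_space by (subst Bochner_Integration.integral_add) auto
      moreover have "(\<integral>y. ?G y + 2 * e \<partial>?T) = J + 2 * e"
        unfolding GJ[symmetric] using T.prob_space by (subst Bochner_Integration.integral_add[OF Gi]) auto
      ultimately show ?thesis by linarith
    qed
    have "\<forall>\<^sub>F N in sequentially. \<bar>(\<Sum>k<N. g (?t k) (?\<omega> k)) / real N - J\<bar> < e"
      using tendstoD[OF avg e] by (simp add: dist_real_def)
    with A show "\<forall>\<^sub>F N in sequentially. dist ((\<Sum>k<N. f (\<nu> k)) / real N) I < e0"
    proof eventually_elim
      case (elim N)
      have "(\<Sum>k<N. f (\<nu> k) - g (?t k) (?\<omega> k)) / real N = (\<Sum>k<N. f (\<nu> k)) / real N - (\<Sum>k<N. g (?t k) (?\<omega> k)) / real N"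
        by (simp add: sum_subtractf diff_divide_distrib)
      then show ?case using elim JI unfolding dist_real_def e_def by linarith
    qed
  qed
  moreover have "\<forall>\<^sub>F N in sequentially. (\<Sum>k<N. f (\<nu> k)) / real N = (\<integral>x. f x \<partial>empirical_distribution N \<nu>)"
    using eventually_gt_at_top[of 0] by eventually_elim (rule integral_empirical_distribution[OF _ \<nu>p fm, symmetric])
  ultimately show "(\<lambda>N. \<integral>x. f x \<partial>empirical_distribution N \<nu>) \<longlonglongrightarrow> (\<integral>x. f x \<partial>driver_law \<beta>)"
    unfolding I by (rule Lim_transform_eventually)
qed

end

section \<open>Reading digits off a point\<close>

definition read_digits :: "nat \<Rightarrow> bool \<Rightarrow> real \<Rightarrow> nat \<Rightarrow> nat" where
  "read_digits b f y r = (if f then b - 1 else nat (\<lfloor>real b ^ Suc r * y\<rfloor> mod int b))"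

lemma read_digits_value:
  assumes b: "2 \<le> b" and z: "adapted b f z"
  shows "read_digits b f (digit_value b z) = z"
proof (cases f)
  case True
  then show ?thesis using z by (auto simp: read_digits_def adapted_def)
next
  case False
  have "nat (\<lfloor>real b ^ Suc r * digit_value b z\<rfloor> mod int b) = z r" for r
    using z
  proof (induction r arbitrary: z)
    case (0 z)
    have ad: "adapted b f (seq_drop 1 z)" by (rule adapted_seq_drop[OF 0])
    have zb: "\<And>r. z r < b" using 0 by (simp add: adapted_def)
    let ?v = "digit_value b (seq_drop 1 z)"
    have v: "0 \<le> ?v" "?v < 1" using adapted_value[OF b ad] False by auto
    have "real b ^ Suc 0 * digit_value b z = real (z 0) + ?v" using digit_value_step[where z=z, OF b zb] b by simp
    then have "\<lfloor>real b ^ Suc 0 * digit_value b z\<rfloor> = int (z 0)" using v by (simp only: floor_eq_iff) simp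
    then show ?case using zb[of 0] by (simp only: nat_mod_as_int[symmetric]) (simp add: zmod_int[symmetric])
  next
    case (Suc r z)
    have ad: "adapted b f (seq_drop 1 z)" by (rule adapted_seq_drop[OF Suc.prems])
    have zb: "\<And>r. z r < b" using Suc.prems by (simp add: adapted_def)
    let ?v = "digit_value b (seq_drop 1 z)"
    have "real b ^ Suc (Suc r) * digit_value b z = of_int (int b * (int b ^ r * int (z 0))) + real b ^ Suc r * ?v"
    proof -
      have bv: "real b * digit_value b z = real (z 0) + ?v" using digit_value_step[where z=z, OF b zb] b by simp
      have "real b ^ Suc (Suc r) * digit_value b z = real b ^ Suc r * (real b * digit_value b z)" by simp
      then show ?thesis unfolding bv by (simp add: algebra_simps)
    qed
    then have "\<lfloor>real b ^ Suc (Suc r) * digit_value b z\<rfloor> mod int b = \<lfloor>real b ^ Suc r * ?v\<rfloor> mod int b"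
      by (simp only: floor_add_int[symmetric] int_add_floor[symmetric] mod_mult_self4)
    then show ?case using Suc.IH[OF ad] by simp
  qed
  then show ?thesis using False by (auto simp: read_digits_def)
qed

lemma measurable_read_digits: "read_digits b f \<in> borel \<rightarrow>\<^sub>M seq_space"
proof (rule measurable_PiM_single')
  fix r
  have "(\<lambda>y::real. \<lfloor>real b ^ Suc r * y\<rfloor>) \<in> borel \<rightarrow>\<^sub>M count_space UNIV" by measurable
  then have "(\<lambda>y::real. nat (\<lfloor>real b ^ Suc r * y\<rfloor> mod int b)) \<in> borel \<rightarrow>\<^sub>M count_space UNIV"
    by (rule measurable_compose) simp
  then show "(\<lambda>y. read_digits b f y r) \<in> borel \<rightarrow>\<^sub>M count_space UNIV"
    by (cases f) (simp_all add: read_digits_def)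
qed auto

section \<open>Bernoulli measures as laws of independent digits\<close>

definition digit_point :: "nat \<Rightarrow> nat \<Rightarrow> (nat \<Rightarrow> nat \<times> nat) \<Rightarrow> real \<times> real" where
  "digit_point m n z = (digit_value m (\<lambda>r. fst (z r)), digit_value n (\<lambda>r. snd (z r)))"

lemma measurable_seq_map: "(\<lambda>z r. h (z r)) \<in> seq_space \<rightarrow>\<^sub>M seq_space"
proof (rule measurable_PiM_single')
  fix r
  show "(\<lambda>z. h (z r)) \<in> seq_space \<rightarrow>\<^sub>M count_space UNIV"
    by (rule measurable_compose[OF measurable_component_singleton[of r UNIV "\<lambda>_. count_space UNIV"]]) simp_all
qed auto

lemma borel_measurable_digit_point: "digit_point m n \<in> borel_measurable seq_space"
  unfolding digit_point_def[abs_def]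
  by (intro borel_measurable_Pair measurable_compose[OF measurable_seq_map borel_measurable_digit_value])

lemma bernoulli_as_iid:
  assumes mn: "2 \<le> m" "m < n" and \<mu>: "bernoulli_for m n \<mu>"
  obtains P where "set_pmf P \<subseteq> {..<m} \<times> {..<n}" "\<mu> = distr (iid P) borel (digit_point m n)"
proof -
  obtain p M where p: "\<And>i j. i < m \<Longrightarrow> j < n \<Longrightarrow> 0 \<le> p i j" and p1: "(\<Sum>i<m. \<Sum>j<n. p i j) = 1"
    and M: "symbolic_bernoulli m n p M" and \<mu>M: "\<mu> = distr M borel (digit_map m n)"
    using \<mu> unfolding bernoulli_for_def by blast
  let ?D = "{..<m} \<times> {..<n}"
  define q where "q x = (if x \<in> ?D then p (fst x) (snd x) else 0)" for x
  have q0: "0 \<le> q x" for x using p by (auto simp: q_def)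
  have q1: "(\<integral>\<^sup>+x. ennreal (q x) \<partial>count_space UNIV) = 1"
  proof -
    have "(\<integral>\<^sup>+x. ennreal (q x) \<partial>count_space UNIV) = (\<integral>\<^sup>+x. ennreal (q x) * indicator ?D x \<partial>count_space UNIV)"
      by (rule nn_integral_cong) (auto simp: q_def indicator_def)
    also have "\<dots> = (\<Sum>x\<in>?D. ennreal (q x))"
      by (simp add: nn_integral_count_space_indicator[symmetric] nn_integral_count_space_finite)
    also have "\<dots> = ennreal (\<Sum>x\<in>?D. p (fst x) (snd x))"
      using p by (subst sum_ennreal) (auto simp: q_def intro!: arg_cong[where f=ennreal])
    also have "(\<Sum>x\<in>?D. p (fst x) (snd x)) = 1"
      unfolding p1[symmetric] sum.cartesian_product by (simp add: split_beta')
    finally show ?thesis by simp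
  qed
  define P where "P = embed_pmf q"
  have pmf: "pmf P x = q x" for x unfolding P_def by (rule pmf_embed_pmf[OF q0 q1])
  have sub: "set_pmf P \<subseteq> ?D" by (auto simp: set_pmf_iff pmf q_def split: if_splits)
  let ?A = "\<Pi>\<^sub>M l\<in>(UNIV :: nat set). count_space {..<m}" and ?B = "\<Pi>\<^sub>M l\<in>(UNIV :: nat set). count_space {..<n}"
  have sM: "sets M = sets (?A \<Otimes>\<^sub>M ?B)" using M by (simp add: symbolic_bernoulli_def)
  have spM: "space M = {u. \<forall>l. u l < m} \<times> {v. \<forall>l. v l < n}"
    using sets_eq_imp_space_eq[OF sM] by (auto simp: space_pair_measure space_PiM)
  let ?zip = "\<lambda>(i, j) r. (i r, j r)"
  have zip: "?zip \<in> M \<rightarrow>\<^sub>M seq_space"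
  proof -
    have "(\<lambda>x r. (fst x r, snd x r)) \<in> ?A \<Otimes>\<^sub>M ?B \<rightarrow>\<^sub>M seq_space"
    proof (rule measurable_PiM_single')
      fix r
      have c: "(\<lambda>x. x) \<in> count_space S \<rightarrow>\<^sub>M count_space UNIV" for S :: "nat set" by simp
      have f: "(\<lambda>x. fst x r) \<in> ?A \<Otimes>\<^sub>M ?B \<rightarrow>\<^sub>M count_space {..<m}"
        by (rule measurable_compose[OF measurable_fst measurable_component_singleton]) simp
      have g: "(\<lambda>x. snd x r) \<in> ?A \<Otimes>\<^sub>M ?B \<rightarrow>\<^sub>M count_space {..<n}"
        by (rule measurable_compose[OF measurable_snd measurable_component_singleton]) simp
      from measurable_Pair[OF measurable_compose[OF f c] measurable_compose[OF g c]]
      show "(\<lambda>x. (fst x r, snd x r)) \<in> ?A \<Otimes>\<^sub>M ?B \<rightarrow>\<^sub>M count_space UNIV"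
        by (simp only: pair_measure_countable[OF countableI_type countableI_type] UNIV_Times_UNIV)
    qed auto
    then show ?thesis unfolding measurable_cong_sets[OF sM refl] by (simp add: split_beta')
  qed
  have cylM: "emeasure M (cylinder m k i \<times> cylinder n k j) = ennreal (\<Prod>l<k. p (i l) (j l))"
    if "\<And>l. l < k \<Longrightarrow> i l < m \<and> j l < n" for k i j
    using M that unfolding symbolic_bernoulli_def by blast
  have iid: "distr M seq_space ?zip = iid P"
  proof (rule word_cylinders_determine)
    have "space M = cylinder m 0 i \<times> cylinder n 0 j" for i j by (auto simp: spM cylinder_def)
    then have "prob_space M" using cylM[of 0] by (intro prob_spaceI) simp
    then show "prob_space (distr M seq_space ?zip)" by (rule prob_space.prob_space_distr[OF _ zip])
    show "sets (iid P) = sets seq_space" by (rule sets_iid)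
    fix k and w :: "nat \<Rightarrow> nat \<times> nat"
    let ?W = "{z. \<forall>r<k. z r = w r}"
    have W: "?W = cyl k (\<lambda>r. {w r})" by (auto simp: cyl_def)
    have l: "emeasure (distr M seq_space ?zip) ?W = emeasure M (?zip -` ?W \<inter> space M)"
      by (rule emeasure_distr[OF zip]) (simp add: W sets_cyl)
    have r: "emeasure (iid P) ?W = (\<Prod>r<k. ennreal (q (w r)))"
      unfolding W emeasure_iid_cyl by (simp add: emeasure_pmf_single pmf)
    show "emeasure (distr M seq_space ?zip) ?W = emeasure (iid P) ?W"
    proof (cases "\<forall>r<k. w r \<in> ?D")
      case True
      have "?zip -` ?W \<inter> space M = cylinder m k (\<lambda>r. fst (w r)) \<times> cylinder n k (\<lambda>r. snd (w r))"
        by (auto simp: spM cylinder_def prod_eq_iff)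
      also have "emeasure M \<dots> = ennreal (\<Prod>r<k. p (fst (w r)) (snd (w r)))"
        by (rule cylM) (use True in \<open>auto simp: mem_Times_iff\<close>)
      also have "(\<Prod>r<k. p (fst (w r)) (snd (w r))) = (\<Prod>r<k. q (w r))"
        using True by (intro prod.cong) (auto simp: q_def)
      finally show ?thesis unfolding l r using q0 by (simp add: prod_ennreal)
    next
      case False
      then obtain r0 where r0: "r0 < k" "w r0 \<notin> ?D" by blast
      have "?zip -` ?W \<inter> space M = {}"
      proof -
        have "x \<notin> ?zip -` ?W \<inter> space M" for x
        proof
          assume x: "x \<in> ?zip -` ?W \<inter> space M"
          then have "(fst x r0, snd x r0) = w r0" using r0(1) by (auto simp: split_beta')
          moreover have "fst x r0 < m" "snd x r0 < n" using x by (auto simp: spM)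
          ultimately show False using r0(2) by (metis mem_Sigma_iff lessThan_iff)
        qed
        then show ?thesis by blast
      qed
      moreover have "(\<Prod>r<k. ennreal (q (w r))) = 0" using r0 by (auto simp: q_def)
      ultimately show ?thesis unfolding l r by simp
    qed
  qed (rule sets_distr)
  have "\<mu> = distr M borel (digit_point m n \<circ> ?zip)"
    unfolding \<mu>M
  proof (rule distr_cong)
    fix x assume "x \<in> space M"
    then show "digit_map m n x = (digit_point m n \<circ> ?zip) x"
      using digit_map_eq[of m n "fst x" "snd x"] mn by (auto simp: spM digit_point_def)
  qed simp_all
  also have "\<dots> = distr (distr M seq_space ?zip) borel (digit_point m n)"
    by (rule distr_distr[OF borel_measurable_digit_point zip, symmetric])
  finally show ?thesis using that[OF sub] unfolding iid by blast
qed

context digit_system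
begin

abbreviation bernoulli :: "(real \<times> real) measure" where
  "bernoulli \<equiv> distr (iid P) borel (digit_point m n)"

lemma measurable_digit_point_iid: "digit_point m n \<in> borel_measurable (iid P)"
  unfolding measurable_cong_sets[OF sets_iid refl] by (rule borel_measurable_digit_point)

lemma law_identity: "law 0 (\<lambda>i. i) = bernoulli"
proof -
  have "stretch n 0 = (\<lambda>x. x)" using n2 by (auto simp: stretch_def)
  then have "law 0 (\<lambda>i. i) = distr sample borel (digit_point m n \<circ> (\<lambda>(i, u) r. (i r, ysel i u r)))"
    unfolding law_def by (intro distr_cong) (auto simp: sample_point_def digit_point_def)
  also have "\<dots> = distr (distr sample seq_space (\<lambda>(i, u) r. (i r, ysel i u r))) borel (digit_point m n)"
    by (rule distr_distr[OF borel_measurable_digit_point measurable_zip, symmetric])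
  finally show ?thesis unfolding iid_P_eq .
qed

lemma AE_iid_adapted:
  "AE z in iid P. adapted m right_closed (\<lambda>r. fst (z r)) \<and> adapted n top_closed (\<lambda>r. snd (z r))"
proof -
  have "AE z in iid P. adapted m right_closed (\<lambda>r. fst (z r))"
    unfolding right_closed_def by (rule AE_adapted) (use P_digits in auto)
  moreover have "AE z in iid P. adapted n top_closed (\<lambda>r. snd (z r))"
    unfolding top_closed_def by (rule AE_adapted) (use P_digits in auto)
  ultimately show ?thesis by eventually_elim blast
qed

lemma AE_digit_point:
  assumes R: "AE z in iid P. R z"
  shows "AE x in bernoulli. \<exists>z. R z \<and> x = digit_point m n z"
proof -
  define dec where "dec x = (\<lambda>r. (read_digits m right_closed (fst x) r, read_digits n top_closed (snd x) r))" for x :: "real \<times> real"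
  have dec: "dec \<in> borel \<rightarrow>\<^sub>M seq_space"
    unfolding dec_def
  proof (rule measurable_PiM_single')
    fix r
    have "(\<lambda>x::real \<times> real. read_digits m right_closed (fst x) r) \<in> borel \<rightarrow>\<^sub>M count_space UNIV"
      "(\<lambda>x::real \<times> real. read_digits n top_closed (snd x) r) \<in> borel \<rightarrow>\<^sub>M count_space UNIV"
      unfolding borel_prod[symmetric]
      by (rule measurable_compose[OF measurable_compose[OF measurable_fst measurable_read_digits] measurable_coordinate],
          rule measurable_compose[OF measurable_compose[OF measurable_snd measurable_read_digits] measurable_coordinate])
    from measurable_Pair[OF this]
    show "(\<lambda>x::real \<times> real. (read_digits m right_closed (fst x) r, read_digits n top_closed (snd x) r)) \<in> borel \<rightarrow>\<^sub>M count_space UNIV"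
      by (simp only: pair_measure_countable[OF countableI_type countableI_type] UNIV_Times_UNIV)
  qed auto
  have dp: "dec (digit_point m n z) = z" if "adapted m right_closed (\<lambda>r. fst (z r)) \<and> adapted n top_closed (\<lambda>r. snd (z r))" for z
    using read_digits_value[OF m2 that[THEN conjunct1]] read_digits_value[OF n2 that[THEN conjunct2]]
    by (simp add: dec_def digit_point_def)
  obtain N where N: "N \<in> null_sets (iid P)" "{z. \<not> R z} \<subseteq> N" using R by (auto simp: eventually_ae_filter)
  let ?H = "{x. dec x \<notin> N \<and> digit_point m n (dec x) = x}"
  have Nm: "N \<in> sets seq_space" using N(1) null_setsD2 sets_iid by blast
  have "{x \<in> space borel. dec x \<notin> N} \<inter> {x \<in> space borel. digit_point m n (dec x) = x} \<in> sets borel"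
  proof (rule sets.Int)
    have "{x \<in> space borel. dec x \<notin> N} = space borel - (dec -` N \<inter> space borel)" by auto
    then show "{x \<in> space borel. dec x \<notin> N} \<in> sets borel" using measurable_sets[OF dec Nm] by auto
    show "{x \<in> space borel. digit_point m n (dec x) = x} \<in> sets borel"
    proof -
      have f: "(\<lambda>x. digit_point m n (dec x)) \<in> borel \<rightarrow>\<^sub>M borel" by (rule measurable_compose[OF dec borel_measurable_digit_point])
      have pr: "fst \<in> borel_measurable (borel :: (real \<times> real) measure)" "snd \<in> borel_measurable (borel :: (real \<times> real) measure)"
        unfolding borel_prod[symmetric] by (rule measurable_fst, rule measurable_snd)
      have "{x \<in> space borel. digit_point m n (dec x) = x} =
        {x \<in> space borel. fst (digit_point m n (dec x)) = fst x} \<inter> {x \<in> space borel. snd (digit_point m n (dec x)) = snd x}"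
        by (auto simp: prod_eq_iff)
      also have "\<dots> \<in> sets borel"
        by (intro sets.Int borel_measurable_eq measurable_compose[OF f] pr)
      finally show ?thesis .
    qed
  qed
  also have "{x \<in> space borel. dec x \<notin> N} \<inter> {x \<in> space borel. digit_point m n (dec x) = x} = ?H" by auto
  finally have H: "?H \<in> sets borel" .
  have "AE z in iid P. digit_point m n z \<in> ?H"
    using AE_iid_adapted AE_not_in[OF N(1)] by eventually_elim (simp add: dp)
  then have "AE x in bernoulli. x \<in> ?H"
    using AE_distr_iff[OF measurable_digit_point_iid, of "\<lambda>x. x \<in> ?H"] H by simp
  then show ?thesis
  proof eventually_elim
    case (elim x)
    then have "R (dec x)" "x = digit_point m n (dec x)" using N(2) by auto
    then show ?case by blast
  qed
qed

end

section \<open>Cells of the partition and their digits\<close>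

lemma partition_iter_unique:
  assumes \<Delta>: "partition_operator E \<Delta>" and B: "B \<in> E"
  shows "partition_iter \<Delta> k B \<subseteq> E"
    and "A \<in> partition_iter \<Delta> k B \<Longrightarrow> A' \<in> partition_iter \<Delta> k B \<Longrightarrow> x \<in> A \<Longrightarrow> x \<in> A' \<Longrightarrow> A = A'"
proof -
  have part: "\<Delta> C \<subseteq> E" "partition_on C (\<Delta> C)" if "C \<in> E" for C
    using \<Delta> that by (auto simp: partition_operator_def)
  have sub: "partition_iter \<Delta> k B \<subseteq> E" for k
    by (induction k) (use B part(1) in auto)
  then show "partition_iter \<Delta> k B \<subseteq> E" .
  show "A \<in> partition_iter \<Delta> k B \<Longrightarrow> A' \<in> partition_iter \<Delta> k B \<Longrightarrow> x \<in> A \<Longrightarrow> x \<in> A' \<Longrightarrow> A = A'"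
  proof (induction k arbitrary: A A')
    case 0
    then show ?case by simp
  next
    case (Suc k)
    obtain C C' where C: "C \<in> partition_iter \<Delta> k B" "A \<in> \<Delta> C" "C' \<in> partition_iter \<Delta> k B" "A' \<in> \<Delta> C'"
      using Suc.prems(1,2) by auto
    have CE: "C \<in> E" "C' \<in> E" using C sub by blast+
    have "x \<in> C" "x \<in> C'" using part(2)[OF CE(1)] part(2)[OF CE(2)] C(2,4) Suc.prems(3,4) by (auto simp: partition_on_def)
    then have "C = C'" by (rule Suc.IH[OF C(1,3)])
    then show ?case using part(2)[OF CE(1)] C(2,4) Suc.prems(3,4) by (auto simp: partition_on_def disjoint_def)
  qed
qed

lemma digit_side_Suc:
  assumes "2 \<le> b" "w k < b"
  shows "sub_side b (w k) (digit_side b k w True) = digit_side b (Suc k) w True"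
proof -
  have p: "prefix_value b (Suc k) w = prefix_value b k w + real (w k) * (1 / real b ^ k) / real b"
    by (simp add: prefix_value_def)
  have b0: "real b > 0" using assms by simp
  have "prefix_value b k w + real (Suc (w k)) * (1 / real b ^ k) / real b = prefix_value b (Suc k) w + 1 / real b ^ Suc k"
    unfolding p using b0 by (simp add: add_divide_distrib distrib_right)
  moreover have "Suc (w k) = b \<and> (\<forall>r<k. w r = b - 1) \<longleftrightarrow> (\<forall>r<Suc k. w r = b - 1)"
    using assms by (auto simp: less_Suc_eq)
  ultimately show ?thesis
    unfolding sub_side_def len_digit_side by (simp add: digit_side_def p del: of_nat_Suc)
qed

context digit_system
begin

definition rows :: "nat \<Rightarrow> nat" where "rows k = nat \<lfloor>real k * \<alpha>\<rfloor>"

definition cell_sides :: "(nat \<Rightarrow> nat) \<Rightarrow> (nat \<Rightarrow> nat) \<Rightarrow> nat \<Rightarrow> side \<times> side" where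
  "cell_sides i j k = (digit_side m k i True, digit_side n (rows k) j True)"

lemma rows_bounds: "real (rows k) \<le> real k * \<alpha>" "real k * \<alpha> < real (rows k) + 1"
proof -
  have "0 \<le> real k * \<alpha>" using \<alpha>_facts by simp
  then show "real (rows k) \<le> real k * \<alpha>" "real k * \<alpha> < real (rows k) + 1" unfolding rows_def by linarith+
qed

lemma rows_Suc: "rows (Suc k) = (if real (rows k) + 1 \<le> real (Suc k) * \<alpha> then Suc (rows k) else rows k)"
proof -
  have s: "real (Suc k) * \<alpha> = real k * \<alpha> + \<alpha>" by (simp add: algebra_simps)
  note b = rows_bounds[of k] rows_bounds[of "Suc k"]
  have "real (rows (Suc k)) < real (rows k) + 2" "real (rows k) < real (rows (Suc k)) + 1"
    using b \<alpha>_facts unfolding s by linarith+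
  then have "rows (Suc k) = rows k \<or> rows (Suc k) = Suc (rows k)" by linarith
  then show ?thesis using b by auto
qed

lemma rows_le: "rows k \<le> k"
proof -
  have "real (rows k) \<le> real k * 1" using rows_bounds(1)[of k] \<alpha>_facts mult_left_mono[of \<alpha> 1 "real k"] by linarith
  then show ?thesis by simp
qed

lemma power_m: "real m ^ k = real n powr (real k * \<alpha>)"
proof -
  have "real n powr (real k * \<alpha>) = (real n powr \<alpha>) powr real k" by (simp add: powr_powr mult.commute)
  then show ?thesis using \<alpha>_facts m2 by (simp add: powr_realpow)
qed

lemma power_n: "real n ^ l = real n powr real l" using n2 by (simp add: powr_realpow)

lemma len_cell_sides: "len (fst (cell_sides i j k)) = 1 / real m ^ k" "len (snd (cell_sides i j k)) = 1 / real n ^ rows k"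
  by (simp_all add: cell_sides_def len_digit_side)

lemma asq_sides_cell: "asq_sides n (cell_sides i j k)"
proof -
  have n1: "1 < real n" using n2 by simp
  have m0: "0 < real m" using m2 by simp
  have 1: "real n ^ rows k \<le> real m ^ k" unfolding power_m power_n using rows_bounds(1) n1 by simp
  have "real m ^ k < real n powr (real (rows k) + 1)" unfolding power_m using rows_bounds(2) n1 by simp
  also have "\<dots> = real n * real n ^ rows k" using n1 by (simp add: powr_add power_n)
  finally have 2: "real m ^ k < real n * real n ^ rows k" .
  show ?thesis unfolding asq_sides_def len_cell_sides using 1 2 m0 n1 by (simp add: field_simps)
qed

lemma splits_cell: "splits m n (cell_sides i j k) \<longleftrightarrow> real (rows k) + 1 \<le> real (Suc k) * \<alpha>"
proof -
  have n1: "1 < real n" using n2 by simp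
  have m0: "0 < real m" using m2 by simp
  have "splits m n (cell_sides i j k) \<longleftrightarrow> real n * real n ^ rows k \<le> real m ^ Suc k"
    unfolding splits_def len_cell_sides using m0 n1 by (simp add: field_simps)
  also have "real n * real n ^ rows k = real n powr (real (rows k) + 1)" using n1 by (simp add: powr_add power_n)
  also have "real n powr (real (rows k) + 1) \<le> real m ^ Suc k \<longleftrightarrow> real (rows k) + 1 \<le> real (Suc k) * \<alpha>"
    unfolding power_m using n1 by simp
  finally show ?thesis .
qed

lemma cell_step:
  assumes "\<And>r. i r < m" "\<And>r. j r < n"
  shows "box_of (cell_sides i j (Suc k)) \<in> asq_operator m n (box_of (cell_sides i j k))"
proof -
  let ?c = "cell_sides i j k"
  let ?l = "if splits m n ?c then j (rows k) else 0"
  have "sub_box m n ?c (i k) ?l = cell_sides i j (Suc k)"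
    unfolding sub_box_def splits_cell using digit_side_Suc[of m i k, OF m2 assms(1)] digit_side_Suc[of n j "rows k", OF n2 assms(2)]
    by (simp add: cell_sides_def rows_Suc)
  moreover have "(i k, ?l) \<in> sub_indices m n ?c" using assms by (simp add: sub_indices_def)
  ultimately show ?thesis
    unfolding asq_operator_box[OF m2 mn asq_sides_cell] by (intro image_eqI[of _ _ "(i k, ?l)"]) simp_all
qed

lemma cell_in_iter:
  assumes "\<And>r. i r < m" "\<And>r. j r < n"
  shows "box_of (cell_sides i j k) \<in> partition_iter (asq_operator m n) k (box_of (cell_sides i j 0))"
  by (induction k) (use cell_step[of i j, OF assms] in auto)

lemma mem_cell:
  assumes "adapted m right_closed i" "adapted n top_closed j"
  shows "(digit_value m i, digit_value n j) \<in> box_of (cell_sides i j k)"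
  unfolding box_of_def cell_sides_def digit_side_def
  using mem_digit_interval[OF m2 assms(1), of k i True] mem_digit_interval[OF n2 assms(2), of "rows k" j True] assms
  by (simp add: adapted_def)

lemma initial_box: "box_of (cell_sides i j 0) = normal_box (base_rect n 0)"
proof -
  have c: "cell_sides i j 0 = ((0, 1, True, True), (0, 1, True, True))"
    by (simp add: cell_sides_def digit_side_def prefix_value_def rows_def)
  have b: "box_of (cell_sides i j 0) = base_rect n 0"
    unfolding c box_of_def base_rect_def using n2 by (auto simp: order_le_less)
  have "normal_box (box_of (cell_sides i j 0)) = box_of (norm_sides (cell_sides i j 0))"
    by (rule normal_box_box_of) (simp_all add: c)
  also have "norm_sides (cell_sides i j 0) = cell_sides i j 0"
    by (simp add: c norm_sides_def norm_scale_def move_side_def)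
  finally show ?thesis unfolding b by (rule sym)
qed

lemma cell_eq:
  assumes "adapted m right_closed i" "adapted n top_closed j"
  shows "cell (asq_operator m n) (normal_box (base_rect n 0)) k (digit_value m i, digit_value n j) = box_of (cell_sides i j k)"
proof -
  have d: "\<And>r. i r < m" "\<And>r. j r < n" using assms by (auto simp: adapted_def)
  have E: "box_of (cell_sides i j 0) \<in> asq_boxes n" unfolding asq_boxes_eq[OF n2] using asq_sides_cell by blast
  show ?thesis
    unfolding cell_def initial_box[of i j, symmetric]
  proof (rule the_equality)
    show *: "box_of (cell_sides i j k) \<in> partition_iter (asq_operator m n) k (box_of (cell_sides i j 0)) \<and>
        (digit_value m i, digit_value n j) \<in> box_of (cell_sides i j k)"
      by (intro conjI cell_in_iter[of i j, OF d] mem_cell[OF assms])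
    fix A assume "A \<in> partition_iter (asq_operator m n) k (box_of (cell_sides i j 0)) \<and> (digit_value m i, digit_value n j) \<in> A"
    with * show "A = box_of (cell_sides i j k)"
      by (intro partition_iter_unique(2)[OF partition_operator_asq[OF m2 mn] E, of A k _ "(digit_value m i, digit_value n j)"]) blast+
  qed
qed

lemma rescaled_cell:
  assumes d: "\<And>r. z r \<in> set_pmf P"
  defines "i \<equiv> \<lambda>r. fst (z r)" and "j \<equiv> \<lambda>r. snd (z r)"
  shows "rescale bernoulli (box_of (cell_sides i j k)) =
    law (frac (real k * \<alpha>)) (comb_seq (k - rows k) (seq_drop (rows k) i))"
proof -
  have im: "i r < m" and jn: "j r < n" for r using d[of r] P_digits by (auto simp: i_def j_def)
  have pos: "pmf P1 (i r) \<noteq> 0" "pmf (K (i r)) (j r) \<noteq> 0" for r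
    using d[of r] pmf_P[of "i r" "j r"] by (auto simp: i_def j_def set_pmf_iff)
  let ?l = "rows k"
  let ?w = "ennreal ((\<Prod>r<k. pmf P1 (i r)) * (\<Prod>r<?l. pmf (K (i r)) (j r)))"
  have w: "?w \<noteq> 0" using pos by (simp add: ennreal_eq_0_iff not_le less_le prod_nonneg mult_nonneg_nonneg)
  have n0: "real n powr 0 = 1" using n2 by simp
  have box: "(move_side (real n powr (- 0 / 2)) 0 (digit_side m k i True), move_side (real n powr (0 / 2)) 0 (digit_side n ?l j True)) = cell_sides i j k"
    unfolding cell_sides_def using n0 by (simp add: move_side_def)
  have "rescale (law 0 (\<lambda>i. i)) (box_of (move_side (real n powr (- 0 / 2)) 0 (digit_side m k i True), move_side (real n powr (0 / 2)) 0 (digit_side n ?l j True))) =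
    law (0 + real k * \<alpha> - real ?l) (comb_seq (k - ?l) (seq_drop ?l i))"
  proof (rule law_on_digit_cell(2)[OF _ measurable_comb_seq_right _ _ _ _ _ _ _ _ refl w])
    show "(\<lambda>i. i) \<in> seq_space \<rightarrow>\<^sub>M seq_space" by simp
    show "AE x in sample. adapted n top_closed (ysel (fst x) (snd x))" using AE_sample_adapted by eventually_elim blast
    show "(\<And>r. r < k \<Longrightarrow> i' r = i r) \<Longrightarrow> r < ?l \<Longrightarrow> i' r = i r" for i' r using rows_le[of k] by simp
    show "(\<And>r. r < k \<Longrightarrow> i' r = i r) \<Longrightarrow> i' (?l + r) = comb_seq (k - ?l) (seq_drop ?l i) (seq_drop k i') r" for i' r
      using rows_le[of k] by (auto simp: comb_seq_def add.commute)
  qed (simp_all add: im jn)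
  moreover have "0 + real k * \<alpha> - real ?l = frac (real k * \<alpha>)"
  proof -
    have "0 \<le> \<lfloor>real k * \<alpha>\<rfloor>" using \<alpha>_facts by simp
    then show ?thesis by (simp add: frac_def rows_def)
  qed
  ultimately show ?thesis unfolding box law_identity by simp
qed

section \<open>The Bernoulli measure generates the chain\<close>

lemma iid_P1_eq: "distr (iid P) seq_space (\<lambda>z r. fst (z r)) = iid P1"
proof (rule word_cylinders_determine)
  have m: "(\<lambda>z r. fst (z r)) \<in> iid P \<rightarrow>\<^sub>M (seq_space :: (nat \<Rightarrow> nat) measure)"
    unfolding measurable_cong_sets[OF sets_iid refl] by (rule measurable_seq_map)
  show "prob_space (distr (iid P) seq_space (\<lambda>z r. fst (z r)))" by (rule prob_space.prob_space_distr[OF prob_space_iid m])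
  show "sets (iid P1) = sets seq_space" by (rule sets_iid)
  fix k and w :: "nat \<Rightarrow> nat"
  let ?W = "{z. \<forall>r<k. z r = w r}"
  have W: "?W = cyl k (\<lambda>r. {w r})" by (auto simp: cyl_def)
  have "emeasure (distr (iid P) seq_space (\<lambda>z r. fst (z r))) ?W = emeasure (iid P) ((\<lambda>z r. fst (z r)) -` ?W \<inter> space (iid P))"
    by (rule emeasure_distr[OF m]) (simp add: W sets_cyl)
  also have "(\<lambda>z r. fst (z r)) -` ?W \<inter> space (iid P) = cyl k (\<lambda>r. fst -` {w r})" by (auto simp: cyl_def)
  also have "emeasure (iid P) \<dots> = (\<Prod>r<k. emeasure (measure_pmf P1) {w r})"
    unfolding emeasure_iid_cyl by (simp add: P1_def)
  also have "\<dots> = emeasure (iid P1) ?W" unfolding W by (rule emeasure_iid_cyl[symmetric])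
  finally show "emeasure (distr (iid P) seq_space (\<lambda>z r. fst (z r))) ?W = emeasure (iid P1) ?W" .
qed (rule sets_distr)

lemma AE_iid_P_fst: "AE i in iid P1. R i \<Longrightarrow> AE z in iid P. R (\<lambda>r. fst (z r))"
proof -
  assume "AE i in iid P1. R i"
  then have "AE i in distr (iid P) seq_space (\<lambda>z r. fst (z r)). R i" unfolding iid_P1_eq .
  moreover have "(\<lambda>z r. fst (z r)) \<in> iid P \<rightarrow>\<^sub>M (seq_space :: (nat \<Rightarrow> nat) measure)"
    unfolding measurable_cong_sets[OF sets_iid refl] by (rule measurable_seq_map)
  ultimately show ?thesis by (rule AE_distrD[rotated])
qed

definition regular_digits :: "(nat \<Rightarrow> nat \<times> nat) \<Rightarrow> bool" where
  "regular_digits z \<longleftrightarrow> adapted m right_closed (\<lambda>r. fst (z r)) \<and> adapted n top_closed (\<lambda>r. snd (z r)) \<and> (\<forall>r. z r \<in> set_pmf P)"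

lemma AE_regular_digits: "AE z in iid P. regular_digits z"
  using AE_iid_adapted AE_iid_set_pmf[of P] unfolding regular_digits_def by eventually_elim blast

lemma rescaled_cell_at:
  assumes z: "regular_digits z"
  shows "rescale bernoulli (cell (asq_operator m n) (normal_box (base_rect n 0)) k (digit_point m n z)) =
    law (frac (real k * \<alpha>)) (comb_seq (k - rows k) (seq_drop (rows k) (\<lambda>r. fst (z r))))"
  using z cell_eq[of "\<lambda>r. fst (z r)" "\<lambda>r. snd (z r)" k] rescaled_cell[of z k]
  by (simp add: regular_digits_def digit_point_def)

lemma generates_multiple:
  assumes q: "0 < q"
  shows "AE x in bernoulli. limitin (weak_topology planar_measures)
    (\<lambda>N. empirical_distribution N (\<lambda>k. rescale bernoulli (cell (asq_operator m n) (normal_box (base_rect n 0)) (q * k) x)))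
    (driver_law (real q * \<alpha>)) sequentially"
proof -
  let ?\<beta> = "real q * \<alpha>"
  have \<beta>: "0 < ?\<beta>" using q \<alpha>_facts by simp
  have "AE z in iid P. regular_digits z \<and> typical_digits ?\<beta> (\<lambda>r. fst (z r))"
    using AE_regular_digits AE_iid_P_fst[OF AE_typical_digits[OF \<beta>]] by eventually_elim blast
  from AE_digit_point[OF this] show ?thesis
  proof eventually_elim
    case (elim x)
    then obtain z where z: "regular_digits z" "typical_digits ?\<beta> (\<lambda>r. fst (z r))" "x = digit_point m n z" by blast
    have qk: "real (q * k) * \<alpha> = real k * ?\<beta>" for k by simp
    have rq: "rows (q * k) = nat \<lfloor>real k * ?\<beta>\<rfloor>" for k unfolding rows_def qk ..
    have d: "filterlim (\<lambda>k. q * k - rows (q * k)) at_top sequentially"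
      unfolding filterlim_at_top
    proof
      fix Z :: nat
      obtain k0 :: nat where k0: "real Z / (1 - \<alpha>) < real k0" using reals_Archimedean2 by blast
      show "\<forall>\<^sub>F k in sequentially. Z \<le> q * k - rows (q * k)"
        unfolding eventually_sequentially
      proof (intro exI[of _ k0] allI impI)
        fix k assume k: "k0 \<le> k"
        have "real Z < real k0 * (1 - \<alpha>)" using k0 \<alpha>_facts by (simp add: pos_divide_less_eq)
        also have "\<dots> \<le> real (q * k) * (1 - \<alpha>)"
        proof (rule mult_right_mono)
          have "k0 \<le> q * k" using k q by (metis One_nat_def Suc_leI le_trans mult.commute mult_le_mono2 mult.right_neutral)
          then show "real k0 \<le> real (q * k)" by (rule of_nat_mono)
        qed (use \<alpha>_facts in simp)
        also have "\<dots> \<le> real (q * k) - real (rows (q * k))"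
          using rows_bounds(1)[of "q * k"] by (simp add: algebra_simps)
        finally show "Z \<le> q * k - rows (q * k)" by linarith
      qed
    qed
    have "(\<lambda>k. rescale bernoulli (cell (asq_operator m n) (normal_box (base_rect n 0)) (q * k) x)) =
      (\<lambda>k. law (frac (real k * ?\<beta>)) (comb_seq (q * k - rows (q * k)) (seq_drop (nat \<lfloor>real k * ?\<beta>\<rfloor>) (\<lambda>r. fst (z r)))))"
      unfolding z(3) rescaled_cell_at[OF z(1)] qk rq ..
    then show ?case using empirical_convergence[OF z(2) d] by simp
  qed
qed

lemma generates_constant:
  "\<exists>Q0. AE x in bernoulli. limitin (weak_topology planar_measures)
    (\<lambda>N. empirical_distribution N (\<lambda>k. rescale bernoulli (cell (asq_operator m n) (normal_box (base_rect n 0)) (0 * k) x)))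
    Q0 sequentially"
proof
  let ?\<nu> = "rescale bernoulli (normal_box (base_rect n 0))"
  show "AE x in bernoulli. limitin (weak_topology planar_measures)
    (\<lambda>N. empirical_distribution N (\<lambda>k. rescale bernoulli (cell (asq_operator m n) (normal_box (base_rect n 0)) (0 * k) x)))
    (empirical_distribution 1 (\<lambda>_. ?\<nu>)) sequentially"
    using AE_digit_point[OF AE_regular_digits]
  proof eventually_elim
    case (elim x)
    then obtain z where z: "regular_digits z" "x = digit_point m n z" by blast
    have c: "cell (asq_operator m n) (normal_box (base_rect n 0)) 0 x = normal_box (base_rect n 0)"
      unfolding z(2) using cell_eq[of "\<lambda>r. fst (z r)" "\<lambda>r. snd (z r)" 0] z(1) initial_box
      by (simp add: regular_digits_def digit_point_def)
    have \<nu>: "?\<nu> \<in> prob_measures euclidean"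
      using rescaled_cell_at[OF z(1), of 0] law_prob_measures[OF measurable_comb_seq_right] c z(2) by simp
    show ?case unfolding mult_0 c
    proof (rule limitin_weak_topology)
      show "\<forall>\<^sub>F N in sequentially. empirical_distribution N (\<lambda>_. ?\<nu>) \<in> prob_measures planar_measures"
        using eventually_gt_at_top[of 0] by eventually_elim (rule empirical_distribution_prob[OF _ \<nu>])
      show "empirical_distribution 1 (\<lambda>_. ?\<nu>) \<in> prob_measures planar_measures"
        by (rule empirical_distribution_prob[OF _ \<nu>]) simp
      fix f :: "(real \<times> real) measure \<Rightarrow> real" assume f: "continuous_map planar_measures euclideanreal f"
      have int: "(\<integral>x. f x \<partial>empirical_distribution N (\<lambda>_. ?\<nu>)) = f ?\<nu>" if "0 < N" for N
        using integral_empirical_distribution[OF that \<nu> borel_measurable_continuous_map[OF f]] that by simp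
      have "\<forall>\<^sub>F N in sequentially. f ?\<nu> = (\<integral>x. f x \<partial>empirical_distribution N (\<lambda>_. ?\<nu>))"
        using eventually_gt_at_top[of 0] by eventually_elim (simp add: int)
      with tendsto_const show "(\<lambda>N. \<integral>x. f x \<partial>empirical_distribution N (\<lambda>_. ?\<nu>)) \<longlonglongrightarrow> (\<integral>x. f x \<partial>empirical_distribution 1 (\<lambda>_. ?\<nu>))"
        unfolding int[OF zero_less_one] by (rule Lim_transform_eventually)
    qed
  qed
qed

lemma prob_space_bernoulli: "prob_space bernoulli"
  by (rule prob_space.prob_space_distr[OF prob_space_iid measurable_digit_point_iid])

lemma bernoulli_on_square: "bernoulli \<in> measures_on (normal_box (base_rect n 0))"
proof -
  interpret prob_space bernoulli by (rule prob_space_bernoulli)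
  have B: "normal_box (base_rect n 0) \<in> sets bernoulli"
    unfolding initial_box[of "\<lambda>_. 0" "\<lambda>_. 0", symmetric] using box_of_borel by simp
  have "AE x in bernoulli. x \<in> normal_box (base_rect n 0)"
    using AE_digit_point[OF AE_regular_digits]
  proof eventually_elim
    case (elim x)
    then obtain z where z: "regular_digits z" "x = digit_point m n z" by blast
    then show ?case
      using mem_cell[of "\<lambda>r. fst (z r)" "\<lambda>r. snd (z r)" 0] unfolding initial_box by (simp add: regular_digits_def digit_point_def)
  qed
  then have "emeasure bernoulli (normal_box (base_rect n 0)) = 1"
    using prob_eq_1[OF B] by (simp add: emeasure_eq_measure)
  then show ?thesis by (simp add: measures_on_def prob_measures_euclidean prob_space_bernoulli)
qed

lemma chain_component_law: "measure_component chain = driver_law \<alpha>"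
  unfolding chain_component driver_law_def driver_def ..

lemma bernoulli_generates_chain: "generates (asq_operator m n) (base_rect n 0) bernoulli chain"
  unfolding generates_def
proof (intro conjI allI)
  show "bernoulli \<in> measures_on (normal_box (base_rect n 0))" by (rule bernoulli_on_square)
  show "AE x in bernoulli. limitin (weak_topology planar_measures)
      (\<lambda>N. empirical_distribution N (\<lambda>k. rescale bernoulli (cell (asq_operator m n) (normal_box (base_rect n 0)) k x)))
      (measure_component chain) sequentially"
    using generates_multiple[of 1] by (simp add: chain_component_law)
  fix q
  show "\<exists>Qq. AE x in bernoulli. limitin (weak_topology planar_measures)
      (\<lambda>N. empirical_distribution N (\<lambda>k. rescale bernoulli (cell (asq_operator m n) (normal_box (base_rect n 0)) (q * k) x)))
      Qq sequentially"
  proof (cases "q = 0")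
    case True
    then show ?thesis using generates_constant by simp
  next
    case False
    then show ?thesis using generates_multiple[of q] by blast
  qed
qed

end

section \<open>The conditional measures on vertical fibres\<close>

lemma measure_eq_rational_halflines:
  fixes M N :: "real measure"
  assumes M: "prob_space M" "sets M = sets borel" and N: "sets N = sets borel"
    and eq: "\<And>q :: rat. emeasure M {..of_rat q} = emeasure N {..of_rat q}"
  shows "M = N"
proof -
  let ?E = "range (\<lambda>q :: rat. {..of_rat q :: real})"
  have gen: "sets borel = sigma_sets UNIV ?E"
  proof (rule antisym)
    have "{..x} \<in> sigma_sets UNIV ?E" for x :: real
    proof -
      have "{..x} = (\<Inter>q\<in>{q :: rat. x < of_rat q}. {..of_rat q})"
      proof (rule set_eqI, rule iffI)
        fix y :: real assume y: "y \<in> (\<Inter>q\<in>{q :: rat. x < of_rat q}. {..of_rat q})"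
        show "y \<in> {..x}"
        proof (rule ccontr)
          assume "y \<notin> {..x}"
          then obtain q where "x < of_rat q" "of_rat q < y" using of_rat_dense[of x y] by auto
          then show False using y by auto
        qed
      qed auto
      also have "\<dots> \<in> sigma_sets UNIV ?E"
      proof -
        interpret sigma_algebra UNIV "sigma_sets UNIV ?E" by (rule sigma_algebra_sigma_sets) simp
        obtain q :: rat where "x < of_rat q" using of_rat_dense[of x "x + 1"] by auto
        then show ?thesis by (intro countable_INT'') auto
      qed
      finally show ?thesis .
    qed
    then have "sigma_sets UNIV (range (\<lambda>a :: real. {..a})) \<subseteq> sigma_sets UNIV ?E"
      by (intro sigma_sets_mono) auto
    moreover have "sets borel = sigma_sets UNIV (range (\<lambda>a :: real. {..a}))"
      using arg_cong[OF borel_eq_atMost, of sets] by (simp add: sets_measure_of)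
    ultimately show "sets borel \<subseteq> sigma_sets UNIV ?E" by simp
    have "a \<in> sets borel" if "a \<in> ?E" for a using that by auto
    then show "sigma_sets UNIV ?E \<subseteq> sets borel"
      using sets.sigma_sets_subset[of ?E borel] by auto
  qed
  interpret M: prob_space M by fact
  show ?thesis
  proof (rule measure_eqI_generator_eq[where E="?E" and \<Omega>=UNIV and A="\<lambda>i. {..of_rat (of_nat i)}"])
    show "Int_stable ?E"
    proof (rule Int_stableI)
      fix a b assume "a \<in> ?E" "b \<in> ?E"
      then obtain p q :: rat where "a = {..of_rat p}" "b = {..of_rat q}" by auto
      then have "a \<inter> b = {..of_rat (min p q)}" by (auto simp: min_def of_rat_less_eq intro: order_trans)
      then show "a \<inter> b \<in> ?E" by blast
    qed
    show "range (\<lambda>i :: nat. {..of_rat (of_nat i)}) \<subseteq> ?E"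
      by (rule image_subsetI) (rule range_eqI, rule refl)
    show "(\<Union>i :: nat. {..of_rat (of_nat i) :: real}) = UNIV"
      using real_arch_simple by (auto simp: of_rat_of_nat_eq)
    show "emeasure M {..of_rat (of_nat i)} \<noteq> \<infinity>" for i by (simp add: M.emeasure_eq_measure)
  qed (use M N gen eq in auto)
qed

context digit_system
begin

definition fibre_law :: "(nat \<Rightarrow> nat) \<Rightarrow> real measure" where
  "fibre_law \<omega> = distr (iid G) borel (\<lambda>u. digit_value n (ysel \<omega> u))"

lemma measurable_fibre_value: "(\<lambda>u. digit_value n (ysel \<omega> u)) \<in> borel_measurable (iid G)"
  unfolding measurable_cong_sets[OF sets_iid refl]
  by (rule measurable_compose[OF measurable_ysel[OF measurable_const measurable_ident_sets[OF refl]] borel_measurable_digit_value]) simp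

lemma measurable_value_iid: "digit_value m \<in> borel_measurable (iid P1)"
  unfolding measurable_cong_sets[OF sets_iid refl] by (rule borel_measurable_digit_value)

lemma bernoulli_first: "distr bernoulli borel fst = distr (iid P1) borel (digit_value m)"
proof -
  have f: "sample_point (\<lambda>i. i) \<in> borel_measurable sample" by (rule measurable_sample_point) simp
  have b: "bernoulli = distr sample borel (sample_point (\<lambda>i. i))"
  proof -
    have "stretch n 0 = (\<lambda>x. x)" using n2 by (auto simp: stretch_def)
    then show ?thesis unfolding law_identity[symmetric] law_def by simp
  qed
  have p: "fst \<in> borel_measurable (borel :: (real \<times> real) measure)"
    unfolding borel_prod[symmetric] by (rule measurable_fst)
  have fs: "fst \<in> sample \<rightarrow>\<^sub>M iid P1" unfolding sample_def by (rule measurable_fst)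
  have "distr bernoulli borel fst = distr sample borel (fst \<circ> sample_point (\<lambda>i. i))"
    unfolding b by (rule distr_distr[OF p f])
  also have "fst \<circ> sample_point (\<lambda>i. i) = digit_value m \<circ> fst" by (auto simp: sample_point_def)
  also have "distr sample borel (digit_value m \<circ> fst) = distr (distr sample (iid P1) fst) borel (digit_value m)"
    by (rule distr_distr[OF measurable_value_iid fs, symmetric])
  also have "distr sample (iid P1) fst = iid P1" unfolding sample_def by (rule IG.distr_pair_fst)
  finally show ?thesis .
qed

lemma bernoulli_rectangle:
  assumes X: "X \<in> sets borel" and Y: "Y \<in> sets borel"
  shows "emeasure bernoulli (X \<times> Y) = (\<integral>\<^sup>+i. emeasure (fibre_law i) Y * indicator X (digit_value m i) \<partial>iid P1)"
    and "(\<lambda>i. emeasure (fibre_law i) Y) \<in> borel_measurable (iid P1)"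
proof -
  have h: "(\<lambda>x. digit_value n (ysel (fst x) (snd x))) \<in> borel_measurable sample"
    unfolding measurable_sample_iff
    by (rule measurable_compose[OF measurable_ysel[OF measurable_fst measurable_snd] borel_measurable_digit_value])
  let ?S = "{x. digit_value m (fst x) \<in> X \<and> digit_value n (ysel (fst x) (snd x)) \<in> Y}"
  let ?T = "{x. digit_value n (ysel (fst x) (snd x)) \<in> Y}"
  have Ts: "?T \<in> sets (iid P1 \<Otimes>\<^sub>M iid G)"
    unfolding sample_def[symmetric] using measurable_sets[OF h Y] by (simp add: vimage_def)
  have fs: "fst \<in> sample \<rightarrow>\<^sub>M iid P1" unfolding sample_def by (rule measurable_fst)
  have "(\<lambda>x. digit_value m (fst x)) -` X \<inter> space sample \<in> sets sample"
    by (rule measurable_sets[OF measurable_compose[OF fs measurable_value_iid] X])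
  then have "{x. digit_value m (fst x) \<in> X} \<inter> ?T \<in> sets (iid P1 \<Otimes>\<^sub>M iid G)"
    unfolding sample_def[symmetric] using Ts[folded sample_def] by (intro sets.Int) (simp_all add: vimage_def)
  also have "{x. digit_value m (fst x) \<in> X} \<inter> ?T = ?S" by auto
  finally have Ss: "?S \<in> sets (iid P1 \<Otimes>\<^sub>M iid G)" .
  have fib: "emeasure (fibre_law i) Y = emeasure (iid G) (Pair i -` ?T)" for i
    unfolding fibre_law_def using emeasure_distr[OF measurable_fibre_value Y, of i] by (simp add: vimage_def)
  show "(\<lambda>i. emeasure (fibre_law i) Y) \<in> borel_measurable (iid P1)"
    unfolding fib by (rule IG.measurable_emeasure_Pair[OF Ts])
  have f: "(\<lambda>x. stretch n 0 (sample_point (\<lambda>i. i) x)) \<in> borel_measurable sample"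
    by (rule measurable_stretched_point) simp
  have st: "stretch n 0 = (\<lambda>x. x)" using n2 by (auto simp: stretch_def)
  have XY: "X \<times> Y \<in> sets borel" unfolding borel_prod[symmetric] using X Y by (rule pair_measureI)
  have "emeasure bernoulli (X \<times> Y) = emeasure sample ((\<lambda>x. stretch n 0 (sample_point (\<lambda>i. i) x)) -` (X \<times> Y) \<inter> space sample)"
    unfolding law_identity[symmetric] law_def by (rule emeasure_distr[OF f XY])
  also have "(\<lambda>x. stretch n 0 (sample_point (\<lambda>i. i) x)) -` (X \<times> Y) \<inter> space sample = ?S"
    by (auto simp: st sample_point_def)
  also have "emeasure sample ?S = (\<integral>\<^sup>+i. emeasure (iid G) (Pair i -` ?S) \<partial>iid P1)"
    unfolding sample_def by (rule IG.emeasure_pair_measure_alt[OF Ss])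
  also have "\<dots> = (\<integral>\<^sup>+i. emeasure (fibre_law i) Y * indicator X (digit_value m i) \<partial>iid P1)"
    unfolding fib by (rule nn_integral_cong) (simp add: indicator_def vimage_def)
  finally show "emeasure bernoulli (X \<times> Y) = (\<integral>\<^sup>+i. emeasure (fibre_law i) Y * indicator X (digit_value m i) \<partial>iid P1)" .
qed

lemma disintegration_unique:
  assumes \<kappa>: "vertical_disintegration bernoulli \<kappa>"
  shows "AE i in iid P1. \<kappa> (digit_value m i) = fibre_law i"
proof -
  have \<kappa>m: "\<kappa> \<in> borel \<rightarrow>\<^sub>M prob_algebra borel"
    using \<kappa> by (intro measurable_prob_algebra_of_weak) (simp add: vertical_disintegration_def)
  have \<kappa>p: "prob_space (\<kappa> x)" "sets (\<kappa> x) = sets borel" for x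
    using measurable_space[OF \<kappa>m, of x] by (auto simp: space_prob_algebra)
  have ad: "AE i in iid P1. adapted m right_closed i"
    using AE_fibre_regular by eventually_elim (simp add: fibre_regular_def)
  have "AE i in iid P1. emeasure (\<kappa> (digit_value m i)) Y = emeasure (fibre_law i) Y" if Y: "Y \<in> sets borel" for Y
  proof (rule I1.density_unique_finite_measure)
    have k: "(\<lambda>x. emeasure (\<kappa> x) Y) \<in> borel_measurable borel"
      by (rule measurable_compose[OF measurable_prob_algebraD[OF \<kappa>m] measurable_emeasure_subprob_algebra[OF Y]])
    then show "(\<lambda>i. emeasure (\<kappa> (digit_value m i)) Y) \<in> borel_measurable (iid P1)"
      by (rule measurable_compose[OF measurable_value_iid])
    show "(\<lambda>i. emeasure (fibre_law i) Y) \<in> borel_measurable (iid P1)"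
      by (rule bernoulli_rectangle(2)[OF sets.empty_sets Y])
    fix S assume "S \<in> sets (iid P1)"
    then have S: "S \<in> sets seq_space" by (simp only: sets_iid)
    define X where "X = read_digits m right_closed -` S"
    have X: "X \<in> sets borel" unfolding X_def using measurable_sets[OF measurable_read_digits S] by simp
    have SX: "AE i in iid P1. indicator S i = (indicator X (digit_value m i) :: ennreal)"
      using ad by eventually_elim (simp add: X_def indicator_def read_digits_value[OF m2])
    have XY: "X \<times> Y \<in> sets borel" unfolding borel_prod[symmetric] using X Y by (rule pair_measureI)
    have "(\<integral>\<^sup>+i. emeasure (\<kappa> (digit_value m i)) Y * indicator S i \<partial>iid P1) =
        (\<integral>\<^sup>+i. emeasure (\<kappa> (digit_value m i)) Y * indicator X (digit_value m i) \<partial>iid P1)"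
      by (rule nn_integral_cong_AE) (use SX in \<open>eventually_elim, simp\<close>)
    also have "\<dots> = (\<integral>\<^sup>+x. emeasure (\<kappa> x) Y * indicator X x \<partial>distr (iid P1) borel (digit_value m))"
      by (rule nn_integral_distr[OF measurable_value_iid, symmetric])
         (use k X in \<open>simp only: measurable_distr_eq1 borel_measurable_times_ennreal borel_measurable_indicator\<close>)
    also have "\<dots> = (\<integral>\<^sup>+x. emeasure (return borel x \<Otimes>\<^sub>M \<kappa> x) (X \<times> Y) \<partial>distr bernoulli borel fst)"
      unfolding bernoulli_first
    proof (rule nn_integral_cong)
      fix x
      interpret \<kappa>x: prob_space "\<kappa> x" by (rule \<kappa>p)
      have "emeasure (return borel x \<Otimes>\<^sub>M \<kappa> x) (X \<times> Y) = emeasure (return borel x) X * emeasure (\<kappa> x) Y"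
        by (rule \<kappa>x.emeasure_pair_measure_Times) (use X Y \<kappa>p in auto)
      then show "emeasure (\<kappa> x) Y * indicator X x = emeasure (return borel x \<Otimes>\<^sub>M \<kappa> x) (X \<times> Y)"
        using X by (simp add: mult.commute)
    qed
    also have "\<dots> = emeasure bernoulli (X \<times> Y)"
      by (rule \<kappa>[unfolded vertical_disintegration_def, THEN conjunct2, THEN conjunct2, THEN bspec, OF XY, symmetric])
    also have "\<dots> = (\<integral>\<^sup>+i. emeasure (fibre_law i) Y * indicator X (digit_value m i) \<partial>iid P1)"
      by (rule bernoulli_rectangle(1)[OF X Y])
    also have "\<dots> = (\<integral>\<^sup>+i. emeasure (fibre_law i) Y * indicator S i \<partial>iid P1)"
      by (rule nn_integral_cong_AE) (use SX in \<open>eventually_elim, simp\<close>)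
    finally show "(\<integral>\<^sup>+i. emeasure (\<kappa> (digit_value m i)) Y * indicator S i \<partial>iid P1) =
      (\<integral>\<^sup>+i. emeasure (fibre_law i) Y * indicator S i \<partial>iid P1)" .
  qed simp_all
  then have "AE i in iid P1. \<forall>q :: rat. emeasure (\<kappa> (digit_value m i)) {..of_rat q} = emeasure (fibre_law i) {..of_rat q}"
    by (simp add: AE_all_countable)
  then show ?thesis
  proof eventually_elim
    case (elim i)
    then show ?case
      by (intro measure_eq_rational_halflines[OF \<kappa>p]) (simp_all add: fibre_law_def)
  qed
qed

lemma limit_law_product: "limit_law t \<omega> = distr (distr (iid P1) borel (digit_value m) \<Otimes>\<^sub>M fibre_law \<omega>) borel (stretch n t)"
proof -
  interpret F: prob_space "fibre_law \<omega>"
    unfolding fibre_law_def by (rule IG.prob_space_distr[OF measurable_fibre_value])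
  have "distr (iid P1) borel (digit_value m) \<Otimes>\<^sub>M fibre_law \<omega> =
    distr sample (borel \<Otimes>\<^sub>M borel) (\<lambda>(i, u). (digit_value m i, digit_value n (ysel \<omega> u)))"
    unfolding fibre_law_def sample_def
    by (rule pair_measure_distr[OF measurable_value_iid measurable_fibre_value])
       (rule F.sigma_finite_measure_axioms[unfolded fibre_law_def])
  also have "\<dots> = distr sample borel (sample_point (\<lambda>_. \<omega>))"
    unfolding borel_prod sample_point_def[abs_def] by (simp add: split_beta')
  finally have *: "distr (iid P1) borel (digit_value m) \<Otimes>\<^sub>M fibre_law \<omega> = distr sample borel (sample_point (\<lambda>_. \<omega>))" .
  have "distr (distr sample borel (sample_point (\<lambda>_. \<omega>))) borel (stretch n t) = distr sample borel (stretch n t \<circ> sample_point (\<lambda>_. \<omega>))"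
    by (rule distr_distr[OF measurable_stretch measurable_sample_point]) simp
  then show ?thesis unfolding * law_def by (simp add: comp_def)
qed

lemma measurable_product_fibre:
  assumes \<kappa>: "\<kappa> \<in> borel \<rightarrow>\<^sub>M prob_algebra borel"
  shows "(\<lambda>(x, t). distr (distr bernoulli borel fst \<Otimes>\<^sub>M \<kappa> x) borel (stretch n t)) \<in> borel \<Otimes>\<^sub>M borel \<rightarrow>\<^sub>M borel_of planar_measures"
proof (rule measurable_into_weak_topology)
  interpret prob_space bernoulli by (rule prob_space_bernoulli)
  have p: "fst \<in> borel_measurable (borel :: (real \<times> real) measure)"
    unfolding borel_prod[symmetric] by (rule measurable_fst)
  have "prob_space (distr bernoulli borel fst)" by (rule prob_space_distr) (simp add: p)
  then have "distr bernoulli borel fst \<in> space (prob_algebra borel)" by (simp add: space_prob_algebra)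
  then have c: "(\<lambda>y. distr bernoulli borel fst) \<in> borel \<Otimes>\<^sub>M borel \<rightarrow>\<^sub>M prob_algebra borel" by (rule measurable_const)
  have pr: "(\<lambda>y. distr bernoulli borel fst \<Otimes>\<^sub>M \<kappa> (fst y)) \<in> borel \<Otimes>\<^sub>M (borel :: real measure) \<rightarrow>\<^sub>M prob_algebra (borel \<Otimes>\<^sub>M borel)"
    by (rule measurable_pair_prob[OF c measurable_compose[OF measurable_fst \<kappa>]])
  have "(\<lambda>(y, z). stretch n (snd y) z) \<in> (borel \<Otimes>\<^sub>M borel) \<Otimes>\<^sub>M (borel \<Otimes>\<^sub>M borel) \<rightarrow>\<^sub>M (borel :: (real \<times> real) measure)"
    unfolding stretch_def borel_prod[symmetric] split_beta' by measurable
  from measurable_distr_prob_space2[OF pr this]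
  show "(\<lambda>(x, t). distr (distr bernoulli borel fst \<Otimes>\<^sub>M \<kappa> x) borel (stretch n t)) \<in> borel \<Otimes>\<^sub>M borel \<rightarrow>\<^sub>M prob_algebra borel"
    by (simp add: split_beta')
qed

lemma product_fibre_distribution_eq:
  assumes \<kappa>: "vertical_disintegration bernoulli \<kappa>"
  shows "product_fibre_distribution n (phase_measure \<alpha>) bernoulli \<kappa> = driver_law \<alpha>"
proof -
  let ?\<tau> = "phase_measure \<alpha>" and ?v = "digit_value m" and ?W = "borel_of planar_measures"
  let ?\<Phi> = "\<lambda>(x, t). distr (distr bernoulli borel fst \<Otimes>\<^sub>M \<kappa> x) borel (stretch n t)"
  have \<kappa>m: "\<kappa> \<in> borel \<rightarrow>\<^sub>M prob_algebra borel"
    using \<kappa> by (intro measurable_prob_algebra_of_weak) (simp add: vertical_disintegration_def)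
  have eq: "sets (borel \<Otimes>\<^sub>M ?\<tau>) = sets (borel \<Otimes>\<^sub>M borel)" by (intro sets_pair_measure_cong sets_phase_measure refl)
  have \<Phi>: "?\<Phi> \<in> borel \<Otimes>\<^sub>M ?\<tau> \<rightarrow>\<^sub>M ?W"
    unfolding measurable_cong_sets[OF eq refl] by (rule measurable_product_fibre[OF \<kappa>m])
  have v: "(\<lambda>(i, t). (?v i, t)) \<in> iid P1 \<Otimes>\<^sub>M ?\<tau> \<rightarrow>\<^sub>M borel \<Otimes>\<^sub>M ?\<tau>"
    unfolding split_beta' by (rule measurable_Pair[OF measurable_compose[OF measurable_fst measurable_value_iid] measurable_snd])
  have "distr (iid P1) borel ?v \<Otimes>\<^sub>M distr ?\<tau> ?\<tau> (\<lambda>t. t) = distr (iid P1 \<Otimes>\<^sub>M ?\<tau>) (borel \<Otimes>\<^sub>M ?\<tau>) (\<lambda>(i, t). (?v i, t))"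
    by (rule pair_measure_distr[OF measurable_value_iid]) (simp_all only: distr_id phase.sigma_finite_measure_axioms measurable_ident_sets)
  then have "product_fibre_distribution n ?\<tau> bernoulli \<kappa> = distr (distr (iid P1 \<Otimes>\<^sub>M ?\<tau>) (borel \<Otimes>\<^sub>M ?\<tau>) (\<lambda>(i, t). (?v i, t))) ?W ?\<Phi>"
    unfolding product_fibre_distribution_def bernoulli_first by (simp only: distr_id)
  also have "\<dots> = distr (iid P1 \<Otimes>\<^sub>M ?\<tau>) ?W (?\<Phi> \<circ> (\<lambda>(i, t). (?v i, t)))"
    by (rule distr_distr[OF \<Phi> v])
  also have "\<dots> = distr (iid P1 \<Otimes>\<^sub>M ?\<tau>) ?W (box_law \<circ> (\<lambda>(i, t). (t, i)))"
  proof (rule distr_cong_AE)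
    obtain N where N: "N \<in> null_sets (iid P1)" "{i. \<kappa> (?v i) \<noteq> fibre_law i} \<subseteq> N"
      using disintegration_unique[OF \<kappa>] by (auto simp: eventually_ae_filter)
    have "N \<times> UNIV \<in> null_sets (iid P1 \<Otimes>\<^sub>M ?\<tau>)"
      using N(1) sets.top[of ?\<tau>]
      by (auto intro!: null_setsI simp: phase.emeasure_pair_measure_Times null_setsD1 null_setsD2 simp del: sets_phase_measure)
    then show "AE y in iid P1 \<Otimes>\<^sub>M ?\<tau>. (?\<Phi> \<circ> (\<lambda>(i, t). (?v i, t))) y = (box_law \<circ> (\<lambda>(i, t). (t, i))) y"
    proof (rule AE_I')
      show "{y \<in> space (iid P1 \<Otimes>\<^sub>M ?\<tau>). (?\<Phi> \<circ> (\<lambda>(i, t). (?v i, t))) y \<noteq> (box_law \<circ> (\<lambda>(i, t). (t, i))) y} \<subseteq> N \<times> UNIV"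
      proof
        fix y assume y: "y \<in> {y \<in> space (iid P1 \<Otimes>\<^sub>M ?\<tau>). (?\<Phi> \<circ> (\<lambda>(i, t). (?v i, t))) y \<noteq> (box_law \<circ> (\<lambda>(i, t). (t, i))) y}"
        obtain i t where it: "y = (i, t)" by (cases y)
        have "\<kappa> (?v i) \<noteq> fibre_law i"
        proof
          assume "\<kappa> (?v i) = fibre_law i"
          then have "(?\<Phi> \<circ> (\<lambda>(i, t). (?v i, t))) y = (box_law \<circ> (\<lambda>(i, t). (t, i))) y"
            unfolding it by (simp add: bernoulli_first limit_law_product)
          then show False using y by simp
        qed
        then show "y \<in> N \<times> UNIV" using N(2) it by auto
      qed
    qed
    show "?\<Phi> \<circ> (\<lambda>(i, t). (?v i, t)) \<in> iid P1 \<Otimes>\<^sub>M ?\<tau> \<rightarrow>\<^sub>M ?W" by (rule measurable_comp[OF v \<Phi>])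
    show "box_law \<circ> (\<lambda>(i, t). (t, i)) \<in> iid P1 \<Otimes>\<^sub>M ?\<tau> \<rightarrow>\<^sub>M ?W"
      by (rule measurable_comp[OF measurable_pair_swap' measurable_box_law])
  qed simp_all
  also have "\<dots> = distr (distr (iid P1 \<Otimes>\<^sub>M ?\<tau>) (?\<tau> \<Otimes>\<^sub>M iid P1) (\<lambda>(i, t). (t, i))) ?W box_law"
    by (rule distr_distr[OF measurable_box_law measurable_pair_swap', symmetric])
  also have "distr (iid P1 \<Otimes>\<^sub>M ?\<tau>) (?\<tau> \<Otimes>\<^sub>M iid P1) (\<lambda>(i, t). (t, i)) = ?\<tau> \<Otimes>\<^sub>M iid P1"
    by (rule driver_pair.distr_pair_swap[symmetric])
  finally show ?thesis by (simp only: driver_law_def)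
qed

end

theorem theorem1p3:
  fixes m n :: nat and \<mu> :: "(real \<times> real) measure" and \<kappa> :: "real \<Rightarrow> real measure"
  assumes "2 \<le> m" and "m < n"
    and "bernoulli_for m n \<mu>"
    and "vertical_disintegration \<mu> \<kappa>"
  shows "\<exists>Q. cp_chain (asq_boxes n) (1 / real m) (asq_operator m n) Q \<and> ergodic_law Q \<and>
           generates (asq_operator m n) (base_rect n 0) \<mu> Q \<and>
           measure_component Q =
             product_fibre_distribution n (phase_measure (asq_exponent m n)) \<mu> \<kappa>"
proof -
  obtain P where P: "set_pmf P \<subseteq> {..<m} \<times> {..<n}" "\<mu> = distr (iid P) borel (digit_point m n)"
    using bernoulli_as_iid[OF assms(1-3)] .
  interpret digit_system m n P by standard (use assms(1,2) P(1) in auto)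
  show ?thesis
  proof (intro exI[of _ chain] conjI)
    show "cp_chain (asq_boxes n) (1 / real m) (asq_operator m n) chain"
      unfolding cp_chain_def
      by (intro conjI partition_operator_asq[OF m2 mn] regular_operator_asq[OF m2 mn] chain_markov chain_stationary)
    show "ergodic_law chain" by (rule chain_ergodic)
    show "generates (asq_operator m n) (base_rect n 0) \<mu> chain"
      unfolding P(2) by (rule bernoulli_generates_chain)
    show "measure_component chain = product_fibre_distribution n (phase_measure \<alpha>) \<mu> \<kappa>"
      using product_fibre_distribution_eq[of \<kappa>] assms(4) by (simp add: P(2) chain_component_law)
  qed
qed

end
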